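(* Let $\Gamma$ be a countable discrete sofic group with the Strong Atiyah property, and such that \[\sup\{|\Lambda|:\Lambda\subseteq \Gamma\text{ is a finite subgroup}\}<\infty.\] Let $\Sigma$ be a sofic approximation of $\Gamma$. Let $A$ be a finitely generated $\mathbb{Z}(\Gamma)$-module. Then $\mathrm{mdim}_{\Sigma,M}(\widehat{A},\Gamma)=0$ if and only if $h_{\Sigma}(\widehat{A},\Gamma)<\infty$.
   Context: $\widehat{A}$ is the Pontryagin dual of $A$ (homomorphisms to $\mathbb{R}/\mathbb{Z}$) with action $(g\chi)(a)=\chi(g^{-1}a)$. **Strong Atiyah property.** For $f\in M_{m,n}(\mathbb{Z}(\Gamma))$, $f_{ab}=\sum_g\widehat{f_{ab}}(g)g$, let $\lambda(f):\ell^2(\Gamma)^{\oplus n}\to\ell^2(\Gamma)^{\oplus m}$, $(\lambda(f)\xi)(l)(h)=\sum_{s}\sum_{g}\widehat{f_{ls}}(g)\xi(s)(g^{-1}h)$. For a closed subspace $\mathcal{K}\subseteq\ell^2(\Gamma)^{\oplus n}$ invariant under the right regular representation, $\dim_{L(\Gamma)}(\mathcal{K})=\mathrm{Tr}\otimes\tau(P_{\mathcal{K}})$, where $P_{\mathcal{K}}\in M_n(L(\Gamma))$ is the orthogonal projection onto $\mathcal{K}$, $L(\Gamma)$ is the group von Neumann algebra, $\tau(x)=\langle x\delta_e,\delta_e\rangle$ and $\mathrm{Tr}\otimes\tau(x)=\sum_j\tau(x_{jj})$. Let $\mathcal{O}(\Gamma)$ be the additive subgroup of $\mathbb{Q}$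 generated by $|\Lambda|^{-1}$ for all finite subgroups $\Lambda\subseteq\Gamma$. $\Gamma$ has the Strong Atiyah property if $\dim_{L(\Gamma)}(\ker\lambda(f))\in\mathcal{O}(\Gamma)$ for all $m,n$ and all $f\in M_{m,n}(\mathbb{Z}(\Gamma))$. **Sofic approximations.** A sofic approximation of a countable discrete group $\Gamma$ is a sequence $\Sigma=(\sigma_i:\Gamma\to S_{d_i})_i$ of functions into symmetric groups (not assumed to be homomorphisms) such that $d_i\to\infty$; $\frac1{d_i}|\{j:(\sigma_i(g)\sigma_i(h))(j)=\sigma_i(gh)(j)\}|\to 1$ for all $g,h\in\Gamma$; and $\frac1{d_i}|\{j:\sigma_i(g)(j)\ne\sigma_i(h)(j)\}|\to 1$ for all $g\neq h$ in $\Gamma$. $\Gamma$ is sofic if it has a sofic approximation. **Topological entropy.** Let $\Gamma$ act by homeomorphisms on a compact metrizable space $X$. A continuous pseudometric $\rho$ on $X$ is dynamically generating if for all $x\neq y$ there is $g\in\Gamma$ with $\rho(gx,gy)>0$. For $\phi,\psi:\{1,\dots,d\}\to X$ put $\rho_2(\phi,\psi)=\left(\frac1d\sum_j\rho(\phi(j),\psi(j))^2\right)^{1/2}$ and $\rho_\infty(\phi,\psi)=\max_j\rho(\phi(j),\psi(j))$. For a pseudometric space $(Y,\theta)$, $S_\varepsilon(Y,\theta)$ is the smallest cardinality of $A\subseteq Y$ such that every point of $Y$ is within distance $\le\varepsilon$ of a point of $A$, and $N_\varepsilon(Y,\theta)$ is the largest cardinality of a subset with pairwise distances $>\varepsilon$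 ($\log 0=-\infty$). For $\sigma:\Gamma\to S_d$, $F\subseteq\Gamma$ finite, $\delta>0$, $\mathrm{Map}(\rho,F,\delta,\sigma)$ is the set of $\phi:\{1,\dots,d\}\to X$ with $\rho_2(\phi\circ\sigma(g),g\phi)<\delta$ for all $g\in F$. Then \[h_\Sigma(X,\Gamma)=\sup_{\varepsilon>0}\inf_{F,\delta}\limsup_{i\to\infty}\frac1{d_i}\log S_\varepsilon(\mathrm{Map}(\rho,F,\delta,\sigma_i),\rho_2),\] independent of the dynamically generating pseudometric $\rho$. **Metric mean dimension.** For a compatible metric $\rho$ on $X$, \[\mathrm{mdim}_{\Sigma,M}(X,\rho)=\liminf_{\varepsilon\to0}\frac{1}{|\log\varepsilon|}\inf_{F,\delta}\limsup_{i\to\infty}\frac1{d_i}\log N_\varepsilon(\mathrm{Map}(\rho,F,\delta,\sigma_i),\rho_\infty),\] and $\mathrm{mdim}_{\Sigma,M}(X,\Gamma)$ is the infimum over all compatible metrics $\rho$. *)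

theory Defs
  imports
    "HOL-Analysis.Analysis"
    "HOL-Library.Poly_Mapping"
    "HOL-Computational_Algebra.Group_Closure"
begin

text \<open>
  The group \<open>\<Gamma>\<close> is a type of class \<^class>\<open>group_add\<close>, which does not assume commutativity:
  \<open>g + h\<close>, \<open>- g\<close> and \<open>0\<close> stand for the product \<open>g h\<close>, the inverse and the identity.
  With the convolution product of \<^theory>\<open>HOL-Library.Poly_Mapping\<close>, the finitely supported
  functions \<open>'g \<Rightarrow>\<^sub>0 int\<close> form the integral group ring; the group element \<open>g\<close> is
  \<open>Poly_Mapping.single g 1\<close>.
\<close>

section \<open>Modules over a not necessarily commutative ring\<close>

text \<open>The library's \<^locale>\<open>module\<close> requires a commutative ring of scalars.\<close>

locale left_module =
  fixes smul :: "'r::ring_1 \<Rightarrow> 'a::ab_group_add \<Rightarrow> 'a"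
  assumes scale_right_distrib: "smul r (x + y) = smul r x + smul r y"
    and scale_left_distrib: "smul (r + s) x = smul r x + smul s x"
    and scale_scale: "smul r (smul s x) = smul (r * s) x"
    and scale_one: "smul 1 x = x"

definition finitely_generated :: "('r::ring_1 \<Rightarrow> 'a::ab_group_add \<Rightarrow> 'a) \<Rightarrow> bool" where
  "finitely_generated smul \<longleftrightarrow>
     (\<exists>S. finite S \<and> (\<forall>a. \<exists>c. a = (\<Sum>s\<in>S. smul (c s) s)))"

section \<open>Finite subgroups\<close>

definition finite_subgroup :: "'g::group_add set \<Rightarrow> bool" where
  "finite_subgroup H \<longleftrightarrow>
     finite H \<and> 0 \<in> H \<and> (\<forall>g\<in>H. \<forall>h\<in>H. g + h \<in> H) \<and> (\<forall>g\<in>H. - g \<in> H)"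

section \<open>The strong Atiyah property\<close>

text \<open>
  An element of the \<open>n\<close>-fold direct sum of \<open>\<ell>\<^sup>2(\<Gamma>)\<close> is a family \<open>\<xi> :: nat \<Rightarrow> 'g \<Rightarrow> complex\<close>
  whose components are indexed by \<open>0, \<dots>, n - 1\<close>, and which vanishes outside this range.
\<close>

definition l2 :: "('g \<Rightarrow> complex) set" where
  "l2 = {x. (\<lambda>h. (cmod (x h))\<^sup>2) summable_on UNIV}"

definition l2_inner :: "('g \<Rightarrow> complex) \<Rightarrow> ('g \<Rightarrow> complex) \<Rightarrow> complex" where
  "l2_inner x y = (\<Sum>\<^sub>\<infinity>h. x h * cnj (y h))"

definition l2_sum :: "nat \<Rightarrow> (nat \<Rightarrow> 'g \<Rightarrow> complex) set" where
  "l2_sum n = {\<xi>. (\<forall>s<n. \<xi> s \<in> l2) \<and> (\<forall>s\<ge>n. \<xi> s = (\<lambda>_. 0))}"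

definition l2_sum_inner ::
  "nat \<Rightarrow> (nat \<Rightarrow> 'g \<Rightarrow> complex) \<Rightarrow> (nat \<Rightarrow> 'g \<Rightarrow> complex) \<Rightarrow> complex" where
  "l2_sum_inner n \<xi> \<eta> = (\<Sum>s<n. l2_inner (\<xi> s) (\<eta> s))"

text \<open>
  An \<open>m \<times> n\<close> matrix over the group ring is a function \<open>f :: nat \<Rightarrow> nat \<Rightarrow> ('g \<Rightarrow>\<^sub>0 int)\<close> of which
  only the entries \<open>f l s\<close> with \<open>l < m\<close> and \<open>s < n\<close> are used.
\<close>

definition conv_op ::
  "nat \<Rightarrow> nat \<Rightarrow> (nat \<Rightarrow> nat \<Rightarrow> ('g::group_add \<Rightarrow>\<^sub>0 int)) \<Rightarrow>
     (nat \<Rightarrow> 'g \<Rightarrow> complex) \<Rightarrow> (nat \<Rightarrow> 'g \<Rightarrow> complex)" where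
  "conv_op m n f \<xi> = (\<lambda>l h.
     if l < m
     then (\<Sum>s<n. \<Sum>g\<in>Poly_Mapping.keys (f l s).
             of_int (Poly_Mapping.lookup (f l s) g) * \<xi> s (- g + h))
     else 0)"

definition conv_ker ::
  "nat \<Rightarrow> nat \<Rightarrow> (nat \<Rightarrow> nat \<Rightarrow> ('g::group_add \<Rightarrow>\<^sub>0 int)) \<Rightarrow> (nat \<Rightarrow> 'g \<Rightarrow> complex) set" where
  "conv_ker m n f = {\<xi> \<in> l2_sum n. conv_op m n f \<xi> = (\<lambda>_ _. 0)}"

text \<open>
  The orthogonal projection onto \<open>K\<close>, characterised by \<open>P \<xi> \<in> K\<close> and \<open>\<xi> - P \<xi> \<bottom> K\<close>; it is
  meaningful for closed linear subspaces \<open>K\<close> of \<open>l2_sum n\<close> and arguments \<open>\<xi> \<in> l2_sum n\<close>.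
\<close>

definition orth_proj ::
  "nat \<Rightarrow> (nat \<Rightarrow> 'g \<Rightarrow> complex) set \<Rightarrow> (nat \<Rightarrow> 'g \<Rightarrow> complex) \<Rightarrow> (nat \<Rightarrow> 'g \<Rightarrow> complex)" where
  "orth_proj n K \<xi> =
     (THE \<eta>. \<eta> \<in> K \<and> (\<forall>\<zeta>\<in>K. l2_sum_inner n (\<lambda>s h. \<xi> s h - \<eta> s h) \<zeta> = 0))"

definition delta_e :: "'g::group_add \<Rightarrow> complex" where
  "delta_e = (\<lambda>h. if h = 0 then 1 else 0)"

definition vn_trace :: "(('g::group_add \<Rightarrow> complex) \<Rightarrow> ('g \<Rightarrow> complex)) \<Rightarrow> complex" where
  "vn_trace x = l2_inner (x delta_e) delta_e"

text \<open>The entry \<open>x\<^sub>i\<^sub>j\<close> of an operator on the direct sum, as an operator on \<open>\<ell>\<^sup>2(\<Gamma>)\<close>.\<close>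

definition op_entry ::
  "((nat \<Rightarrow> 'g \<Rightarrow> complex) \<Rightarrow> (nat \<Rightarrow> 'g \<Rightarrow> complex)) \<Rightarrow> nat \<Rightarrow> nat \<Rightarrow>
     ('g \<Rightarrow> complex) \<Rightarrow> ('g \<Rightarrow> complex)" where
  "op_entry x i j v = x (\<lambda>s. if s = j then v else (\<lambda>_. 0)) i"

text \<open>
  The von Neumann dimension of a closed subspace invariant under the right regular
  representation. The trace is kept as a complex number; it is real for such subspaces.
\<close>

definition vn_dim :: "nat \<Rightarrow> (nat \<Rightarrow> 'g::group_add \<Rightarrow> complex) set \<Rightarrow> complex" where
  "vn_dim n K = (\<Sum>j<n. vn_trace (op_entry (orth_proj n K) j j))"

definition order_group :: "'g::group_add itself \<Rightarrow> rat set" where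
  "order_group _ = group_closure {1 / of_nat (card H) |H :: 'g set. finite_subgroup H}"

definition strong_atiyah :: "'g::group_add itself \<Rightarrow> bool" where
  "strong_atiyah _ \<longleftrightarrow>
     (\<forall>m n. \<forall>f :: nat \<Rightarrow> nat \<Rightarrow> ('g \<Rightarrow>\<^sub>0 int).
        vn_dim n (conv_ker m n f) \<in> of_rat ` order_group TYPE('g))"

section \<open>Sofic approximations\<close>

text \<open>An element of the symmetric group \<open>S\<^sub>d\<close> is a function \<open>nat \<Rightarrow> nat\<close> that permutes \<open>{1..d}\<close>.\<close>

definition sofic_approximation ::
  "(nat \<Rightarrow> nat) \<Rightarrow> (nat \<Rightarrow> 'g::group_add \<Rightarrow> nat \<Rightarrow> nat) \<Rightarrow> bool" where
  "sofic_approximation d \<sigma> \<longleftrightarrow>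
     (\<forall>i. 0 < d i) \<and>
     (\<forall>i g. \<sigma> i g permutes {1..d i}) \<and>
     filterlim d at_top sequentially \<and>
     (\<forall>g h. (\<lambda>i. real (card {j\<in>{1..d i}. (\<sigma> i g \<circ> \<sigma> i h) j = \<sigma> i (g + h) j}) / real (d i))
              \<longlonglongrightarrow> 1) \<and>
     (\<forall>g h. g \<noteq> h \<longrightarrow>
        (\<lambda>i. real (card {j\<in>{1..d i}. \<sigma> i g j \<noteq> \<sigma> i h j}) / real (d i)) \<longlonglongrightarrow> 1)"

definition sofic :: "'g::group_add itself \<Rightarrow> bool" where
  "sofic _ \<longleftrightarrow> (\<exists>d (\<sigma> :: nat \<Rightarrow> 'g \<Rightarrow> nat \<Rightarrow> nat). sofic_approximation d \<sigma>)"

section \<open>Sofic entropy and metric mean dimension\<close>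

text \<open>
  Throughout, \<open>X\<close> is a topology and \<open>act :: 'g \<Rightarrow> 'x \<Rightarrow> 'x\<close> an action on its points; the notions are
  meant for compact metrizable \<open>X\<close> and actions by homeomorphisms.
\<close>

definition continuous_pseudometric :: "'x topology \<Rightarrow> ('x \<Rightarrow> 'x \<Rightarrow> real) \<Rightarrow> bool" where
  "continuous_pseudometric X \<rho> \<longleftrightarrow>
     (\<forall>x\<in>topspace X. \<forall>y\<in>topspace X. 0 \<le> \<rho> x y) \<and>
     (\<forall>x\<in>topspace X. \<rho> x x = 0) \<and>
     (\<forall>x\<in>topspace X. \<forall>y\<in>topspace X. \<rho> x y = \<rho> y x) \<and>
     (\<forall>x\<in>topspace X. \<forall>y\<in>topspace X. \<forall>z\<in>topspace X. \<rho> x z \<le> \<rho> x y + \<rho> y z) \<and>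
     continuous_map (prod_topology X X) euclideanreal (\<lambda>(x, y). \<rho> x y)"

definition dynamically_generating ::
  "'x topology \<Rightarrow> ('g \<Rightarrow> 'x \<Rightarrow> 'x) \<Rightarrow> ('x \<Rightarrow> 'x \<Rightarrow> real) \<Rightarrow> bool" where
  "dynamically_generating X act \<rho> \<longleftrightarrow>
     continuous_pseudometric X \<rho> \<and>
     (\<forall>x\<in>topspace X. \<forall>y\<in>topspace X. x \<noteq> y \<longrightarrow> (\<exists>g. 0 < \<rho> (act g x) (act g y)))"

definition compatible_metric :: "'x topology \<Rightarrow> ('x \<Rightarrow> 'x \<Rightarrow> real) \<Rightarrow> bool" where
  "compatible_metric X \<rho> \<longleftrightarrow>
     Metric_space (topspace X) \<rho> \<and> Metric_space.mtopology (topspace X) \<rho> = X"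

definition rho_2 :: "('x \<Rightarrow> 'x \<Rightarrow> real) \<Rightarrow> nat \<Rightarrow> (nat \<Rightarrow> 'x) \<Rightarrow> (nat \<Rightarrow> 'x) \<Rightarrow> real" where
  "rho_2 \<rho> d \<phi> \<psi> = sqrt (1 / real d * (\<Sum>j\<in>{1..d}. (\<rho> (\<phi> j) (\<psi> j))\<^sup>2))"

definition rho_inf :: "('x \<Rightarrow> 'x \<Rightarrow> real) \<Rightarrow> nat \<Rightarrow> (nat \<Rightarrow> 'x) \<Rightarrow> (nat \<Rightarrow> 'x) \<Rightarrow> real" where
  "rho_inf \<rho> d \<phi> \<psi> = Max ((\<lambda>j. \<rho> (\<phi> j) (\<psi> j)) ` {1..d})"

definition Map_set ::
  "'x topology \<Rightarrow> ('g \<Rightarrow> 'x \<Rightarrow> 'x) \<Rightarrow> ('x \<Rightarrow> 'x \<Rightarrow> real) \<Rightarrow> 'g set \<Rightarrow> real \<Rightarrow>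
     nat \<Rightarrow> ('g \<Rightarrow> nat \<Rightarrow> nat) \<Rightarrow> (nat \<Rightarrow> 'x) set" where
  "Map_set X act \<rho> F \<delta> d \<sigma> =
     {\<phi> \<in> {1..d} \<rightarrow>\<^sub>E topspace X.
        \<forall>g\<in>F. rho_2 \<rho> d (\<phi> \<circ> \<sigma> g) (\<lambda>j. act g (\<phi> j)) < \<delta>}"

text \<open>Spanning and separation numbers, with value \<open>\<infinity>\<close> if there is no finite bound.\<close>

definition span_num :: "real \<Rightarrow> 'y set \<Rightarrow> ('y \<Rightarrow> 'y \<Rightarrow> real) \<Rightarrow> enat" where
  "span_num \<epsilon> Y \<theta> =
     (INF A\<in>{A. finite A \<and> A \<subseteq> Y \<and> (\<forall>y\<in>Y. \<exists>a\<in>A. \<theta> y a \<le> \<epsilon>)}. enat (card A))"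

definition sep_num :: "real \<Rightarrow> 'y set \<Rightarrow> ('y \<Rightarrow> 'y \<Rightarrow> real) \<Rightarrow> enat" where
  "sep_num \<epsilon> Y \<theta> =
     (SUP A\<in>{A. finite A \<and> A \<subseteq> Y \<and> (\<forall>a\<in>A. \<forall>b\<in>A. a \<noteq> b \<longrightarrow> \<epsilon> < \<theta> a b)}. enat (card A))"

fun log_enat :: "enat \<Rightarrow> ereal" where
  "log_enat (enat k) = (if k = 0 then -\<infinity> else ereal (ln (real k)))"
| "log_enat \<infinity> = \<infinity>"

definition sofic_entropy_wrt ::
  "(nat \<Rightarrow> nat) \<Rightarrow> (nat \<Rightarrow> 'g::group_add \<Rightarrow> nat \<Rightarrow> nat) \<Rightarrow>
     'x topology \<Rightarrow> ('g \<Rightarrow> 'x \<Rightarrow> 'x) \<Rightarrow> ('x \<Rightarrow> 'x \<Rightarrow> real) \<Rightarrow> ereal" where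
  "sofic_entropy_wrt d \<sigma> X act \<rho> =
     (SUP \<epsilon>\<in>{0<..}. INF F\<in>{F. finite F}. INF \<delta>\<in>{0<..}.
        limsup (\<lambda>i. ereal (1 / real (d i)) *
          log_enat (span_num \<epsilon> (Map_set X act \<rho> F \<delta> (d i) (\<sigma> i)) (rho_2 \<rho> (d i)))))"

text \<open>
  The entropy does not depend on the dynamically generating continuous pseudometric used to
  compute it, so an arbitrary one is chosen. One exists when \<open>X\<close> is metrizable.
\<close>

definition sofic_entropy ::
  "(nat \<Rightarrow> nat) \<Rightarrow> (nat \<Rightarrow> 'g::group_add \<Rightarrow> nat \<Rightarrow> nat) \<Rightarrow>
     'x topology \<Rightarrow> ('g \<Rightarrow> 'x \<Rightarrow> 'x) \<Rightarrow> ereal" where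
  "sofic_entropy d \<sigma> X act =
     sofic_entropy_wrt d \<sigma> X act (SOME \<rho>. dynamically_generating X act \<rho>)"

definition metric_mdim_wrt ::
  "(nat \<Rightarrow> nat) \<Rightarrow> (nat \<Rightarrow> 'g::group_add \<Rightarrow> nat \<Rightarrow> nat) \<Rightarrow>
     'x topology \<Rightarrow> ('g \<Rightarrow> 'x \<Rightarrow> 'x) \<Rightarrow> ('x \<Rightarrow> 'x \<Rightarrow> real) \<Rightarrow> ereal" where
  "metric_mdim_wrt d \<sigma> X act \<rho> =
     Liminf (at_right 0) (\<lambda>\<epsilon>. ereal (1 / \<bar>ln \<epsilon>\<bar>) *
       (INF F\<in>{F. finite F}. INF \<delta>\<in>{0<..}.
          limsup (\<lambda>i. ereal (1 / real (d i)) *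
            log_enat (sep_num \<epsilon> (Map_set X act \<rho> F \<delta> (d i) (\<sigma> i)) (rho_inf \<rho> (d i))))))"

definition metric_mdim ::
  "(nat \<Rightarrow> nat) \<Rightarrow> (nat \<Rightarrow> 'g::group_add \<Rightarrow> nat \<Rightarrow> nat) \<Rightarrow>
     'x topology \<Rightarrow> ('g \<Rightarrow> 'x \<Rightarrow> 'x) \<Rightarrow> ereal" where
  "metric_mdim d \<sigma> X act = (INF \<rho>\<in>{\<rho>. compatible_metric X \<rho>}. metric_mdim_wrt d \<sigma> X act \<rho>)"

section \<open>The Pontryagin dual of a discrete abelian group\<close>

text \<open>The circle group \<open>\<real>/\<int>\<close> with the quotient topology.\<close>

quotient_type rmodz = real / "\<lambda>x y :: real. x - y \<in> \<int>"
proof (rule equivpI)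
  show "reflp (\<lambda>x y :: real. x - y \<in> \<int>)"
    by (simp add: reflp_def)
  show "symp (\<lambda>x y :: real. x - y \<in> \<int>)"
    by (metis (no_types, lifting) Ints_minus minus_diff_eq sympI)
  show "transp (\<lambda>x y :: real. x - y \<in> \<int>)"
  proof (rule transpI)
    fix x y z :: real
    assume "x - y \<in> \<int>" "y - z \<in> \<int>"
    then have "(x - y) + (y - z) \<in> \<int>" by (rule Ints_add)
    then show "x - z \<in> \<int>" by simp
  qed
qed

instantiation rmodz :: ab_group_add
begin

lift_definition zero_rmodz :: rmodz is "0 :: real" .

lift_definition plus_rmodz :: "rmodz \<Rightarrow> rmodz \<Rightarrow> rmodz" is "(+) :: real \<Rightarrow> real \<Rightarrow> real"
  by (metis (no_types, lifting) Ints_add add_diff_add)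

lift_definition uminus_rmodz :: "rmodz \<Rightarrow> rmodz" is "uminus :: real \<Rightarrow> real"
  by (metis (no_types, lifting) Ints_minus minus_diff_minus)

lift_definition minus_rmodz :: "rmodz \<Rightarrow> rmodz \<Rightarrow> rmodz" is "(-) :: real \<Rightarrow> real \<Rightarrow> real"
proof -
  fix a b c e :: real
  assume "a - b \<in> \<int>" "c - e \<in> \<int>"
  then have "(a - b) - (c - e) \<in> \<int>" by (rule Ints_diff)
  then show "(a - c) - (b - e) \<in> \<int>" by (simp add: algebra_simps)
qed

instance
  by standard (transfer; simp)+

end

instantiation rmodz :: topological_space
begin

definition open_rmodz :: "rmodz set \<Rightarrow> bool" where
  "open_rmodz U \<longleftrightarrow> open (abs_rmodz -` U)"

instance
  by standard (auto simp: open_rmodz_def vimage_Union)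

end

text \<open>
  On homomorphisms defined on a discrete group the compact-open topology is the topology of
  pointwise convergence, which is the topology of the function type.
\<close>

definition dual_topology :: "('a::ab_group_add \<Rightarrow> rmodz) topology" where
  "dual_topology = top_of_set {u. Modules.additive u}"

definition dual_act ::
  "(('g::group_add \<Rightarrow>\<^sub>0 int) \<Rightarrow> 'a \<Rightarrow> 'a) \<Rightarrow> 'g \<Rightarrow> ('a \<Rightarrow> rmodz) \<Rightarrow> ('a \<Rightarrow> rmodz)" where
  "dual_act smul g u = (\<lambda>a. u (smul (Poly_Mapping.single (- g) 1) a))"

end

theory Submission
  imports Defs "Jordan_Normal_Form.Schur_Decomposition"
begin

text \<open>
  Let the module \<open>A\<close> be generated by \<open>a\<^sub>0, \<dots>, a\<^sub>n\<^sub>-\<^sub>1\<close>. A finite matrix \<open>f\<close> over the group ring is a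
  matrix of relations if \<open>\<Sum>\<^sub>s f\<^sub>l\<^sub>s a\<^sub>s = 0\<close> for every row \<open>l\<close>. If the orders of the finite subgroups are
  at most \<open>B\<close>, the strong Atiyah property places the von Neumann dimension of every \<open>ker \<lambda>(f)\<close> in
  \<open>(1/B!)\<int>\<close>. Hence either some matrix of relations has kernel dimension \<open>0\<close>, and then the entropy
  is finite (\<open>entropy_finite\<close>), or all of them have kernel dimension at least \<open>1/B!\<close>, and then the
  metric mean dimension is at least \<open>1/(16 B!)\<close> for every compatible metric
  (\<open>metric_mdim_ge_of_moments\<close>). Conversely finite entropy forces metric mean dimension at most
  \<open>0\<close> (\<open>metric_mdim_le_0\<close>), and it is never negative because the trivial character is a fixed point.

  The dimension is accessible without spectral theory. Let \<open>M = \<lambda>(f)\<close>, let \<open>C\<close> exceed \<open>\<parallel>M\<parallel>\<^sup>2\<close> and put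
  \<open>S = 1 - M*M/C\<close>. The powers of this positive contraction converge to the projection onto \<open>ker M\<close>,
  so the dimension is the limit of the decreasing sequence \<open>t \<mapsto> \<Sum>\<^sub>s \<langle>S\<^sup>t \<delta>\<^sub>s, \<delta>\<^sub>s\<rangle>\<close>
  (\<open>vn_dim_conv_ker\<close>). Each term involves finitely many group elements only, and is therefore
  the limit of the normalized traces of the \<open>t\<close>-th powers of the analogous operators \<open>S\<^sub>i\<close> on
  \<open>\<real>\<^bsup>n d\<^sub>i\<^esup>\<close> (\<open>model_trace_generic\<close>).

  If the dimension is \<open>0\<close>, lift an approximately equivariant map to a vector \<open>\<xi> \<in> [0,1]\<^bsup>n d\<^sub>i\<^esup>\<close>. The relations
  say that \<open>M\<^sub>i \<xi>\<close> is close to an integer vector \<open>z\<close>, for which there are only exponentially many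
  choices, at a rate that does not depend on the scale \<open>\<epsilon>\<close>. If two lifts share \<open>z\<close>, their difference
  \<open>v\<close> almost lies in \<open>ker M\<^sub>i\<close>, so \<open>v\<close> is close to \<open>S\<^sub>i\<^sup>t v\<close>. Since the trace of \<open>S\<^sub>i\<^bsup>2t\<^esup>\<close> is a
  small multiple of \<open>d\<^sub>i\<close>, rounding the coordinates of \<open>\<xi>\<close> to \<open>0\<close> or \<open>1\<close> suitably changes \<open>S\<^sub>i\<^sup>t \<xi>\<close> very little
  (\<open>round_coefficients\<close>). So \<open>z\<close> and the rounded vector determine \<open>\<xi>\<close> up to \<open>\<epsilon>\<close>, which bounds the
  entropy.

  If the dimension is at least \<open>c\<close> for all matrices of relations, let \<open>J\<close> be a minimal set of
  coordinates that determine the vectors of \<open>ker M\<^sub>i\<close>. Then \<open>det (M\<^sub>i*M\<^sub>i + z) \<ge> z\<^bsup>|J|\<^esup>\<close>, because the principal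
  minor of \<open>M\<^sub>i*M\<^sub>i\<close> on the complement of \<open>J\<close> is a positive integer, whereas the logarithmic series bounds the
  determinant from above in terms of the traces of the powers of \<open>S\<^sub>i\<close>. For small \<open>z\<close> this gives \<open>|J| \<ge> (c/4) d\<^sub>i\<close>
  (\<open>kernel_dimension\<close>). The vectors of \<open>ker M\<^sub>i\<close> with values in \<open>[0,1/2]\<close> on \<open>J\<close> form a cube of
  approximately equivariant maps, once \<open>f\<close> contains enough relations
  (\<open>finitely_many_relations\<close>). Lipschitz functions that detect the coordinates in \<open>J\<close>
  take the values \<open>0\<close> and \<open>1\<close> on opposite faces, so by Kuhn's combinatorial lemma they jointly
  attain all values approximately (\<open>cube_attained\<close>). This produces about \<open>(\<epsilon>\<^sub>0/2\<epsilon>)\<^bsup>|J|\<^esup>\<close> maps that are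
  \<open>\<epsilon>\<close>-separated (\<open>separated_maps\<close>).
\<close>

section \<open>Finitely supported functions as a pre-Hilbert space\<close>

instantiation poly_mapping :: (type, real_vector) real_vector
begin

lift_definition scaleR_poly_mapping :: "real \<Rightarrow> ('a \<Rightarrow>\<^sub>0 'b) \<Rightarrow> ('a \<Rightarrow>\<^sub>0 'b)"
  is "\<lambda>r x k. r *\<^sub>R x k"
  by (rule finite_subset[rotated]) auto

instance
  by standard (transfer; simp add: scaleR_add_right scaleR_add_left)+

end

instantiation poly_mapping :: (type, real_inner) real_inner
begin

definition inner_poly_mapping :: "('a \<Rightarrow>\<^sub>0 'b) \<Rightarrow> ('a \<Rightarrow>\<^sub>0 'b) \<Rightarrow> real" where
  "inner x y = (\<Sum>k\<in>Poly_Mapping.keys x. inner (Poly_Mapping.lookup x k) (Poly_Mapping.lookup y k))"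

definition norm_poly_mapping :: "('a \<Rightarrow>\<^sub>0 'b) \<Rightarrow> real" where
  "norm (x :: 'a \<Rightarrow>\<^sub>0 'b) = sqrt (inner x x)"

definition sgn_poly_mapping :: "('a \<Rightarrow>\<^sub>0 'b) \<Rightarrow> ('a \<Rightarrow>\<^sub>0 'b)" where
  "sgn (x :: 'a \<Rightarrow>\<^sub>0 'b) = x /\<^sub>R norm x"

definition dist_poly_mapping :: "('a \<Rightarrow>\<^sub>0 'b) \<Rightarrow> ('a \<Rightarrow>\<^sub>0 'b) \<Rightarrow> real" where
  "dist (x :: 'a \<Rightarrow>\<^sub>0 'b) y = norm (x - y)"

definition uniformity_poly_mapping :: "(('a \<Rightarrow>\<^sub>0 'b) \<times> ('a \<Rightarrow>\<^sub>0 'b)) filter" where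
  "uniformity = (INF e\<in>{0<..}. principal {(x :: 'a \<Rightarrow>\<^sub>0 'b, y). dist x y < e})"

definition open_poly_mapping :: "('a \<Rightarrow>\<^sub>0 'b) set \<Rightarrow> bool" where
  "open (U :: ('a \<Rightarrow>\<^sub>0 'b) set) \<longleftrightarrow> (\<forall>x\<in>U. eventually (\<lambda>(x', y). x' = x \<longrightarrow> y \<in> U) uniformity)"

lemma inner_poly_mapping_superset_aux:
  fixes x y :: "'a \<Rightarrow>\<^sub>0 'b"
  assumes "finite A" "Poly_Mapping.keys x \<subseteq> A"
  shows "inner x y = (\<Sum>k\<in>A. inner (Poly_Mapping.lookup x k) (Poly_Mapping.lookup y k))"
  unfolding inner_poly_mapping_def using assms
  by (intro sum.mono_neutral_left) (auto simp: in_keys_iff)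

instance
proof
  fix x y z :: "'a \<Rightarrow>\<^sub>0 'b" and r :: real
  let ?A = "Poly_Mapping.keys x \<union> Poly_Mapping.keys y \<union> Poly_Mapping.keys z"
  have A: "finite ?A" "Poly_Mapping.keys (x + y) \<subseteq> ?A" "Poly_Mapping.keys x \<subseteq> ?A" "Poly_Mapping.keys y \<subseteq> ?A"
    "Poly_Mapping.keys (r *\<^sub>R x) \<subseteq> ?A"
    using Poly_Mapping.keys_add[of x y] by (auto simp: in_keys_iff scaleR_poly_mapping.rep_eq)
  note E = inner_poly_mapping_superset_aux[OF A(1)]
  show "sgn x = x /\<^sub>R norm x" by (simp add: sgn_poly_mapping_def)
  show "dist x y = norm (x - y)" by (simp add: dist_poly_mapping_def)
  show "uniformity = (INF e\<in>{0<..}. principal {(x, y :: 'a \<Rightarrow>\<^sub>0 'b). dist x y < e})"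
    by (simp add: uniformity_poly_mapping_def)
  show "open U = (\<forall>x\<in>U. eventually (\<lambda>(x', y). x' = x \<longrightarrow> y \<in> U) uniformity)"
    for U :: "('a \<Rightarrow>\<^sub>0 'b) set"
    by (simp add: open_poly_mapping_def)
  show "inner x y = inner y x"
    by (simp add: E A inner_commute)
  show "inner (x + y) z = inner x z + inner y z"
    by (simp add: E A lookup_add inner_add_left sum.distrib)
  show "inner (r *\<^sub>R x) y = r * inner x y"
    by (simp add: E A scaleR_poly_mapping.rep_eq sum_distrib_left)
  show "0 \<le> inner x x"
    by (simp add: inner_poly_mapping_def sum_nonneg)
  show "(inner x x = 0) = (x = 0)"
    by (auto simp: inner_poly_mapping_def sum_nonneg_eq_0_iff in_keys_iff
        intro!: poly_mapping_eqI)
  show "norm x = sqrt (inner x x)" by (simp add: norm_poly_mapping_def)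
qed

end

lemmas lookup_scaleR = scaleR_poly_mapping.rep_eq

lemma inner_poly_mapping_superset:
  fixes x y :: "'a \<Rightarrow>\<^sub>0 'b::real_inner"
  assumes "finite A" "Poly_Mapping.keys x \<subseteq> A"
  shows "inner x y = (\<Sum>k\<in>A. inner (Poly_Mapping.lookup x k) (Poly_Mapping.lookup y k))"
  by (rule inner_poly_mapping_superset_aux[OF assms])

lemma norm_poly_mapping_superset:
  fixes x :: "'a \<Rightarrow>\<^sub>0 real"
  assumes "finite A" "Poly_Mapping.keys x \<subseteq> A"
  shows "(norm x)\<^sup>2 = (\<Sum>k\<in>A. (Poly_Mapping.lookup x k)\<^sup>2)"
  unfolding power2_norm_eq_inner inner_poly_mapping_superset[OF assms] by (simp add: power2_eq_square)

definition unit :: "'i \<Rightarrow> ('i \<Rightarrow>\<^sub>0 real)" where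
  "unit i = Poly_Mapping.single i 1"

lemma lookup_unit: "Poly_Mapping.lookup (unit i) k = (if i = k then 1 else 0)"
  by (simp add: unit_def lookup_single when_def)

lemma keys_unit [simp]: "Poly_Mapping.keys (unit i) = {i}"
  by (simp add: unit_def)

lemma inner_unit_right: "inner x (unit i) = Poly_Mapping.lookup x i"
  by (subst inner_commute) (simp add: inner_poly_mapping_def lookup_unit)

lemma inner_unit_left: "inner (unit i) x = Poly_Mapping.lookup x i"
  by (simp add: inner_poly_mapping_def lookup_unit)

lemma norm_unit [simp]: "norm (unit i) = 1"
  by (simp add: norm_poly_mapping_def inner_unit_left lookup_unit)

lemma unit_expansion:
  assumes "finite A" "Poly_Mapping.keys x \<subseteq> A"
  shows "x = (\<Sum>i\<in>A. Poly_Mapping.lookup x i *\<^sub>R unit i)"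
proof (rule poly_mapping_eqI)
  fix k
  have "(\<Sum>i\<in>A. Poly_Mapping.lookup x i * (if i = k then 1 else 0)) =
        (\<Sum>i\<in>A. if i = k then Poly_Mapping.lookup x i else 0)"
    by (intro sum.cong) auto
  then show "Poly_Mapping.lookup x k = Poly_Mapping.lookup (\<Sum>i\<in>A. Poly_Mapping.lookup x i *\<^sub>R unit i) k"
    using assms by (auto simp: lookup_sum lookup_scaleR lookup_unit in_keys_iff)
qed

section \<open>Powers of a positive contraction\<close>

locale adjoint_pair =
  fixes M :: "'a::real_inner \<Rightarrow> 'b::real_inner" and Ma :: "'b \<Rightarrow> 'a" and C :: real
  assumes linear_M: "linear M" and linear_Ma: "linear Ma"
    and adjoint: "inner (M x) y = inner x (Ma y)"
    and bound: "(norm (M x))\<^sup>2 \<le> C * (norm x)\<^sup>2"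
    and C_pos: "0 < C"
begin

definition S :: "'a \<Rightarrow> 'a" where
  "S x = x - (1 / C) *\<^sub>R Ma (M x)"

lemma norm_M_le: "norm (M x) \<le> sqrt C * norm x"
  using bound[of x] C_pos by - (rule power2_le_imp_le, auto simp: power_mult_distrib)

lemma norm_Ma_le: "norm (Ma y) \<le> sqrt C * norm y"
proof (cases "Ma y = 0")
  case False
  have "(norm (Ma y))\<^sup>2 = inner (M (Ma y)) y"
    by (simp add: power2_norm_eq_inner adjoint)
  also have "\<dots> \<le> norm (M (Ma y)) * norm y" by (rule norm_cauchy_schwarz)
  also have "\<dots> \<le> sqrt C * norm (Ma y) * norm y"
    by (intro mult_right_mono norm_M_le) auto
  finally have "norm (Ma y) * norm (Ma y) \<le> norm (Ma y) * (sqrt C * norm y)"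
    by (simp add: power2_eq_square mult_ac)
  then show ?thesis using False by simp
qed (use C_pos in auto)

lemma bound_Ma: "(norm (Ma y))\<^sup>2 \<le> C * (norm y)\<^sup>2"
  using power_mono[OF norm_Ma_le[of y], of 2] C_pos by (simp add: power_mult_distrib)

lemma linear_S: "linear S"
  using linear_compose_sub[OF linear_ident linear_compose_scale_right[OF linear_compose[OF linear_M linear_Ma]], of "1 / C"]
  by (simp add: S_def[abs_def] o_def)

lemma inner_Ma_M: "inner (Ma (M x)) y = inner (M x) (M y)"
  unfolding inner_commute[of "Ma (M x)"] adjoint[symmetric] by (rule inner_commute)

lemma S_symmetric: "inner (S x) y = inner x (S y)"
  by (simp add: S_def inner_diff_left inner_diff_right inner_Ma_M adjoint)

lemma inner_S_self: "inner (S x) x = (norm x)\<^sup>2 - (norm (M x))\<^sup>2 / C"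
  by (simp add: S_def inner_diff_left power2_norm_eq_inner inner_Ma_M)

lemma S_nonneg: "0 \<le> inner (S x) x"
  using bound[of x] C_pos by (simp add: inner_S_self field_simps)

lemma S_le: "inner (S x) x \<le> (norm x)\<^sup>2"
  using C_pos by (simp add: inner_S_self)

text \<open>
  This is \<open>S\<^sup>2 \<le> S\<close>; with \<open>S_le\<close> and \<open>S_nonneg\<close> it makes the moments below decrease.
\<close>

lemma norm_S_sq_le: "(norm (S x))\<^sup>2 \<le> inner (S x) x"
proof -
  define w where "w = Ma (M x)"
  have w: "inner x w = (norm (M x))\<^sup>2" "inner w x = (norm (M x))\<^sup>2"
    by (simp_all add: w_def inner_Ma_M adjoint[symmetric] power2_norm_eq_inner)
  have "inner (x - c *\<^sub>R w) (x - c *\<^sub>R w) = inner x x - 2 * c * inner x w + c\<^sup>2 * inner w w" for c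
    by (simp add: inner_diff_left inner_diff_right w power2_eq_square algebra_simps)
  from this[of "1 / C"]
  have "(norm (S x))\<^sup>2 = (norm x)\<^sup>2 - 2 * (norm (M x))\<^sup>2 / C + (norm w)\<^sup>2 / C\<^sup>2"
    unfolding S_def w_def[symmetric] power2_norm_eq_inner[symmetric] w by (simp add: power_divide)
  also have "(norm w)\<^sup>2 / C\<^sup>2 \<le> (norm (M x))\<^sup>2 / C"
    using bound_Ma[of "M x"] C_pos unfolding w_def[symmetric] by (simp add: divide_simps power2_eq_square mult_ac)
  finally show ?thesis by (simp add: inner_S_self)
qed

lemma norm_S_le: "norm (S x) \<le> norm x"
  using order_trans[OF norm_S_sq_le S_le, of x] by (rule power2_le_imp_le) simp

lemma linear_S_pow: "linear (S ^^ t)"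
proof (induction t)
  case 0
  show ?case using linear_id by (simp add: id_def)
next
  case (Suc t)
  show ?case using linear_compose[OF Suc linear_S] by (simp add: o_def)
qed

lemma norm_S_pow_le: "norm ((S ^^ t) x) \<le> norm x"
  by (induction t) (auto intro: order_trans[OF norm_S_le])

lemma inner_S_pow: "inner ((S ^^ p) x) ((S ^^ q) y) = inner ((S ^^ (p + q)) x) y"
proof (induction q arbitrary: p)
  case (Suc q)
  have "inner ((S ^^ p) x) ((S ^^ Suc q) y) = inner ((S ^^ Suc p) x) ((S ^^ q) y)"
    by (simp add: S_symmetric)
  then show ?case using Suc[of "Suc p"] by simp
qed simp

text \<open>The numbers \<open>\<langle>S\<^sup>t x, x\<rangle>\<close> are the moments of the spectral measure of \<open>x\<close>.\<close>

definition moment :: "'a \<Rightarrow> nat \<Rightarrow> real" where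
  "moment x t = inner ((S ^^ t) x) x"

lemma moment_even: "moment x (2 * p) = (norm ((S ^^ p) x))\<^sup>2"
  by (simp add: moment_def power2_norm_eq_inner inner_S_pow mult_2)

lemma moment_odd: "moment x (Suc (2 * p)) = inner (S ((S ^^ p) x)) ((S ^^ p) x)"
  using inner_S_pow[of "Suc p" x p x] by (simp add: moment_def mult_2)

lemma moment_Suc_le: "moment x (Suc t) \<le> moment x t"
proof (cases "even t")
  case True
  then obtain p where t: "t = 2 * p" by auto
  show ?thesis unfolding t moment_even moment_odd by (rule S_le)
next
  case False
  then obtain p where t: "t = Suc (2 * p)" by (auto elim: oddE)
  have "moment x (2 * Suc p) \<le> moment x (Suc (2 * p))"
    unfolding moment_even moment_odd using norm_S_sq_le by simp
  then show ?thesis by (simp add: t)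
qed

lemma moment_decseq: "decseq (moment x)"
  by (simp add: decseq_Suc_iff moment_Suc_le)

lemma moment_nonneg: "0 \<le> moment x t"
proof (cases "even t")
  case True
  then obtain p where t: "t = 2 * p" by auto
  show ?thesis unfolding t moment_even by simp
next
  case False
  then obtain p where t: "t = Suc (2 * p)" by (auto elim: oddE)
  show ?thesis unfolding t moment_odd by (rule S_nonneg)
qed

lemma moment_le: "moment x t \<le> (norm x)\<^sup>2"
  using decseqD[OF moment_decseq, of 0 t x] by (simp add: moment_def power2_norm_eq_inner)

lemma moment_convergent: "convergent (moment x)"
  using decseq_convergent[OF moment_decseq[of x], of 0] moment_nonneg by (metis convergentI)

lemma norm_M_S_pow: "(norm (M ((S ^^ t) x)))\<^sup>2 = C * (moment x (2 * t) - moment x (Suc (2 * t)))"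
  unfolding moment_even moment_odd inner_S_self using C_pos by simp

text \<open>
  Since the moments converge, this makes \<open>S\<^sup>t x\<close> a Cauchy sequence; its limit is the projection of
  \<open>x\<close> onto the kernel of \<open>M\<close>.
\<close>

lemma norm_S_pow_diff:
  "(norm ((S ^^ p) x - (S ^^ q) x))\<^sup>2 = moment x (2 * p) - 2 * moment x (p + q) + moment x (2 * q)"
proof -
  have "inner ((S ^^ q) x) ((S ^^ p) x) = moment x (p + q)"
    by (simp add: inner_S_pow moment_def add.commute)
  moreover have "inner ((S ^^ p) x) ((S ^^ q) x) = moment x (p + q)"
    by (simp add: inner_S_pow moment_def)
  ultimately show ?thesis
    unfolding moment_even power2_norm_eq_inner
    by (simp add: inner_diff_left inner_diff_right)
qed

text \<open>
  An almost-kernel vector of \<open>M\<close> is almost fixed by the powers of \<open>S\<close>: each application of \<open>S\<close>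
  moves it by \<open>M*(M x)/C\<close>.
\<close>

lemma norm_diff_S_pow_le: "norm (x - (S ^^ t) x) \<le> real t * norm (M x) / sqrt C"
proof (induction t)
  case (Suc t)
  have "norm (x - S x) = norm (Ma (M x)) / C"
    using C_pos by (simp add: S_def)
  also have "\<dots> \<le> sqrt C * norm (M x) / C"
    using norm_Ma_le[of "M x"] C_pos by (simp add: divide_right_mono)
  also have "\<dots> = norm (M x) / sqrt C"
    using C_pos by (simp add: divide_simps)
  finally have 1: "norm (x - S x) \<le> norm (M x) / sqrt C" .
  have "norm (S (x - (S ^^ t) x)) \<le> real t * norm (M x) / sqrt C"
    by (rule order_trans[OF norm_S_le Suc])
  moreover have "x - (S ^^ Suc t) x = (x - S x) + S (x - (S ^^ t) x)"
    by (simp add: linear_diff[OF linear_S])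
  ultimately have "norm (x - (S ^^ Suc t) x) \<le> norm (M x) / sqrt C + real t * norm (M x) / sqrt C"
    using 1 by (smt (verit) norm_triangle_ineq)
  then show ?case by (simp add: algebra_simps add_divide_distrib)
qed simp

end

text \<open>
  The coefficients are rounded one after the other. Of the two possible rounding errors at the
  next vector, one makes an obtuse angle with the error accumulated so far, and so the squared
  norms at most add up. No power of the number of vectors enters, in contrast to the triangle
  inequality.
\<close>

lemma round_coefficients:
  fixes a :: "'i \<Rightarrow> 'a::real_inner" and v :: "'i \<Rightarrow> real"
  assumes "finite I" "\<And>i. i \<in> I \<Longrightarrow> 0 \<le> v i \<and> v i \<le> 1"
  shows "\<exists>s. (\<forall>i. s i \<in> {0, 1}) \<and> (norm (\<Sum>i\<in>I. (v i - s i) *\<^sub>R a i))\<^sup>2 \<le> (\<Sum>i\<in>I. (norm (a i))\<^sup>2)"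
  using assms
proof (induction I rule: finite_induct)
  case empty
  show ?case by (intro exI[of _ "\<lambda>_. 0"]) auto
next
  case (insert j I)
  then obtain s where s: "\<forall>i. s i \<in> {0, 1}"
    "(norm (\<Sum>i\<in>I. (v i - s i) *\<^sub>R a i))\<^sup>2 \<le> (\<Sum>i\<in>I. (norm (a i))\<^sup>2)" by auto
  define u where "u = (\<Sum>i\<in>I. (v i - s i) *\<^sub>R a i)"
  \<comment> \<open>one of the two candidate errors points away from the error made so far\<close>
  define e :: real where "e = (if inner u (a j) \<le> 0 then 0 else 1)"
  have v: "0 \<le> v j" "v j \<le> 1" using insert.prems by auto
  have "(v j - e) * inner u (a j) \<le> 0"
    using v by (auto simp: e_def mult_nonneg_nonpos mult_nonpos_nonneg)
  moreover have "(v j - e)\<^sup>2 \<le> 1"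
    using v by (auto simp: e_def abs_square_le_1)
  then have "(v j - e)\<^sup>2 * (norm (a j))\<^sup>2 \<le> (norm (a j))\<^sup>2"
    by (simp add: mult_left_le_one_le)
  moreover have "(norm (u + (v j - e) *\<^sub>R a j))\<^sup>2 =
      (norm u)\<^sup>2 + 2 * ((v j - e) * inner u (a j)) + (v j - e)\<^sup>2 * (norm (a j))\<^sup>2"
    unfolding power2_norm_eq_inner
    by (simp add: inner_add_left inner_add_right inner_commute[of "a j" u] power2_eq_square algebra_simps)
  ultimately have *: "(norm (u + (v j - e) *\<^sub>R a j))\<^sup>2 \<le> (norm (a j))\<^sup>2 + (\<Sum>i\<in>I. (norm (a i))\<^sup>2)"
    using s(2) by (simp add: u_def)
  have "(\<Sum>i\<in>I. (v i - (s(j := e)) i) *\<^sub>R a i) = u"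
    unfolding u_def using insert.hyps by (intro sum.cong) auto
  then show ?case
    using s(1) insert.hyps * by (intro exI[of _ "s(j := e)"]) (auto simp: e_def add.commute)
qed

section \<open>Matrices over the group ring acting on finitely supported functions\<close>

text \<open>
  Pulling back along a partial map can destroy finiteness of the support. The default value \<open>0\<close> in
  that case makes the operation total; it never occurs for partial injections.
\<close>

lift_definition pull :: "('i \<Rightarrow> 'j option) \<Rightarrow> ('j \<Rightarrow>\<^sub>0 real) \<Rightarrow> ('i \<Rightarrow>\<^sub>0 real)"
  is "\<lambda>p x i. if finite {i. p i \<noteq> None \<and> x (the (p i)) \<noteq> 0} then (case p i of None \<Rightarrow> 0 | Some k \<Rightarrow> x k) else 0"
proof -
  fix p :: "'i \<Rightarrow> 'j option" and x :: "'j \<Rightarrow> real"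
  let ?A = "{i. p i \<noteq> None \<and> x (the (p i)) \<noteq> 0}"
  have "{i. (if finite ?A then (case p i of None \<Rightarrow> 0 | Some k \<Rightarrow> x k) else 0) \<noteq> 0}
      \<subseteq> (if finite ?A then ?A else {})"
    by (auto split: option.splits)
  then show "finite {i. (if finite ?A then (case p i of None \<Rightarrow> 0 | Some k \<Rightarrow> x k) else 0) \<noteq> 0}"
    by (rule finite_subset) auto
qed

definition partial_inverses :: "('i \<Rightarrow> 'j option) \<Rightarrow> ('j \<Rightarrow> 'i option) \<Rightarrow> bool" where
  "partial_inverses p q \<longleftrightarrow> (\<forall>i k. p i = Some k \<longleftrightarrow> q k = Some i)"

lemma lookup_pull:
  assumes "partial_inverses p q"
  shows "Poly_Mapping.lookup (pull p x) i = (case p i of None \<Rightarrow> 0 | Some k \<Rightarrow> Poly_Mapping.lookup x k)"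
proof -
  have "{i. p i \<noteq> None \<and> Poly_Mapping.lookup x (the (p i)) \<noteq> 0} \<subseteq> (the \<circ> q) ` Poly_Mapping.keys x"
    using assms by (force simp: partial_inverses_def in_keys_iff image_iff)
  then have "finite {i. p i \<noteq> None \<and> Poly_Mapping.lookup x (the (p i)) \<noteq> 0}"
    by (rule finite_subset) auto
  then show ?thesis by (simp add: pull.rep_eq)
qed

lemma partial_inverses_sym: "partial_inverses p q \<Longrightarrow> partial_inverses q p"
  by (auto simp: partial_inverses_def)

lemma linear_pull: "partial_inverses p q \<Longrightarrow> linear (pull p)"
  by (rule linearI; rule poly_mapping_eqI) (auto simp: lookup_pull lookup_add lookup_scaleR split: option.splits)

lemma pull_adjoint:
  assumes "partial_inverses p q"
  shows "inner (pull p x) y = inner x (pull q y)"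
proof -
  have "inner (pull p x) y = (\<Sum>i\<in>Poly_Mapping.keys y. Poly_Mapping.lookup (pull p x) i * Poly_Mapping.lookup y i)"
    by (subst inner_commute) (simp add: inner_poly_mapping_def mult.commute)
  also have "\<dots> = (\<Sum>i\<in>Poly_Mapping.keys y. \<Sum>k\<in>Poly_Mapping.keys x.
      if p i = Some k then Poly_Mapping.lookup x k * Poly_Mapping.lookup y i else 0)"
  proof (rule sum.cong[OF refl])
    fix i
    show "Poly_Mapping.lookup (pull p x) i * Poly_Mapping.lookup y i = (\<Sum>k\<in>Poly_Mapping.keys x.
      if p i = Some k then Poly_Mapping.lookup x k * Poly_Mapping.lookup y i else 0)"
      by (cases "p i") (auto simp: lookup_pull[OF assms] in_keys_iff)
  qed
  also have "\<dots> = (\<Sum>k\<in>Poly_Mapping.keys x. \<Sum>i\<in>Poly_Mapping.keys y.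
      if q k = Some i then Poly_Mapping.lookup x k * Poly_Mapping.lookup y i else 0)"
    using assms by (subst sum.swap) (auto simp: partial_inverses_def intro!: sum.cong)
  also have "\<dots> = (\<Sum>k\<in>Poly_Mapping.keys x. Poly_Mapping.lookup x k * Poly_Mapping.lookup (pull q y) k)"
  proof (rule sum.cong[OF refl])
    fix k
    show "(\<Sum>i\<in>Poly_Mapping.keys y.
      if q k = Some i then Poly_Mapping.lookup x k * Poly_Mapping.lookup y i else 0) =
      Poly_Mapping.lookup x k * Poly_Mapping.lookup (pull q y) k"
      by (cases "q k") (auto simp: lookup_pull[OF partial_inverses_sym[OF assms]] in_keys_iff)
  qed
  finally show ?thesis by (simp add: inner_poly_mapping_def)
qed

lemma norm_pull_le:
  assumes "partial_inverses p q"
  shows "norm (pull p x) \<le> norm x"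
proof (rule power2_le_imp_le)
  let ?K = "Poly_Mapping.keys (pull p x)"
  have K: "\<exists>k. p i = Some k \<and> k \<in> Poly_Mapping.keys x" if "i \<in> ?K" for i
    using that by (auto simp: in_keys_iff lookup_pull[OF assms] split: option.splits)
  have inj: "inj_on (the \<circ> p) ?K"
  proof (rule inj_onI)
    fix i j assume "i \<in> ?K" "j \<in> ?K" and eq: "(the \<circ> p) i = (the \<circ> p) j"
    then obtain k where "p i = Some k" "p j = Some k" using K by fastforce
    then show "i = j" using assms unfolding partial_inverses_def by (metis option.inject)
  qed
  have "(norm (pull p x))\<^sup>2 = (\<Sum>i\<in>?K. (Poly_Mapping.lookup (pull p x) i)\<^sup>2)"
    by (rule norm_poly_mapping_superset) auto
  also have "\<dots> = (\<Sum>i\<in>?K. (Poly_Mapping.lookup x ((the \<circ> p) i))\<^sup>2)"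
    using K by (intro sum.cong) (fastforce simp: lookup_pull[OF assms])+
  also have "\<dots> = (\<Sum>k\<in>(the \<circ> p) ` ?K. (Poly_Mapping.lookup x k)\<^sup>2)"
    using sum.reindex[OF inj, of "\<lambda>k. (Poly_Mapping.lookup x k)\<^sup>2"] by (simp only: o_def)
  also have "\<dots> \<le> (\<Sum>k\<in>Poly_Mapping.keys x. (Poly_Mapping.lookup x k)\<^sup>2)"
    using K by (intro sum_mono2) fastforce+
  also have "\<dots> = (norm x)\<^sup>2"
    by (rule norm_poly_mapping_superset[symmetric]) auto
  finally show "(norm (pull p x))\<^sup>2 \<le> (norm x)\<^sup>2" .
qed simp

text \<open>
  The matrix unit with entry \<open>(l, s)\<close>, twisted by a bijection \<open>a\<close> of the points.
\<close>

definition move :: "nat \<Rightarrow> nat \<Rightarrow> ('v \<Rightarrow> 'v) \<Rightarrow> nat \<times> 'v \<Rightarrow> (nat \<times> 'v) option" where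
  "move l s a = (\<lambda>(l', v). if l' = l then Some (s, a v) else None)"

lemma partial_inverses_move:
  assumes "\<And>v. b (a v) = v" "\<And>v. a (b v) = v"
  shows "partial_inverses (move l s a) (move s l b)"
  using assms by (auto simp: partial_inverses_def move_def split: if_splits)

text \<open>
  The action of a matrix over the group ring is the same formula for the left translations of the
  group (where it is \<open>\<lambda>(f)\<close>) and for the almost-actions of a sofic approximation; \<open>\<alpha> g\<close> is the map
  that stands for the inverse of \<open>g\<close>, and in \<open>mat_adj\<close> below \<open>\<beta> g\<close> is the inverse map of \<open>\<alpha> g\<close>.
\<close>

definition mat_op ::
  "nat \<Rightarrow> nat \<Rightarrow> (nat \<Rightarrow> nat \<Rightarrow> ('g \<Rightarrow>\<^sub>0 int)) \<Rightarrow> ('g \<Rightarrow> 'v \<Rightarrow> 'v) \<Rightarrow>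
     (nat \<times> 'v \<Rightarrow>\<^sub>0 real) \<Rightarrow> (nat \<times> 'v \<Rightarrow>\<^sub>0 real)" where
  "mat_op m n f \<alpha> x = (\<Sum>l<m. \<Sum>s<n. \<Sum>g\<in>Poly_Mapping.keys (f l s).
     of_int (Poly_Mapping.lookup (f l s) g) *\<^sub>R pull (move l s (\<alpha> g)) x)"

definition mat_adj ::
  "nat \<Rightarrow> nat \<Rightarrow> (nat \<Rightarrow> nat \<Rightarrow> ('g \<Rightarrow>\<^sub>0 int)) \<Rightarrow> ('g \<Rightarrow> 'v \<Rightarrow> 'v) \<Rightarrow>
     (nat \<times> 'v \<Rightarrow>\<^sub>0 real) \<Rightarrow> (nat \<times> 'v \<Rightarrow>\<^sub>0 real)" where
  "mat_adj m n f \<beta> y = (\<Sum>l<m. \<Sum>s<n. \<Sum>g\<in>Poly_Mapping.keys (f l s).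
     of_int (Poly_Mapping.lookup (f l s) g) *\<^sub>R pull (move s l (\<beta> g)) y)"

definition mat_norm :: "nat \<Rightarrow> nat \<Rightarrow> (nat \<Rightarrow> nat \<Rightarrow> ('g \<Rightarrow>\<^sub>0 int)) \<Rightarrow> real" where
  "mat_norm m n f = (\<Sum>l<m. \<Sum>s<n. \<Sum>g\<in>Poly_Mapping.keys (f l s).
     \<bar>of_int (Poly_Mapping.lookup (f l s) g)\<bar>)"

lemma mat_norm_nonneg: "0 \<le> mat_norm m n f"
  by (auto simp: mat_norm_def intro!: sum_nonneg)

text \<open>
  The summand \<open>1\<close> keeps the bound positive for the zero matrix.
\<close>

definition mat_bound :: "nat \<Rightarrow> nat \<Rightarrow> (nat \<Rightarrow> nat \<Rightarrow> ('g \<Rightarrow>\<^sub>0 int)) \<Rightarrow> real" where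
  "mat_bound m n f = (1 + mat_norm m n f)\<^sup>2"

locale inverse_family =
  fixes \<alpha> \<beta> :: "'g \<Rightarrow> 'v \<Rightarrow> 'v"
  assumes inv1: "\<beta> g (\<alpha> g v) = v" and inv2: "\<alpha> g (\<beta> g v) = v"
begin

lemma move_inv: "partial_inverses (move l s (\<alpha> g)) (move s l (\<beta> g))"
  by (rule partial_inverses_move) (simp_all add: inv1 inv2)

lemmas move_inv' = partial_inverses_sym[OF move_inv]

lemma lookup_mat_op:
  "Poly_Mapping.lookup (mat_op m n f \<alpha> x) (l, v) =
     (if l < m then (\<Sum>s<n. \<Sum>g\<in>Poly_Mapping.keys (f l s).
       of_int (Poly_Mapping.lookup (f l s) g) * Poly_Mapping.lookup x (s, \<alpha> g v)) else 0)"
proof -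
  have "Poly_Mapping.lookup (mat_op m n f \<alpha> x) (l, v) =
    (\<Sum>l'<m. if l' = l then (\<Sum>s<n. \<Sum>g\<in>Poly_Mapping.keys (f l' s).
       of_int (Poly_Mapping.lookup (f l' s) g) * Poly_Mapping.lookup x (s, \<alpha> g v)) else 0)"
    unfolding mat_op_def lookup_sum lookup_scaleR lookup_pull[OF move_inv]
    by (intro sum.cong) (auto simp: move_def)
  then show ?thesis by simp
qed

lemma lookup_mat_adj:
  "Poly_Mapping.lookup (mat_adj m n f \<beta> y) (s, w) =
     (if s < n then (\<Sum>l<m. \<Sum>g\<in>Poly_Mapping.keys (f l s).
       of_int (Poly_Mapping.lookup (f l s) g) * Poly_Mapping.lookup y (l, \<beta> g w)) else 0)"
proof -
  have "Poly_Mapping.lookup (mat_adj m n f \<beta> y) (s, w) =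
    (\<Sum>l<m. \<Sum>s'<n. if s' = s then (\<Sum>g\<in>Poly_Mapping.keys (f l s').
       of_int (Poly_Mapping.lookup (f l s') g) * Poly_Mapping.lookup y (l, \<beta> g w)) else 0)"
    unfolding mat_adj_def lookup_sum lookup_scaleR lookup_pull[OF move_inv']
    by (intro sum.cong) (auto simp: move_def)
  then show ?thesis by simp
qed

lemma linear_mat_op: "linear (mat_op m n f \<alpha>)"
  unfolding mat_op_def
  by (intro linear_compose_sum ballI linear_compose_scale_right linear_pull[OF move_inv])

lemma linear_mat_adj: "linear (mat_adj m n f \<beta>)"
  unfolding mat_adj_def
  by (intro linear_compose_sum ballI linear_compose_scale_right linear_pull[OF move_inv'])

lemma mat_adjoint: "inner (mat_op m n f \<alpha> x) y = inner x (mat_adj m n f \<beta> y)"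
  unfolding mat_op_def mat_adj_def
  by (simp add: inner_sum_left inner_sum_right pull_adjoint[OF move_inv])

lemma norm_mat_op: "norm (mat_op m n f \<alpha> x) \<le> mat_norm m n f * norm x"
  unfolding mat_op_def mat_norm_def sum_distrib_right
  by (intro order_trans[OF norm_sum] sum_mono) (simp add: mult_left_mono norm_pull_le[OF move_inv])

lemma adjoint_pair: "adjoint_pair (mat_op m n f \<alpha>) (mat_adj m n f \<beta>) (mat_bound m n f)"
proof (rule adjoint_pair.intro)
  show "(norm (mat_op m n f \<alpha> x))\<^sup>2 \<le> mat_bound m n f * (norm x)\<^sup>2" for x
  proof -
    have "norm (mat_op m n f \<alpha> x) \<le> (1 + mat_norm m n f) * norm x"
      using norm_mat_op[of m n f x] by (simp add: distrib_right add_increasing)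
    then show ?thesis
      unfolding mat_bound_def power_mult_distrib[symmetric] by (rule power_mono) simp
  qed
  show "0 < mat_bound m n f"
    using mat_norm_nonneg[of m n f] by (simp add: mat_bound_def)
qed (rule linear_mat_op linear_mat_adj mat_adjoint)+

end

section \<open>Generic points of a sofic approximation\<close>

text \<open>
  Pairs \<open>(i, j)\<close> with \<open>j \<in> {1..d i}\<close>, filtered by the properties that fail for an asymptotically
  vanishing proportion of the points. The laws of a group action hold eventually in this filter,
  which turns the combination of finitely many of them into filter calculus.
\<close>

definition generic :: "(nat \<Rightarrow> nat) \<Rightarrow> (nat \<times> nat) filter" where
  "generic d = Abs_filter (\<lambda>P. (\<lambda>i. real (card {j\<in>{1..d i}. \<not> P (i, j)}) / real (d i)) \<longlonglongrightarrow> 0)"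

lemma eventually_generic:
  "eventually P (generic d) \<longleftrightarrow> (\<lambda>i. real (card {j\<in>{1..d i}. \<not> P (i, j)}) / real (d i)) \<longlonglongrightarrow> 0"
  unfolding generic_def
proof (rule eventually_Abs_filter, rule is_filter.intro)
  show "(\<lambda>i. real (card {j \<in> {1..d i}. \<not> True}) / real (d i)) \<longlonglongrightarrow> 0" by simp
next
  fix P Q :: "nat \<times> nat \<Rightarrow> bool"
  assume "(\<lambda>i. real (card {j \<in> {1..d i}. \<not> P (i, j)}) / real (d i)) \<longlonglongrightarrow> 0"
    and "(\<lambda>i. real (card {j \<in> {1..d i}. \<not> Q (i, j)}) / real (d i)) \<longlonglongrightarrow> 0"
  from tendsto_add[OF this]
  have lim: "(\<lambda>i. (real (card {j \<in> {1..d i}. \<not> P (i, j)}) + real (card {j \<in> {1..d i}. \<not> Q (i, j)})) / real (d i)) \<longlonglongrightarrow> 0"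
    by (simp add: add_divide_distrib)
  show "(\<lambda>i. real (card {j \<in> {1..d i}. \<not> (P (i, j) \<and> Q (i, j))}) / real (d i)) \<longlonglongrightarrow> 0"
  proof (rule tendsto_sandwich[OF _ _ tendsto_const lim]; intro always_eventually allI)
    fix i
    have "{j \<in> {1..d i}. \<not> (P (i, j) \<and> Q (i, j))} = {j \<in> {1..d i}. \<not> P (i, j)} \<union> {j \<in> {1..d i}. \<not> Q (i, j)}"
      by auto
    then have "card {j \<in> {1..d i}. \<not> (P (i, j) \<and> Q (i, j))} \<le>
        card {j \<in> {1..d i}. \<not> P (i, j)} + card {j \<in> {1..d i}. \<not> Q (i, j)}"
      by (rule ord_eq_le_trans[OF arg_cong[where f = card] card_Un_le])
    then show "real (card {j \<in> {1..d i}. \<not> (P (i, j) \<and> Q (i, j))}) / real (d i) \<le>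
      (real (card {j \<in> {1..d i}. \<not> P (i, j)}) + real (card {j \<in> {1..d i}. \<not> Q (i, j)})) / real (d i)"
      by (intro divide_right_mono) linarith+
  qed simp
next
  fix P Q :: "nat \<times> nat \<Rightarrow> bool"
  assume PQ: "\<forall>x. P x \<longrightarrow> Q x"
    and lim: "(\<lambda>i. real (card {j \<in> {1..d i}. \<not> P (i, j)}) / real (d i)) \<longlonglongrightarrow> 0"
  show "(\<lambda>i. real (card {j \<in> {1..d i}. \<not> Q (i, j)}) / real (d i)) \<longlonglongrightarrow> 0"
  proof (rule tendsto_sandwich[OF _ _ tendsto_const lim]; intro always_eventually allI)
    show "real (card {j \<in> {1..d i}. \<not> Q (i, j)}) / real (d i)
       \<le> real (card {j \<in> {1..d i}. \<not> P (i, j)}) / real (d i)" for i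
      using PQ by (intro divide_right_mono of_nat_mono card_mono) auto
  qed simp
qed

lemma generic_card_le:
  assumes "eventually P (generic d)" "0 < \<delta>"
  shows "\<forall>\<^sub>F i in sequentially. real (card {j\<in>{1..d i}. \<not> P (i, j)}) \<le> \<delta> * real (d i)"
  using order_tendstoD(2)[OF assms(1)[unfolded eventually_generic] assms(2)]
proof eventually_elim
  case (elim i)
  then show ?case by (cases "d i = 0") (auto simp: field_simps)
qed

text \<open>
  The points where the bound \<open>u\<close> fails are few and contribute at most \<open>D\<close> each.
\<close>

lemma generic_sum_le:
  fixes b :: "nat \<Rightarrow> nat \<Rightarrow> real"
  assumes "eventually (\<lambda>(i, j). b i j \<le> u) (generic d)"
    and "\<And>i j. j \<in> {1..d i} \<Longrightarrow> b i j \<le> D" "0 \<le> u" "0 \<le> D" "0 < \<delta>"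
  shows "\<forall>\<^sub>F i in sequentially. (\<Sum>j\<in>{1..d i}. b i j) \<le> (u + \<delta>) * real (d i)"
proof -
  have "0 < \<delta> / (D + 1)" using assms by simp
  from generic_card_le[OF assms(1) this] show ?thesis
  proof eventually_elim
    case (elim i)
    let ?B = "{j\<in>{1..d i}. \<not> b i j \<le> u}"
    have "(\<Sum>j\<in>{1..d i}. b i j) \<le> (\<Sum>j\<in>{1..d i}. u + (if j \<in> ?B then D else 0))"
      using assms(2,3) by (intro sum_mono) (auto intro: add_increasing)
    also have "\<dots> = u * real (d i) + D * real (card ?B)"
    proof -
      have "(\<Sum>j\<in>{1..d i}. if j \<in> ?B then D else 0) = (\<Sum>j\<in>?B. D)"
        by (rule sum.mono_neutral_cong_right) auto
      then show ?thesis by (simp add: sum.distrib)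
    qed
    also have "D * real (card ?B) \<le> D * (\<delta> / (D + 1) * real (d i))"
      using elim assms(4) by (intro mult_left_mono) auto
    also have "\<dots> \<le> \<delta> * real (d i)"
    proof -
      have "D * (\<delta> / (D + 1)) \<le> \<delta>" using assms(4,5) by (simp add: field_simps)
      then show ?thesis by (simp only: mult.assoc[symmetric] mult_right_mono of_nat_0_le_iff)
    qed
    finally show ?case by (simp add: algebra_simps)
  qed
qed

lemma generic_sum_ge:
  fixes b :: "nat \<Rightarrow> nat \<Rightarrow> real"
  assumes "eventually (\<lambda>(i, j). u \<le> b i j) (generic d)"
    and "\<And>i j. j \<in> {1..d i} \<Longrightarrow> 0 \<le> b i j" "0 < \<delta>"
  shows "\<forall>\<^sub>F i in sequentially. (u - \<delta>) * real (d i) \<le> (\<Sum>j\<in>{1..d i}. b i j)"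
proof (cases "u \<le> 0")
  case True
  show ?thesis
  proof (intro always_eventually allI)
    fix i
    have "(u - \<delta>) * real (d i) \<le> 0" using True assms(3) by (intro mult_nonpos_nonneg) auto
    also have "0 \<le> (\<Sum>j\<in>{1..d i}. b i j)" by (intro sum_nonneg assms(2)) auto
    finally show "(u - \<delta>) * real (d i) \<le> (\<Sum>j\<in>{1..d i}. b i j)" .
  qed
next
  case False
  have "eventually (\<lambda>(i, j). u - min u (b i j) \<le> 0) (generic d)"
    using assms(1) by eventually_elim auto
  from generic_sum_le[OF this, of u \<delta>] False assms(2,3)
  have "\<forall>\<^sub>F i in sequentially. (\<Sum>j\<in>{1..d i}. u - min u (b i j)) \<le> \<delta> * real (d i)"
    by simp
  then show ?thesis
  proof eventually_elim
    case (elim i)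
    have "(\<Sum>j\<in>{1..d i}. u - b i j) \<le> (\<Sum>j\<in>{1..d i}. u - min u (b i j))"
      by (intro sum_mono) auto
    with elim show ?case by (simp add: sum_subtractf algebra_simps)
  qed
qed

locale sofic_model =
  fixes d :: "nat \<Rightarrow> nat" and \<sigma> :: "nat \<Rightarrow> 'g::group_add \<Rightarrow> nat \<Rightarrow> nat"
  assumes sofic_approx: "sofic_approximation d \<sigma>"
begin

lemma d_pos: "0 < d i"
  and permutes: "\<sigma> i g permutes {1..d i}"
  using sofic_approx by (auto simp: sofic_approximation_def)

lemma sigma_in: "j \<in> {1..d i} \<Longrightarrow> \<sigma> i g j \<in> {1..d i}"
  using permutes by (metis permutes_in_image)

lemma generic_compl:
  assumes "(\<lambda>i. real (card {j\<in>{1..d i}. P i j}) / real (d i)) \<longlonglongrightarrow> 1"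
  shows "eventually (\<lambda>(i, j). P i j) (generic d)"
proof -
  have "real (card {j\<in>{1..d i}. \<not> P i j}) / real (d i) = 1 - real (card {j\<in>{1..d i}. P i j}) / real (d i)" for i
  proof -
    have "card {j\<in>{1..d i}. P i j} + card {j\<in>{1..d i}. \<not> P i j} = card ({j\<in>{1..d i}. P i j} \<union> {j\<in>{1..d i}. \<not> P i j})"
      by (rule card_Un_disjoint[symmetric]) auto
    also have "{j\<in>{1..d i}. P i j} \<union> {j\<in>{1..d i}. \<not> P i j} = {1..d i}" by auto
    finally have "real (card {j\<in>{1..d i}. P i j}) + real (card {j\<in>{1..d i}. \<not> P i j}) = real (d i)"
      by (simp flip: of_nat_add)
    then show ?thesis using d_pos[of i] by (simp add: field_simps)
  qed
  moreover have "(\<lambda>i. 1 - real (card {j\<in>{1..d i}. P i j}) / real (d i)) \<longlonglongrightarrow> 1 - 1"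
    by (intro tendsto_intros assms)
  ultimately show ?thesis by (simp add: eventually_generic)
qed

lemma generic_mult: "eventually (\<lambda>(i, j). \<sigma> i g (\<sigma> i h j) = \<sigma> i (g + h) j) (generic d)"
  using sofic_approx by (intro generic_compl) (auto simp: sofic_approximation_def)

lemma generic_free: "g \<noteq> h \<Longrightarrow> eventually (\<lambda>(i, j). \<sigma> i g j \<noteq> \<sigma> i h j) (generic d)"
  using sofic_approx by (intro generic_compl) (auto simp: sofic_approximation_def)

lemma sigma_inj: "\<sigma> i g j = \<sigma> i g k \<Longrightarrow> j = k"
  using permutes_inj[OF permutes] by (simp add: inj_def)

text \<open>
  Multiplicativity at the identity gives \<open>\<sigma>\<^sub>0 \<circ> \<sigma>\<^sub>0 = \<sigma>\<^sub>0\<close> at most points, and a permutation can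
  be cancelled.
\<close>

lemma generic_zero: "eventually (\<lambda>(i, j). \<sigma> i 0 j = j) (generic d)"
  using generic_mult[of 0 0] by eventually_elim (auto dest: sigma_inj)

end

section \<open>Transporting finitely supported functions from the group to the models\<close>

text \<open>
  Based at a point \<open>j\<close> of the model, the orbit map \<open>w \<mapsto> \<sigma>\<^sub>w(j)\<close> carries functions on the group to
  functions on the model. For most \<open>j\<close> it is injective on a given finite set and intertwines the
  actions.
\<close>

definition transport :: "('v \<Rightarrow> 'w) \<Rightarrow> (nat \<times> 'v \<Rightarrow>\<^sub>0 real) \<Rightarrow> (nat \<times> 'w \<Rightarrow>\<^sub>0 real)" where
  "transport p x = (\<Sum>k\<in>Poly_Mapping.keys x. Poly_Mapping.lookup x k *\<^sub>R unit (fst k, p (snd k)))"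

lemma transport_superset:
  assumes "finite A" "Poly_Mapping.keys x \<subseteq> A"
  shows "transport p x = (\<Sum>k\<in>A. Poly_Mapping.lookup x k *\<^sub>R unit (fst k, p (snd k)))"
  unfolding transport_def using assms
  by (intro sum.mono_neutral_left) (auto simp: in_keys_iff)

lemma linear_transport: "linear (transport p)"
proof (rule linearI)
  fix x y :: "nat \<times> 'a \<Rightarrow>\<^sub>0 real" and r :: real
  let ?A = "Poly_Mapping.keys x \<union> Poly_Mapping.keys y"
  have 1: "Poly_Mapping.keys (x + y) \<subseteq> ?A" "Poly_Mapping.keys (r *\<^sub>R x) \<subseteq> ?A"
    using Poly_Mapping.keys_add[of x y] by (auto simp: in_keys_iff lookup_scaleR)
  note T = transport_superset[of ?A]
  show "transport p (x + y) = transport p x + transport p y"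
    using 1 by (simp add: T lookup_add scaleR_add_left sum.distrib)
  show "transport p (r *\<^sub>R x) = r *\<^sub>R transport p x"
    using 1 by (simp add: T lookup_scaleR scaleR_sum_right)
qed

lemma transport_unit [simp]: "transport p (unit (s, v)) = unit (s, p v)"
  by (simp add: transport_def lookup_unit)

lemma inner_transport:
  assumes "inj_on p (snd ` (Poly_Mapping.keys x \<union> Poly_Mapping.keys y))"
  shows "inner (transport p x) (transport p y) = inner x y"
proof -
  let ?A = "Poly_Mapping.keys x \<union> Poly_Mapping.keys y"
  have *: "inner (unit (fst k, p (snd k))) (unit (fst k', p (snd k'))) = (if k = k' then 1 else 0)"
    if "k \<in> ?A" "k' \<in> ?A" for k k'
  proof -
    have "p (snd k) = p (snd k') \<longleftrightarrow> snd k = snd k'"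
      using inj_on_eq_iff[OF assms, of "snd k" "snd k'"] that by blast
    then show ?thesis by (auto simp: inner_unit_left lookup_unit prod_eq_iff)
  qed
  have "inner (transport p x) (transport p y) =
    (\<Sum>k'\<in>?A. \<Sum>k\<in>?A. Poly_Mapping.lookup y k' * (Poly_Mapping.lookup x k *
        inner (unit (fst k, p (snd k))) (unit (fst k', p (snd k')))))"
    by (simp add: transport_superset[of ?A] inner_sum_left inner_sum_right sum_distrib_left)
  also have "\<dots> = (\<Sum>k'\<in>?A. \<Sum>k\<in>?A. if k = k' then Poly_Mapping.lookup x k * Poly_Mapping.lookup y k else 0)"
    by (intro sum.cong refl) (simp add: *)
  also have "\<dots> = inner x y"
    by (simp add: inner_poly_mapping_superset[of ?A x y])
  finally show ?thesis .
qed

lemma pull_move_unit: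
  assumes "\<And>v. b (a v) = v" "\<And>v. a (b v) = v"
  shows "pull (move l s a) (unit (s', w)) = (if s' = s then unit (l, b w) else 0)"
proof (rule poly_mapping_eqI)
  fix k :: "nat \<times> 'a"
  obtain l' v where k: "k = (l', v)" by fastforce
  have "a v = w \<longleftrightarrow> b w = v" using assms(1)[of v] assms(2)[of w] by auto
  then show "Poly_Mapping.lookup (pull (move l s a) (unit (s', w))) k =
      Poly_Mapping.lookup (if s' = s then unit (l, b w) else 0) k"
    unfolding k lookup_pull[OF partial_inverses_move[of b a, OF assms]]
    unfolding move_def
    by (auto simp: lookup_unit)
qed

abbreviation (input) ltrans_inv :: "'g::group_add \<Rightarrow> 'g \<Rightarrow> 'g" where "ltrans_inv g h \<equiv> - g + h"
abbreviation (input) ltrans :: "'g::group_add \<Rightarrow> 'g \<Rightarrow> 'g" where "ltrans g h \<equiv> g + h"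

lemma group_family: "inverse_family (ltrans_inv :: 'g::group_add \<Rightarrow> 'g \<Rightarrow> 'g) ltrans"
  by standard (simp_all add: add.assoc[symmetric])

abbreviation (in sofic_model) act_inv :: "nat \<Rightarrow> 'g \<Rightarrow> nat \<Rightarrow> nat" where "act_inv i g \<equiv> \<sigma> i (- g)"
abbreviation (in sofic_model) act :: "nat \<Rightarrow> 'g \<Rightarrow> nat \<Rightarrow> nat" where "act i g \<equiv> inv_into UNIV (\<sigma> i (- g))"

context sofic_model
begin

lemma model_family: "inverse_family (act_inv i) (act i)"
  by standard (simp_all add: permutes_inverses[OF permutes])

sublocale G: inverse_family "ltrans_inv :: 'g \<Rightarrow> 'g \<Rightarrow> 'g" ltrans
  by (rule group_family)

abbreviation \<theta> :: "nat \<Rightarrow> nat \<Rightarrow> (nat \<times> 'g \<Rightarrow>\<^sub>0 real) \<Rightarrow> (nat \<times> nat \<Rightarrow>\<^sub>0 real)" where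
  "\<theta> i j \<equiv> transport (\<lambda>w. \<sigma> i w j)"

lemma generic_transport_linear:
  fixes L :: "(nat \<times> 'g \<Rightarrow>\<^sub>0 real) \<Rightarrow> (nat \<times> 'g \<Rightarrow>\<^sub>0 real)"
    and L' :: "nat \<Rightarrow> (nat \<times> nat \<Rightarrow>\<^sub>0 real) \<Rightarrow> (nat \<times> nat \<Rightarrow>\<^sub>0 real)"
  assumes L: "linear L" and L': "\<And>i. linear (L' i)"
    and "\<And>s w. eventually (\<lambda>(i, j). \<theta> i j (L (unit (s, w))) = L' i (\<theta> i j (unit (s, w)))) (generic d)"
  shows "eventually (\<lambda>(i, j). \<theta> i j (L x) = L' i (\<theta> i j x)) (generic d)"
proof -
  have "eventually (\<lambda>q. \<forall>k\<in>Poly_Mapping.keys x. (\<lambda>(i, j). \<theta> i j (L (unit k)) = L' i (\<theta> i j (unit k))) q) (generic d)"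
    using assms(3) by (intro eventually_ball_finite ballI) (auto simp del: transport_unit)
  then show ?thesis
  proof eventually_elim
    case (elim q)
    obtain i j where q: "q = (i, j)" by fastforce
    have x: "x = (\<Sum>k\<in>Poly_Mapping.keys x. Poly_Mapping.lookup x k *\<^sub>R unit k)"
      by (rule unit_expansion) auto
    have "\<theta> i j (L x) = (\<Sum>k\<in>Poly_Mapping.keys x. Poly_Mapping.lookup x k *\<^sub>R \<theta> i j (L (unit k)))"
      by (subst x) (simp add: linear_sum[OF L] linear_sum[OF linear_transport] linear_scale[OF L] linear_scale[OF linear_transport])
    also have "\<dots> = (\<Sum>k\<in>Poly_Mapping.keys x. Poly_Mapping.lookup x k *\<^sub>R L' i (\<theta> i j (unit k)))"
      using elim by (intro sum.cong) (auto simp: q)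
    also have "\<dots> = L' i (\<theta> i j (\<Sum>k\<in>Poly_Mapping.keys x. Poly_Mapping.lookup x k *\<^sub>R unit k))"
      by (simp add: linear_sum[OF L'] linear_sum[OF linear_transport] linear_scale[OF L'] linear_scale[OF linear_transport])
    finally show ?case by (simp add: q flip: x)
  qed
qed

lemma generic_pull_act_inv:
  "eventually (\<lambda>(i, j). \<theta> i j (pull (move l s (ltrans_inv g)) x) = pull (move l s (act_inv i g)) (\<theta> i j x)) (generic d)"
proof (rule generic_transport_linear[OF linear_pull[OF G.move_inv] linear_pull[OF inverse_family.move_inv[OF model_family]]])
  fix s' w
  show "eventually (\<lambda>(i, j). \<theta> i j (pull (move l s (ltrans_inv g)) (unit (s', w))) =
    pull (move l s (act_inv i g)) (\<theta> i j (unit (s', w)))) (generic d)"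
    using generic_mult[of "- g" "g + w"]
  proof eventually_elim
    case (elim q)
    obtain i j where q: "q = (i, j)" by fastforce
    have "act i g (\<sigma> i w j) = \<sigma> i (g + w) j"
      using elim permutes_inverses(2)[OF permutes, of i "- g" "\<sigma> i (g + w) j"]
      by (simp add: q add.assoc[symmetric])
    then show ?case
      using inverse_family.inv1[OF model_family] inverse_family.inv2[OF model_family]
      by (simp add: q pull_move_unit[where a = "ltrans_inv g" and b = "ltrans g"] add.assoc[symmetric]
          pull_move_unit[where a = "act_inv i g" and b = "act i g"] linear_0[OF linear_transport])
  qed
qed

lemma generic_pull_act:
  "eventually (\<lambda>(i, j). \<theta> i j (pull (move l s (ltrans g)) x) = pull (move l s (act i g)) (\<theta> i j x)) (generic d)"
proof (rule generic_transport_linear[OF linear_pull[OF G.move_inv'] linear_pull[OF inverse_family.move_inv'[OF model_family]]])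
  fix s' w
  show "eventually (\<lambda>(i, j). \<theta> i j (pull (move l s (ltrans g)) (unit (s', w))) =
    pull (move l s (act i g)) (\<theta> i j (unit (s', w)))) (generic d)"
    using generic_mult[of "- g" w]
  proof eventually_elim
    case (elim q)
    obtain i j where q: "q = (i, j)" by fastforce
    show ?case
      using elim inverse_family.inv1[OF model_family] inverse_family.inv2[OF model_family]
      by (simp add: q pull_move_unit[where a = "ltrans g" and b = "ltrans_inv g"] add.assoc[symmetric]
          pull_move_unit[where a = "act i g" and b = "act_inv i g"] linear_0[OF linear_transport])
  qed
qed

end

locale group_matrix =
  fixes m n :: nat and f :: "nat \<Rightarrow> nat \<Rightarrow> ('g::group_add \<Rightarrow>\<^sub>0 int)"
begin

definition C where "C = mat_bound m n f"

abbreviation "MG \<equiv> mat_op m n f (ltrans_inv :: 'g \<Rightarrow> 'g \<Rightarrow> 'g)"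
abbreviation "MaG \<equiv> mat_adj m n f (ltrans :: 'g \<Rightarrow> 'g \<Rightarrow> 'g)"

sublocale GF: inverse_family "ltrans_inv :: 'g \<Rightarrow> 'g \<Rightarrow> 'g" ltrans
  by (rule group_family)

sublocale GA: adjoint_pair MG MaG C
  unfolding C_def by (rule GF.adjoint_pair)

end

locale sofic_matrix = sofic_model d \<sigma> + group_matrix m n f
  for d and \<sigma> :: "nat \<Rightarrow> 'g::group_add \<Rightarrow> nat \<Rightarrow> nat" and m n and f :: "nat \<Rightarrow> nat \<Rightarrow> ('g \<Rightarrow>\<^sub>0 int)"
begin

abbreviation "MM i \<equiv> mat_op m n f (act_inv i)"
abbreviation "MMa i \<equiv> mat_adj m n f (act i)"

lemma model_pair: "adjoint_pair (MM i) (MMa i) C"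
  unfolding C_def by (rule inverse_family.adjoint_pair[OF model_family])

abbreviation "SS i \<equiv> adjoint_pair.S (MM i) (MMa i) C"

lemma eventually_ball_lessThan:
  assumes "\<And>l. eventually (P l) F"
  shows "eventually (\<lambda>q. \<forall>l\<in>{..<N::nat}. P l q) F"
  using assms by (intro eventually_ball_finite) auto

lemma generic_MM: "eventually (\<lambda>(i, j). \<theta> i j (MG x) = MM i (\<theta> i j x)) (generic d)"
proof -
  have "eventually (\<lambda>q. \<forall>l\<in>{..<m}. \<forall>s\<in>{..<n}. \<forall>g\<in>Poly_Mapping.keys (f l s).
     (\<lambda>(i, j). \<theta> i j (pull (move l s (ltrans_inv g)) x) = pull (move l s (act_inv i g)) (\<theta> i j x)) q) (generic d)"
    by (intro eventually_ball_finite ballI generic_pull_act_inv) auto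
  then show ?thesis
    by eventually_elim
       (auto simp: mat_op_def linear_sum[OF linear_transport] linear_scale[OF linear_transport])
qed

lemma generic_MMa: "eventually (\<lambda>(i, j). \<theta> i j (MaG x) = MMa i (\<theta> i j x)) (generic d)"
proof -
  have "eventually (\<lambda>q. \<forall>l\<in>{..<m}. \<forall>s\<in>{..<n}. \<forall>g\<in>Poly_Mapping.keys (f l s).
     (\<lambda>(i, j). \<theta> i j (pull (move s l (ltrans g)) x) = pull (move s l (act i g)) (\<theta> i j x)) q) (generic d)"
    by (intro eventually_ball_finite ballI generic_pull_act) auto
  then show ?thesis
    by eventually_elim
       (auto simp: mat_adj_def linear_sum[OF linear_transport] linear_scale[OF linear_transport])
qed

lemma generic_SS: "eventually (\<lambda>(i, j). \<theta> i j (GA.S x) = SS i (\<theta> i j x)) (generic d)"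
  using generic_MM[of x] generic_MMa[of "MG x"]
proof eventually_elim
  case (elim q)
  obtain i j where q: "q = (i, j)" by fastforce
  interpret I: adjoint_pair "MM i" "MMa i" C by (rule model_pair)
  show ?case
    using elim by (simp add: q GA.S_def I.S_def linear_diff[OF linear_transport] linear_scale[OF linear_transport])
qed

lemma generic_SS_pow: "eventually (\<lambda>(i, j). \<theta> i j ((GA.S ^^ t) x) = (SS i ^^ t) (\<theta> i j x)) (generic d)"
proof (induction t)
  case (Suc t)
  from Suc generic_SS[of "(GA.S ^^ t) x"] show ?case by eventually_elim auto
qed simp

lemma generic_inj:
  assumes "finite (W :: 'g set)"
  shows "eventually (\<lambda>(i, j). inj_on (\<lambda>w. \<sigma> i w j) W) (generic d)"
proof -
  have "eventually (\<lambda>q. \<forall>g\<in>W. \<forall>h\<in>W. (\<lambda>(i, j). g \<noteq> h \<longrightarrow> \<sigma> i g j \<noteq> \<sigma> i h j) q) (generic d)"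
  proof (intro eventually_ball_finite ballI assms)
    fix g h
    show "eventually (\<lambda>(i, j). g \<noteq> h \<longrightarrow> \<sigma> i g j \<noteq> \<sigma> i h j) (generic d)"
      by (cases "g = h") (use generic_free[of g h] in \<open>auto simp: case_prod_unfold\<close>)
  qed
  then show ?thesis by eventually_elim (auto simp: inj_on_def)
qed

text \<open>
  A moment is determined by finitely many values, so the local isomorphism between group and model
  transfers it exactly, at most points.
\<close>

lemma generic_moment:
  "eventually (\<lambda>(i, j). adjoint_pair.moment (MM i) (MMa i) C (unit (s, j)) t = GA.moment (unit (s, 0)) t) (generic d)"
proof -
  let ?x = "(GA.S ^^ t) (unit (s, 0))"
  have "finite (snd ` (Poly_Mapping.keys ?x \<union> Poly_Mapping.keys (unit (s, 0 :: 'g))))" by simp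
  from generic_inj[OF this] generic_SS_pow[of t "unit (s, 0)"] generic_zero
  show ?thesis
  proof eventually_elim
    case (elim q)
    obtain i j where q: "q = (i, j)" by fastforce
    interpret I: adjoint_pair "MM i" "MMa i" C by (rule model_pair)
    have "inner (\<theta> i j ?x) (\<theta> i j (unit (s, 0))) = inner ?x (unit (s, 0))"
      using elim(1) by (intro inner_transport) (simp add: q)
    with elim(2,3) show ?case by (simp add: q I.moment_def GA.moment_def)
  qed
qed

end

section \<open>The von Neumann dimension of a kernel as a limit of moments\<close>

lemma l2_mult_abs_summable:
  assumes "a \<in> l2" "b \<in> l2"
  shows "(\<lambda>h. norm (a h * cnj (b h))) summable_on UNIV"
proof (rule summable_on_comparison_test)
  show "(\<lambda>h. (cmod (a h))\<^sup>2 + (cmod (b h))\<^sup>2) summable_on UNIV"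
    using assms by (intro summable_on_add) (auto simp: l2_def)
  show "norm (a h * cnj (b h)) \<le> (cmod (a h))\<^sup>2 + (cmod (b h))\<^sup>2" for h
  proof -
    have "0 \<le> cmod (a h) * cmod (b h)" by simp
    then show ?thesis
      using sum_squares_bound[of "cmod (a h)" "cmod (b h)"] unfolding norm_mult complex_mod_cnj by linarith
  qed
qed auto

lemma l2_mult_summable:
  assumes "a \<in> l2" "b \<in> l2"
  shows "(\<lambda>h. a h * cnj (b h)) summable_on UNIV"
  using abs_summable_summable[OF l2_mult_abs_summable[OF assms]] .

lemma infsum_diff:
  fixes p q :: "'i \<Rightarrow> complex"
  assumes "p summable_on A" "q summable_on A"
  shows "infsum (\<lambda>h. p h - q h) A = infsum p A - infsum q A"
  using infsum_add[OF assms(1), of "\<lambda>h. - q h"] assms(2)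
  by (simp add: summable_on_uminus infsum_uminus)

lemma cmod_diff_sq_le: "(cmod (a - b))\<^sup>2 \<le> 2 * (cmod a)\<^sup>2 + 2 * (cmod b)\<^sup>2"
proof -
  have "(cmod (a - b))\<^sup>2 \<le> (cmod a + cmod b)\<^sup>2"
    by (intro power_mono norm_triangle_ineq4) auto
  also have "\<dots> \<le> 2 * (cmod a)\<^sup>2 + 2 * (cmod b)\<^sup>2"
    using sum_squares_bound[of "cmod a" "cmod b"] by (simp add: power2_sum)
  finally show ?thesis .
qed

lemma l2_diff:
  assumes "a \<in> l2" "b \<in> l2"
  shows "(\<lambda>h. a h - b h) \<in> l2"
  unfolding l2_def mem_Collect_eq
proof (rule summable_on_comparison_test)
  show "(\<lambda>h. 2 * (cmod (a h))\<^sup>2 + 2 * (cmod (b h))\<^sup>2) summable_on UNIV"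
    using assms by (intro summable_on_add summable_on_cmult_right) (auto simp: l2_def)
qed (auto intro: cmod_diff_sq_le)

lemma l2_bounded:
  assumes "\<And>F. finite F \<Longrightarrow> (\<Sum>h\<in>F. (cmod (a h))\<^sup>2) \<le> B"
  shows "a \<in> l2" "infsum (\<lambda>h. (cmod (a h))\<^sup>2) UNIV \<le> B"
proof -
  show "a \<in> l2" unfolding l2_def mem_Collect_eq
    using assms by (intro nonneg_bdd_above_summable_on) (auto simp: bdd_above_def)
  then show "infsum (\<lambda>h. (cmod (a h))\<^sup>2) UNIV \<le> B"
    using assms by (intro infsum_le_finite_sums) (auto simp: l2_def)
qed

text \<open>
  Outside a finite set that carries most of \<open>z\<close>, the inner products are uniformly small because
  the sequence is bounded; on the finite set pointwise convergence suffices.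
\<close>

lemma l2_weak_limit:
  fixes a :: "nat \<Rightarrow> 'g \<Rightarrow> complex"
  assumes bound: "\<And>t F. finite F \<Longrightarrow> (\<Sum>h\<in>F. (cmod (a t h))\<^sup>2) \<le> B"
    and lim: "\<And>h. (\<lambda>t. a t h) \<longlonglongrightarrow> w h" and z: "z \<in> l2"
  shows "w \<in> l2" "(\<lambda>t. infsum (\<lambda>h. a t h * cnj (z h)) UNIV) \<longlonglongrightarrow> infsum (\<lambda>h. w h * cnj (z h)) UNIV"
proof -
  have wB: "(\<Sum>h\<in>F. (cmod (w h))\<^sup>2) \<le> B" if "finite F" for F
  proof (rule LIMSEQ_le_const2)
    show "(\<lambda>t. \<Sum>h\<in>F. (cmod (a t h))\<^sup>2) \<longlonglongrightarrow> (\<Sum>h\<in>F. (cmod (w h))\<^sup>2)"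
      by (intro tendsto_intros lim)
  qed (use bound[OF that] in auto)
  show w: "w \<in> l2" by (rule l2_bounded[OF wB])
  have a: "a t \<in> l2" for t by (rule l2_bounded[OF bound])
  have B: "0 \<le> B" using bound[of "{}"] by simp
  have D: "(\<lambda>h. a t h - w h) \<in> l2" for t by (rule l2_diff[OF a w])
  have Dle: "infsum (\<lambda>h. (cmod (a t h - w h))\<^sup>2) UNIV \<le> 4 * B" for t
  proof (rule l2_bounded(2))
    fix F :: "'g set" assume F: "finite F"
    have "(\<Sum>h\<in>F. (cmod (a t h - w h))\<^sup>2) \<le> (\<Sum>h\<in>F. 2 * (cmod (a t h))\<^sup>2 + 2 * (cmod (w h))\<^sup>2)"
      by (intro sum_mono cmod_diff_sq_le)
    also have "\<dots> = 2 * (\<Sum>h\<in>F. (cmod (a t h))\<^sup>2) + 2 * (\<Sum>h\<in>F. (cmod (w h))\<^sup>2)"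
      by (simp add: sum.distrib sum_distrib_left)
    finally show "(\<Sum>h\<in>F. (cmod (a t h - w h))\<^sup>2) \<le> 4 * B"
      using bound[OF F, of t] wB[OF F] by linarith
  qed
  define q where "q h = (cmod (z h))\<^sup>2" for h
  have q: "q summable_on UNIV" using z by (simp add: l2_def q_def[abs_def])
  show "(\<lambda>t. infsum (\<lambda>h. a t h * cnj (z h)) UNIV) \<longlonglongrightarrow> infsum (\<lambda>h. w h * cnj (z h)) UNIV"
  proof (rule tendstoI)
    fix e :: real assume e: "0 < e"
    define c where "c = e / (4 * B + 2)"
    have c: "0 < c" using e B by (simp add: c_def)
    obtain W where W: "finite W" "dist (infsum q UNIV) (sum q W) < c\<^sup>2"
    proof -
      have "(q has_sum infsum q UNIV) UNIV" using q by (rule has_sum_infsum)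
      then have "\<forall>\<^sub>F F in finite_subsets_at_top UNIV. dist (sum q F) (infsum q UNIV) < c\<^sup>2"
        using c unfolding has_sum_def by (intro tendstoD) auto
      then obtain W where "finite W" "dist (sum q W) (infsum q UNIV) < c\<^sup>2"
        unfolding eventually_finite_subsets_at_top by (metis subset_UNIV subset_refl)
      then show thesis using that by (auto simp: dist_commute)
    qed
    have qs: "q summable_on A" for A using q by (rule summable_on_subset_banach) simp
    have "infsum q (UNIV - W) = infsum q UNIV - infsum q W"
      by (rule infsum_Diff[OF q qs]) simp
    then have tail: "infsum q (UNIV - W) \<le> c\<^sup>2"
      using W by (simp add: dist_real_def)
    have "(\<lambda>t. \<Sum>h\<in>W. (a t h - w h) * cnj (z h)) \<longlonglongrightarrow> (\<Sum>h\<in>W. (w h - w h) * cnj (z h))"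
      by (intro tendsto_intros lim)
    then have "\<forall>\<^sub>F t in sequentially. dist (\<Sum>h\<in>W. (a t h - w h) * cnj (z h)) 0 < c"
      using c by (intro tendstoD) auto
    then show "\<forall>\<^sub>F t in sequentially. dist (infsum (\<lambda>h. a t h * cnj (z h)) UNIV) (infsum (\<lambda>h. w h * cnj (z h)) UNIV) < e"
    proof eventually_elim
      case (elim t)
      let ?p = "\<lambda>h. (a t h - w h) * cnj (z h)"
      let ?D = "\<lambda>h. (cmod (a t h - w h))\<^sup>2"
      have Ds: "?D summable_on A" for A
        using D[of t] unfolding l2_def mem_Collect_eq by (rule summable_on_subset_banach) simp
      have pa: "(\<lambda>h. norm (?p h)) summable_on UNIV" by (rule l2_mult_abs_summable[OF D z])
      have paA: "(\<lambda>h. norm (?p h)) summable_on A" for A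
        using pa by (rule summable_on_subset_banach) simp
      have ps: "?p summable_on A" for A by (rule abs_summable_summable[OF paA])
      have "infsum (\<lambda>h. a t h * cnj (z h)) UNIV - infsum (\<lambda>h. w h * cnj (z h)) UNIV = infsum ?p UNIV"
        unfolding left_diff_distrib
        by (rule infsum_diff[symmetric]) (intro l2_mult_summable a w z)+
      also have "\<dots> = infsum ?p (UNIV - W) + sum ?p W"
        using infsum_Diff[OF ps ps, of W UNIV] W(1) by simp
      finally have eq: "infsum (\<lambda>h. a t h * cnj (z h)) UNIV - infsum (\<lambda>h. w h * cnj (z h)) UNIV = infsum ?p (UNIV - W) + sum ?p W" .
      have "norm (infsum ?p (UNIV - W)) \<le> infsum (\<lambda>h. norm (?p h)) (UNIV - W)"
        by (rule norm_infsum_bound[OF paA])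
      also have "\<dots> \<le> infsum (\<lambda>h. c * ?D h + (1 / c) * q h) (UNIV - W)"
      proof (rule infsum_mono[OF paA])
        show "(\<lambda>h. c * ?D h + (1 / c) * q h) summable_on UNIV - W"
          by (intro summable_on_add summable_on_cmult_right Ds qs)
        fix h
        have "0 \<le> (sqrt c * cmod (a t h - w h) - cmod (z h) / sqrt c)\<^sup>2" by simp
        then have "2 * (cmod (a t h - w h) * cmod (z h)) \<le> c * ?D h + (1 / c) * q h"
          using c unfolding q_def power2_diff by (simp add: power_mult_distrib power_divide)
        moreover have "0 \<le> cmod (a t h - w h) * cmod (z h)" by simp
        ultimately have "cmod (a t h - w h) * cmod (z h) \<le> c * ?D h + (1 / c) * q h" by linarith
        then show "norm (?p h) \<le> c * ?D h + (1 / c) * q h" by (simp add: norm_mult)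
      qed
      also have "\<dots> = c * infsum ?D (UNIV - W) + (1 / c) * infsum q (UNIV - W)"
        by (subst infsum_add) (intro summable_on_cmult_right Ds qs, intro summable_on_cmult_right Ds qs, simp only: infsum_cmult_right')
      also have "\<dots> \<le> c * (4 * B) + (1 / c) * c\<^sup>2"
      proof (intro add_mono mult_left_mono tail)
        show "infsum ?D (UNIV - W) \<le> 4 * B"
          by (rule order_trans[OF infsum_mono2[OF Ds Ds] Dle]) auto
      qed (use c in auto)
      also have "\<dots> = c * (4 * B + 1)" using c by (simp add: power2_eq_square algebra_simps)
      finally have "norm (infsum ?p (UNIV - W) + sum ?p W) < c * (4 * B + 1) + c"
        using elim by (intro norm_triangle_lt) simp
      also have "\<dots> = c * (4 * B + 2)" by (simp add: algebra_simps)
      also have "\<dots> = e" using B by (simp add: c_def)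
      finally show ?case by (simp add: dist_norm eq)
    qed
  qed
qed

lemma lookup_le_norm: "\<bar>Poly_Mapping.lookup x k\<bar> \<le> norm (x :: 'i \<Rightarrow>\<^sub>0 real)"
  using Cauchy_Schwarz_ineq2[of x "unit k"] by (simp add: inner_unit_right)

lemma sum_lookup_sq_le:
  fixes x :: "'i \<Rightarrow>\<^sub>0 real"
  assumes "finite F"
  shows "(\<Sum>k\<in>F. (Poly_Mapping.lookup x k)\<^sup>2) \<le> (norm x)\<^sup>2"
proof -
  have "(\<Sum>k\<in>F. (Poly_Mapping.lookup x k)\<^sup>2) \<le> (\<Sum>k\<in>F \<union> Poly_Mapping.keys x. (Poly_Mapping.lookup x k)\<^sup>2)"
    using assms by (intro sum_mono2) auto
  also have "\<dots> = (norm x)\<^sup>2"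
    using assms by (intro norm_poly_mapping_superset[symmetric]) auto
  finally show ?thesis .
qed

lemma l2_sum_diff: "a \<in> l2_sum n \<Longrightarrow> b \<in> l2_sum n \<Longrightarrow> (\<lambda>s h. a s h - b s h) \<in> l2_sum n"
  by (auto simp: l2_sum_def fun_eq_iff intro: l2_diff)

lemma l2_sum_inner_diff:
  assumes "a \<in> l2_sum n" "b \<in> l2_sum n" "z \<in> l2_sum n"
  shows "l2_sum_inner n (\<lambda>s h. a s h - b s h) z = l2_sum_inner n a z - l2_sum_inner n b z"
  unfolding l2_sum_inner_def sum_subtractf[symmetric]
proof (rule sum.cong[OF refl])
  fix s assume "s \<in> {..<n}"
  then have "a s \<in> l2" "b s \<in> l2" "z s \<in> l2" using assms by (auto simp: l2_sum_def)
  then show "l2_inner (\<lambda>h. a s h - b s h) (z s) = l2_inner (a s) (z s) - l2_inner (b s) (z s)"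
    unfolding l2_inner_def left_diff_distrib by (intro infsum_diff l2_mult_summable)
qed

lemma l2_sum_inner_self_0:
  assumes a: "a \<in> l2_sum n" and "l2_sum_inner n a a = 0"
  shows "a = (\<lambda>_ _. 0)"
proof -
  have l2: "(\<lambda>h. (cmod (a s h))\<^sup>2) summable_on UNIV" if "s < n" for s
    using a that by (auto simp: l2_sum_def l2_def)
  have eq: "l2_inner (a s) (a s) = of_real (infsum (\<lambda>h. (cmod (a s h))\<^sup>2) UNIV)" if "s < n" for s
    unfolding l2_inner_def complex_norm_square[symmetric] by (rule infsumI has_sum_of_real has_sum_infsum l2 that)+
  have "of_real (\<Sum>s<n. infsum (\<lambda>h. (cmod (a s h))\<^sup>2) UNIV) = (0 :: complex)"
    using assms(2) by (simp add: l2_sum_inner_def eq)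
  then have "(\<Sum>s<n. infsum (\<lambda>h. (cmod (a s h))\<^sup>2) UNIV) = 0"
    by (simp only: of_real_eq_0_iff)
  then have 0: "infsum (\<lambda>h. (cmod (a s h))\<^sup>2) UNIV = 0" if "s < n" for s
    using that by (subst (asm) sum_nonneg_eq_0_iff) (auto intro!: infsum_nonneg)
  have "a s h = 0" for s h
  proof (cases "s < n")
    case True
    have "(cmod (a s h))\<^sup>2 = 0"
      using nonneg_infsum_le_0D[of "\<lambda>h. (cmod (a s h))\<^sup>2" UNIV h] 0[OF True] l2[OF True] by auto
    then show ?thesis by simp
  qed (use a in \<open>auto simp: l2_sum_def\<close>)
  then show ?thesis by auto
qed

lemma conv_op_diff:
  "conv_op m n f (\<lambda>s h. a s h - b s h) = (\<lambda>l h. conv_op m n f a l h - conv_op m n f b l h)"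
  by (auto simp: conv_op_def fun_eq_iff right_diff_distrib sum_subtractf)

lemma conv_ker_diff:
  assumes "a \<in> conv_ker m n f" "b \<in> conv_ker m n f"
  shows "(\<lambda>s h. a s h - b s h) \<in> conv_ker m n f"
  using assms by (simp add: conv_ker_def l2_sum_diff conv_op_diff)

lemma orth_proj_eqI:
  assumes x: "x \<in> l2_sum n" and v: "v \<in> conv_ker m n f"
    and orth: "\<And>z. z \<in> conv_ker m n f \<Longrightarrow> l2_sum_inner n (\<lambda>s h. x s h - v s h) z = 0"
  shows "orth_proj n (conv_ker m n f) x = v"
  unfolding orth_proj_def
proof (rule the_equality)
  fix y assume y: "y \<in> conv_ker m n f \<and> (\<forall>z\<in>conv_ker m n f. l2_sum_inner n (\<lambda>s h. x s h - y s h) z = 0)"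
  let ?w = "\<lambda>s h. y s h - v s h"
  have w: "?w \<in> conv_ker m n f" using y v by (intro conv_ker_diff) auto
  have l2: "y \<in> l2_sum n" "v \<in> l2_sum n" "?w \<in> l2_sum n"
    using y v w by (auto simp: conv_ker_def)
  have "l2_sum_inner n x ?w - l2_sum_inner n y ?w = 0" "l2_sum_inner n x ?w - l2_sum_inner n v ?w = 0"
    using y w orth[OF w] l2 x by (simp_all flip: l2_sum_inner_diff)
  then have "l2_sum_inner n ?w ?w = 0"
    using l2 by (simp add: l2_sum_inner_diff)
  then have "?w = (\<lambda>_ _. 0)" using l2 by (intro l2_sum_inner_self_0)
  then show "y = v" by (auto simp: fun_eq_iff)
qed (use v orth in auto)

context group_matrix
begin

text \<open>
  The inner product of \<open>\<ell>\<^sup>2\<close>, with a finitely supported vector in the first argument, so that only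
  finite sums occur.
\<close>

definition pairing :: "(nat \<Rightarrow> 'g \<Rightarrow> complex) \<Rightarrow> (nat \<times> 'g \<Rightarrow>\<^sub>0 real) \<Rightarrow> complex" where
  "pairing z x = (\<Sum>k\<in>Poly_Mapping.keys x. of_real (Poly_Mapping.lookup x k) * cnj (z (fst k) (snd k)))"

lemma pairing_superset:
  assumes "finite A" "Poly_Mapping.keys x \<subseteq> A"
  shows "pairing z x = (\<Sum>k\<in>A. of_real (Poly_Mapping.lookup x k) * cnj (z (fst k) (snd k)))"
  unfolding pairing_def using assms
  by (intro sum.mono_neutral_left) (auto simp: in_keys_iff)

lemma linear_pairing: "linear (pairing z)"
proof (rule linearI)
  fix x y :: "nat \<times> 'g \<Rightarrow>\<^sub>0 real" and r :: real
  let ?A = "Poly_Mapping.keys x \<union> Poly_Mapping.keys y"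
  have 1: "Poly_Mapping.keys (x + y) \<subseteq> ?A" "Poly_Mapping.keys (r *\<^sub>R x) \<subseteq> ?A"
    using Poly_Mapping.keys_add[of x y] by (auto simp: in_keys_iff lookup_scaleR)
  note T = pairing_superset[of ?A]
  show "pairing z (x + y) = pairing z x + pairing z y"
    using 1 by (simp add: T lookup_add distrib_right sum.distrib)
  show "pairing z (r *\<^sub>R x) = r *\<^sub>R pairing z x"
    using 1 by (simp add: T lookup_scaleR scaleR_conv_of_real sum_distrib_left mult.assoc)
qed

lemma pairing_unit: "pairing z (unit (s, w)) = cnj (z s w)"
  by (simp add: pairing_def lookup_unit)

text \<open>
  A kernel vector of \<open>M\<close> is orthogonal to the range of \<open>M*\<close>.
\<close>

lemma pairing_MaG:
  assumes "z \<in> conv_ker m n f"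
  shows "pairing z (MaG y) = 0"
proof -
  have unit: "pairing z (MaG (unit (l', w))) = 0" for l' w
  proof -
    have "pairing z (MaG (unit (l', w))) = (\<Sum>l<m. \<Sum>s<n. \<Sum>g\<in>Poly_Mapping.keys (f l s).
        if l' = l then of_int (Poly_Mapping.lookup (f l s) g) * cnj (z s (- g + w)) else 0)"
      unfolding mat_adj_def linear_sum[OF linear_pairing] linear_scale[OF linear_pairing]
      by (intro sum.cong refl)
         (simp add: pull_move_unit[of "ltrans_inv g" "ltrans g" for g] pairing_unit
           linear_0[OF linear_pairing] scaleR_conv_of_real add.assoc[symmetric])
    also have "\<dots> = (\<Sum>l<m. if l = l' then cnj (conv_op m n f z l w) else 0)"
      by (intro sum.cong refl) (auto simp: conv_op_def)
    also have "\<dots> = 0"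
      using assms by (auto simp: conv_ker_def)
    finally show ?thesis .
  qed
  show ?thesis
    by (subst unit_expansion[OF finite_keys subset_refl, of y])
       (simp add: linear_sum[OF GF.linear_mat_adj] linear_scale[OF GF.linear_mat_adj]
         linear_sum[OF linear_pairing] linear_scale[OF linear_pairing] unit split_paired_all)
qed

lemma pairing_S_pow:
  assumes "z \<in> conv_ker m n f"
  shows "pairing z ((GA.S ^^ t) x) = pairing z x"
  by (induction t)
     (simp_all add: GA.S_def linear_diff[OF linear_pairing] linear_scale[OF linear_pairing] pairing_MaG[OF assms])

context
  fixes j :: nat
  assumes j: "j < n"
begin

abbreviation "xi t \<equiv> (GA.S ^^ t) (unit (j, 0 :: 'g))"

lemma lookup_xi_outside: "n \<le> s \<Longrightarrow> Poly_Mapping.lookup (xi t) (s, h) = 0"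
  using j by (induction t) (auto simp: lookup_unit GA.S_def lookup_minus lookup_scaleR GF.lookup_mat_adj)

lemma norm_xi: "norm (xi t) \<le> 1"
  using GA.norm_S_pow_le[of t "unit (j, 0)"] by simp

lemma xi_convergent: "convergent (\<lambda>t. Poly_Mapping.lookup (xi t) k)"
proof (rule Cauchy_convergent, rule metric_CauchyI)
  fix e :: real assume e: "0 < e"
  obtain L where L: "GA.moment (unit (j, 0)) \<longlonglongrightarrow> L"
    using GA.moment_convergent convergent_def by blast
  have "0 < e\<^sup>2 / 4" using e by simp
  from LIMSEQ_D[OF L this] obtain N where
    N: "\<And>t. N \<le> t \<Longrightarrow> \<bar>GA.moment (unit (j, 0)) t - L\<bar> < e\<^sup>2 / 4" by auto
  have "dist (Poly_Mapping.lookup (xi p) k) (Poly_Mapping.lookup (xi q) k) < e" if "N \<le> p" "N \<le> q" for p q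
  proof -
    have "(norm (xi p - xi q))\<^sup>2 < e\<^sup>2"
      unfolding GA.norm_S_pow_diff using N[of "2 * p"] N[of "p + q"] N[of "2 * q"] that by linarith
    then have "norm (xi p - xi q) < e" using e by (simp add: power_less_imp_less_base)
    then show ?thesis
      using lookup_le_norm[of "xi p - xi q" k] by (simp add: dist_real_def lookup_minus)
  qed
  then show "\<exists>N. \<forall>p\<ge>N. \<forall>q\<ge>N. dist (Poly_Mapping.lookup (xi p) k) (Poly_Mapping.lookup (xi q) k) < e"
    by blast
qed

text \<open>
  The projection of the basis vector \<open>\<delta>\<^sub>j\<close> onto the kernel, obtained as a pointwise limit.
\<close>

definition xi_lim :: "nat \<Rightarrow> 'g \<Rightarrow> complex" where
  "xi_lim s h = of_real (lim (\<lambda>t. Poly_Mapping.lookup (xi t) (s, h)))"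

lemma xi_lim: "(\<lambda>t. complex_of_real (Poly_Mapping.lookup (xi t) (s, h))) \<longlonglongrightarrow> xi_lim s h"
  unfolding xi_lim_def using xi_convergent by (intro tendsto_of_real) (simp add: convergent_LIMSEQ_iff)

lemma xi_bound:
  assumes "finite F"
  shows "(\<Sum>h\<in>F. (cmod (complex_of_real (Poly_Mapping.lookup (xi t) (s, h))))\<^sup>2) \<le> 1"
proof -
  have "(\<Sum>h\<in>F. (cmod (complex_of_real (Poly_Mapping.lookup (xi t) (s, h))))\<^sup>2) =
      (\<Sum>k\<in>Pair s ` F. (Poly_Mapping.lookup (xi t) k)\<^sup>2)"
    by (subst sum.reindex) (auto simp: inj_on_def)
  also have "\<dots> \<le> (norm (xi t))\<^sup>2" using assms by (intro sum_lookup_sq_le) auto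
  also have "\<dots> \<le> 1" using norm_xi[of t] by (simp add: abs_square_le_1)
  finally show ?thesis .
qed

text \<open>
  \<open>\<parallel>M S\<^sup>t x\<parallel>\<^sup>2\<close> is \<open>C\<close> times the difference of two consecutive moments and tends to \<open>0\<close>.
\<close>

lemma xi_lim_ker: "xi_lim \<in> conv_ker m n f"
proof -
  have zero: "(\<lambda>_. 0) \<in> l2" by (simp add: l2_def)
  have "xi_lim s \<in> l2" for s
    by (rule l2_weak_limit(1)[OF xi_bound xi_lim zero])
  moreover have "xi_lim s = (\<lambda>_. 0)" if "n \<le> s" for s
    using that by (auto simp: fun_eq_iff xi_lim_def lookup_xi_outside)
  moreover have "conv_op m n f xi_lim l h = 0" for l h
  proof (cases "l < m")
    case True
    have "(\<lambda>t. complex_of_real (Poly_Mapping.lookup (MG (xi t)) (l, h))) \<longlonglongrightarrow> conv_op m n f xi_lim l h"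
      unfolding GF.lookup_mat_op conv_op_def of_real_sum of_real_mult
      using True by (auto intro!: tendsto_intros xi_lim simp: of_real_sum)
    moreover have "(\<lambda>t. complex_of_real (Poly_Mapping.lookup (MG (xi t)) (l, h))) \<longlonglongrightarrow> 0"
    proof (rule Lim_null_comparison)
      obtain L where L: "GA.moment (unit (j, 0)) \<longlonglongrightarrow> L"
        using GA.moment_convergent convergent_def by blast
      have "(\<lambda>t. sqrt (C * (GA.moment (unit (j, 0)) (2 * t) - GA.moment (unit (j, 0)) (Suc (2 * t))))) \<longlonglongrightarrow> sqrt (C * (L - L))"
        by (intro tendsto_intros LIMSEQ_subseq_LIMSEQ[OF L, unfolded o_def] strict_monoI) auto
      then show "(\<lambda>t. norm (MG (xi t))) \<longlonglongrightarrow> 0"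
        by (simp flip: GA.norm_M_S_pow)
    qed (simp add: lookup_le_norm)
    ultimately show ?thesis by (rule LIMSEQ_unique)
  qed (simp add: conv_op_def)
  ultimately show ?thesis by (auto simp: conv_ker_def l2_sum_def fun_eq_iff)
qed

abbreviation "delta_j \<equiv> (\<lambda>s. if s = j then delta_e else (\<lambda>_. 0 :: complex)) :: nat \<Rightarrow> 'g \<Rightarrow> complex"

lemma delta_e_l2: "(delta_e :: 'g \<Rightarrow> complex) \<in> l2"
proof (rule l2_bounded(1))
  fix F :: "'g set" assume "finite F"
  have "(\<Sum>h\<in>F. (cmod (delta_e h))\<^sup>2) = (\<Sum>h\<in>F. if h = 0 then 1 else 0)"
    by (intro sum.cong) (auto simp: delta_e_def)
  then show "(\<Sum>h\<in>F. (cmod (delta_e h))\<^sup>2) \<le> 1" using \<open>finite F\<close> by simp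
qed

lemma delta_j_l2: "delta_j \<in> l2_sum n"
  using j delta_e_l2 by (auto simp: l2_sum_def l2_def)

lemma infsum_single_point:
  fixes p :: "'g \<Rightarrow> complex"
  assumes "\<And>h. h \<noteq> h0 \<Longrightarrow> p h = 0"
  shows "infsum p UNIV = p h0"
  using infsum_cong_neutral[of "{h0}" UNIV p p] assms by auto

text \<open>
  Against a kernel vector \<open>z\<close>, all \<open>S\<^sup>t \<delta>\<^sub>j\<close> have the same inner product, and weak convergence
  passes this to the limit.
\<close>

lemma xi_lim_orth:
  assumes z: "z \<in> conv_ker m n f"
  shows "l2_sum_inner n (\<lambda>s h. delta_j s h - xi_lim s h) z = 0"
proof -
  have zl: "z \<in> l2_sum n" and zs: "s < n \<Longrightarrow> z s \<in> l2" for s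
    using z by (auto simp: conv_ker_def l2_sum_def)
  have "l2_sum_inner n xi_lim z = cnj (z j 0)"
  proof (rule LIMSEQ_unique)
    show "(\<lambda>t. \<Sum>s<n. infsum (\<lambda>h. complex_of_real (Poly_Mapping.lookup (xi t) (s, h)) * cnj (z s h)) UNIV)
        \<longlonglongrightarrow> l2_sum_inner n xi_lim z"
      unfolding l2_sum_inner_def l2_inner_def
      by (intro tendsto_sum l2_weak_limit(2)[OF xi_bound xi_lim]) (auto intro: zs)
    have "(\<Sum>s<n. infsum (\<lambda>h. complex_of_real (Poly_Mapping.lookup (xi t) (s, h)) * cnj (z s h)) UNIV) = cnj (z j 0)" for t
    proof -
      let ?W = "snd ` Poly_Mapping.keys (xi t)"
      have "(\<Sum>s<n. infsum (\<lambda>h. complex_of_real (Poly_Mapping.lookup (xi t) (s, h)) * cnj (z s h)) UNIV) =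
        (\<Sum>s<n. \<Sum>h\<in>?W. complex_of_real (Poly_Mapping.lookup (xi t) (s, h)) * cnj (z s h))"
      proof (rule sum.cong[OF refl])
        fix s
        have "h \<in> ?W" if "Poly_Mapping.lookup (xi t) (s, h) \<noteq> 0" for h
          using that by (force simp: in_keys_iff image_iff)
        then have "infsum (\<lambda>h. complex_of_real (Poly_Mapping.lookup (xi t) (s, h)) * cnj (z s h)) UNIV =
          infsum (\<lambda>h. complex_of_real (Poly_Mapping.lookup (xi t) (s, h)) * cnj (z s h)) ?W"
          by (intro infsum_cong_neutral) auto
        then show "infsum (\<lambda>h. complex_of_real (Poly_Mapping.lookup (xi t) (s, h)) * cnj (z s h)) UNIV =
          (\<Sum>h\<in>?W. complex_of_real (Poly_Mapping.lookup (xi t) (s, h)) * cnj (z s h))" by simp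
      qed
      also have "\<dots> = pairing z (xi t)"
      proof -
        have "Poly_Mapping.keys (xi t) \<subseteq> {..<n} \<times> ?W"
        proof (rule subsetI)
          fix k assume k: "k \<in> Poly_Mapping.keys (xi t)"
          then have "fst k < n"
            using lookup_xi_outside[of "fst k" t "snd k"] by (cases "fst k < n") (simp_all add: in_keys_iff)
          with k show "k \<in> {..<n} \<times> ?W" by (cases k) force
        qed
        then show ?thesis
          by (subst pairing_superset[of "{..<n} \<times> ?W"]) (auto simp: sum.cartesian_product case_prod_unfold)
      qed
      also have "\<dots> = cnj (z j 0)"
        by (simp add: pairing_S_pow[OF z] pairing_unit)
      finally show ?thesis .
    qed
    then show "(\<lambda>t. \<Sum>s<n. infsum (\<lambda>h. complex_of_real (Poly_Mapping.lookup (xi t) (s, h)) * cnj (z s h)) UNIV) \<longlonglongrightarrow> cnj (z j 0)"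
      by simp
  qed
  moreover have "l2_sum_inner n delta_j z = cnj (z j 0)"
  proof -
    have "l2_sum_inner n delta_j z = (\<Sum>s<n. if s = j then cnj (z j 0) else 0)"
      unfolding l2_sum_inner_def
    proof (rule sum.cong[OF refl])
      fix s
      show "l2_inner (delta_j s) (z s) = (if s = j then cnj (z j 0) else 0)"
        unfolding l2_inner_def by (subst infsum_single_point[of 0]) (auto simp: delta_e_def)
    qed
    then show ?thesis using j by simp
  qed
  ultimately show ?thesis
    using xi_lim_ker zl by (simp add: l2_sum_inner_diff[OF delta_j_l2] conv_ker_def)
qed

lemma vn_trace_entry:
  "vn_trace (op_entry (orth_proj n (conv_ker m n f)) j j) = of_real (lim (GA.moment (unit (j, 0))))"
proof -
  have "orth_proj n (conv_ker m n f) delta_j = xi_lim"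
    by (rule orth_proj_eqI[OF delta_j_l2 xi_lim_ker xi_lim_orth])
  then have "vn_trace (op_entry (orth_proj n (conv_ker m n f)) j j) = xi_lim j 0"
    unfolding vn_trace_def op_entry_def l2_inner_def
    by (subst infsum_single_point[of 0]) (auto simp: delta_e_def)
  also have "\<dots> = of_real (lim (GA.moment (unit (j, 0))))"
    by (simp add: xi_lim_def GA.moment_def[abs_def] inner_unit_right)
  finally show ?thesis .
qed

end

definition tr_moment :: "nat \<Rightarrow> real" where
  "tr_moment t = (\<Sum>s<n. GA.moment (unit (s, 0)) t)"

text \<open>
  Summing \<open>\<langle>P \<delta>\<^sub>j, \<delta>\<^sub>j\<rangle> = lim\<^sub>t \<langle>S\<^sup>t \<delta>\<^sub>j, \<delta>\<^sub>j\<rangle>\<close> over \<open>j\<close>, where \<open>P\<close> is the projection onto the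
  kernel.
\<close>

theorem vn_dim_conv_ker:
  shows "vn_dim n (conv_ker m n f) = of_real (lim tr_moment)"
    and "tr_moment \<longlonglongrightarrow> lim tr_moment" and "decseq tr_moment"
proof -
  have "tr_moment \<longlonglongrightarrow> (\<Sum>s<n. lim (GA.moment (unit (s, 0))))"
    unfolding tr_moment_def[abs_def] using GA.moment_convergent
    by (intro tendsto_sum) (auto simp: convergent_LIMSEQ_iff)
  then have 1: "lim tr_moment = (\<Sum>s<n. lim (GA.moment (unit (s, 0))))" by (rule limI)
  then show "tr_moment \<longlonglongrightarrow> lim tr_moment" using \<open>tr_moment \<longlonglongrightarrow> _\<close> by simp
  show "vn_dim n (conv_ker m n f) = of_real (lim tr_moment)"
    by (simp add: vn_dim_def 1 vn_trace_entry)
  show "decseq tr_moment"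
    unfolding tr_moment_def[abs_def] decseq_def
    by (intro allI impI sum_mono decseqD[OF GA.moment_decseq])
qed

end

section \<open>Determinants and traces of Gram matrices\<close>

definition mat_trace :: "'a::comm_monoid_add mat \<Rightarrow> 'a" where
  "mat_trace A = (\<Sum>i<dim_row A. A $$ (i, i))"

lemma mat_trace_commute:
  fixes A B :: "'a::comm_semiring_0 mat"
  assumes "A \<in> carrier_mat r r" "B \<in> carrier_mat r r"
  shows "mat_trace (A * B) = mat_trace (B * A)"
proof -
  have "mat_trace (A * B) = (\<Sum>i<r. \<Sum>k<r. A $$ (i, k) * B $$ (k, i))"
    using assms by (auto simp: mat_trace_def scalar_prod_def atLeast0LessThan intro!: sum.cong)
  also have "\<dots> = (\<Sum>k<r. \<Sum>i<r. B $$ (k, i) * A $$ (i, k))"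
    by (subst sum.swap) (simp add: mult.commute)
  also have "\<dots> = mat_trace (B * A)"
    using assms by (auto simp: mat_trace_def scalar_prod_def atLeast0LessThan intro!: sum.cong)
  finally show ?thesis .
qed

lemma similar_mat_wit_affine:
  fixes A :: "complex mat"
  assumes "similar_mat_wit A B P Q" "A \<in> carrier_mat r r"
  shows "similar_mat_wit (\<alpha> \<cdot>\<^sub>m 1\<^sub>m r + \<beta> \<cdot>\<^sub>m A) (\<alpha> \<cdot>\<^sub>m 1\<^sub>m r + \<beta> \<cdot>\<^sub>m B) P Q"
proof -
  from similar_mat_witD2[OF assms(2,1)]
  have PQ: "P * Q = 1\<^sub>m r" "Q * P = 1\<^sub>m r" and A: "A = P * B * Q"
    and B: "B \<in> carrier_mat r r" and P: "P \<in> carrier_mat r r" and Q: "Q \<in> carrier_mat r r" by auto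
  have "P * (\<alpha> \<cdot>\<^sub>m 1\<^sub>m r + \<beta> \<cdot>\<^sub>m B) = P * (\<alpha> \<cdot>\<^sub>m 1\<^sub>m r) + P * (\<beta> \<cdot>\<^sub>m B)"
    using B by (intro mult_add_distrib_mat[OF P]) auto
  also have "\<dots> = \<alpha> \<cdot>\<^sub>m P + \<beta> \<cdot>\<^sub>m (P * B)"
    using mult_smult_distrib[OF P one_carrier_mat, of \<alpha>] mult_smult_distrib[OF P B, of \<beta>] P by simp
  finally have "P * (\<alpha> \<cdot>\<^sub>m 1\<^sub>m r + \<beta> \<cdot>\<^sub>m B) * Q = (\<alpha> \<cdot>\<^sub>m P + \<beta> \<cdot>\<^sub>m (P * B)) * Q"
    by simp
  also have "\<dots> = \<alpha> \<cdot>\<^sub>m (P * Q) + \<beta> \<cdot>\<^sub>m (P * B * Q)"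
    using B P Q by (subst add_mult_distrib_mat[where nc = r and nr = r and n = r])
      (auto simp: mult_smult_assoc_mat[where n = r and nr = r and nc = r])
  finally have "\<alpha> \<cdot>\<^sub>m 1\<^sub>m r + \<beta> \<cdot>\<^sub>m A = P * (\<alpha> \<cdot>\<^sub>m 1\<^sub>m r + \<beta> \<cdot>\<^sub>m B) * Q"
    by (simp add: PQ A)
  then show ?thesis
    using PQ B P Q assms(2) by (intro similar_mat_witI[where n = r]) auto
qed

lemma upper_triangular_pow:
  fixes B :: "complex mat"
  assumes B: "B \<in> carrier_mat r r" and ut: "upper_triangular B"
  shows "i < r \<Longrightarrow> j \<le> i \<Longrightarrow> (B ^\<^sub>m k) $$ (i, j) = (if i = j then (B $$ (i, i)) ^ k else 0)"
proof (induction k arbitrary: i j)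
  case 0
  then show ?case using B by simp
next
  case (Suc k)
  have Bk: "B ^\<^sub>m k \<in> carrier_mat r r" using B by simp
  have "(B ^\<^sub>m Suc k) $$ (i, j) = (\<Sum>l<r. (B ^\<^sub>m k) $$ (i, l) * B $$ (l, j))"
    using B Bk Suc.prems by (simp add: scalar_prod_def atLeast0LessThan)
  also have "\<dots> = (\<Sum>l<r. if l = i then (B $$ (i, i)) ^ k * B $$ (i, j) else 0)"
  proof (rule sum.cong[OF refl])
    fix l assume l: "l \<in> {..<r}"
    show "(B ^\<^sub>m k) $$ (i, l) * B $$ (l, j) = (if l = i then (B $$ (i, i)) ^ k * B $$ (i, j) else 0)"
    proof (cases "l \<le> i")
      case True
      then show ?thesis using Suc.IH[OF Suc.prems(1) True] by auto
    next
      case False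
      then have "B $$ (l, j) = 0" using upper_triangularD[OF ut, of j l] Suc.prems l B by auto
      then show ?thesis using False by auto
    qed
  qed
  also have "\<dots> = (B $$ (i, i)) ^ k * B $$ (i, j)" using Suc.prems by simp
  also have "\<dots> = (if i = j then (B $$ (i, i)) ^ Suc k else 0)"
    using upper_triangularD[OF ut, of j i] Suc.prems B by auto
  finally show ?case .
qed

text \<open>
  Schur's triangular form computes determinants and traces of powers simultaneously, for all
  affine combinations with the identity at once.
\<close>

lemma eigenvalue_list:
  fixes A :: "complex mat"
  assumes A: "A \<in> carrier_mat r r"
  obtains es where "length es = r" "\<And>e. e \<in> set es \<Longrightarrow> eigenvalue A e"
    "\<And>\<alpha> \<beta>. Determinant.det (\<alpha> \<cdot>\<^sub>m 1\<^sub>m r + \<beta> \<cdot>\<^sub>m A) = (\<Prod>e\<leftarrow>es. \<alpha> + \<beta> * e)"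
    "\<And>\<alpha> \<beta> k. mat_trace ((\<alpha> \<cdot>\<^sub>m 1\<^sub>m r + \<beta> \<cdot>\<^sub>m A) ^\<^sub>m k) = (\<Sum>e\<leftarrow>es. (\<alpha> + \<beta> * e) ^ k)"
proof -
  obtain es where es: "char_poly A = (\<Prod>e\<leftarrow>es. [:- e, 1:])" "length es = r"
    using char_poly_factorized[OF A] by auto
  obtain B P Q where BPQ: "schur_decomposition A es = (B, P, Q)" by (cases "schur_decomposition A es") auto
  from schur_decomposition[OF A es(1) BPQ]
  have sim: "similar_mat_wit A B P Q" and ut: "upper_triangular B" and diag: "diag_mat B = es" by auto
  from similar_mat_witD2[OF A sim] have B: "B \<in> carrier_mat r r" and P: "P \<in> carrier_mat r r"
    and Q: "Q \<in> carrier_mat r r" and QP: "Q * P = 1\<^sub>m r" by auto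
  have es_nth: "es ! i = B $$ (i, i)" if "i < r" for i
    using that B unfolding diag[symmetric] diag_mat_def by simp
  have ev: "eigenvalue A e" if "e \<in> set es" for e
    unfolding eigenvalue_root_char_poly[OF A] es(1) poly_prod_list
    using that by (auto simp: prod_list_zero_iff)
  have 1: "Determinant.det (\<alpha> \<cdot>\<^sub>m 1\<^sub>m r + \<beta> \<cdot>\<^sub>m A) = (\<Prod>e\<leftarrow>es. \<alpha> + \<beta> * e)"
    and 2: "mat_trace ((\<alpha> \<cdot>\<^sub>m 1\<^sub>m r + \<beta> \<cdot>\<^sub>m A) ^\<^sub>m k) = (\<Sum>e\<leftarrow>es. (\<alpha> + \<beta> * e) ^ k)" for \<alpha> \<beta> k
  proof -
    let ?X = "\<alpha> \<cdot>\<^sub>m 1\<^sub>m r + \<beta> \<cdot>\<^sub>m A" and ?Y = "\<alpha> \<cdot>\<^sub>m 1\<^sub>m r + \<beta> \<cdot>\<^sub>m B"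
    have wit: "similar_mat_wit ?X ?Y P Q" by (rule similar_mat_wit_affine[OF sim A])
    have Y: "?Y \<in> carrier_mat r r" using B by simp
    have utY: "upper_triangular ?Y"
      using ut B by (auto simp: upper_triangular_def)
    have Ydiag: "?Y $$ (i, i) = \<alpha> + \<beta> * es ! i" if "i < r" for i
      using that B by (simp add: es_nth)
    have "Determinant.det ?X = Determinant.det ?Y"
      by (rule det_similar) (use wit in \<open>auto simp: similar_mat_def\<close>)
    also have "\<dots> = prod_list (diag_mat ?Y)" by (rule det_upper_triangular[OF utY Y])
    also have "diag_mat ?Y = map (\<lambda>e. \<alpha> + \<beta> * e) es"
      by (intro nth_equalityI)
         (simp_all only: diag_mat_def length_map length_upt nth_map nth_upt carrier_matD[OF Y] es(2) Ydiag add_0 minus_nat.diff_0)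
    finally show "Determinant.det ?X = (\<Prod>e\<leftarrow>es. \<alpha> + \<beta> * e)" .
    have Yk: "?Y ^\<^sub>m k \<in> carrier_mat r r" using Y by simp
    have "mat_trace (?X ^\<^sub>m k) = mat_trace (P * ?Y ^\<^sub>m k * Q)"
      by (simp add: similar_mat_wit_pow_id[OF wit])
    also have "\<dots> = mat_trace (P * (?Y ^\<^sub>m k * Q))"
      using P Yk Q by (simp add: assoc_mult_mat[of _ r r _ r _ r])
    also have "\<dots> = mat_trace (?Y ^\<^sub>m k * Q * P)"
      using P Yk Q by (intro mat_trace_commute[of _ r]) auto
    also have "?Y ^\<^sub>m k * Q * P = ?Y ^\<^sub>m k"
      using P Yk Q QP by (simp add: assoc_mult_mat[of _ r r _ r _ r] right_mult_one_mat[OF Yk])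
    also have "mat_trace (?Y ^\<^sub>m k) = (\<Sum>i<r. (\<alpha> + \<beta> * es ! i) ^ k)"
      unfolding mat_trace_def using Yk
      by (auto intro!: sum.cong simp: upper_triangular_pow[OF Y utY] Ydiag simp del: index_add_mat)
    also have "\<dots> = (\<Sum>e\<leftarrow>es. (\<alpha> + \<beta> * e) ^ k)"
      by (simp add: sum_list_sum_nth es(2) atLeast0LessThan)
    finally show "mat_trace (?X ^\<^sub>m k) = (\<Sum>e\<leftarrow>es. (\<alpha> + \<beta> * e) ^ k)" .
  qed
  show thesis by (rule that[OF es(2) ev 1 2])
qed

definition gram :: "('i \<Rightarrow> 'b::real_inner) \<Rightarrow> 'i list \<Rightarrow> real mat" where
  "gram u xs = Matrix.mat (length xs) (length xs) (\<lambda>(a, b). inner (u (xs ! a)) (u (xs ! b)))"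

lemma gram_carrier [simp]: "gram u xs \<in> carrier_mat (length xs) (length xs)"
  by (simp add: gram_def)

lemma gram_quadratic:
  "(\<Sum>a<length xs. \<Sum>b<length xs. p a * q b * gram u xs $$ (a, b)) =
     inner (\<Sum>a<length xs. p a *\<^sub>R u (xs ! a)) (\<Sum>b<length xs. q b *\<^sub>R u (xs ! b))"
  by (simp add: inner_sum_left inner_sum_right gram_def sum_distrib_left mult_ac)
     (rule sum.swap)

abbreviation cmat :: "real mat \<Rightarrow> complex mat" where "cmat \<equiv> map_mat complex_of_real"

text \<open>
  An eigenvector is complex, but the quadratic form of a real symmetric matrix splits into those
  of the real and the imaginary part; the Rayleigh quotient is therefore real and lies between the
  bounds of the form.
\<close>

lemma gram_eigenvalue:
  assumes "eigenvalue (cmat (gram u xs)) e"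
    and bound: "\<And>p. (norm (\<Sum>a<length xs. p a *\<^sub>R u (xs ! a)))\<^sup>2 \<le> C * (\<Sum>a<length xs. (p a)\<^sup>2)"
  shows "\<exists>r. e = complex_of_real r \<and> 0 \<le> r \<and> r \<le> C"
proof -
  let ?N = "length xs"
  obtain v where v: "v \<in> carrier_vec ?N" "v \<noteq> 0\<^sub>v ?N" "cmat (gram u xs) *\<^sub>v v = e \<cdot>\<^sub>v v"
    using assms(1) by (auto simp: eigenvalue_def eigenvector_def gram_def)
  define w where "w a = vec_index v a" for a
  have row: "(\<Sum>b<?N. complex_of_real (gram u xs $$ (a, b)) * w b) = e * w a" if "a < ?N" for a
  proof -
    have "vec_index (cmat (gram u xs) *\<^sub>v v) a = (\<Sum>b<?N. complex_of_real (gram u xs $$ (a, b)) * w b)"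
      using that v(1) by (auto simp: scalar_prod_def atLeast0LessThan gram_def w_def intro!: sum.cong)
    then show ?thesis using v that by (simp add: w_def)
  qed
  define p where "p a = Re (w a)" for a
  define q where "q a = Im (w a)" for a
  let ?G = "\<lambda>a b. gram u xs $$ (a, b)"
  let ?n = "\<lambda>p. (norm (\<Sum>a<?N. p a *\<^sub>R u (xs ! a)))\<^sup>2"
  have quad: "(\<Sum>a<?N. \<Sum>b<?N. cnj (w a) * (complex_of_real (?G a b) * w b)) = complex_of_real (?n p + ?n q)"
  proof -
    have "cnj (w a) * (complex_of_real g * w b) =
        Complex (p a * p b * g + q a * q b * g) (p a * q b * g - q a * p b * g)" for a b g
      by (simp add: complex_eq_iff p_def q_def algebra_simps)
    then have "(\<Sum>a<?N. \<Sum>b<?N. cnj (w a) * (complex_of_real (?G a b) * w b)) =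
      Complex ((\<Sum>a<?N. \<Sum>b<?N. p a * p b * ?G a b) + (\<Sum>a<?N. \<Sum>b<?N. q a * q b * ?G a b))
        ((\<Sum>a<?N. \<Sum>b<?N. p a * q b * ?G a b) - (\<Sum>a<?N. \<Sum>b<?N. q a * p b * ?G a b))"
      by (simp add: complex_eq_iff sum.distrib sum_subtractf)
    then show ?thesis
      unfolding gram_quadratic power2_norm_eq_inner
      by (simp add: complex_eq_iff inner_commute)
  qed
  define s where "s = (\<Sum>a<?N. (p a)\<^sup>2) + (\<Sum>a<?N. (q a)\<^sup>2)"
  have "(\<Sum>a<?N. \<Sum>b<?N. cnj (w a) * (complex_of_real (?G a b) * w b)) = (\<Sum>a<?N. cnj (w a) * (e * w a))"
    by (intro sum.cong refl) (simp add: row flip: sum_distrib_left)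
  also have "\<dots> = e * complex_of_real s"
  proof -
    have "cnj (w a) * (e * w a) = e * complex_of_real ((p a)\<^sup>2 + (q a)\<^sup>2)" for a
      unfolding p_def q_def cmod_power2[symmetric] complex_norm_square by (simp add: mult_ac)
    then show ?thesis by (simp add: s_def sum_distrib_left sum.distrib distrib_left)
  qed
  finally have eq: "e * complex_of_real s = complex_of_real (?n p + ?n q)" using quad by simp
  obtain a where a: "a < ?N" "w a \<noteq> 0"
    using v(1,2) unfolding w_def by (metis carrier_vecD eq_vecI index_zero_vec(1,2))
  have s: "0 < s"
  proof -
    have "0 < (p a)\<^sup>2 + (q a)\<^sup>2"
      using a(2) by (simp add: p_def q_def complex_eq_iff sum_power2_gt_zero_iff)
    also have "\<dots> \<le> s" unfolding s_def using a(1) by (intro add_mono member_le_sum) auto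
    finally show ?thesis .
  qed
  have "e = complex_of_real ((?n p + ?n q) / s)"
    using eq s by (simp add: field_simps)
  moreover have "?n p + ?n q \<le> C * s"
    using bound[of p] bound[of q] by (simp add: s_def distrib_left)
  ultimately show ?thesis using s by (intro exI[of _ "(?n p + ?n q) / s"]) (auto simp: field_simps)
qed

lemma cmat_affine:
  assumes "A \<in> carrier_mat r r"
  shows "cmat (\<alpha> \<cdot>\<^sub>m 1\<^sub>m r + \<beta> \<cdot>\<^sub>m A) = complex_of_real \<alpha> \<cdot>\<^sub>m 1\<^sub>m r + complex_of_real \<beta> \<cdot>\<^sub>m cmat A"
  using assms by (intro eq_matI) auto

lemma cmat_pow:
  assumes "A \<in> carrier_mat r r"
  shows "cmat (A ^\<^sub>m k) = cmat A ^\<^sub>m k"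
  by (rule of_real_hom.mat_hom_pow[OF assms])

lemma mat_trace_cmat: "A \<in> carrier_mat r r \<Longrightarrow> mat_trace (cmat A) = complex_of_real (mat_trace A)"
  by (auto simp: mat_trace_def intro!: sum.cong)

lemma gram_spectrum:
  assumes bound: "\<And>p. (norm (\<Sum>a<length xs. p a *\<^sub>R u (xs ! a)))\<^sup>2 \<le> C * (\<Sum>a<length xs. (p a)\<^sup>2)"
  obtains es where "length es = length xs" "\<And>e. e \<in> set es \<Longrightarrow> 0 \<le> e \<and> e \<le> C"
    "\<And>\<alpha> \<beta>. Determinant.det (\<alpha> \<cdot>\<^sub>m 1\<^sub>m (length xs) + \<beta> \<cdot>\<^sub>m gram u xs) = (\<Prod>e\<leftarrow>es. \<alpha> + \<beta> * e)"
    "\<And>\<alpha> \<beta> k. mat_trace ((\<alpha> \<cdot>\<^sub>m 1\<^sub>m (length xs) + \<beta> \<cdot>\<^sub>m gram u xs) ^\<^sub>m k) = (\<Sum>e\<leftarrow>es. (\<alpha> + \<beta> * e) ^ k)"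
proof -
  let ?N = "length xs"
  have c: "cmat (gram u xs) \<in> carrier_mat ?N ?N" by (simp add: gram_def)
  obtain es where es: "length es = ?N" "\<And>e. e \<in> set es \<Longrightarrow> eigenvalue (cmat (gram u xs)) e"
    "\<And>\<alpha> \<beta>. Determinant.det (\<alpha> \<cdot>\<^sub>m 1\<^sub>m ?N + \<beta> \<cdot>\<^sub>m cmat (gram u xs)) = (\<Prod>e\<leftarrow>es. \<alpha> + \<beta> * e)"
    "\<And>\<alpha> \<beta> k. mat_trace ((\<alpha> \<cdot>\<^sub>m 1\<^sub>m ?N + \<beta> \<cdot>\<^sub>m cmat (gram u xs)) ^\<^sub>m k) = (\<Sum>e\<leftarrow>es. (\<alpha> + \<beta> * e) ^ k)"
    using eigenvalue_list[OF c] by blast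
  have real: "\<exists>r. e = complex_of_real r \<and> 0 \<le> r \<and> r \<le> C" if "e \<in> set es" for e
    by (rule gram_eigenvalue[OF es(2)[OF that] bound])
  have es_Re: "es = map complex_of_real (map Re es)"
    unfolding map_map o_def by (rule map_idI[symmetric]) (auto dest!: real)
  show thesis
  proof (rule that[of "map Re es"])
    show "length (map Re es) = ?N" using es by simp
    show "0 \<le> e \<and> e \<le> C" if "e \<in> set (map Re es)" for e
      using that by (auto dest!: real)
    fix \<alpha> \<beta> :: real
    let ?X = "\<alpha> \<cdot>\<^sub>m 1\<^sub>m ?N + \<beta> \<cdot>\<^sub>m gram u xs"
    have "complex_of_real (Determinant.det ?X) = Determinant.det (cmat ?X)" by simp
    also have "\<dots> = (\<Prod>e\<leftarrow>es. complex_of_real \<alpha> + complex_of_real \<beta> * e)"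
      by (simp only: cmat_affine[OF gram_carrier] es(3))
    also have "\<dots> = complex_of_real (\<Prod>e\<leftarrow>map Re es. \<alpha> + \<beta> * e)"
      by (subst es_Re) (simp add: o_def of_real_hom.hom_prod_list)
    finally show "Determinant.det ?X = (\<Prod>e\<leftarrow>map Re es. \<alpha> + \<beta> * e)" by (simp only: of_real_eq_iff)
    fix k
    have X: "?X \<in> carrier_mat ?N ?N" by simp
    have Xk: "?X ^\<^sub>m k \<in> carrier_mat ?N ?N" using X by (rule pow_carrier_mat)
    have "complex_of_real (mat_trace (?X ^\<^sub>m k)) = mat_trace (cmat (?X ^\<^sub>m k))"
      by (rule mat_trace_cmat[OF Xk, symmetric])
    also have "\<dots> = (\<Sum>e\<leftarrow>es. (complex_of_real \<alpha> + complex_of_real \<beta> * e) ^ k)"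
      by (simp only: cmat_pow[OF X] cmat_affine[OF gram_carrier] es(4))
    also have "\<dots> = complex_of_real (\<Sum>e\<leftarrow>map Re es. (\<alpha> + \<beta> * e) ^ k)"
      by (subst es_Re) (simp add: o_def of_real_hom.hom_sum_list)
    finally show "mat_trace (?X ^\<^sub>m k) = (\<Sum>e\<leftarrow>map Re es. (\<alpha> + \<beta> * e) ^ k)" by (simp only: of_real_eq_iff)
  qed
qed

lemma gram_bound_exists:
  fixes w :: "nat \<Rightarrow> 'b::real_inner"
  shows "\<exists>C\<ge>0. \<forall>p. (norm (\<Sum>a<N. p a *\<^sub>R w a))\<^sup>2 \<le> C * (\<Sum>a<N. (p a)\<^sup>2)"
proof (intro exI[of _ "\<Sum>a<N. (norm (w a))\<^sup>2"] conjI allI sum_nonneg)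
  fix p :: "nat \<Rightarrow> real"
  have "norm (\<Sum>a<N. p a *\<^sub>R w a) \<le> (\<Sum>a<N. \<bar>p a\<bar> * \<bar>norm (w a)\<bar>)"
    by (rule order_trans[OF norm_sum]) simp
  also have "\<dots> \<le> L2_set p {..<N} * L2_set (\<lambda>a. norm (w a)) {..<N}"
    by (rule L2_set_mult_ineq)
  finally have "(norm (\<Sum>a<N. p a *\<^sub>R w a))\<^sup>2 \<le> (L2_set p {..<N} * L2_set (\<lambda>a. norm (w a)) {..<N})\<^sup>2"
    by (rule power_mono) simp
  then show "(norm (\<Sum>a<N. p a *\<^sub>R w a))\<^sup>2 \<le> (\<Sum>a<N. (norm (w a))\<^sup>2) * (\<Sum>a<N. (p a)\<^sup>2)"
    by (simp add: power_mult_distrib L2_set_def sum_nonneg mult.commute)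
qed auto

lemma gram_det_nonneg: "0 \<le> Determinant.det (gram u xs)"
proof -
  obtain C where "\<And>p. (norm (\<Sum>a<length xs. p a *\<^sub>R u (xs ! a)))\<^sup>2 \<le> C * (\<Sum>a<length xs. (p a)\<^sup>2)"
    using gram_bound_exists[of "\<lambda>a. u (xs ! a)" "length xs"] by auto
  from gram_spectrum[OF this] obtain es where es: "\<And>e. e \<in> set es \<Longrightarrow> 0 \<le> e \<and> e \<le> C"
    "\<And>\<alpha> \<beta>. Determinant.det (\<alpha> \<cdot>\<^sub>m 1\<^sub>m (length xs) + \<beta> \<cdot>\<^sub>m gram u xs) = (\<Prod>e\<leftarrow>es. \<alpha> + \<beta> * e)"
    by metis
  have "0 \<cdot>\<^sub>m 1\<^sub>m (length xs) + 1 \<cdot>\<^sub>m gram u xs = gram u xs"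
    by (intro eq_matI) (auto simp: gram_def)
  then have "Determinant.det (gram u xs) = prod_list es" using es(2)[of 0 1] by simp
  also have "\<dots> \<ge> 0" using es(1) by (intro prod_list_nonneg) auto
  finally show ?thesis .
qed

text \<open>Adding \<open>z\<close> to the diagonal entries with index in \<open>Z\<close> keeps a Gram matrix a Gram matrix.\<close>

definition ext :: "('i \<Rightarrow> 'b::real_inner) \<Rightarrow> real \<Rightarrow> 'i set \<Rightarrow> 'i \<Rightarrow> 'b \<times> ('i \<Rightarrow>\<^sub>0 real)" where
  "ext u z Z i = (u i, (if i \<in> Z then sqrt z else 0) *\<^sub>R unit i)"

lemma inner_ext:
  assumes "0 \<le> z"
  shows "inner (ext u z Z i) (ext u z Z j) = inner (u i) (u j) + (if i = j \<and> i \<in> Z then z else 0)"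
  using assms by (auto simp: ext_def inner_unit_left lookup_unit)

lemma gram_ext_UNIV:
  assumes "0 \<le> z" "distinct xs"
  shows "gram (ext u z UNIV) xs = z \<cdot>\<^sub>m 1\<^sub>m (length xs) + 1 \<cdot>\<^sub>m gram u xs"
  using assms by (intro eq_matI) (auto simp: gram_def inner_ext nth_eq_iff_index_eq)

text \<open>
  Expanding along the first column, the shift \<open>z\<close> of the diagonal entry at \<open>j\<close> contributes \<open>z\<close>
  times the complementary minor; the remainder is the determinant of another Gram matrix, hence
  nonnegative.
\<close>

lemma det_gram_ext_Cons:
  assumes z: "0 \<le> z" and j: "j \<notin> set xs"
  shows "z * Determinant.det (gram (ext u z UNIV) xs) \<le> Determinant.det (gram (ext u z UNIV) (j # xs))"
proof -
  let ?A = "gram (ext u z UNIV) (j # xs)" and ?B = "gram (ext u z (- {j})) (j # xs)"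
  let ?N = "Suc (length xs)"
  have A: "?A \<in> carrier_mat ?N ?N" and B: "?B \<in> carrier_mat ?N ?N" by (simp_all add: gram_def)
  have xs: "xs ! a \<noteq> j" if "a < length xs" for a using j that nth_mem by metis
  have del: "mat_delete ?A i 0 = mat_delete ?B i 0" for i
    using xs unfolding mat_delete_def
    by (intro eq_matI) (auto simp: gram_def inner_ext[OF z] nth_Cons')
  have del0: "mat_delete ?A 0 0 = gram (ext u z UNIV) xs"
    unfolding mat_delete_def by (intro eq_matI) (auto simp: gram_def)
  have "Determinant.det ?A = (\<Sum>i<?N. ?A $$ (i, 0) * cofactor ?A i 0)"
    by (rule laplace_expansion_column[OF A]) simp
  also have "\<dots> = (\<Sum>i<?N. ?B $$ (i, 0) * cofactor ?B i 0 + (if i = 0 then z * Determinant.det (gram (ext u z UNIV) xs) else 0))"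
  proof (rule sum.cong[OF refl])
    fix i assume "i \<in> {..<?N}"
    then have "?A $$ (i, 0) = ?B $$ (i, 0) + (if i = 0 then z else 0)"
      using xs by (cases i) (auto simp: gram_def inner_ext[OF z])
    moreover have "cofactor ?A i 0 = cofactor ?B i 0" by (simp add: cofactor_def del)
    moreover have "cofactor ?B 0 0 = Determinant.det (gram (ext u z UNIV) xs)"
      by (simp add: cofactor_def del[symmetric] del0)
    ultimately show "?A $$ (i, 0) * cofactor ?A i 0 =
      ?B $$ (i, 0) * cofactor ?B i 0 + (if i = 0 then z * Determinant.det (gram (ext u z UNIV) xs) else 0)"
      by (auto simp: distrib_right)
  qed
  also have "\<dots> = Determinant.det ?B + z * Determinant.det (gram (ext u z UNIV) xs)"
    unfolding sum.distrib laplace_expansion_column[OF B zero_less_Suc] by simp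
  finally show ?thesis using gram_det_nonneg[of "ext u z (- {j})" "j # xs"] by linarith
qed

lemma det_gram_ext_append:
  assumes z: "0 \<le> z" and "distinct (js @ ys)"
  shows "z ^ length js * Determinant.det (gram (ext u z UNIV) ys) \<le> Determinant.det (gram (ext u z UNIV) (js @ ys))"
  using assms(2)
proof (induction js)
  case (Cons j js)
  have "z * (z ^ length js * Determinant.det (gram (ext u z UNIV) ys)) \<le> z * Determinant.det (gram (ext u z UNIV) (js @ ys))"
    using Cons z by (intro mult_left_mono) auto
  also have "\<dots> \<le> Determinant.det (gram (ext u z UNIV) (j # js @ ys))"
    using Cons.prems by (intro det_gram_ext_Cons z) auto
  finally show ?case by (simp add: mult.assoc)
qed simp

text \<open>
  The shift moves every eigenvalue, all of which are nonnegative, up by \<open>z\<close>.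
\<close>

lemma det_gram_le_ext:
  assumes z: "0 \<le> z" and "distinct ys"
  shows "Determinant.det (gram u ys) \<le> Determinant.det (gram (ext u z UNIV) ys)"
proof -
  obtain C where "\<And>p. (norm (\<Sum>a<length ys. p a *\<^sub>R u (ys ! a)))\<^sup>2 \<le> C * (\<Sum>a<length ys. (p a)\<^sup>2)"
    using gram_bound_exists[of "\<lambda>a. u (ys ! a)" "length ys"] by auto
  from gram_spectrum[OF this] obtain es where es: "\<And>e. e \<in> set es \<Longrightarrow> 0 \<le> e \<and> e \<le> C"
    "\<And>\<alpha> \<beta>. Determinant.det (\<alpha> \<cdot>\<^sub>m 1\<^sub>m (length ys) + \<beta> \<cdot>\<^sub>m gram u ys) = (\<Prod>e\<leftarrow>es. \<alpha> + \<beta> * e)"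
    by metis
  have "0 \<cdot>\<^sub>m 1\<^sub>m (length ys) + 1 \<cdot>\<^sub>m gram u ys = gram u ys"
    by (intro eq_matI) (auto simp: gram_def)
  then have "Determinant.det (gram u ys) = (\<Prod>e\<leftarrow>es. e)" using es(2)[of 0 1] by simp
  moreover have "Determinant.det (gram (ext u z UNIV) ys) = (\<Prod>e\<leftarrow>es. z + e)"
    using es(2)[of z 1] by (simp add: gram_ext_UNIV[OF assms])
  moreover have "(\<Prod>e\<leftarrow>es. e) \<le> (\<Prod>e\<leftarrow>es. z + e) \<and> 0 \<le> (\<Prod>e\<leftarrow>es. e)"
    using es(1)
  proof (induction es)
    case (Cons e es)
    then have "0 \<le> e" "(\<Prod>e\<leftarrow>es. e) \<le> (\<Prod>e\<leftarrow>es. z + e)" "0 \<le> (\<Prod>e\<leftarrow>es. e)" by auto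
    then show ?case using z by (auto intro!: mult_mono)
  qed simp
  ultimately show ?thesis by simp
qed

lemma det_Ints:
  assumes "A \<in> carrier_mat r r" "\<And>i j. i < r \<Longrightarrow> j < r \<Longrightarrow> A $$ (i, j) \<in> \<int>"
  shows "Determinant.det A \<in> (\<int> :: real set)"
proof -
  have "signof p \<in> (\<int> :: real set)" for p :: "nat \<Rightarrow> nat"
    by (auto simp: sign_def)
  then show ?thesis
    unfolding det_def'[OF assms(1)]
    using assms(2) by (auto intro!: Ints_sum Ints_mult Ints_prod simp: permutes_in_image)
qed

text \<open>
  A Gram determinant of independent vectors is positive; here it is moreover an integer.
\<close>

lemma det_gram_ge_1:
  assumes int: "\<And>x y. x \<in> set ys \<Longrightarrow> y \<in> set ys \<Longrightarrow> inner (u x) (u y) \<in> \<int>"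
    and indep: "\<And>p. (\<Sum>a<length ys. p a *\<^sub>R u (ys ! a)) = 0 \<Longrightarrow> \<forall>a<length ys. p a = 0"
  shows "1 \<le> Determinant.det (gram u ys)"
proof -
  have "Determinant.det (gram u ys) \<in> \<int>"
    by (rule det_Ints[OF gram_carrier]) (auto simp: gram_def intro: int)
  then obtain k where k: "Determinant.det (gram u ys) = real_of_int k" by (auto elim: Ints_cases)
  have "Determinant.det (gram u ys) \<noteq> 0"
  proof
    assume "Determinant.det (gram u ys) = 0"
    then obtain v where v: "v \<in> carrier_vec (length ys)" "v \<noteq> 0\<^sub>v (length ys)"
      "gram u ys *\<^sub>v v = 0\<^sub>v (length ys)"
      by (auto simp: det_0_iff_vec_prod_zero[OF gram_carrier])
    define p where "p a = vec_index v a" for a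
    have row: "(\<Sum>b<length ys. gram u ys $$ (a, b) * p b) = 0" if "a < length ys" for a
    proof -
      have "vec_index (gram u ys *\<^sub>v v) a = (\<Sum>b<length ys. gram u ys $$ (a, b) * p b)"
        using that v(1) by (auto simp: scalar_prod_def atLeast0LessThan gram_def p_def intro!: sum.cong)
      then show ?thesis using v that by simp
    qed
    have "(\<Sum>a<length ys. \<Sum>b<length ys. p a * p b * gram u ys $$ (a, b)) =
      (\<Sum>a<length ys. p a * (\<Sum>b<length ys. gram u ys $$ (a, b) * p b))"
      by (simp add: sum_distrib_left mult_ac)
    also have "\<dots> = 0" by (simp add: row)
    finally have "(\<Sum>a<length ys. p a *\<^sub>R u (ys ! a)) = 0" by (simp only: gram_quadratic inner_eq_zero_iff)
    from indep[OF this] have "v = 0\<^sub>v (length ys)"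
      using v(1) by (intro eq_vecI) (auto simp: p_def)
    with v(2) show False by simp
  qed
  with gram_det_nonneg[of u ys] have "0 < real_of_int k" by (simp add: k)
  then show ?thesis by (simp add: k)
qed

text \<open>
  The two sides bound the logarithm of \<open>det (gram + z)\<close>. From below, splitting off the indices
  \<open>js\<close> leaves \<open>z\<^bsup>|js|\<^esup>\<close> times a determinant that is at least \<open>1\<close> by integrality. From above, an eigenvalue \<open>e\<close>
  contributes \<open>ln (z + e) = ln (C + z) + ln (1 - \<theta> s)\<close> with \<open>\<theta> = C/(C + z)\<close> and \<open>s = 1 - e/C\<close>, and the partial sums of
  \<open>- ln (1 - \<theta> s)\<close> are sums of traces of powers.
\<close>

lemma card_ge_of_traces:
  fixes u :: "'i \<Rightarrow> 'b::real_inner"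
  assumes dist: "distinct (js @ ys)"
    and int: "\<And>x y. x \<in> set ys \<Longrightarrow> y \<in> set ys \<Longrightarrow> inner (u x) (u y) \<in> \<int>"
    and indep: "\<And>p. (\<Sum>a<length ys. p a *\<^sub>R u (ys ! a)) = 0 \<Longrightarrow> \<forall>a<length ys. p a = 0"
    and bound: "\<And>p. (norm (\<Sum>a<length (js @ ys). p a *\<^sub>R u ((js @ ys) ! a)))\<^sup>2 \<le> C * (\<Sum>a<length (js @ ys). (p a)\<^sup>2)"
    and C: "0 < C" and z: "0 < z"
  shows "(\<Sum>k=1..K. (C / (C + z)) ^ k / real k *
        mat_trace ((1 \<cdot>\<^sub>m 1\<^sub>m (length (js @ ys)) + (- 1 / C) \<cdot>\<^sub>m gram u (js @ ys)) ^\<^sub>m k))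
      \<le> real (length (js @ ys)) * ln (C + z) - real (length js) * ln z"
proof -
  let ?N = "length (js @ ys)"
  define \<theta> where "\<theta> = C / (C + z)"
  have \<theta>: "0 < \<theta>" "\<theta> < 1" using C z by (auto simp: \<theta>_def)
  from gram_spectrum[OF bound] obtain es where es: "length es = ?N" "\<And>e. e \<in> set es \<Longrightarrow> 0 \<le> e \<and> e \<le> C"
    "\<And>\<alpha> \<beta>. Determinant.det (\<alpha> \<cdot>\<^sub>m 1\<^sub>m ?N + \<beta> \<cdot>\<^sub>m gram u (js @ ys)) = (\<Prod>e\<leftarrow>es. \<alpha> + \<beta> * e)"
    "\<And>\<alpha> \<beta> k. mat_trace ((\<alpha> \<cdot>\<^sub>m 1\<^sub>m ?N + \<beta> \<cdot>\<^sub>m gram u (js @ ys)) ^\<^sub>m k) = (\<Sum>e\<leftarrow>es. (\<alpha> + \<beta> * e) ^ k)"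
    by metis
  have "z ^ length js * 1 \<le> z ^ length js * Determinant.det (gram (ext u z UNIV) ys)"
    using det_gram_ge_1[OF int indep] det_gram_le_ext[of z ys u] dist z
    by (intro mult_left_mono) force+
  also have "\<dots> \<le> Determinant.det (gram (ext u z UNIV) (js @ ys))"
    using z by (intro det_gram_ext_append dist) simp
  also have "\<dots> = (\<Prod>e\<leftarrow>es. z + e)"
    using es(3)[of z 1] gram_ext_UNIV[OF _ dist, of z u] z by simp
  finally have "z ^ length js \<le> (\<Prod>e\<leftarrow>es. z + e)" by simp
  then have "ln (z ^ length js) \<le> ln (\<Prod>e\<leftarrow>es. z + e)"
    using z by (subst ln_le_cancel_iff) (auto intro: less_le_trans[of 0 "z ^ length js"])
  also have "ln (\<Prod>e\<leftarrow>es. z + e) = (\<Sum>e\<leftarrow>es. ln (z + e)) \<and> 0 < (\<Prod>e\<leftarrow>es. z + e)"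
    using es(2)
  proof (induction es)
    case (Cons e es)
    then have *: "0 < z + e" "ln (\<Prod>e\<leftarrow>es. z + e) = (\<Sum>e\<leftarrow>es. ln (z + e))" "0 < (\<Prod>e\<leftarrow>es. z + e)"
      using z by (auto intro: add_pos_nonneg)
    from ln_mult_pos[OF *(1,3)] *(1,2) mult_pos_pos[OF *(1,3)] show ?case by simp
  qed simp
  then have "ln (\<Prod>e\<leftarrow>es. z + e) = (\<Sum>e\<leftarrow>es. ln (z + e))" ..
  also have "\<dots> \<le> (\<Sum>e\<leftarrow>es. ln (C + z) - (\<Sum>k=1..K. \<theta> ^ k / real k * (1 + - 1 / C * e) ^ k))"
  proof (rule sum_list_mono)
    fix e assume e: "e \<in> set es"
    define s where "s = 1 + - 1 / C * e"
    have s: "0 \<le> s" "s \<le> 1" using es(2)[OF e] C by (auto simp: s_def field_simps)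
    have x: "0 \<le> \<theta> * s" "\<theta> * s < 1"
      using \<theta> s mult_left_le[of s \<theta>] by (auto intro: le_less_trans[of _ \<theta>])
    have "(C + z) * \<theta> = C" using C z by (simp add: \<theta>_def)
    moreover have "C * s = C - e" using C by (simp add: s_def field_simps)
    ultimately have "z + e = (C + z) * (1 - \<theta> * s)"
      by (simp add: right_diff_distrib mult.assoc[symmetric])
    then have "ln (z + e) = ln (C + z) + ln (1 - \<theta> * s)"
      using C z x by (simp add: ln_mult)
    moreover have "ln (1 - \<theta> * s) \<le> - (\<Sum>k=1..K. \<theta> ^ k / real k * s ^ k)"
    proof -
      have "(\<lambda>k. - ((- (- (\<theta> * s))) ^ k) / real k) sums ln (1 + - (\<theta> * s))"
        using x by (intro ln_series') auto
      then have "(\<lambda>k. (\<theta> * s) ^ k / real k) sums (- ln (1 - \<theta> * s))"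
        using sums_minus by fastforce
      then have "(\<Sum>k\<in>{1..K}. (\<theta> * s) ^ k / real k) \<le> - ln (1 - \<theta> * s)"
        using x by (subst sums_unique) (auto intro!: sum_le_suminf simp: sums_iff)
      then show ?thesis by (simp add: power_mult_distrib)
    qed
    ultimately show "ln (z + e) \<le> ln (C + z) - (\<Sum>k=1..K. \<theta> ^ k / real k * (1 + - 1 / C * e) ^ k)"
      by (simp add: s_def)
  qed
  also have "\<dots> = real ?N * ln (C + z) - (\<Sum>e\<leftarrow>es. \<Sum>k=1..K. \<theta> ^ k / real k * (1 + - 1 / C * e) ^ k)"
    unfolding es(1)[symmetric] by (induction es) (simp_all add: algebra_simps)
  also have "(\<Sum>e\<leftarrow>es. \<Sum>k=1..K. \<theta> ^ k / real k * (1 + - 1 / C * e) ^ k) =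
      (\<Sum>k=1..K. \<theta> ^ k / real k * (\<Sum>e\<leftarrow>es. (1 + - 1 / C * e) ^ k))"
    by (induction es) (simp_all add: sum.distrib distrib_left)
  also have "\<dots> = (\<Sum>k=1..K. \<theta> ^ k / real k *
      mat_trace ((1 \<cdot>\<^sub>m 1\<^sub>m ?N + (- 1 / C) \<cdot>\<^sub>m gram u (js @ ys)) ^\<^sub>m k))"
    by (simp only: es(4))
  finally show ?thesis
    using z by (simp add: \<theta>_def ln_realpow)
qed

section \<open>The kernels of the finite models\<close>

text \<open>
  Take a set \<open>J\<close> of coordinates of least cardinality that determines the kernel vectors: without
  any \<open>k \<in> J\<close> it fails to, so some kernel vector vanishes on \<open>J - {k}\<close> but not at \<open>k\<close>.
\<close>

lemma dual_basis_of_kernel: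
  fixes M :: "('i \<Rightarrow>\<^sub>0 real) \<Rightarrow> 'b::real_vector"
  assumes M: "linear M" and I: "finite I"
  obtains J b where "J \<subseteq> I"
    "\<And>x. Poly_Mapping.keys x \<subseteq> I \<Longrightarrow> M x = 0 \<Longrightarrow> (\<And>k. k \<in> J \<Longrightarrow> Poly_Mapping.lookup x k = 0) \<Longrightarrow> x = 0"
    "\<And>k. k \<in> J \<Longrightarrow> Poly_Mapping.keys (b k) \<subseteq> I \<and> M (b k) = 0"
    "\<And>k k'. k \<in> J \<Longrightarrow> k' \<in> J \<Longrightarrow> Poly_Mapping.lookup (b k) k' = (if k = k' then 1 else 0)"
proof -
  define det where "det J \<longleftrightarrow> J \<subseteq> I \<and> (\<forall>x. Poly_Mapping.keys x \<subseteq> I \<longrightarrow> M x = 0 \<longrightarrow>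
    (\<forall>k\<in>J. Poly_Mapping.lookup x k = 0) \<longrightarrow> x = 0)" for J
  have "det I"
    unfolding det_def by (auto simp: in_keys_iff intro!: poly_mapping_eqI)
  define J where "J = arg_min card det"
  have J: "det J" and min: "\<And>J'. det J' \<Longrightarrow> card J \<le> card J'"
    using arg_min_nat_lemma[of det I card] \<open>det I\<close> unfolding J_def by auto
  have finJ: "finite J" using J I finite_subset unfolding det_def by auto
  have "\<exists>b. Poly_Mapping.keys b \<subseteq> I \<and> M b = 0 \<and>
      (\<forall>k'\<in>J. Poly_Mapping.lookup b k' = (if k = k' then 1 else 0))" if k: "k \<in> J" for k
  proof -
    have "\<not> det (J - {k})"
      using min[of "J - {k}"] card_Diff1_less[OF finJ k] by linarith
    then obtain x where x: "Poly_Mapping.keys x \<subseteq> I" "M x = 0"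
      "\<And>k'. k' \<in> J - {k} \<Longrightarrow> Poly_Mapping.lookup x k' = 0" "x \<noteq> 0"
      using J unfolding det_def by blast
    have xk: "Poly_Mapping.lookup x k \<noteq> 0"
    proof
      assume "Poly_Mapping.lookup x k = 0"
      then have "\<forall>k'\<in>J. Poly_Mapping.lookup x k' = 0" using x(3) by auto
      then show False using J x unfolding det_def by blast
    qed
    show ?thesis
    proof (intro exI[of _ "(1 / Poly_Mapping.lookup x k) *\<^sub>R x"] conjI ballI)
      show "Poly_Mapping.keys ((1 / Poly_Mapping.lookup x k) *\<^sub>R x) \<subseteq> I"
        using x(1) by (auto simp: in_keys_iff lookup_scaleR)
      show "M ((1 / Poly_Mapping.lookup x k) *\<^sub>R x) = 0"
        by (simp add: linear_scale[OF M] x)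
      show "Poly_Mapping.lookup ((1 / Poly_Mapping.lookup x k) *\<^sub>R x) k' = (if k = k' then 1 else 0)"
        if "k' \<in> J" for k'
        using x(3)[of k'] that xk by (auto simp: lookup_scaleR)
    qed
  qed
  then obtain b where b: "\<And>k. k \<in> J \<Longrightarrow> Poly_Mapping.keys (b k) \<subseteq> I \<and> M (b k) = 0 \<and>
      (\<forall>k'\<in>J. Poly_Mapping.lookup (b k) k' = (if k = k' then 1 else 0))" by metis
  show thesis
    by (rule that[of J b]) (use J b in \<open>auto simp: det_def\<close>)
qed

context sofic_matrix
begin

definition I where "I i = {..<n} \<times> {1..d i}"

lemma finite_I [simp]: "finite (I i)" by (simp add: I_def)

lemma card_I: "card (I i) = n * d i" by (simp add: I_def)

lemma act_inv_in_iff: "act_inv i g v \<in> {1..d i} \<longleftrightarrow> v \<in> {1..d i}"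
  by (rule permutes_in_image[OF permutes])

lemma act_in_iff: "act i g v \<in> {1..d i} \<longleftrightarrow> v \<in> {1..d i}"
  by (rule permutes_in_image[OF permutes_inv[OF permutes]])

lemma keys_MM:
  assumes "Poly_Mapping.keys x \<subseteq> I i"
  shows "Poly_Mapping.keys (MM i x) \<subseteq> {..<m} \<times> {1..d i}"
proof (rule subsetI)
  fix k assume "k \<in> Poly_Mapping.keys (MM i x)"
  then have nz: "Poly_Mapping.lookup (MM i x) k \<noteq> 0" by (simp add: in_keys_iff)
  obtain l v where k: "k = (l, v)" by fastforce
  from nz obtain s g where "l < m" "Poly_Mapping.lookup x (s, act_inv i g v) \<noteq> 0"
    unfolding k inverse_family.lookup_mat_op[OF model_family]
    by (auto elim!: sum.not_neutral_contains_not_neutral split: if_splits)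
  then have "l < m" "act_inv i g v \<in> {1..d i}"
    using assms by (auto simp: in_keys_iff I_def)
  then show "k \<in> {..<m} \<times> {1..d i}" unfolding act_inv_in_iff by (simp add: k)
qed

lemma keys_MMa:
  assumes "Poly_Mapping.keys y \<subseteq> {..<m} \<times> {1..d i}"
  shows "Poly_Mapping.keys (MMa i y) \<subseteq> I i"
proof (rule subsetI)
  fix k assume "k \<in> Poly_Mapping.keys (MMa i y)"
  then have nz: "Poly_Mapping.lookup (MMa i y) k \<noteq> 0" by (simp add: in_keys_iff)
  obtain s v where k: "k = (s, v)" by fastforce
  from nz obtain l g where "s < n" "Poly_Mapping.lookup y (l, act i g v) \<noteq> 0"
    unfolding k inverse_family.lookup_mat_adj[OF model_family]
    by (auto elim!: sum.not_neutral_contains_not_neutral split: if_splits)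
  then have "s < n" "act i g v \<in> {1..d i}"
    using assms by (auto simp: in_keys_iff)
  then show "k \<in> I i" unfolding act_in_iff by (simp add: k I_def)
qed

lemma keys_SS:
  assumes "Poly_Mapping.keys x \<subseteq> I i"
  shows "Poly_Mapping.keys (SS i x) \<subseteq> I i"
proof -
  interpret A: adjoint_pair "MM i" "MMa i" C by (rule model_pair)
  have "Poly_Mapping.lookup (A.S x) k = 0" if "k \<notin> I i" for k
  proof -
    have "k \<notin> Poly_Mapping.keys x" "k \<notin> Poly_Mapping.keys (MMa i (MM i x))"
      using that assms keys_MMa[OF keys_MM[OF assms]] by auto
    then show ?thesis by (simp add: A.S_def lookup_minus lookup_scaleR not_in_keys_iff_lookup_eq_zero)
  qed
  then show ?thesis by (metis in_keys_iff subsetI)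
qed

lemma MM_unit_Ints: "Poly_Mapping.lookup (MM i (unit k)) k' \<in> \<int>"
proof (cases k')
  case (Pair l v)
  then show ?thesis
    unfolding Pair inverse_family.lookup_mat_op[OF model_family]
    by (auto simp: lookup_unit intro!: Ints_sum Ints_mult)
qed

lemma inner_MM_Ints: "inner (MM i (unit k)) (MM i (unit k')) \<in> \<int>"
  unfolding inner_poly_mapping_def by (auto intro!: Ints_sum Ints_mult MM_unit_Ints)

abbreviation "mom i \<equiv> adjoint_pair.moment (MM i) (MMa i) C"

text \<open>
  The matrix is that of \<open>S\<^sub>i\<close> in the standard basis, because \<open>\<langle>M\<^sub>i e\<^sub>k, M\<^sub>i e\<^sub>l\<rangle>\<close> are the entries
  of \<open>M\<^sub>i*M\<^sub>i\<close>.
\<close>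

lemma model_trace:
  assumes xs: "distinct xs" "set xs = I i"
  shows "mat_trace ((1 \<cdot>\<^sub>m 1\<^sub>m (length xs) + (- 1 / C) \<cdot>\<^sub>m gram (\<lambda>k. MM i (unit k)) xs) ^\<^sub>m t)
    = (\<Sum>k\<in>I i. mom i (unit k) t)"
proof -
  interpret A: adjoint_pair "MM i" "MMa i" C by (rule model_pair)
  define X where "X = 1 \<cdot>\<^sub>m 1\<^sub>m (length xs) + (- 1 / C) \<cdot>\<^sub>m gram (\<lambda>k. MM i (unit k)) xs"
  have X: "X \<in> carrier_mat (length xs) (length xs)" by (simp add: X_def)
  have entry: "X $$ (a, b) = inner (A.S (unit (xs ! b))) (unit (xs ! a))" if "a < length xs" "b < length xs" for a b
  proof -
    have "X $$ (a, b) = (if a = b then 1 else 0) - inner (MM i (unit (xs ! a))) (MM i (unit (xs ! b))) / C"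
      using that unfolding X_def by (simp add: carrier_matD[OF gram_carrier]) (simp add: gram_def)
    moreover have "inner (A.S (unit (xs ! b))) (unit (xs ! a)) =
        (if a = b then 1 else 0) - inner (MM i (unit (xs ! b))) (MM i (unit (xs ! a))) / C"
      using that xs(1) by (simp add: A.S_def inner_diff_left A.inner_Ma_M inner_unit_left[of "xs ! b" "unit (xs ! a)"]
          lookup_unit nth_eq_iff_index_eq)
    ultimately show ?thesis by (simp only: inner_commute)
  qed
  have supp: "(\<Sum>l<length xs. Poly_Mapping.lookup x (xs ! l) *\<^sub>R unit (xs ! l)) = x" if "Poly_Mapping.keys x \<subseteq> I i" for x
  proof -
    have "(\<Sum>l<length xs. Poly_Mapping.lookup x (xs ! l) *\<^sub>R unit (xs ! l)) = (\<Sum>k\<in>I i. Poly_Mapping.lookup x k *\<^sub>R unit k)"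
      by (rule sum.reindex_bij_betw[OF bij_betw_nth[OF xs(1) refl xs(2)[symmetric]]])
    also have "\<dots> = x" by (rule unit_expansion[symmetric]) (use that in auto)
    finally show ?thesis .
  qed
  have pow: "(X ^\<^sub>m t) $$ (a, b) = inner ((A.S ^^ t) (unit (xs ! b))) (unit (xs ! a))" if "a < length xs" "b < length xs" for a b t
    using that
  proof (induction t arbitrary: a b)
    case 0
    then show ?case using xs(1) X by (simp add: inner_unit_left lookup_unit nth_eq_iff_index_eq)
  next
    case (Suc t)
    have Xt: "X ^\<^sub>m t \<in> carrier_mat (length xs) (length xs)" using X by (rule pow_carrier_mat)
    have "(X ^\<^sub>m Suc t) $$ (a, b) = (\<Sum>l<length xs. (X ^\<^sub>m t) $$ (a, l) * X $$ (l, b))"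
      using Suc.prems carrier_matD[OF Xt] carrier_matD[OF X]
      by (simp add: scalar_prod_def atLeast0LessThan)
    also have "\<dots> = (\<Sum>l<length xs. inner ((A.S ^^ t) (unit (xs ! l))) (unit (xs ! a)) *
        Poly_Mapping.lookup (A.S (unit (xs ! b))) (xs ! l))"
      using Suc by (intro sum.cong refl) (simp add: entry inner_unit_right)
    also have "\<dots> = inner ((A.S ^^ t) (\<Sum>l<length xs. Poly_Mapping.lookup (A.S (unit (xs ! b))) (xs ! l) *\<^sub>R unit (xs ! l))) (unit (xs ! a))"
      by (simp add: linear_sum[OF A.linear_S_pow] linear_scale[OF A.linear_S_pow] inner_sum_left mult.commute)
    also have "(\<Sum>l<length xs. Poly_Mapping.lookup (A.S (unit (xs ! b))) (xs ! l) *\<^sub>R unit (xs ! l)) = A.S (unit (xs ! b))"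
      using xs(2) Suc.prems nth_mem[of b xs] by (intro supp keys_SS) auto
    finally show ?case by (simp add: funpow_swap1)
  qed
  have "mat_trace (X ^\<^sub>m t) = (\<Sum>a<length xs. mom i (unit (xs ! a)) t)"
    unfolding mat_trace_def carrier_matD(1)[OF pow_carrier_mat[OF X]]
    by (intro sum.cong refl) (simp add: pow A.moment_def)
  also have "\<dots> = (\<Sum>k\<in>I i. mom i (unit k) t)"
    by (rule sum.reindex_bij_betw[OF bij_betw_nth[OF xs(1) refl xs(2)[symmetric]]])
  finally show ?thesis by (simp only: X_def)
qed

lemma model_trace_generic:
  assumes "0 < \<delta>"
  shows "\<forall>\<^sub>F i in sequentially. \<bar>(\<Sum>k\<in>I i. mom i (unit k) t) - tr_moment t * real (d i)\<bar> \<le> \<delta> * real (d i)"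
proof -
  have gen: "eventually (\<lambda>q. \<forall>s\<in>{..<n}. (\<lambda>(i, j). mom i (unit (s, j)) t = GA.moment (unit (s, 0)) t) q) (generic d)"
    by (intro eventually_ball_lessThan generic_moment)
  have nn: "0 \<le> mom i x t" and le: "mom i (unit k) t \<le> 1" for i x k
    using adjoint_pair.moment_nonneg[OF model_pair, of i x t]
      adjoint_pair.moment_le[OF model_pair, of i "unit k" t] by simp_all
  have "\<forall>\<^sub>F i in sequentially. (\<Sum>j\<in>{1..d i}. \<Sum>s<n. mom i (unit (s, j)) t) \<le> (tr_moment t + \<delta>) * real (d i)"
  proof (rule generic_sum_le)
    show "eventually (\<lambda>(i, j). (\<Sum>s<n. mom i (unit (s, j)) t) \<le> tr_moment t) (generic d)"
      using gen by eventually_elim (auto simp: tr_moment_def)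
    show "(\<Sum>s<n. mom i (unit (s, j)) t) \<le> real n" for i j
      using sum_bounded_above[of "{..<n}" "\<lambda>s. mom i (unit (s, j)) t" 1] le by simp
    show "0 \<le> tr_moment t" by (simp add: tr_moment_def sum_nonneg GA.moment_nonneg)
  qed (use assms in auto)
  moreover have "\<forall>\<^sub>F i in sequentially. (tr_moment t - \<delta>) * real (d i) \<le> (\<Sum>j\<in>{1..d i}. \<Sum>s<n. mom i (unit (s, j)) t)"
  proof (rule generic_sum_ge)
    show "eventually (\<lambda>(i, j). tr_moment t \<le> (\<Sum>s<n. mom i (unit (s, j)) t)) (generic d)"
      using gen by eventually_elim (auto simp: tr_moment_def)
  qed (use assms in \<open>auto intro!: sum_nonneg nn\<close>)
  ultimately show ?thesis
  proof eventually_elim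
    case (elim i)
    have "(\<Sum>k\<in>I i. mom i (unit k) t) = (\<Sum>j\<in>{1..d i}. \<Sum>s<n. mom i (unit (s, j)) t)"
      unfolding I_def by (subst sum.swap) (simp add: sum.cartesian_product case_prod_unfold)
    with elim show ?case by (simp add: abs_le_iff algebra_simps)
  qed
qed

lemma C_ge_1: "1 \<le> C"
  using mat_norm_nonneg[of m n f] by (simp add: C_def mat_bound_def)

text \<open>
  With \<open>ln z = - L\<close> the trace inequality reads, up to constants, \<open>L c d \<le> n d ln (C + 1) + L |J|\<close>,
  because \<open>\<Sum>\<^sub>k \<theta>\<^sup>k/k\<close> exceeds \<open>L\<close>. For \<open>L\<close> large compared with \<open>n ln (C + 1)/c\<close> the term without
  \<open>L\<close> is absorbed. Integrality of the coefficients allows \<open>z\<close> to be so small uniformly in \<open>i\<close>.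
\<close>

theorem kernel_dimension:
  assumes c: "0 < c" and tr: "\<And>t. c \<le> tr_moment t"
  shows "\<forall>\<^sub>F i in sequentially. \<forall>J\<subseteq>I i.
    (\<forall>x. Poly_Mapping.keys x \<subseteq> I i \<longrightarrow> MM i x = 0 \<longrightarrow> (\<forall>k\<in>J. Poly_Mapping.lookup x k = 0) \<longrightarrow> x = 0) \<longrightarrow>
      c / 4 * real (d i) \<le> real (card J)"
proof -
  have lnC: "0 < ln (C + 1)" using C_ge_1 by simp
  \<comment> \<open>the summand \<open>1\<close> keeps \<open>L\<close> positive for \<open>n = 0\<close>\<close>
  define L where "L = 4 * real n * ln (C + 1) / c + 1"
  have L: "0 < L" unfolding L_def using c lnC by (intro add_nonneg_pos) auto
  have nL: "real n * ln (C + 1) \<le> c / 4 * L" using c by (simp add: L_def field_simps)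
  define z where "z = exp (- L)"
  have z: "0 < z" "z < 1" "ln z = - L" using L by (auto simp: z_def)
  define \<theta> where "\<theta> = C / (C + z)"
  have \<theta>: "0 \<le> \<theta>" "\<theta> < 1" using C_ge_1 z by (auto simp: \<theta>_def)
  obtain K where K: "L \<le> (\<Sum>k=1..K. \<theta> ^ k / real k)"
  proof -
    have "(\<lambda>k. - ((- (- \<theta>)) ^ k) / real k) sums ln (1 + - \<theta>)"
      using \<theta> by (intro ln_series') auto
    then have "(\<lambda>k. \<theta> ^ k / real k) sums (- ln (1 - \<theta>))"
      using sums_minus by fastforce
    then have lim: "(\<lambda>K. \<Sum>k<K. \<theta> ^ k / real k) \<longlonglongrightarrow> - ln (1 - \<theta>)"
      by (simp add: sums_def)
    have "1 - \<theta> = z / (C + z)" using C_ge_1 z by (simp add: \<theta>_def field_simps)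
    then have "- ln (1 - \<theta>) = L + ln (C + z)" using C_ge_1 z by (simp add: ln_div)
    moreover have "0 < ln (C + z)" using C_ge_1 z by simp
    ultimately have "L < - ln (1 - \<theta>)" by simp
    then obtain K where "L < (\<Sum>k<K. \<theta> ^ k / real k)"
      using order_tendstoD(1)[OF lim] by (auto simp: eventually_sequentially)
    also have "(\<Sum>k<K. \<theta> ^ k / real k) \<le> (\<Sum>k\<in>{0..K}. \<theta> ^ k / real k)"
      using \<theta> by (intro sum_mono2) auto
    also have "(\<Sum>k\<in>{0..K}. \<theta> ^ k / real k) = (\<Sum>k=1..K. \<theta> ^ k / real k)"
      by (rule sum.mono_neutral_right) auto
    finally show thesis by (intro that[of K] less_imp_le)
  qed
  have "\<forall>\<^sub>F i in sequentially. \<forall>k\<in>{1..K}. \<bar>(\<Sum>x\<in>I i. mom i (unit x) k) - tr_moment k * real (d i)\<bar> \<le> c / 2 * real (d i)"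
    using c by (intro eventually_ball_finite ballI model_trace_generic) auto
  then show ?thesis
  proof eventually_elim
    case (elim i)
    have elim': "c / 2 * real (d i) \<le> (\<Sum>x\<in>I i. mom i (unit x) k)" if "k \<in> {1..K}" for k
    proof -
      have "c * real (d i) \<le> tr_moment k * real (d i)" by (intro mult_right_mono tr) simp
      with bspec[OF elim that] show ?thesis unfolding abs_le_iff by linarith
    qed
    show ?case
    proof (intro allI impI)
      fix J assume JI: "J \<subseteq> I i" and det: "\<forall>x. Poly_Mapping.keys x \<subseteq> I i \<longrightarrow> MM i x = 0 \<longrightarrow> (\<forall>k\<in>J. Poly_Mapping.lookup x k = 0) \<longrightarrow> x = 0"
      have finJ: "finite J" using JI finite_I finite_subset by blast
      obtain js where js: "set js = J" "distinct js" using finite_distinct_list[OF finJ] by auto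
      obtain ys where ys: "set ys = I i - J" "distinct ys" using finite_distinct_list[of "I i - J"] by auto
      let ?xs = "js @ ys"
      have xs: "distinct ?xs" "set ?xs = I i" using js ys JI by auto
      let ?u = "\<lambda>k. MM i (unit k)"
      interpret A: adjoint_pair "MM i" "MMa i" C by (rule model_pair)
      have comb: "(\<Sum>a<length zs. p a *\<^sub>R ?u (zs ! a)) = MM i (\<Sum>a<length zs. p a *\<^sub>R unit (zs ! a))" for p zs
        by (simp add: linear_sum[OF A.linear_M] linear_scale[OF A.linear_M])
      have lk: "Poly_Mapping.lookup (\<Sum>a<length zs. p a *\<^sub>R unit (zs ! a)) (zs ! b) = p b"
        if "distinct zs" "b < length zs" for p b and zs :: "(nat \<times> nat) list"
      proof -
        have "Poly_Mapping.lookup (\<Sum>a<length zs. p a *\<^sub>R unit (zs ! a)) (zs ! b) = (\<Sum>a<length zs. if a = b then p a else 0)"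
          unfolding lookup_sum lookup_scaleR lookup_unit using that
          by (intro sum.cong) (auto simp: nth_eq_iff_index_eq)
        then show ?thesis using that by simp
      qed
      have keys: "Poly_Mapping.keys (\<Sum>a<length zs. p a *\<^sub>R unit (zs ! a)) \<subseteq> set zs" for p and zs :: "(nat \<times> nat) list"
      proof (rule subsetI, rule ccontr)
        fix k assume k: "k \<in> Poly_Mapping.keys (\<Sum>a<length zs. p a *\<^sub>R unit (zs ! a))" "k \<notin> set zs"
        then have "zs ! a \<noteq> k" if "a < length zs" for a using that nth_mem by metis
        then have "Poly_Mapping.lookup (\<Sum>a<length zs. p a *\<^sub>R unit (zs ! a)) k = 0"
          by (simp add: lookup_sum lookup_scaleR lookup_unit)
        with k show False by (simp add: in_keys_iff)
      qed
      have "(\<Sum>k=1..K. (C / (C + z)) ^ k / real k *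
          mat_trace ((1 \<cdot>\<^sub>m 1\<^sub>m (length ?xs) + (- 1 / C) \<cdot>\<^sub>m gram ?u ?xs) ^\<^sub>m k))
        \<le> real (length ?xs) * ln (C + z) - real (length js) * ln z"
      proof (rule card_ge_of_traces[OF xs(1) inner_MM_Ints _ _ A.C_pos z(1)])
        fix p :: "nat \<Rightarrow> real"
        assume "(\<Sum>a<length ys. p a *\<^sub>R ?u (ys ! a)) = 0"
        then have 0: "MM i (\<Sum>a<length ys. p a *\<^sub>R unit (ys ! a)) = 0" by (simp add: comb)
        have "(\<Sum>a<length ys. p a *\<^sub>R unit (ys ! a)) = 0"
        proof (rule det[rule_format, OF _ 0])
          show "Poly_Mapping.keys (\<Sum>a<length ys. p a *\<^sub>R unit (ys ! a)) \<subseteq> I i"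
            using keys[of p ys] ys by auto
          show "Poly_Mapping.lookup (\<Sum>a<length ys. p a *\<^sub>R unit (ys ! a)) k = 0" if "k \<in> J" for k
            using keys[of p ys] ys that by (auto simp: in_keys_iff)
        qed
        then show "\<forall>a<length ys. p a = 0" using lk[OF ys(2), of _ p] by simp
      next
        fix p :: "nat \<Rightarrow> real"
        let ?x = "\<Sum>a<length ?xs. p a *\<^sub>R unit (?xs ! a)"
        have "(norm ?x)\<^sup>2 = (\<Sum>k\<in>I i. (Poly_Mapping.lookup ?x k)\<^sup>2)"
          using keys[of p ?xs] xs by (intro norm_poly_mapping_superset) auto
        also have "\<dots> = (\<Sum>a<length ?xs. (Poly_Mapping.lookup ?x (?xs ! a))\<^sup>2)"
          by (rule sum.reindex_bij_betw[OF bij_betw_nth[OF xs(1) refl xs(2)[symmetric]], symmetric])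
        also have "\<dots> = (\<Sum>a<length ?xs. (p a)\<^sup>2)" by (intro sum.cong refl) (simp only: lk[OF xs(1)] lessThan_iff)
        finally show "(norm (\<Sum>a<length ?xs. p a *\<^sub>R ?u (?xs ! a)))\<^sup>2 \<le> C * (\<Sum>a<length ?xs. (p a)\<^sup>2)"
          unfolding comb using A.bound[of ?x] by simp
      qed
      moreover have "length ?xs = n * d i"
        using distinct_card[OF xs(1)] xs(2) card_I by metis
      moreover have "length js = card J" using distinct_card[OF js(2)] js(1) by simp
      ultimately have 1: "(\<Sum>k=1..K. \<theta> ^ k / real k * (\<Sum>x\<in>I i. mom i (unit x) k)) \<le>
        real (n * d i) * ln (C + z) - real (card J) * ln z"
        unfolding model_trace[OF xs] by (simp only: \<theta>_def)
      have 2: "(\<Sum>k=1..K. \<theta> ^ k / real k * (c / 2 * real (d i))) \<le> (\<Sum>k=1..K. \<theta> ^ k / real k * (\<Sum>x\<in>I i. mom i (unit x) k))"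
        using \<theta> by (intro sum_mono mult_left_mono elim') auto
      have 3: "L * (c / 2 * real (d i)) \<le> (\<Sum>k=1..K. \<theta> ^ k / real k * (c / 2 * real (d i)))"
        unfolding sum_distrib_right[symmetric] using K c by (intro mult_right_mono) auto
      have 4: "real (n * d i) * ln (C + z) \<le> real (d i) * (c / 4 * L)"
      proof -
        have "real n * ln (C + z) \<le> c / 4 * L"
          using z C_ge_1 by (intro order_trans[OF mult_left_mono nL]) auto
        then have "real (d i) * (real n * ln (C + z)) \<le> real (d i) * (c / 4 * L)" by (intro mult_left_mono) auto
        then show ?thesis by (simp add: mult_ac)
      qed
      have 5: "L * (c / 2 * real (d i)) = L * (c / 4 * real (d i)) + L * (c / 4 * real (d i))"
        by (simp add: algebra_simps)
      have 6: "real (d i) * (c / 4 * L) = L * (c / 4 * real (d i))" by simp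
      have 7: "real (card J) * ln z = - (L * real (card J))" by (simp add: z(3))
      have "L * (c / 4 * real (d i)) \<le> L * real (card J)"
        using 1 2 3 4 unfolding 5 6 7 by linarith
      then show "c / 4 * real (d i) \<le> real (card J)" using L by simp
    qed
  qed
qed

end

section \<open>The circle as a compact metric group\<close>

lift_definition circ :: "rmodz \<Rightarrow> real" is "\<lambda>r. \<bar>r - of_int (round r)\<bar>"
proof -
  fix x y :: real assume "x - y \<in> \<int>"
  then obtain k where "x = y + of_int k" by (metis Ints_cases add.commute diff_add_cancel)
  moreover have "round (y + of_int k) = round y + k"
  proof -
    have "y + of_int k + 1 / 2 = (y + 1 / 2) + of_int k" by simp
    then show ?thesis unfolding round_def by (simp only: floor_add_int)
  qed
  ultimately show "\<bar>x - of_int (round x)\<bar> = \<bar>y - of_int (round y)\<bar>" by simp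
qed

lemma circ_abs_le: "circ (abs_rmodz r) \<le> \<bar>r - of_int k\<bar>"
  by transfer (simp add: round_diff_minimal abs_minus_commute)

lemma abs_rmodz_add: "abs_rmodz (x + y) = abs_rmodz x + abs_rmodz y"
  by (simp add: plus_rmodz.abs_eq)

lemma abs_rmodz_diff: "abs_rmodz (x - y) = abs_rmodz x - abs_rmodz y"
  by (simp add: minus_rmodz.abs_eq)

lemma abs_rmodz_of_int [simp]: "abs_rmodz (of_int k) = 0"
  unfolding zero_rmodz_def by (simp add: rmodz.abs_eq_iff)

lemma abs_rmodz_0 [simp]: "abs_rmodz 0 = 0"
  by (simp add: zero_rmodz_def)

lemma rmodz_cases: obtains r where "x = abs_rmodz r" "0 \<le> r" "r < 1"
proof -
  obtain s where s: "x = abs_rmodz s" by (metis Quotient_rep_abs Quotient_rmodz Quotient_abs_rep)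
  have "s - frac s \<in> \<int>" by (simp add: frac_def)
  then have "x = abs_rmodz (frac s)" by (simp add: s rmodz.abs_eq_iff)
  then show thesis using that frac_lt_1 frac_ge_0 by blast
qed

lemma circ_attained: obtains r where "x = abs_rmodz r" "\<bar>r\<bar> = circ x"
proof -
  obtain s where s: "x = abs_rmodz s" by (rule rmodz_cases)
  have "x = abs_rmodz (s - of_int (round s))" by (simp add: s abs_rmodz_diff)
  moreover have "\<bar>s - of_int (round s)\<bar> = circ x" by (simp add: s circ.abs_eq)
  ultimately show thesis using that by blast
qed

lemma circ_abs_le': "circ (abs_rmodz r) \<le> \<bar>r\<bar>"
  using circ_abs_le[of r 0] by simp

lemma circ_nonneg: "0 \<le> circ x"
  by transfer simp

lemma circ_0 [simp]: "circ 0 = 0"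
  by transfer simp

lemma circ_eq_0: "circ x = 0 \<longleftrightarrow> x = 0"
proof
  assume "circ x = 0"
  moreover obtain r where "x = abs_rmodz r" "\<bar>r\<bar> = circ x" by (rule circ_attained)
  ultimately show "x = 0" by simp
qed simp

lemma circ_minus: "circ (- x) \<le> circ x"
proof -
  obtain r where r: "x = abs_rmodz r" "\<bar>r\<bar> = circ x" by (rule circ_attained)
  have "- x = abs_rmodz (- r)" by (simp add: r uminus_rmodz.abs_eq)
  then show ?thesis using circ_abs_le'[of "- r"] r by simp
qed

lemma circ_triangle: "circ (x + y) \<le> circ x + circ y"
proof -
  obtain r where r: "x = abs_rmodz r" "\<bar>r\<bar> = circ x" by (rule circ_attained)
  obtain s where s: "y = abs_rmodz s" "\<bar>s\<bar> = circ y" by (rule circ_attained)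
  show ?thesis using circ_abs_le'[of "r + s"] r s by (simp add: abs_rmodz_add)
qed

lemma circ_sum: "circ (\<Sum>i\<in>A. p i) \<le> (\<Sum>i\<in>A. circ (p i))"
  by (induction A rule: infinite_finite_induct) (auto intro: order_trans[OF circ_triangle])

lemma circ_half: "circ (abs_rmodz (1 / 2)) = 1 / 2"
  by transfer (simp add: round_def)

instantiation rmodz :: metric_space
begin

definition dist_rmodz :: "rmodz \<Rightarrow> rmodz \<Rightarrow> real" where
  "dist x y = circ (x - y)"

definition uniformity_rmodz :: "(rmodz \<times> rmodz) filter" where
  "uniformity = (INF e\<in>{0<..}. principal {(x :: rmodz, y). dist x y < e})"

instance
proof
  show "uniformity = (INF e\<in>{0<..}. principal {(x :: rmodz, y). dist x y < e})"
    by (simp add: uniformity_rmodz_def)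
  show "(dist x y = 0) = (x = y)" for x y :: rmodz
    by (simp add: dist_rmodz_def circ_eq_0)
  show "dist x y \<le> dist x z + dist y z" for x y z :: rmodz
    using circ_triangle[of "x - z" "z - y"] circ_minus[of "y - z"] by (simp add: dist_rmodz_def)
  show "open U = (\<forall>x\<in>U. eventually (\<lambda>(x', y). x' = x \<longrightarrow> y \<in> U) uniformity)" for U :: "rmodz set"
  proof -
    have ev: "eventually P uniformity \<longleftrightarrow> (\<exists>e>0. \<forall>x y :: rmodz. dist x y < e \<longrightarrow> P (x, y))" for P
      unfolding uniformity_rmodz_def
      by (subst eventually_INF_base) (auto simp: eventually_principal subset_eq intro: bexI[of _ "min _ _"])
    have "open U \<longleftrightarrow> (\<forall>r. abs_rmodz r \<in> U \<longrightarrow> (\<exists>e>0. \<forall>s. \<bar>s - r\<bar> < e \<longrightarrow> abs_rmodz s \<in> U))"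
      by (auto simp: open_rmodz_def open_dist dist_real_def)
    also have "\<dots> \<longleftrightarrow> (\<forall>x\<in>U. \<exists>e>0. \<forall>y. dist x y < e \<longrightarrow> y \<in> U)"
    proof safe
      fix x assume *: "\<forall>r. abs_rmodz r \<in> U \<longrightarrow> (\<exists>e>0. \<forall>s. \<bar>s - r\<bar> < e \<longrightarrow> abs_rmodz s \<in> U)" and "x \<in> U"
      obtain r where r: "x = abs_rmodz r" by (rule rmodz_cases)
      then obtain e where e: "e > 0" "\<And>s. \<bar>s - r\<bar> < e \<Longrightarrow> abs_rmodz s \<in> U" using * \<open>x \<in> U\<close> by blast
      have "y \<in> U" if "dist x y < e" for y
      proof -
        obtain t where t: "x - y = abs_rmodz t" "\<bar>t\<bar> = circ (x - y)" by (rule circ_attained)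
        have "y = abs_rmodz (r - t)" using t(1) r by (simp add: abs_rmodz_diff algebra_simps)
        then show ?thesis using e(2)[of "r - t"] that t(2) by (simp add: dist_rmodz_def)
      qed
      then show "\<exists>e>0. \<forall>y. dist x y < e \<longrightarrow> y \<in> U" using e(1) by blast
    next
      fix r assume "\<forall>x\<in>U. \<exists>e>0. \<forall>y. dist x y < e \<longrightarrow> y \<in> U" "abs_rmodz r \<in> U"
      then obtain e where e: "e > 0" "\<And>y. dist (abs_rmodz r) y < e \<Longrightarrow> y \<in> U" by blast
      have "abs_rmodz s \<in> U" if "\<bar>s - r\<bar> < e" for s
        using e(2)[of "abs_rmodz s"] circ_abs_le'[of "r - s"] that
        by (simp add: dist_rmodz_def abs_rmodz_diff)
      then show "\<exists>e>0. \<forall>s. \<bar>s - r\<bar> < e \<longrightarrow> abs_rmodz s \<in> U" using e(1) by blast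
    qed
    finally show ?thesis unfolding ev by auto
  qed
qed

end

lemma dist_abs_rmodz_le: "dist (abs_rmodz r) (abs_rmodz s) \<le> \<bar>r - s\<bar>"
  using circ_abs_le'[of "r - s"] by (simp add: dist_rmodz_def abs_rmodz_diff)

lemma dist_add_rmodz: "dist (x + y) (x' + y') \<le> dist x x' + dist y (y' :: rmodz)"
  using circ_triangle[of "x - x'" "y - y'"] by (simp add: dist_rmodz_def algebra_simps)

instance rmodz :: topological_monoid_add
proof
  fix a b :: rmodz
  show "filterlim (\<lambda>x. fst x + snd x) (nhds (a + b)) (nhds a \<times>\<^sub>F nhds b)"
  proof (rule tendstoI)
    fix e :: real assume e: "0 < e"
    have "\<forall>\<^sub>F x in nhds a. dist x a < e / 2" "\<forall>\<^sub>F y in nhds b. dist y b < e / 2"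
      using e by (auto simp: eventually_nhds_metric intro!: exI[of _ "e / 2"])
    then have "\<forall>\<^sub>F p in nhds a \<times>\<^sub>F nhds b. dist (fst p) a < e / 2 \<and> dist (snd p) b < e / 2"
      unfolding eventually_prod_filter by fastforce
    then show "\<forall>\<^sub>F p in nhds a \<times>\<^sub>F nhds b. dist (fst p + snd p) (a + b) < e"
      by eventually_elim (use dist_add_rmodz in \<open>smt (verit, best) field_sum_of_halves\<close>)
  qed
qed

instance rmodz :: topological_comm_monoid_add ..

lemma continuous_abs_rmodz: "continuous_on S abs_rmodz"
  unfolding continuous_on_iff
  by (metis dist_abs_rmodz_le dist_real_def order_le_less_trans)

lemma compact_UNIV_rmodz: "compact (UNIV :: rmodz set)"
proof -
  have "UNIV = abs_rmodz ` {0..1}"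
  proof (rule UNIV_eq_I)
    fix x show "x \<in> abs_rmodz ` {0..1}" by (rule rmodz_cases[of x]) auto
  qed
  then show ?thesis
    using compact_continuous_image[OF continuous_abs_rmodz compact_Icc] by metis
qed

lemma compact_UNIV_fun_rmodz: "compact (UNIV :: ('k \<Rightarrow> rmodz) set)"
proof -
  have "compact_space (product_topology (\<lambda>i :: 'k. euclidean :: rmodz topology) UNIV)"
    by (subst compact_space_product_topology) (simp add: compact_space_def compactin_euclidean_iff compact_UNIV_rmodz)
  then show ?thesis
    by (simp add: compact_space_def euclidean_product_topology compactin_euclidean_iff)
qed

section \<open>The dual group\<close>

lemma closed_additive: "closed {u :: 'a::ab_group_add \<Rightarrow> rmodz. Modules.additive u}"
proof -
  have "{u :: 'a \<Rightarrow> rmodz. Modules.additive u} = (\<Inter>a. \<Inter>b. {u. u (a + b) = u a + u b})"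
    by (auto simp: Modules.additive_def)
  also have "closed \<dots>"
    by (intro closed_INT ballI closed_Collect_eq continuous_intros) auto
  finally show ?thesis .
qed

lemma topspace_dual [simp]: "topspace dual_topology = {u. Modules.additive u}"
  by (simp add: dual_topology_def)

lemma compact_dual: "compact_space (dual_topology :: ('a::ab_group_add \<Rightarrow> rmodz) topology)"
proof -
  have "compact ({u. Modules.additive u} :: ('a \<Rightarrow> rmodz) set)"
    using compact_Int_closed[OF compact_UNIV_fun_rmodz closed_additive] by simp
  then show ?thesis
    unfolding dual_topology_def by (simp add: compact_space_subtopology compactin_euclidean_iff)
qed

lemma metrizable_dual:
  assumes "countable (UNIV :: 'a::ab_group_add set)"
  shows "metrizable_space (dual_topology :: ('a \<Rightarrow> rmodz) topology)"
proof -
  have "metrizable_space (product_topology (\<lambda>i :: 'a. euclidean :: rmodz topology) UNIV)"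
    unfolding metrizable_space_product_topology
    using countable_subset[OF _ assms] by (auto simp: metrizable_space_euclidean)
  then show ?thesis
    unfolding dual_topology_def euclidean_product_topology by (rule metrizable_space_subtopology)
qed

section \<open>Quadratic means\<close>

definition qmean :: "nat \<Rightarrow> (nat \<Rightarrow> real) \<Rightarrow> real" where
  "qmean d p = sqrt (1 / real d * (\<Sum>j\<in>{1..d}. (p j)\<^sup>2))"

lemma rho_2_qmean: "rho_2 \<rho> d \<phi> \<psi> = qmean d (\<lambda>j. \<rho> (\<phi> j) (\<psi> j))"
  by (simp add: rho_2_def qmean_def)

lemma qmean_L2_set: "qmean d p = L2_set p {1..d} / sqrt (real d)"
  by (simp add: qmean_def L2_set_def real_sqrt_divide)

lemma qmean_nonneg: "0 \<le> qmean d p"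
  by (simp add: qmean_L2_set)

lemma qmean_sq: "0 < d \<Longrightarrow> (\<Sum>j\<in>{1..d}. (p j)\<^sup>2) = real d * (qmean d p)\<^sup>2"
  by (simp add: qmean_def sum_nonneg)

lemma qmean_mono:
  assumes "\<And>j. j \<in> {1..d} \<Longrightarrow> 0 \<le> p j" "\<And>j. j \<in> {1..d} \<Longrightarrow> p j \<le> q j"
  shows "qmean d p \<le> qmean d q"
  unfolding qmean_L2_set using assms by (intro divide_right_mono L2_set_mono) auto

lemma qmean_triangle: "qmean d (\<lambda>j. p j + q j) \<le> qmean d p + qmean d q"
  unfolding qmean_L2_set add_divide_distrib[symmetric]
  by (intro divide_right_mono L2_set_triangle_ineq) auto

lemma qmean_const: "0 < d \<Longrightarrow> 0 \<le> c \<Longrightarrow> qmean d (\<lambda>_. c) = c"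
  by (simp add: qmean_def real_sqrt_mult)

lemma qmean_cmult: "0 \<le> c \<Longrightarrow> qmean d (\<lambda>j. c * p j) = c * qmean d p"
  unfolding qmean_L2_set by (simp add: L2_set_right_distrib)

lemma qmean_sum: "qmean d (\<lambda>j. \<Sum>h\<in>E. p h j) \<le> (\<Sum>h\<in>E. qmean d (p h))"
proof (induction E rule: infinite_finite_induct)
  case (insert x F)
  then show ?case
    using qmean_triangle[of d "p x" "\<lambda>j. \<Sum>h\<in>F. p h j"] by simp
qed (simp_all add: qmean_def)

lemma qmean_permutes:
  assumes "\<pi> permutes {1..d}"
  shows "qmean d (\<lambda>j. p (\<pi> j)) = qmean d p"
  unfolding qmean_def using sum.permute[OF assms, of "\<lambda>j. (p j)\<^sup>2"] by (simp add: o_def)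

lemma qmean_le_card:
  assumes d: "0 < d" and D: "\<And>j. j \<in> {1..d} \<Longrightarrow> 0 \<le> p j \<and> p j \<le> D" "0 \<le> D"
    and bad: "real (card {j\<in>{1..d}. p j \<noteq> 0}) \<le> \<gamma>\<^sup>2 * real d" and "0 \<le> \<gamma>"
  shows "qmean d p \<le> D * \<gamma>"
proof -
  let ?B = "{j\<in>{1..d}. p j \<noteq> 0}"
  have "(\<Sum>j\<in>{1..d}. (p j)\<^sup>2) = (\<Sum>j\<in>?B. (p j)\<^sup>2)"
    by (rule sum.mono_neutral_right) auto
  also have "\<dots> \<le> (\<Sum>j\<in>?B. D\<^sup>2)"
    using D by (intro sum_mono power_mono) auto
  also have "\<dots> = real (card ?B) * D\<^sup>2" by simp
  also have "\<dots> \<le> \<gamma>\<^sup>2 * real d * D\<^sup>2" by (intro mult_right_mono bad) auto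
  finally have "1 / real d * (\<Sum>j\<in>{1..d}. (p j)\<^sup>2) \<le> (D * \<gamma>)\<^sup>2"
    using d by (simp add: field_simps power_mult_distrib)
  then show ?thesis
    unfolding qmean_def using assms by (intro real_le_lsqrt) auto
qed

section \<open>Comparing pseudometrics on compact systems\<close>

locale compact_system =
  fixes X :: "'x topology" and act :: "'g::group_add \<Rightarrow> 'x \<Rightarrow> 'x"
  assumes compact: "compact_space X"
    and act_continuous: "continuous_map X X (act g)"
    and act_add: "x \<in> topspace X \<Longrightarrow> act (g + h) x = act g (act h x)"
    and act_zero: "x \<in> topspace X \<Longrightarrow> act 0 x = x"
begin

lemma act_in: "x \<in> topspace X \<Longrightarrow> act g x \<in> topspace X"
  using act_continuous[of g] by (auto simp: continuous_map_def)

lemma compact_square: "compact_space (prod_topology X X)"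
  using compact by (simp add: compact_space_prod_topology)

lemma pseudometric_bounded:
  assumes "continuous_pseudometric X \<rho>"
  obtains D where "0 < D" "\<And>x y. x \<in> topspace X \<Longrightarrow> y \<in> topspace X \<Longrightarrow> \<rho> x y \<le> D"
proof -
  have "compactin euclideanreal ((\<lambda>(x, y). \<rho> x y) ` topspace (prod_topology X X))"
    using assms compact_square unfolding compact_space_def continuous_pseudometric_def
    by (intro image_compactin[where X = "prod_topology X X"]) auto
  then have "bounded ((\<lambda>(x, y). \<rho> x y) ` (topspace X \<times> topspace X))"
    by (simp add: compact_imp_bounded)
  then obtain D where D: "\<And>z. z \<in> (\<lambda>(x, y). \<rho> x y) ` (topspace X \<times> topspace X) \<Longrightarrow> norm z \<le> D"
    unfolding bounded_iff by blast
  show thesis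
  proof (rule that[of "max D 1"])
    fix x y assume "x \<in> topspace X" "y \<in> topspace X"
    then have "norm (\<rho> x y) \<le> D" by (intro D) auto
    then show "\<rho> x y \<le> max D 1" by auto
  qed simp
qed

text \<open>
  The pairs with \<open>\<rho> \<ge> \<eta>\<close> form a compact set disjoint from the diagonal, and the open sets
  \<open>p h > 1/(k+1)\<close> cover it.
\<close>

lemma separation_modulus:
  fixes p :: "'h \<Rightarrow> 'x \<Rightarrow> 'x \<Rightarrow> real"
  assumes \<rho>: "continuous_pseudometric X \<rho>"
    and p: "\<And>h. continuous_map (prod_topology X X) euclideanreal (\<lambda>(x, y). p h x y)"
    and sep: "\<And>x y. x \<in> topspace X \<Longrightarrow> y \<in> topspace X \<Longrightarrow> x \<noteq> y \<Longrightarrow> \<exists>h. 0 < p h x y"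
    and \<eta>: "0 < \<eta>"
  obtains E \<kappa> where "finite E" "0 < \<kappa>"
    "\<And>x y. x \<in> topspace X \<Longrightarrow> y \<in> topspace X \<Longrightarrow> (\<And>h. h \<in> E \<Longrightarrow> p h x y < \<kappa>) \<Longrightarrow> \<rho> x y < \<eta>"
proof -
  let ?P = "prod_topology X X"
  let ?K = "{z \<in> topspace ?P. (\<lambda>(x, y). \<rho> x y) z \<in> {\<eta>..}}"
  let ?U = "\<lambda>(h, k). {z \<in> topspace ?P. (\<lambda>(x, y). p h x y) z \<in> {1 / real (Suc k)<..}}"
  have "closedin ?P ?K"
    using \<rho> unfolding continuous_pseudometric_def by (intro closedin_continuous_map_preimage[of _ euclideanreal]) auto
  then have K: "compactin ?P ?K" by (rule closedin_compact_space[OF compact_square])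
  have op: "openin ?P (?U q)" for q
  proof (cases q)
    case (Pair h k)
    have "openin ?P {z \<in> topspace ?P. (\<lambda>(x, y). p h x y) z \<in> {1 / real (Suc k)<..}}"
      by (rule openin_continuous_map_preimage[OF p]) simp
    then show ?thesis unfolding Pair by (simp only: case_prod_conv)
  qed
  have cover: "?K \<subseteq> \<Union> (range ?U)"
  proof
    fix z assume z: "z \<in> ?K"
    obtain x y where xy: "z = (x, y)" by fastforce
    have "x \<in> topspace X" "y \<in> topspace X" "\<eta> \<le> \<rho> x y" using z by (auto simp: xy)
    moreover have "x \<noteq> y" using \<rho> calculation \<eta> by (auto simp: continuous_pseudometric_def)
    ultimately obtain h where h: "0 < p h x y" using sep by blast
    obtain k where "1 / real (Suc k) < p h x y" using nat_approx_posE[OF h] by blast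
    then have "z \<in> ?U (h, k)" using z by (auto simp: xy)
    then show "z \<in> \<Union> (range ?U)" by blast
  qed
  obtain \<F> where \<F>: "finite \<F>" "\<F> \<subseteq> range ?U" "?K \<subseteq> \<Union> \<F>"
    using compactinD[OF K, of "range ?U"] op cover by blast
  obtain Q where Q: "finite Q" "\<F> = ?U ` Q" using finite_subset_image[OF \<F>(1,2)] by blast
  define N where "N = Max (insert 0 (snd ` Q))"
  show thesis
  proof (rule that[of "fst ` Q" "1 / real (Suc N)"])
    fix x y assume xy: "x \<in> topspace X" "y \<in> topspace X" and small: "\<And>h. h \<in> fst ` Q \<Longrightarrow> p h x y < 1 / real (Suc N)"
    show "\<rho> x y < \<eta>"
    proof (rule ccontr)
      assume "\<not> \<rho> x y < \<eta>"
      then have "(x, y) \<in> ?K" using xy by auto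
      then obtain h k where hk: "(h, k) \<in> Q" "1 / real (Suc k) < p h x y" using \<F>(3) Q by auto
      have "k \<le> N" unfolding N_def using hk(1) Q(1) by (intro Max_ge) force+
      then have "1 / real (Suc N) \<le> 1 / real (Suc k)" by (intro divide_left_mono) auto
      then show False using hk small[of h] by force
    qed
  qed (use Q in auto)
qed

lemma continuous_act_pair:
  assumes "continuous_map (prod_topology X X) euclideanreal (\<lambda>(x, y). \<rho> x y)"
  shows "continuous_map (prod_topology X X) euclideanreal (\<lambda>(x, y). \<rho> (act h x) (act h y))"
proof -
  have "continuous_map (prod_topology X X) (prod_topology X X) (\<lambda>z. (act h (fst z), act h (snd z)))"
    by (intro continuous_map_pairedI continuous_map_compose[OF continuous_map_fst act_continuous, unfolded o_def]
        continuous_map_compose[OF continuous_map_snd act_continuous, unfolded o_def])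
  from continuous_map_compose[OF this assms] show ?thesis by (simp add: o_def case_prod_unfold)
qed

text \<open>
  A linear form of the modulus of \<open>separation_modulus\<close>, which can be inserted into quadratic
  means: if some translate of \<open>\<rho>\<close> is at least \<open>\<kappa>\<close>, then \<open>D/\<kappa>\<close> times it is at least the bound \<open>D\<close>
  of \<open>\<rho>'\<close>.
\<close>

lemma generating_dominates:
  assumes gen: "dynamically_generating X act \<rho>" and \<rho>': "continuous_pseudometric X \<rho>'" and \<eta>: "0 < \<eta>"
  obtains E K where "finite E" "0 < K"
    "\<And>x y. x \<in> topspace X \<Longrightarrow> y \<in> topspace X \<Longrightarrow> \<rho>' x y \<le> \<eta> + K * (\<Sum>h\<in>E. \<rho> (act h x) (act h y))"
proof -
  have \<rho>: "continuous_pseudometric X \<rho>" using gen by (simp add: dynamically_generating_def)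
  have cont: "continuous_map (prod_topology X X) euclideanreal (\<lambda>(x, y). \<rho> (act h x) (act h y))" for h
    using \<rho> by (intro continuous_act_pair) (simp add: continuous_pseudometric_def)
  have sep: "\<exists>h. 0 < \<rho> (act h x) (act h y)" if "x \<in> topspace X" "y \<in> topspace X" "x \<noteq> y" for x y
    using gen that by (auto simp: dynamically_generating_def)
  obtain E \<kappa> where E: "finite E" "0 < \<kappa>"
    and md: "\<And>x y. x \<in> topspace X \<Longrightarrow> y \<in> topspace X \<Longrightarrow> (\<And>h. h \<in> E \<Longrightarrow> \<rho> (act h x) (act h y) < \<kappa>) \<Longrightarrow> \<rho>' x y < \<eta>"
    using separation_modulus[OF \<rho>' cont sep \<eta>] by blast
  obtain D where D: "0 < D" "\<And>x y. x \<in> topspace X \<Longrightarrow> y \<in> topspace X \<Longrightarrow> \<rho>' x y \<le> D"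
    using pseudometric_bounded[OF \<rho>'] by blast
  show thesis
  proof (rule that[of E "D / \<kappa>"])
    fix x y assume xy: "x \<in> topspace X" "y \<in> topspace X"
    have nn: "0 \<le> \<rho> (act h x) (act h y)" for h
      using \<rho> xy act_in by (auto simp: continuous_pseudometric_def)
    show "\<rho>' x y \<le> \<eta> + D / \<kappa> * (\<Sum>h\<in>E. \<rho> (act h x) (act h y))"
    proof (cases "\<forall>h\<in>E. \<rho> (act h x) (act h y) < \<kappa>")
      case True
      then have "\<rho>' x y < \<eta>" using md xy by blast
      moreover have "0 \<le> D / \<kappa> * (\<Sum>h\<in>E. \<rho> (act h x) (act h y))"
        using D(1) E(2) by (intro mult_nonneg_nonneg sum_nonneg nn) auto
      ultimately show ?thesis by simp
    next
      case False
      then obtain h where h: "h \<in> E" "\<kappa> \<le> \<rho> (act h x) (act h y)" by force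
      have "\<kappa> \<le> (\<Sum>h\<in>E. \<rho> (act h x) (act h y))"
        using member_le_sum[OF h(1), of "\<lambda>h. \<rho> (act h x) (act h y)"] h(2) nn E(1) by force
      then have "D / \<kappa> * \<kappa> \<le> D / \<kappa> * (\<Sum>h\<in>E. \<rho> (act h x) (act h y))"
        using D(1) E(2) by (intro mult_left_mono) auto
      then show ?thesis using D(2)[OF xy] E(2) \<eta> by simp
    qed
  qed (use E D in auto)
qed

end

locale sofic_system = sofic_model d \<sigma> + compact_system X T
  for d and \<sigma> :: "nat \<Rightarrow> 'g::group_add \<Rightarrow> nat \<Rightarrow> nat" and X :: "'x topology" and T :: "'g \<Rightarrow> 'x \<Rightarrow> 'x"
begin

abbreviation "Maps \<rho> F \<delta> i \<equiv> Map_set X T \<rho> F \<delta> (d i) (\<sigma> i)"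

lemma Maps_in: "\<phi> \<in> Maps \<rho> F \<delta> i \<Longrightarrow> j \<in> {1..d i} \<Longrightarrow> \<phi> j \<in> topspace X"
  by (auto simp: Map_set_def PiE_def)

lemma Maps_less: "\<phi> \<in> Maps \<rho> F \<delta> i \<Longrightarrow> g \<in> F \<Longrightarrow> qmean (d i) (\<lambda>j. \<rho> (\<phi> (\<sigma> i g j)) (T g (\<phi> j))) < \<delta>"
  by (auto simp: Map_set_def rho_2_qmean)

lemma Maps_mono: "F \<subseteq> F' \<Longrightarrow> \<delta>' \<le> \<delta> \<Longrightarrow> Maps \<rho> F' \<delta>' i \<subseteq> Maps \<rho> F \<delta> i"
  by (force simp: Map_set_def)

text \<open>
  By \<open>generating_dominates\<close> it suffices to estimate the translates \<open>\<rho>(h \<cdot>, h \<cdot>)\<close> of the defect of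
  equivariance under \<open>g\<close>. Such a translate is compared through \<open>\<phi>(\<sigma>\<^sub>h \<sigma>\<^sub>g j)\<close> and \<open>\<phi>(\<sigma>\<^sub>h\<^sub>g j)\<close>,
  which agree at most points \<open>j\<close>.
\<close>

lemma Maps_subset:
  assumes gen: "dynamically_generating X T \<rho>" and \<rho>': "continuous_pseudometric X \<rho>'"
    and F: "finite F" and \<delta>: "0 < \<delta>"
  obtains F' \<delta>' where "finite F'" "0 < \<delta>'" "\<forall>\<^sub>F i in sequentially. Maps \<rho> F' \<delta>' i \<subseteq> Maps \<rho>' F \<delta> i"
proof -
  have \<rho>: "continuous_pseudometric X \<rho>" using gen by (simp add: dynamically_generating_def)
  have tri: "\<And>x y z. x \<in> topspace X \<Longrightarrow> y \<in> topspace X \<Longrightarrow> z \<in> topspace X \<Longrightarrow> \<rho> x z \<le> \<rho> x y + \<rho> y z"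
    and sym: "\<And>x y. x \<in> topspace X \<Longrightarrow> y \<in> topspace X \<Longrightarrow> \<rho> x y = \<rho> y x"
    and nn: "\<And>x y. x \<in> topspace X \<Longrightarrow> y \<in> topspace X \<Longrightarrow> 0 \<le> \<rho> x y"
    and refl: "\<And>x. x \<in> topspace X \<Longrightarrow> \<rho> x x = 0"
    using \<rho> by (auto simp: continuous_pseudometric_def)
  obtain D where D: "0 < D" "\<And>x y. x \<in> topspace X \<Longrightarrow> y \<in> topspace X \<Longrightarrow> \<rho> x y \<le> D"
    using pseudometric_bounded[OF \<rho>] by blast
  have "0 < \<delta> / 3" using \<delta> by simp
  from generating_dominates[OF gen \<rho>' this] obtain E K where E: "finite E" "0 < K"
    and dom: "\<And>x y. x \<in> topspace X \<Longrightarrow> y \<in> topspace X \<Longrightarrow> \<rho>' x y \<le> \<delta> / 3 + K * (\<Sum>h\<in>E. \<rho> (T h x) (T h y))"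
    by blast
  define \<delta>' where "\<delta>' = \<delta> / (9 * (K * real (card E) + 1))"
  have \<delta>': "0 < \<delta>'" unfolding \<delta>'_def using \<delta> E(2) by (intro divide_pos_pos) (auto intro!: add_nonneg_pos)
  have small: "K * (real (card E) * (3 * \<delta>')) \<le> \<delta> / 3"
  proof -
    have "0 < K * real (card E) + 1" using E(2) by (intro add_nonneg_pos) auto
    then show ?thesis using \<delta> by (simp add: \<delta>'_def field_simps)
  qed
  define F' where "F' = E \<union> (\<lambda>(h, g). h + g) ` (E \<times> F)"
  have "finite F'" using E F by (simp add: F'_def)
  define \<gamma> where "\<gamma> = \<delta>' / D"
  have \<gamma>: "0 < \<gamma>" using \<delta>' D by (simp add: \<gamma>_def)
  have "\<forall>\<^sub>F i in sequentially. \<forall>h\<in>E. \<forall>g\<in>F.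
      real (card {j\<in>{1..d i}. \<not> (\<sigma> i h (\<sigma> i g j) = \<sigma> i (h + g) j)}) \<le> \<gamma>\<^sup>2 * real (d i)"
  proof (intro eventually_ball_finite ballI E F)
    fix h g
    show "\<forall>\<^sub>F i in sequentially. real (card {j\<in>{1..d i}. \<not> (\<sigma> i h (\<sigma> i g j) = \<sigma> i (h + g) j)}) \<le> \<gamma>\<^sup>2 * real (d i)"
      using generic_card_le[OF generic_mult, of "\<gamma>\<^sup>2" h g] \<gamma> by simp
  qed
  then have "\<forall>\<^sub>F i in sequentially. Maps \<rho> F' \<delta>' i \<subseteq> Maps \<rho>' F \<delta> i"
  proof eventually_elim
    case (elim i)
    show ?case
    proof
      fix \<phi> assume \<phi>: "\<phi> \<in> Maps \<rho> F' \<delta>' i"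
      have X: "\<phi> j \<in> topspace X" "\<phi> (\<sigma> i g j) \<in> topspace X" "\<phi> (\<sigma> i h (\<sigma> i g j)) \<in> topspace X"
        if "j \<in> {1..d i}" for j g h
        using Maps_in[OF \<phi>] that sigma_in by blast+
      have "qmean (d i) (\<lambda>j. \<rho>' (\<phi> (\<sigma> i g j)) (T g (\<phi> j))) < \<delta>" if g: "g \<in> F" for g
      proof -
        have one: "qmean (d i) (\<lambda>j. \<rho> (T h (\<phi> (\<sigma> i g j))) (T h (T g (\<phi> j)))) \<le> 3 * \<delta>'" if h: "h \<in> E" for h
        proof -
          let ?a = "\<lambda>j. \<rho> (\<phi> (\<sigma> i h (\<sigma> i g j))) (T h (\<phi> (\<sigma> i g j)))"
          let ?b = "\<lambda>j. \<rho> (\<phi> (\<sigma> i h (\<sigma> i g j))) (\<phi> (\<sigma> i (h + g) j))"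
          let ?c = "\<lambda>j. \<rho> (\<phi> (\<sigma> i (h + g) j)) (T (h + g) (\<phi> j))"
          have a: "qmean (d i) ?a \<le> \<delta>'"
            using qmean_permutes[OF permutes, where p = "\<lambda>j. \<rho> (\<phi> (\<sigma> i h j)) (T h (\<phi> j))"] Maps_less[OF \<phi>, of h] h
            by (simp add: F'_def)
          have c: "qmean (d i) ?c \<le> \<delta>'"
            using Maps_less[OF \<phi>, of "h + g"] h g by (force simp: F'_def)
          have b: "qmean (d i) ?b \<le> \<delta>'"
          proof -
            have "qmean (d i) ?b \<le> D * \<gamma>"
            proof (rule qmean_le_card[OF d_pos])
              have "{j\<in>{1..d i}. ?b j \<noteq> 0} \<subseteq> {j\<in>{1..d i}. \<not> (\<sigma> i h (\<sigma> i g j) = \<sigma> i (h + g) j)}"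
                using refl X by auto
              then have "card {j\<in>{1..d i}. ?b j \<noteq> 0} \<le> card {j\<in>{1..d i}. \<not> (\<sigma> i h (\<sigma> i g j) = \<sigma> i (h + g) j)}"
                by (intro card_mono) auto
              then show "real (card {j\<in>{1..d i}. ?b j \<noteq> 0}) \<le> \<gamma>\<^sup>2 * real (d i)"
                using elim h g by (meson of_nat_mono order_trans)
            qed (use D nn X \<gamma> in auto)
            then show ?thesis using D(1) by (simp add: \<gamma>_def)
          qed
          have "qmean (d i) (\<lambda>j. \<rho> (T h (\<phi> (\<sigma> i g j))) (T h (T g (\<phi> j)))) \<le> qmean (d i) (\<lambda>j. ?a j + (?b j + ?c j))"
          proof (rule qmean_mono)
            fix j assume j: "j \<in> {1..d i}"
            note Xj = X[OF j]
            have A: "T h (\<phi> (\<sigma> i g j)) \<in> topspace X" "T h (T g (\<phi> j)) \<in> topspace X"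
              using Xj act_in by blast+
            show "0 \<le> \<rho> (T h (\<phi> (\<sigma> i g j))) (T h (T g (\<phi> j)))" using A by (rule nn)
            have "\<rho> (T h (\<phi> (\<sigma> i g j))) (T h (T g (\<phi> j))) \<le>
              \<rho> (T h (\<phi> (\<sigma> i g j))) (\<phi> (\<sigma> i h (\<sigma> i g j))) + \<rho> (\<phi> (\<sigma> i h (\<sigma> i g j))) (T h (T g (\<phi> j)))"
              using A Xj by (intro tri) auto
            also have "\<rho> (\<phi> (\<sigma> i h (\<sigma> i g j))) (T h (T g (\<phi> j))) \<le>
              \<rho> (\<phi> (\<sigma> i h (\<sigma> i g j))) (\<phi> (\<sigma> i (h + g) j)) + \<rho> (\<phi> (\<sigma> i (h + g) j)) (T h (T g (\<phi> j)))"
              using A Xj by (intro tri) auto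
            finally show "\<rho> (T h (\<phi> (\<sigma> i g j))) (T h (T g (\<phi> j))) \<le> ?a j + (?b j + ?c j)"
              using sym A Xj by (simp add: act_add)
          qed
          also have "\<dots> \<le> qmean (d i) ?a + (qmean (d i) ?b + qmean (d i) ?c)"
            by (intro order_trans[OF qmean_triangle] add_left_mono qmean_triangle)
          also have "\<dots> \<le> 3 * \<delta>'" using a b c by simp
          finally show ?thesis .
        qed
        have "qmean (d i) (\<lambda>j. \<rho>' (\<phi> (\<sigma> i g j)) (T g (\<phi> j))) \<le>
          qmean (d i) (\<lambda>j. \<delta> / 3 + K * (\<Sum>h\<in>E. \<rho> (T h (\<phi> (\<sigma> i g j))) (T h (T g (\<phi> j)))))"
          using X act_in \<rho>' by (intro qmean_mono dom) (auto simp: continuous_pseudometric_def)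
        also have "\<dots> \<le> qmean (d i) (\<lambda>j. \<delta> / 3) + qmean (d i) (\<lambda>j. K * (\<Sum>h\<in>E. \<rho> (T h (\<phi> (\<sigma> i g j))) (T h (T g (\<phi> j)))))"
          by (rule qmean_triangle)
        also have "\<dots> = \<delta> / 3 + K * qmean (d i) (\<lambda>j. \<Sum>h\<in>E. \<rho> (T h (\<phi> (\<sigma> i g j))) (T h (T g (\<phi> j))))"
          using \<delta> E(2) d_pos by (simp add: qmean_const qmean_cmult)
        also have "\<dots> \<le> \<delta> / 3 + K * (\<Sum>h\<in>E. 3 * \<delta>')"
          using E(2) by (intro add_left_mono mult_left_mono order_trans[OF qmean_sum] sum_mono one) auto
        also have "\<dots> \<le> \<delta> / 3 + \<delta> / 3" using small by simp
        also have "\<dots> < \<delta>" using \<delta> by simp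
        finally show ?thesis .
      qed
      then show "\<phi> \<in> Maps \<rho>' F \<delta> i" using \<phi> by (auto simp: Map_set_def rho_2_qmean)
    qed
  qed
  then show thesis using that \<open>finite F'\<close> \<delta>' by blast
qed

text \<open>
  The translates \<open>\<rho>(h \<phi>(j), h \<psi>(j))\<close> are within the defect of equivariance of
  \<open>\<rho>(\<phi>(\<sigma>\<^sub>h j), \<psi>(\<sigma>\<^sub>h j))\<close>, and the permutation \<open>\<sigma>\<^sub>h\<close> preserves quadratic means.
\<close>

lemma rho_2_compare:
  assumes gen: "dynamically_generating X T \<rho>" and \<rho>': "continuous_pseudometric X \<rho>'" and \<epsilon>': "0 < \<epsilon>'"
  obtains \<epsilon> F' \<delta>' where "0 < \<epsilon>" "finite F'" "0 < \<delta>'"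
    "\<And>i \<phi> \<psi>. \<phi> \<in> Maps \<rho> F' \<delta>' i \<Longrightarrow> \<psi> \<in> Maps \<rho> F' \<delta>' i \<Longrightarrow> rho_2 \<rho> (d i) \<phi> \<psi> \<le> 2 * \<epsilon> \<Longrightarrow> rho_2 \<rho>' (d i) \<phi> \<psi> \<le> \<epsilon>'"
proof -
  have \<rho>: "continuous_pseudometric X \<rho>" using gen by (simp add: dynamically_generating_def)
  have tri: "\<And>x y z. x \<in> topspace X \<Longrightarrow> y \<in> topspace X \<Longrightarrow> z \<in> topspace X \<Longrightarrow> \<rho> x z \<le> \<rho> x y + \<rho> y z"
    and sym: "\<And>x y. x \<in> topspace X \<Longrightarrow> y \<in> topspace X \<Longrightarrow> \<rho> x y = \<rho> y x"
    and nn: "\<And>x y. x \<in> topspace X \<Longrightarrow> y \<in> topspace X \<Longrightarrow> 0 \<le> \<rho> x y"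
    using \<rho> by (auto simp: continuous_pseudometric_def)
  have "0 < \<epsilon>' / 2" using \<epsilon>' by simp
  from generating_dominates[OF gen \<rho>' this] obtain E K where E: "finite E" "0 < K"
    and dom: "\<And>x y. x \<in> topspace X \<Longrightarrow> y \<in> topspace X \<Longrightarrow> \<rho>' x y \<le> \<epsilon>' / 2 + K * (\<Sum>h\<in>E. \<rho> (T h x) (T h y))"
    by blast
  define \<epsilon> where "\<epsilon> = \<epsilon>' / (8 * (K * real (card E) + 1))"
  have \<epsilon>: "0 < \<epsilon>" unfolding \<epsilon>_def using \<epsilon>' E(2) by (intro divide_pos_pos) (auto intro!: add_nonneg_pos)
  have small: "K * (real (card E) * (4 * \<epsilon>)) \<le> \<epsilon>' / 2"
  proof -
    have "0 < K * real (card E) + 1" using E(2) by (intro add_nonneg_pos) auto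
    then show ?thesis using \<epsilon>' by (simp add: \<epsilon>_def field_simps)
  qed
  show thesis
  proof (rule that[OF \<epsilon> E(1) \<epsilon>])
    fix i \<phi> \<psi> assume \<phi>: "\<phi> \<in> Maps \<rho> E \<epsilon> i" and \<psi>: "\<psi> \<in> Maps \<rho> E \<epsilon> i" and close: "rho_2 \<rho> (d i) \<phi> \<psi> \<le> 2 * \<epsilon>"
    have one: "qmean (d i) (\<lambda>j. \<rho> (T h (\<phi> j)) (T h (\<psi> j))) \<le> 4 * \<epsilon>" if h: "h \<in> E" for h
    proof -
      let ?a = "\<lambda>j. \<rho> (\<phi> (\<sigma> i h j)) (T h (\<phi> j))"
      let ?b = "\<lambda>j. \<rho> (\<phi> (\<sigma> i h j)) (\<psi> (\<sigma> i h j))"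
      let ?c = "\<lambda>j. \<rho> (\<psi> (\<sigma> i h j)) (T h (\<psi> j))"
      have "qmean (d i) (\<lambda>j. \<rho> (T h (\<phi> j)) (T h (\<psi> j))) \<le> qmean (d i) (\<lambda>j. ?a j + (?b j + ?c j))"
      proof (rule qmean_mono)
        fix j assume j: "j \<in> {1..d i}"
        have A: "T h (\<phi> j) \<in> topspace X" "T h (\<psi> j) \<in> topspace X" "\<phi> (\<sigma> i h j) \<in> topspace X" "\<psi> (\<sigma> i h j) \<in> topspace X"
          using Maps_in[OF \<phi>] Maps_in[OF \<psi>] j sigma_in act_in by blast+
        show "0 \<le> \<rho> (T h (\<phi> j)) (T h (\<psi> j))" using A by (intro nn)
        have "\<rho> (T h (\<phi> j)) (T h (\<psi> j)) \<le> \<rho> (T h (\<phi> j)) (\<phi> (\<sigma> i h j)) + \<rho> (\<phi> (\<sigma> i h j)) (T h (\<psi> j))"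
          using A by (intro tri)
        also have "\<rho> (\<phi> (\<sigma> i h j)) (T h (\<psi> j)) \<le> ?b j + ?c j" using A by (intro tri)
        finally show "\<rho> (T h (\<phi> j)) (T h (\<psi> j)) \<le> ?a j + (?b j + ?c j)" using sym A by simp
      qed
      also have "\<dots> \<le> qmean (d i) ?a + (qmean (d i) ?b + qmean (d i) ?c)"
        by (intro order_trans[OF qmean_triangle] add_left_mono qmean_triangle)
      also have "\<dots> \<le> 4 * \<epsilon>"
        using Maps_less[OF \<phi> h] Maps_less[OF \<psi> h] close
          qmean_permutes[OF permutes, where p = "\<lambda>j. \<rho> (\<phi> j) (\<psi> j)"] by (simp add: rho_2_qmean)
      finally show ?thesis .
    qed
    have "rho_2 \<rho>' (d i) \<phi> \<psi> \<le> qmean (d i) (\<lambda>j. \<epsilon>' / 2 + K * (\<Sum>h\<in>E. \<rho> (T h (\<phi> j)) (T h (\<psi> j))))"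
      unfolding rho_2_qmean using Maps_in[OF \<phi>] Maps_in[OF \<psi>] \<rho>'
      by (intro qmean_mono dom) (auto simp: continuous_pseudometric_def)
    also have "\<dots> \<le> qmean (d i) (\<lambda>j. \<epsilon>' / 2) + qmean (d i) (\<lambda>j. K * (\<Sum>h\<in>E. \<rho> (T h (\<phi> j)) (T h (\<psi> j))))"
      by (rule qmean_triangle)
    also have "\<dots> = \<epsilon>' / 2 + K * qmean (d i) (\<lambda>j. \<Sum>h\<in>E. \<rho> (T h (\<phi> j)) (T h (\<psi> j)))"
      using \<epsilon>' E(2) d_pos by (simp add: qmean_const qmean_cmult)
    also have "\<dots> \<le> \<epsilon>' / 2 + K * (\<Sum>h\<in>E. 4 * \<epsilon>)"
      using E(2) by (intro add_left_mono mult_left_mono order_trans[OF qmean_sum] sum_mono one) auto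
    also have "\<dots> \<le> \<epsilon>'" using small by simp
    finally show "rho_2 \<rho>' (d i) \<phi> \<psi> \<le> \<epsilon>'" .
  qed
qed

end

section \<open>Spanning and separation numbers\<close>

lemma log_enat_mono: "a \<le> b \<Longrightarrow> log_enat a \<le> log_enat b"
proof -
  assume ab: "a \<le> b"
  show ?thesis
  proof (cases b)
    case b: (enat l)
    then obtain k where k: "a = enat k" "k \<le> l" using ab enat_ile by (metis enat_ord_simps(1))
    show ?thesis
    proof (cases "k = 0")
      case True
      then have "log_enat a = - \<infinity>" by (simp add: k)
      then show ?thesis by simp
    next
      case False
      then have "ln (real k) \<le> ln (real l)" using k(2) by (subst ln_le_cancel_iff) auto
      then show ?thesis using False k(2) unfolding k(1) b by (simp only: log_enat.simps) simp
    qed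
  next
    case infinity
    then show ?thesis by simp
  qed
qed

lemma span_num_le_card:
  assumes "finite A" "A \<subseteq> Y" "\<And>y. y \<in> Y \<Longrightarrow> \<exists>a\<in>A. \<theta> y a \<le> \<epsilon>"
  shows "span_num \<epsilon> Y \<theta> \<le> enat (card A)"
  unfolding span_num_def using assms by (intro INF_lower) auto

lemma span_num_attained:
  assumes "span_num \<epsilon> Y \<theta> = enat k"
  obtains A where "finite A" "A \<subseteq> Y" "\<And>y. y \<in> Y \<Longrightarrow> \<exists>a\<in>A. \<theta> y a \<le> \<epsilon>" "card A = k"
proof -
  let ?S = "{A. finite A \<and> A \<subseteq> Y \<and> (\<forall>y\<in>Y. \<exists>a\<in>A. \<theta> y a \<le> \<epsilon>)}"
  have ne: "(\<lambda>A. enat (card A)) ` ?S \<noteq> {}"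
  proof
    assume *: "(\<lambda>A. enat (card A)) ` ?S = {}"
    have "span_num \<epsilon> Y \<theta> = \<infinity>" unfolding span_num_def * by (simp add: top_enat_def)
    then show False using assms by simp
  qed
  then obtain e where "e \<in> (\<lambda>A. enat (card A)) ` ?S" by blast
  then have "Inf ((\<lambda>A. enat (card A)) ` ?S) \<in> (\<lambda>A. enat (card A)) ` ?S"
    by (rule wellorder_InfI)
  then have "enat k \<in> (\<lambda>A. enat (card A)) ` ?S" using assms by (simp add: span_num_def)
  then show thesis using that by auto
qed

lemma span_num_le_classes:
  assumes fin: "finite (c ` Y)" and same: "\<And>y y'. y \<in> Y \<Longrightarrow> y' \<in> Y \<Longrightarrow> c y = c y' \<Longrightarrow> \<theta> y y' \<le> \<epsilon>"
  shows "span_num \<epsilon> Y \<theta> \<le> enat (card (c ` Y))"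
proof -
  define r where "r k = (SOME y. y \<in> Y \<and> c y = k)" for k
  have r: "r (c y) \<in> Y \<and> c (r (c y)) = c y" if "y \<in> Y" for y
    unfolding r_def by (rule someI[of _ y]) (use that in auto)
  have "span_num \<epsilon> Y \<theta> \<le> enat (card (r ` c ` Y))"
  proof (rule span_num_le_card)
    show "\<exists>a\<in>r ` c ` Y. \<theta> y a \<le> \<epsilon>" if "y \<in> Y" for y
      using r[OF that] that by (intro bexI[of _ "r (c y)"] same) auto
  qed (use fin r in auto)
  also have "\<dots> \<le> enat (card (c ` Y))" by (simp add: card_image_le fin)
  finally show ?thesis .
qed

text \<open>
  A spanning set partitions \<open>Y'\<close> into classes of \<open>\<theta>\<close>-diameter at most \<open>2 \<epsilon>\<close>. Choosing
  representatives in \<open>Y'\<close> avoids that the spanning set itself need not lie there.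
\<close>

lemma span_num_transfer:
  assumes sub: "Y' \<subseteq> Y"
    and tri: "\<And>x y z. x \<in> Y \<Longrightarrow> y \<in> Y \<Longrightarrow> z \<in> Y \<Longrightarrow> \<theta> x z \<le> \<theta> x y + \<theta> z y"
    and imp: "\<And>y y'. y \<in> Y' \<Longrightarrow> y' \<in> Y' \<Longrightarrow> \<theta> y y' \<le> 2 * \<epsilon> \<Longrightarrow> \<theta>' y y' \<le> \<epsilon>'"
  shows "span_num \<epsilon>' Y' \<theta>' \<le> span_num \<epsilon> Y \<theta>"
proof (cases "span_num \<epsilon> Y \<theta>")
  case (enat k)
  then obtain A where A: "finite A" "A \<subseteq> Y" "\<And>y. y \<in> Y \<Longrightarrow> \<exists>a\<in>A. \<theta> y a \<le> \<epsilon>" "card A = k"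
    by (rule span_num_attained) blast
  then obtain c where c: "\<And>y. y \<in> Y \<Longrightarrow> c y \<in> A \<and> \<theta> y (c y) \<le> \<epsilon>" by metis
  have cA: "c ` Y' \<subseteq> A" using c sub by auto
  have "span_num \<epsilon>' Y' \<theta>' \<le> enat (card (c ` Y'))"
  proof (rule span_num_le_classes)
    show "finite (c ` Y')" using cA A(1) by (rule finite_subset)
    fix y y' assume y: "y \<in> Y'" "y' \<in> Y'" "c y = c y'"
    then have Y: "y \<in> Y" "y' \<in> Y" "c y \<in> Y" using sub c A(2) by blast+
    have "\<theta> y y' \<le> \<theta> y (c y) + \<theta> y' (c y)" by (rule tri) (use Y in auto)
    also have "\<dots> \<le> 2 * \<epsilon>" using c[OF Y(1)] c[OF Y(2)] y(3) by simp
    finally show "\<theta>' y y' \<le> \<epsilon>'" using imp y by blast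
  qed
  also have "\<dots> \<le> enat k" using card_mono[OF A(1) cA] A(4) by simp
  finally show ?thesis using enat by simp
qed simp

context compact_system
begin

lemma compatible_continuous:
  assumes "compatible_metric X \<rho>"
  shows "continuous_pseudometric X \<rho>"
proof -
  interpret M: Metric_space "topspace X" \<rho> using assms by (simp add: compatible_metric_def)
  have X: "M.mtopology = X" using assms by (simp add: compatible_metric_def)
  have "continuous_map (prod_topology X X) euclideanreal (\<lambda>z. mdist (metric (topspace X, \<rho>)) (fst z) (snd z))"
    using continuous_map_mdist[of "prod_topology X X" "metric (topspace X, \<rho>)" fst snd]
    by (simp add: X continuous_map_fst continuous_map_snd)
  then show ?thesis
    unfolding continuous_pseudometric_def
    using M.triangle by (auto simp: M.commute case_prod_unfold)
qed

lemma compatible_generating: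
  assumes "compatible_metric X \<rho>"
  shows "dynamically_generating X act \<rho>"
proof -
  interpret M: Metric_space "topspace X" \<rho> using assms by (simp add: compatible_metric_def)
  show ?thesis
    unfolding dynamically_generating_def
  proof (intro conjI compatible_continuous assms ballI impI)
    fix x y assume "x \<in> topspace X" "y \<in> topspace X" "x \<noteq> y"
    then show "\<exists>g. 0 < \<rho> (act g x) (act g y)"
      by (intro exI[of _ 0]) (simp add: act_zero M.mdist_pos_eq)
  qed
qed

lemma finite_net:
  assumes \<rho>: "continuous_pseudometric X \<rho>" and \<epsilon>: "0 < \<epsilon>"
  obtains C :: "'x set" and cl where "finite C" "\<And>x. x \<in> topspace X \<Longrightarrow> cl x \<in> C"
    "\<And>x y. x \<in> topspace X \<Longrightarrow> y \<in> topspace X \<Longrightarrow> cl x = cl y \<Longrightarrow> \<rho> x y < \<epsilon>"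
proof -
  let ?U = "\<lambda>x. {y \<in> topspace X. \<rho> x y \<in> {..<\<epsilon> / 2}}"
  have op: "openin X (?U x)" if x: "x \<in> topspace X" for x
  proof -
    have "continuous_map X (prod_topology X X) (\<lambda>y. (x, y))"
      using x by (intro continuous_map_pairedI) auto
    from continuous_map_compose[OF this, of euclideanreal "\<lambda>(x, y). \<rho> x y"]
    have "continuous_map X euclideanreal (\<rho> x)"
      using \<rho> by (simp add: continuous_pseudometric_def o_def)
    then show ?thesis by (rule openin_continuous_map_preimage) simp
  qed
  have "compactin X (topspace X)" using compact by (simp add: compact_space_def)
  moreover have "topspace X \<subseteq> \<Union> (?U ` topspace X)"
    using \<rho> \<epsilon> by (auto simp: continuous_pseudometric_def)
  ultimately obtain \<F> where \<F>: "finite \<F>" "\<F> \<subseteq> ?U ` topspace X" "topspace X \<subseteq> \<Union> \<F>"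
    using compactinD[of X "topspace X" "?U ` topspace X"] op by blast
  obtain C where C: "finite C" "C \<subseteq> topspace X" "\<F> = ?U ` C" using finite_subset_image[OF \<F>(1,2)] by blast
  have "\<exists>c\<in>C. \<rho> c x < \<epsilon> / 2" if "x \<in> topspace X" for x using \<F>(3) C(3) that by auto
  then obtain cl where cl: "\<And>x. x \<in> topspace X \<Longrightarrow> cl x \<in> C \<and> \<rho> (cl x) x < \<epsilon> / 2" by metis
  show thesis
  proof (rule that[OF C(1), of cl])
    show "cl x \<in> C" if "x \<in> topspace X" for x using cl that by blast
    fix x y assume xy: "x \<in> topspace X" "y \<in> topspace X" "cl x = cl y"
    have "cl x \<in> topspace X" using cl xy C by blast
    then have "\<rho> x y \<le> \<rho> x (cl x) + \<rho> (cl x) y" "\<rho> x (cl x) = \<rho> (cl x) x"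
      using \<rho> xy unfolding continuous_pseudometric_def by blast+
    with cl[OF xy(1)] cl[OF xy(2)] xy(3) show "\<rho> x y < \<epsilon>" by simp
  qed
qed

end

section \<open>Entropy does not depend on the generating pseudometric\<close>

lemma normalized_log_mono: "a \<le> b \<Longrightarrow> ereal (1 / real d) * log_enat a \<le> ereal (1 / real d) * log_enat b"
  by (intro ereal_mult_left_mono log_enat_mono) auto

lemma log_enat_le:
  assumes "0 < d" "a \<le> enat k" "ln (real k) \<le> B * real d" "0 \<le> B"
  shows "ereal (1 / real d) * log_enat a \<le> ereal B"
proof -
  have "log_enat (enat k) \<le> ereal (B * real d)" using assms by auto
  with log_enat_mono[OF assms(2)] have "log_enat a \<le> ereal (B * real d)" by (rule order_trans)
  then have "ereal (1 / real d) * log_enat a \<le> ereal (1 / real d) * ereal (B * real d)"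
    by (intro ereal_mult_left_mono) auto
  then show ?thesis using assms(1) by simp
qed

lemma log_enat_ge:
  assumes "0 < d" "enat k \<le> a" "0 < k" "B * real d \<le> ln (real k)"
  shows "ereal B \<le> ereal (1 / real d) * log_enat a"
proof -
  have "ereal (B * real d) \<le> log_enat (enat k)" using assms by auto
  also have "\<dots> \<le> log_enat a" by (rule log_enat_mono[OF assms(2)])
  finally have "ereal (1 / real d) * ereal (B * real d) \<le> ereal (1 / real d) * log_enat a"
    by (intro ereal_mult_left_mono) auto
  then show ?thesis using assms(1) by simp
qed

context sofic_system
begin

abbreviation "span_rate \<rho> \<epsilon> F \<delta> \<equiv>
  limsup (\<lambda>i. ereal (1 / real (d i)) * log_enat (span_num \<epsilon> (Maps \<rho> F \<delta> i) (rho_2 \<rho> (d i))))"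

abbreviation "sep_rate \<rho> \<epsilon> F \<delta> \<equiv>
  limsup (\<lambda>i. ereal (1 / real (d i)) * log_enat (sep_num \<epsilon> (Maps \<rho> F \<delta> i) (rho_inf \<rho> (d i))))"

lemma rho_2_triangle:
  assumes \<rho>: "continuous_pseudometric X \<rho>" and "\<phi> \<in> Maps \<rho>1 F1 \<delta>1 i" "\<psi> \<in> Maps \<rho>1 F1 \<delta>1 i" "\<omega> \<in> Maps \<rho>1 F1 \<delta>1 i"
  shows "rho_2 \<rho> (d i) \<phi> \<omega> \<le> rho_2 \<rho> (d i) \<phi> \<psi> + rho_2 \<rho> (d i) \<omega> \<psi>"
proof -
  have "rho_2 \<rho> (d i) \<phi> \<omega> \<le> qmean (d i) (\<lambda>j. \<rho> (\<phi> j) (\<psi> j) + \<rho> (\<omega> j) (\<psi> j))"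
    unfolding rho_2_qmean
  proof (rule qmean_mono)
    fix j assume "j \<in> {1..d i}"
    then have X: "\<phi> j \<in> topspace X" "\<psi> j \<in> topspace X" "\<omega> j \<in> topspace X" using assms Maps_in by blast+
    then show "0 \<le> \<rho> (\<phi> j) (\<omega> j)" using \<rho> by (simp add: continuous_pseudometric_def)
    have "\<rho> (\<phi> j) (\<omega> j) \<le> \<rho> (\<phi> j) (\<psi> j) + \<rho> (\<psi> j) (\<omega> j)" "\<rho> (\<psi> j) (\<omega> j) = \<rho> (\<omega> j) (\<psi> j)"
      using \<rho> X unfolding continuous_pseudometric_def by blast+
    then show "\<rho> (\<phi> j) (\<omega> j) \<le> \<rho> (\<phi> j) (\<psi> j) + \<rho> (\<omega> j) (\<psi> j)" by simp
  qed
  also have "\<dots> \<le> rho_2 \<rho> (d i) \<phi> \<psi> + rho_2 \<rho> (d i) \<omega> \<psi>"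
    unfolding rho_2_qmean by (rule qmean_triangle)
  finally show ?thesis .
qed

text \<open>
  Approximately equivariant maps for \<open>\<rho>'\<close> are approximately equivariant for \<open>\<rho>\<close> (\<open>Maps_subset\<close>),
  and on those \<open>\<rho>\<close>-closeness implies \<open>\<rho>'\<close>-closeness (\<open>rho_2_compare\<close>).
\<close>

lemma entropy_le:
  assumes gen: "dynamically_generating X T \<rho>" and gen': "dynamically_generating X T \<rho>'"
  shows "sofic_entropy_wrt d \<sigma> X T \<rho>' \<le> sofic_entropy_wrt d \<sigma> X T \<rho>"
proof -
  have \<rho>: "continuous_pseudometric X \<rho>" and \<rho>': "continuous_pseudometric X \<rho>'"
    using gen gen' by (auto simp: dynamically_generating_def)
  show ?thesis
    unfolding sofic_entropy_wrt_def
  proof (rule SUP_least)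
    fix \<epsilon>' :: real assume "\<epsilon>' \<in> {0<..}"
    then obtain \<epsilon> F1 \<delta>1 where \<epsilon>: "0 < \<epsilon>" and F1: "finite F1" "0 < \<delta>1"
      and comp: "\<And>i \<phi> \<psi>. \<phi> \<in> Maps \<rho> F1 \<delta>1 i \<Longrightarrow> \<psi> \<in> Maps \<rho> F1 \<delta>1 i \<Longrightarrow> rho_2 \<rho> (d i) \<phi> \<psi> \<le> 2 * \<epsilon> \<Longrightarrow> rho_2 \<rho>' (d i) \<phi> \<psi> \<le> \<epsilon>'"
      using rho_2_compare[OF gen \<rho>'] by (metis greaterThan_iff)
    have "(INF F\<in>{F. finite F}. INF \<delta>\<in>{0<..}. span_rate \<rho>' \<epsilon>' F \<delta>) \<le> (INF F\<in>{F. finite F}. INF \<delta>\<in>{0<..}. span_rate \<rho> \<epsilon> F \<delta>)"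
    proof (intro INF_greatest)
      fix F :: "'g set" and \<delta> :: real assume F: "F \<in> {F. finite F}" and \<delta>: "\<delta> \<in> {0<..}"
      obtain F' \<delta>' where F': "finite F'" "0 < \<delta>'"
        and sub: "\<forall>\<^sub>F i in sequentially. Maps \<rho>' F' \<delta>' i \<subseteq> Maps \<rho> (F \<union> F1) (min \<delta> \<delta>1) i"
        using Maps_subset[OF gen' \<rho>, of "F \<union> F1" "min \<delta> \<delta>1"] F \<delta> F1 by auto
      have "span_rate \<rho>' \<epsilon>' F' \<delta>' \<le> span_rate \<rho> \<epsilon> F \<delta>"
      proof (rule Limsup_mono, use sub in eventually_elim)
        case (elim i)
        have s1: "Maps \<rho>' F' \<delta>' i \<subseteq> Maps \<rho> F \<delta> i" and s2: "Maps \<rho>' F' \<delta>' i \<subseteq> Maps \<rho> F1 \<delta>1 i"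
          using elim Maps_mono[of F "F \<union> F1" "min \<delta> \<delta>1" \<delta> \<rho> i] Maps_mono[of F1 "F \<union> F1" "min \<delta> \<delta>1" \<delta>1 \<rho> i]
          by auto
        have "span_num \<epsilon>' (Maps \<rho>' F' \<delta>' i) (rho_2 \<rho>' (d i)) \<le> span_num \<epsilon> (Maps \<rho> F \<delta> i) (rho_2 \<rho> (d i))"
        proof (rule span_num_transfer[OF s1])
          show "rho_2 \<rho> (d i) x z \<le> rho_2 \<rho> (d i) x y + rho_2 \<rho> (d i) z y"
            if "x \<in> Maps \<rho> F \<delta> i" "y \<in> Maps \<rho> F \<delta> i" "z \<in> Maps \<rho> F \<delta> i" for x y z
            using rho_2_triangle[OF \<rho> that] .
          show "rho_2 \<rho>' (d i) y y' \<le> \<epsilon>'" if "y \<in> Maps \<rho>' F' \<delta>' i" "y' \<in> Maps \<rho>' F' \<delta>' i" "rho_2 \<rho> (d i) y y' \<le> 2 * \<epsilon>" for y y'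
            using comp s2 that by blast
        qed
        then show ?case by (rule normalized_log_mono)
      qed
      then show "(INF F\<in>{F. finite F}. INF \<delta>\<in>{0<..}. span_rate \<rho>' \<epsilon>' F \<delta>) \<le> span_rate \<rho> \<epsilon> F \<delta>"
        using F' by (intro INF_lower2[of F'] INF_lower2[of \<delta>']) auto
    qed
    then show "(INF F\<in>{F. finite F}. INF \<delta>\<in>{0<..}. span_rate \<rho>' \<epsilon>' F \<delta>) \<le>
      (SUP \<epsilon>\<in>{0<..}. INF F\<in>{F. finite F}. INF \<delta>\<in>{0<..}. span_rate \<rho> \<epsilon> F \<delta>)"
      using \<epsilon> by (intro SUP_upper2[of \<epsilon>]) auto
  qed
qed

lemma entropy_eq:
  assumes "dynamically_generating X T \<rho>"
  shows "sofic_entropy d \<sigma> X T = sofic_entropy_wrt d \<sigma> X T \<rho>"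
  unfolding sofic_entropy_def
  using entropy_le[OF assms] entropy_le[OF _ assms] someI[of "dynamically_generating X T", OF assms]
  by (intro antisym) auto

lemma entropy_finiteI:
  assumes gen: "dynamically_generating X T \<rho>" and B: "0 \<le> B"
    and classes: "\<And>\<epsilon>. 0 < \<epsilon> \<Longrightarrow> \<exists>F \<delta>. finite F \<and> 0 < \<delta> \<and>
      (\<forall>\<^sub>F i in sequentially. \<exists>k. span_num \<epsilon> (Maps \<rho> F \<delta> i) (rho_2 \<rho> (d i)) \<le> enat k \<and> ln (real k) \<le> B * real (d i))"
  shows "sofic_entropy d \<sigma> X T < \<infinity>"
proof -
  have "sofic_entropy_wrt d \<sigma> X T \<rho> \<le> ereal B"
    unfolding sofic_entropy_wrt_def
  proof (rule SUP_least)
    fix \<epsilon> :: real assume "\<epsilon> \<in> {0<..}"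
    then obtain F \<delta> where F: "finite F" "0 < \<delta>" and
      ev: "\<forall>\<^sub>F i in sequentially. \<exists>k. span_num \<epsilon> (Maps \<rho> F \<delta> i) (rho_2 \<rho> (d i)) \<le> enat k \<and> ln (real k) \<le> B * real (d i)"
      using classes[of \<epsilon>] by auto
    have "span_rate \<rho> \<epsilon> F \<delta> \<le> ereal B"
      by (rule Limsup_bounded, use ev in eventually_elim) (use log_enat_le d_pos B in blast)
    then show "(INF F\<in>{F. finite F}. INF \<delta>\<in>{0<..}. span_rate \<rho> \<epsilon> F \<delta>) \<le> ereal B"
      using F by (intro INF_lower2[of F] INF_lower2[of \<delta>]) auto
  qed
  then show ?thesis unfolding entropy_eq[OF gen] by (rule order_le_less_trans) simp
qed

section \<open>Finite entropy forces zero metric mean dimension\<close>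

lemma rho_inf_less_iff: "\<epsilon> < rho_inf \<rho> (d i) \<phi> \<psi> \<longleftrightarrow> (\<exists>j\<in>{1..d i}. \<epsilon> < \<rho> (\<phi> j) (\<psi> j))"
  unfolding rho_inf_def using d_pos[of i] by (subst Max_gr_iff) auto

text \<open>
  A separated family is encoded injectively. A map is close to an element \<open>a\<close> of the spanning set
  \<open>A\<close> in quadratic mean, hence \<open>\<epsilon>/2\<close>-close to \<open>a\<close> outside an exceptional set of at most \<open>\<kappa> d\<close>
  points. Recorded are \<open>a\<close>, the exceptional set and the cells of a finite net that contain the
  values there.
\<close>

lemma sep_num_le_span:
  assumes \<rho>: "continuous_pseudometric X \<rho>" and \<epsilon>: "0 < \<epsilon>" and \<kappa>: "0 < \<kappa>"
    and cl: "finite C" "\<And>x. x \<in> topspace X \<Longrightarrow> cl x \<in> C"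
      "\<And>x y. x \<in> topspace X \<Longrightarrow> y \<in> topspace X \<Longrightarrow> cl x = cl y \<Longrightarrow> \<rho> x y < \<epsilon>"
    and A: "finite A" "A \<subseteq> Maps \<rho> F \<delta> i"
      "\<And>\<phi>. \<phi> \<in> Maps \<rho> F \<delta> i \<Longrightarrow> \<exists>a\<in>A. rho_2 \<rho> (d i) \<phi> a \<le> \<epsilon> / 2 * sqrt \<kappa>"
  shows "sep_num \<epsilon> (Maps \<rho> F \<delta> i) (rho_inf \<rho> (d i)) \<le> enat (card A * (2 ^ d i * (card C + 1) ^ nat \<lfloor>\<kappa> * real (d i)\<rfloor>))"
  unfolding sep_num_def
proof (rule SUP_least)
  fix S assume "S \<in> {S. finite S \<and> S \<subseteq> Maps \<rho> F \<delta> i \<and> (\<forall>a\<in>S. \<forall>b\<in>S. a \<noteq> b \<longrightarrow> \<epsilon> < rho_inf \<rho> (d i) a b)}"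
  then have S: "finite S" "S \<subseteq> Maps \<rho> F \<delta> i" "\<And>a b. a \<in> S \<Longrightarrow> b \<in> S \<Longrightarrow> a \<noteq> b \<Longrightarrow> \<epsilon> < rho_inf \<rho> (d i) a b" by auto
  have tri: "\<And>x y z. x \<in> topspace X \<Longrightarrow> y \<in> topspace X \<Longrightarrow> z \<in> topspace X \<Longrightarrow> \<rho> x z \<le> \<rho> x y + \<rho> y z"
    and sym: "\<And>x y. x \<in> topspace X \<Longrightarrow> y \<in> topspace X \<Longrightarrow> \<rho> x y = \<rho> y x"
    using \<rho> by (auto simp: continuous_pseudometric_def)
  let ?I = "{1..d i}" and ?q = "nat \<lfloor>\<kappa> * real (d i)\<rfloor>"
  obtain c where c: "\<And>\<phi>. \<phi> \<in> Maps \<rho> F \<delta> i \<Longrightarrow> c \<phi> \<in> A \<and> rho_2 \<rho> (d i) \<phi> (c \<phi>) \<le> \<epsilon> / 2 * sqrt \<kappa>"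
    using A(3) by metis
  define bad where "bad \<phi> = {j\<in>?I. \<epsilon> / 2 < \<rho> (\<phi> j) (c \<phi> j)}" for \<phi>
  have card_bad: "card (bad \<phi>) \<le> ?q" if \<phi>: "\<phi> \<in> Maps \<rho> F \<delta> i" for \<phi>
  proof -
    have nn: "0 \<le> rho_2 \<rho> (d i) \<phi> (c \<phi>)" unfolding rho_2_qmean by (rule qmean_nonneg)
    have "real (card (bad \<phi>)) * (\<epsilon> / 2)\<^sup>2 = (\<Sum>j\<in>bad \<phi>. (\<epsilon> / 2)\<^sup>2)" by simp
    also have "\<dots> \<le> (\<Sum>j\<in>bad \<phi>. (\<rho> (\<phi> j) (c \<phi> j))\<^sup>2)"
      using \<epsilon> by (intro sum_mono power_mono) (auto simp: bad_def)
    also have "\<dots> \<le> (\<Sum>j\<in>?I. (\<rho> (\<phi> j) (c \<phi> j))\<^sup>2)"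
      by (intro sum_mono2) (auto simp: bad_def)
    also have "\<dots> = real (d i) * (rho_2 \<rho> (d i) \<phi> (c \<phi>))\<^sup>2"
      unfolding rho_2_qmean by (rule qmean_sq[OF d_pos])
    also have "\<dots> \<le> real (d i) * (\<epsilon> / 2 * sqrt \<kappa>)\<^sup>2"
      using c[OF \<phi>] nn by (intro mult_left_mono power_mono) auto
    also have "(\<epsilon> / 2 * sqrt \<kappa>)\<^sup>2 = (\<epsilon> / 2)\<^sup>2 * \<kappa>"
      using \<kappa> by (simp only: power_mult_distrib real_sqrt_pow2 less_imp_le)
    also have "real (d i) * ((\<epsilon> / 2)\<^sup>2 * \<kappa>) = (\<kappa> * real (d i)) * (\<epsilon> / 2)\<^sup>2" by (simp only: mult_ac)
    finally have "real (card (bad \<phi>)) \<le> \<kappa> * real (d i)" using \<epsilon> by simp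
    then show ?thesis by (simp add: le_nat_iff le_floor_iff)
  qed
  let ?\<B> = "{B. B \<subseteq> ?I \<and> card B \<le> ?q}"
  let ?W = "SIGMA B:?\<B>. B \<rightarrow>\<^sub>E C"
  define key where "key \<phi> = (c \<phi>, (bad \<phi>, restrict (\<lambda>j. cl (\<phi> j)) (bad \<phi>)))" for \<phi>
  have fin\<B>: "finite ?\<B>" by (rule finite_subset[of _ "Pow ?I"]) auto
  have fB: "finite B" if "B \<in> ?\<B>" for B using that finite_subset[of B ?I] by auto
  have finW: "finite ?W"
    using cl(1) by (intro finite_SigmaI fin\<B> finite_PiE fB)
  have "card ?W = (\<Sum>B\<in>?\<B>. card (B \<rightarrow>\<^sub>E C))"
    using cl(1) by (intro card_SigmaI fin\<B> ballI finite_PiE fB)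
  also have "\<dots> \<le> (\<Sum>B\<in>?\<B>. (card C + 1) ^ ?q)"
  proof (rule sum_mono)
    fix B assume B: "B \<in> ?\<B>"
    then have "finite B" by (rule fB)
    then have "card (B \<rightarrow>\<^sub>E C) = card C ^ card B" by (simp add: card_PiE)
    also have "\<dots> \<le> (card C + 1) ^ card B" by (intro power_mono) auto
    also have "\<dots> \<le> (card C + 1) ^ ?q" using B by (intro power_increasing) auto
    finally show "card (B \<rightarrow>\<^sub>E C) \<le> (card C + 1) ^ ?q" .
  qed
  also have "\<dots> \<le> 2 ^ d i * (card C + 1) ^ ?q"
  proof -
    have "card ?\<B> \<le> card (Pow ?I)" by (intro card_mono) auto
    then show ?thesis by (simp add: card_Pow)
  qed
  finally have cardW: "card ?W \<le> 2 ^ d i * (card C + 1) ^ ?q" .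
  have "inj_on key S"
  proof (rule inj_onI, rule ccontr)
    fix \<phi> \<psi> assume *: "\<phi> \<in> S" "\<psi> \<in> S" "key \<phi> = key \<psi>" "\<phi> \<noteq> \<psi>"
    then have M: "\<phi> \<in> Maps \<rho> F \<delta> i" "\<psi> \<in> Maps \<rho> F \<delta> i" using S(2) by auto
    obtain j where j: "j \<in> ?I" "\<epsilon> < \<rho> (\<phi> j) (\<psi> j)" using S(3)[OF *(1,2,4)] rho_inf_less_iff by blast
    have X: "\<phi> j \<in> topspace X" "\<psi> j \<in> topspace X" "c \<phi> j \<in> topspace X"
      using Maps_in[OF M(1) j(1)] Maps_in[OF M(2) j(1)] c[OF M(1)] A(2) Maps_in[OF _ j(1)] by blast+
    have key: "c \<phi> = c \<psi>" "bad \<phi> = bad \<psi>" "\<And>j. j \<in> bad \<phi> \<Longrightarrow> cl (\<phi> j) = cl (\<psi> j)"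
      using *(3) unfolding key_def by (auto dest: fun_cong simp: restrict_def split: if_splits)
    show False
    proof (cases "j \<in> bad \<phi>")
      case True
      then have "\<rho> (\<phi> j) (\<psi> j) < \<epsilon>" using key(3) cl(3) X by blast
      then show False using j(2) by simp
    next
      case False
      then have nb: "j \<notin> bad \<phi>" "j \<notin> bad \<psi>" unfolding key(2) by auto
      have "\<rho> (\<phi> j) (c \<phi> j) \<le> \<epsilon> / 2" using nb(1) j(1) by (simp add: bad_def)
      moreover have "\<rho> (\<psi> j) (c \<phi> j) \<le> \<epsilon> / 2" unfolding key(1) using nb(2) j(1) by (simp add: bad_def)
      moreover have "\<rho> (\<phi> j) (\<psi> j) \<le> \<rho> (\<phi> j) (c \<phi> j) + \<rho> (c \<phi> j) (\<psi> j)" "\<rho> (c \<phi> j) (\<psi> j) = \<rho> (\<psi> j) (c \<phi> j)"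
        using tri[OF X(1,3,2)] sym[OF X(3,2)] .
      ultimately show False using j(2) by linarith
    qed
  qed
  then have "card S = card (key ` S)" by (simp add: card_image)
  also have "\<dots> \<le> card (A \<times> ?W)"
  proof (rule card_mono)
    show "key ` S \<subseteq> A \<times> ?W"
    proof
      fix k assume "k \<in> key ` S"
      then obtain \<phi> where \<phi>: "\<phi> \<in> S" "k = key \<phi>" by blast
      then have M: "\<phi> \<in> Maps \<rho> F \<delta> i" using S(2) by auto
      show "k \<in> A \<times> ?W"
        using c[OF M] card_bad[OF M] Maps_in[OF M] cl(2) unfolding \<phi>(2) key_def by (auto simp: bad_def)
    qed
  qed (use A finW in auto)
  also have "\<dots> \<le> card A * (2 ^ d i * (card C + 1) ^ ?q)"
    unfolding card_cartesian_product by (intro mult_left_mono cardW) auto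
  finally show "enat (card S) \<le> enat (card A * (2 ^ d i * (card C + 1) ^ ?q))" by simp
qed

text \<open>
  The bound does not depend on \<open>\<epsilon>\<close>, although the net \<open>C\<close> does: \<open>\<kappa>\<close> is chosen after \<open>C\<close>, and the
  entropy bounds the spanning sets at every scale by the same rate.
\<close>

lemma sep_rate_bounded:
  assumes \<rho>: "continuous_pseudometric X \<rho>" and ent: "sofic_entropy_wrt d \<sigma> X T \<rho> \<le> ereal B" and B: "0 \<le> B"
    and \<epsilon>: "0 < \<epsilon>"
  shows "(INF F\<in>{F. finite F}. INF \<delta>\<in>{0<..}. sep_rate \<rho> \<epsilon> F \<delta>) \<le> ereal (B + 3)"
proof -
  obtain C :: "'x set" and cl where cl: "finite C" "\<And>x. x \<in> topspace X \<Longrightarrow> cl x \<in> C"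
    "\<And>x y. x \<in> topspace X \<Longrightarrow> y \<in> topspace X \<Longrightarrow> cl x = cl y \<Longrightarrow> \<rho> x y < \<epsilon>"
    by (rule finite_net[OF \<rho> \<epsilon>]) (rule that)
  define L where "L = ln (real (card C + 1))"
  \<comment> \<open>so few exceptional points that recording the values there costs at most \<open>1\<close> per point of the model\<close>
  define \<kappa> where "\<kappa> = 1 / (L + 1)"
  have lnC: "0 \<le> L" by (simp add: L_def)
  then have \<kappa>: "0 < \<kappa>" "\<kappa> * L \<le> 1" by (simp_all add: \<kappa>_def pos_divide_le_eq add_nonneg_pos)
  define e where "e = \<epsilon> / 2 * sqrt \<kappa>"
  have e: "0 < e" using \<epsilon> \<kappa>(1) by (simp add: e_def)
  have "(INF F\<in>{F. finite F}. INF \<delta>\<in>{0<..}. span_rate \<rho> e F \<delta>) \<le> ereal B"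
    by (rule order_trans[OF SUP_upper ent[unfolded sofic_entropy_wrt_def]]) (use e in simp)
  then have "(INF F\<in>{F. finite F}. INF \<delta>\<in>{0<..}. span_rate \<rho> e F \<delta>) < ereal (B + 1)"
    by (rule order_le_less_trans) simp
  then obtain F \<delta> where F: "finite F" "0 < \<delta>" and less: "span_rate \<rho> e F \<delta> < ereal (B + 1)"
    unfolding INF_less_iff by auto
  have "sep_rate \<rho> \<epsilon> F \<delta> \<le> ereal (B + 3)"
  proof (rule Limsup_bounded, use Limsup_lessD[OF less] in eventually_elim)
    case (elim i)
    have "span_num e (Maps \<rho> F \<delta> i) (rho_2 \<rho> (d i)) \<noteq> \<infinity>"
    proof
      assume "span_num e (Maps \<rho> F \<delta> i) (rho_2 \<rho> (d i)) = \<infinity>"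
      with elim d_pos[of i] show False by simp
    qed
    then obtain k where k: "span_num e (Maps \<rho> F \<delta> i) (rho_2 \<rho> (d i)) = enat k" by blast
    obtain A where A: "finite A" "A \<subseteq> Maps \<rho> F \<delta> i"
      "\<And>\<phi>. \<phi> \<in> Maps \<rho> F \<delta> i \<Longrightarrow> \<exists>a\<in>A. rho_2 \<rho> (d i) \<phi> a \<le> e" "card A = k"
      by (rule span_num_attained[OF k]) (rule that)
    let ?q = "nat \<lfloor>\<kappa> * real (d i)\<rfloor>"
    let ?N = "k * (2 ^ d i * (card C + 1) ^ ?q)"
    have sep: "sep_num \<epsilon> (Maps \<rho> F \<delta> i) (rho_inf \<rho> (d i)) \<le> enat ?N"
      using sep_num_le_span[OF \<rho> \<epsilon> \<kappa>(1) cl A(1,2) A(3)[unfolded e_def]] unfolding A(4) .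
    have "ln (real ?N) \<le> (B + 3) * real (d i)"
    proof (cases "k = 0")
      case True
      then show ?thesis using B by simp
    next
      case False
      have "ereal (1 / real (d i)) * ereal (ln (real k)) < ereal (B + 1)" using elim k False by simp
      then have 1: "ln (real k) \<le> (B + 1) * real (d i)" using d_pos[of i] by (simp add: field_simps)
      have 2: "real (d i) * ln 2 \<le> real (d i)" using ln_2_less_1 by (simp add: mult_left_le)
      have "real ?q \<le> \<kappa> * real (d i)" using \<kappa>(1) by simp
      then have "real ?q * L \<le> \<kappa> * real (d i) * L"
        using lnC by (rule mult_right_mono)
      also have "\<dots> = real (d i) * (\<kappa> * L)" by simp
      also have "\<dots> \<le> real (d i)" using \<kappa>(2) by (simp add: mult_left_le)
      finally have 3: "real ?q * L \<le> real (d i)" .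
      have "real ?N = real k * (2 ^ d i * real (card C + 1) ^ ?q)" by simp
      moreover have "ln (real k * (2 ^ d i * real (card C + 1) ^ ?q)) = ln (real k) + (ln (2 ^ d i) + ln (real (card C + 1) ^ ?q))"
        using False by (subst ln_mult_pos, simp, simp, subst ln_mult_pos) simp_all
      moreover have "ln (2 ^ d i :: real) = real (d i) * ln 2" "ln (real (card C + 1) ^ ?q) = real ?q * L"
        by (simp_all only: ln_realpow L_def zero_less_numeral of_nat_0_less_iff zero_less_Suc Suc_eq_plus1[symmetric])
      ultimately have "ln (real ?N) = ln (real k) + (real (d i) * ln 2 + real ?q * L)" by simp
      moreover have "(B + 3) * real (d i) = (B + 1) * real (d i) + (real (d i) + real (d i))"
        by (simp add: algebra_simps)
      ultimately show ?thesis using 1 2 3 by linarith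
    qed
    then show ?case using log_enat_le[OF d_pos sep] B by simp
  qed
  then show ?thesis using F by (intro INF_lower2[of F] INF_lower2[of \<delta>]) auto
qed

lemma ln_at_right_0: "filterlim (\<lambda>\<epsilon>. \<bar>ln \<epsilon>\<bar>) at_top (at_right (0 :: real))"
  using filterlim_compose[OF filterlim_abs_real filterlim_uminus_at_top_at_bot[THEN filterlim_compose, OF ln_at_0]]
  by simp

lemma metric_mdim_le_0:
  assumes \<rho>: "continuous_pseudometric X \<rho>" and ent: "sofic_entropy_wrt d \<sigma> X T \<rho> < \<infinity>"
  shows "metric_mdim_wrt d \<sigma> X T \<rho> \<le> 0"
proof -
  obtain B where B: "0 \<le> B" "sofic_entropy_wrt d \<sigma> X T \<rho> \<le> ereal B"
  proof (cases "sofic_entropy_wrt d \<sigma> X T \<rho>")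
    case (real r)
    then show ?thesis using that[of "max 0 r"] by simp
  qed (use ent that[of 0] in auto)
  have lim: "((\<lambda>\<epsilon>. ereal (1 / \<bar>ln \<epsilon>\<bar>) * ereal (B + 3)) \<longlongrightarrow> ereal 0) (at_right 0)"
  proof -
    have "((\<lambda>\<epsilon>. (B + 3) / \<bar>ln \<epsilon>\<bar>) \<longlongrightarrow> 0) (at_right 0)"
      by (rule real_tendsto_divide_at_top[OF tendsto_const ln_at_right_0])
    then show ?thesis by simp
  qed
  have "metric_mdim_wrt d \<sigma> X T \<rho> \<le> Liminf (at_right 0) (\<lambda>\<epsilon>. ereal (1 / \<bar>ln \<epsilon>\<bar>) * ereal (B + 3))"
    unfolding metric_mdim_wrt_def
  proof (rule Liminf_mono)
    have "\<forall>\<^sub>F \<epsilon> :: real in at_right 0. 0 < \<epsilon>" by (simp add: eventually_at_right_less)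
    then show "\<forall>\<^sub>F \<epsilon> in at_right 0. ereal (1 / \<bar>ln \<epsilon>\<bar>) * (INF F\<in>{F. finite F}. INF \<delta>\<in>{0<..}. sep_rate \<rho> \<epsilon> F \<delta>)
        \<le> ereal (1 / \<bar>ln \<epsilon>\<bar>) * ereal (B + 3)"
      by eventually_elim (intro ereal_mult_left_mono sep_rate_bounded[OF \<rho> B(2,1)], auto)
  qed
  also have "\<dots> = ereal 0" by (rule lim_imp_Liminf[OF _ lim]) simp
  finally show ?thesis by (simp add: zero_ereal_def)
qed

lemma sep_num_ge: "finite A \<Longrightarrow> A \<subseteq> Y \<Longrightarrow> (\<And>a b. a \<in> A \<Longrightarrow> b \<in> A \<Longrightarrow> a \<noteq> b \<Longrightarrow> \<epsilon> < th a b) \<Longrightarrow> enat (card A) \<le> sep_num \<epsilon> Y th"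
  unfolding sep_num_def by (rule SUP_upper) auto

lemma metric_mdim_nonneg:
  assumes "x0 \<in> topspace X" "\<And>g. T g x0 = x0" and comp: "compatible_metric X \<rho>"
  shows "0 \<le> metric_mdim_wrt d \<sigma> X T \<rho>"
proof -
  have \<rho>: "continuous_pseudometric X \<rho>" by (rule compatible_continuous[OF comp])
  have rate: "0 \<le> sep_rate \<rho> \<epsilon> F \<delta>" if "0 < \<delta>" for \<epsilon> F \<delta>
  proof (rule le_Limsup[OF _ always_eventually], simp, rule allI)
    fix i
    let ?\<phi> = "\<lambda>j. if j \<in> {1..d i} then x0 else undefined"
    have "rho_2 \<rho> (d i) (?\<phi> \<circ> \<sigma> i g) (\<lambda>j. T g (?\<phi> j)) = 0" for g
    proof -
      have "\<rho> ((?\<phi> \<circ> \<sigma> i g) j) (T g (?\<phi> j)) = 0" if "j \<in> {1..d i}" for j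
        using that sigma_in[OF that] assms \<rho> by (simp add: continuous_pseudometric_def)
      then show ?thesis by (simp add: rho_2_def)
    qed
    then have "?\<phi> \<in> Maps \<rho> F \<delta> i" using assms that by (auto simp: Map_set_def)
    then have "enat 1 \<le> sep_num \<epsilon> (Maps \<rho> F \<delta> i) (rho_inf \<rho> (d i))"
      using sep_num_ge[of "{?\<phi>}"] by (simp add: one_enat_def)
    from log_enat_ge[OF d_pos this, of 0 i] show "0 \<le> ereal (1 / real (d i)) * log_enat (sep_num \<epsilon> (Maps \<rho> F \<delta> i) (rho_inf \<rho> (d i)))"
      by (simp add: zero_ereal_def)
  qed
  have "0 \<le> ereal (1 / \<bar>ln \<epsilon>\<bar>) * (INF F\<in>{F. finite F}. INF \<delta>\<in>{0<..}. sep_rate \<rho> \<epsilon> F \<delta>)" for \<epsilon>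
    by (intro ereal_0_le_mult INF_greatest rate) auto
  then show ?thesis
    unfolding metric_mdim_wrt_def by (intro Liminf_bounded always_eventually allI)
qed

text \<open>
  Half of the constant absorbs \<open>D\<close>, which is small against \<open>|ln \<epsilon>|\<close>.
\<close>

lemma metric_mdim_ge:
  assumes c: "0 < c" and \<epsilon>0: "0 < \<epsilon>0"
    and many: "\<And>\<epsilon> F \<delta>. 0 < \<epsilon> \<Longrightarrow> \<epsilon> < \<epsilon>0 \<Longrightarrow> finite F \<Longrightarrow> 0 < \<delta> \<Longrightarrow> \<forall>\<^sub>F i in sequentially.
      \<exists>A. finite A \<and> A \<noteq> {} \<and> A \<subseteq> Maps \<rho> F \<delta> i \<and> (\<forall>a\<in>A. \<forall>b\<in>A. a \<noteq> b \<longrightarrow> (\<exists>j\<in>{1..d i}. \<epsilon> < \<rho> (a j) (b j))) \<and>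
        (c * \<bar>ln \<epsilon>\<bar> - D) * real (d i) \<le> ln (real (card A))"
  shows "ereal (c / 2) \<le> metric_mdim_wrt d \<sigma> X T \<rho>"
  unfolding metric_mdim_wrt_def
proof (rule Liminf_bounded)
  have 1: "\<forall>\<^sub>F \<epsilon> in at_right 0. max 1 (2 * D / c) \<le> \<bar>ln \<epsilon>\<bar>"
    using ln_at_right_0 unfolding filterlim_at_top by blast
  have 2: "\<forall>\<^sub>F \<epsilon> :: real in at_right 0. 0 < \<epsilon> \<and> \<epsilon> < \<epsilon>0"
    using eventually_at_right_less[of 0] eventually_at_right_real[OF \<epsilon>0] by eventually_elim auto
  from 1 2 show "\<forall>\<^sub>F \<epsilon> in at_right 0. ereal (c / 2) \<le> ereal (1 / \<bar>ln \<epsilon>\<bar>) * (INF F\<in>{F. finite F}. INF \<delta>\<in>{0<..}. sep_rate \<rho> \<epsilon> F \<delta>)"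
  proof eventually_elim
    case (elim \<epsilon>)
    let ?b = "c * \<bar>ln \<epsilon>\<bar> - D"
    have "ereal ?b \<le> sep_rate \<rho> \<epsilon> F \<delta>" if "finite F" "0 < \<delta>" for F \<delta>
    proof (rule le_Limsup)
      have "0 < \<epsilon>" "\<epsilon> < \<epsilon>0" using elim by auto
      from many[OF this that]
      show "\<forall>\<^sub>F i in sequentially. ereal ?b \<le> ereal (1 / real (d i)) * log_enat (sep_num \<epsilon> (Maps \<rho> F \<delta> i) (rho_inf \<rho> (d i)))"
      proof eventually_elim
        case (elim i)
        then obtain A where A: "finite A" "A \<noteq> {}" "A \<subseteq> Maps \<rho> F \<delta> i"
          "\<forall>a\<in>A. \<forall>b\<in>A. a \<noteq> b \<longrightarrow> (\<exists>j\<in>{1..d i}. \<epsilon> < \<rho> (a j) (b j))"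
          "?b * real (d i) \<le> ln (real (card A))" by (elim exE conjE) (rule that)
        have "enat (card A) \<le> sep_num \<epsilon> (Maps \<rho> F \<delta> i) (rho_inf \<rho> (d i))"
          using A(1,3,4) by (intro sep_num_ge) (auto simp only: rho_inf_less_iff)
        from log_enat_ge[OF d_pos this _ A(5)] A(1,2) show ?case by (simp add: card_gt_0_iff)
      qed
    qed simp
    then have "ereal ?b \<le> (INF F\<in>{F. finite F}. INF \<delta>\<in>{0<..}. sep_rate \<rho> \<epsilon> F \<delta>)"
      by (intro INF_greatest) auto
    then have "ereal (1 / \<bar>ln \<epsilon>\<bar>) * ereal ?b \<le> ereal (1 / \<bar>ln \<epsilon>\<bar>) * (INF F\<in>{F. finite F}. INF \<delta>\<in>{0<..}. sep_rate \<rho> \<epsilon> F \<delta>)"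
      by (intro ereal_mult_left_mono) auto
    moreover have "ereal (c / 2) \<le> ereal (1 / \<bar>ln \<epsilon>\<bar>) * ereal ?b"
    proof -
      have 1: "0 < \<bar>ln \<epsilon>\<bar>" "2 * D / c \<le> \<bar>ln \<epsilon>\<bar>" using elim by auto
      from 1(2) c have 2: "2 * D \<le> c * \<bar>ln \<epsilon>\<bar>" by (simp add: pos_divide_le_eq mult.commute)
      have "c / 2 * \<bar>ln \<epsilon>\<bar> \<le> ?b" using 2 by simp
      then have "c / 2 \<le> ?b / \<bar>ln \<epsilon>\<bar>" using 1(1) by (simp only: pos_le_divide_eq)
      then show ?thesis by simp
    qed
    ultimately show ?case by (rule order_trans[rotated])
  qed
qed

end

section \<open>Modules over the group ring and their dual systems\<close>

lift_definition imul :: "int \<Rightarrow> rmodz \<Rightarrow> rmodz" is "\<lambda>k r. of_int k * r"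
proof -
  fix k :: int and x y :: real assume "x - y \<in> \<int>"
  then have "of_int k * (x - y) \<in> \<int>" by (intro Ints_mult) auto
  then show "of_int k * x - of_int k * y \<in> \<int>" by (simp add: right_diff_distrib)
qed

lemma imul_abs: "imul k (abs_rmodz r) = abs_rmodz (of_int k * r)"
  by (rule imul.abs_eq)

lemma imul_add_left: "imul (j + k) x = imul j x + imul k x"
  by (rule rmodz_cases[of x]) (simp add: imul_abs distrib_right abs_rmodz_add)

lemma imul_diff_left: "imul (j - k) x = imul j x - imul k x"
  by (rule rmodz_cases[of x]) (simp add: imul_abs left_diff_distrib abs_rmodz_diff)

lemma imul_0_left [simp]: "imul 0 x = 0"
  by (rule rmodz_cases[of x]) (simp add: imul_abs)

lemma imul_1_left [simp]: "imul 1 x = x"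
  by (rule rmodz_cases[of x]) (simp add: imul_abs)

lemma imul_diff_right: "imul k (x - y) = imul k x - imul k y"
  by (rule rmodz_cases[of x], rule rmodz_cases[of y])
     (simp add: imul_abs right_diff_distrib flip: abs_rmodz_diff)

lemma circ_imul: "circ (imul k x) \<le> \<bar>of_int k\<bar> * circ x"
proof -
  obtain r where "x = abs_rmodz r" "\<bar>r\<bar> = circ x" by (rule circ_attained)
  then show ?thesis using circ_abs_le'[of "of_int k * r"] by (simp add: imul_abs abs_mult)
qed

lemma additive_int:
  fixes h :: "int \<Rightarrow> rmodz"
  assumes "\<And>j k. h (j + k) = h j + h k"
  shows "h k = imul k (h 1)"
proof -
  have h0: "h 0 = 0" using assms[of 0 0] by simp
  show ?thesis
  proof (induction k rule: int_induct[of _ 0])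
    case base
    then show ?case by (simp add: h0)
  next
    case (step1 k)
    then show ?case by (simp add: assms imul_add_left)
  next
    case (step2 k)
    have "h k = h (k - 1) + h 1" using assms[of "k - 1" 1] by simp
    then have "h (k - 1) = h k - h 1" by simp
    then show ?case using step2 by (simp add: imul_diff_left)
  qed
qed

lemma additive_sum:
  assumes "Modules.additive (u :: 'a::ab_group_add \<Rightarrow> rmodz)"
  shows "u (\<Sum>i\<in>A. x i) = (\<Sum>i\<in>A. u (x i))"
  using additive.sum[OF assms] by simp

locale dual_system = sofic_model d \<sigma> + left_module smul
  for d and \<sigma> :: "nat \<Rightarrow> 'g::{group_add, countable} \<Rightarrow> nat \<Rightarrow> nat"
    and smul :: "('g \<Rightarrow>\<^sub>0 int) \<Rightarrow> 'a::ab_group_add \<Rightarrow> 'a" +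
  fixes n :: nat and gen :: "nat \<Rightarrow> 'a"
  assumes generated: "\<exists>c. x = (\<Sum>s<n. smul (c s) (gen s))"
begin

abbreviation "X \<equiv> (dual_topology :: ('a \<Rightarrow> rmodz) topology)"
abbreviation "T \<equiv> dual_act smul"
abbreviation el :: "'g \<Rightarrow> 'g \<Rightarrow>\<^sub>0 int" where "el g \<equiv> Poly_Mapping.single g 1"

lemma smul_0_left [simp]: "smul 0 x = 0"
  using scale_left_distrib[of 0 0 x] by simp

lemma smul_0_right [simp]: "smul r 0 = 0"
  using scale_right_distrib[of r 0 0] by simp

lemma smul_diff_left: "smul (r - r') x = smul r x - smul r' x"
  using scale_left_distrib[of "r - r'" r' x] by simp

lemma smul_sum_left: "smul (\<Sum>i\<in>A. r i) x = (\<Sum>i\<in>A. smul (r i) x)"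
  by (induction A rule: infinite_finite_induct) (auto simp: scale_left_distrib)

lemma additive_smul:
  assumes u: "Modules.additive (u :: 'a \<Rightarrow> rmodz)"
  shows "u (smul r x) = (\<Sum>g\<in>Poly_Mapping.keys r. imul (Poly_Mapping.lookup r g) (u (smul (el g) x)))"
proof -
  have r: "r = (\<Sum>g\<in>Poly_Mapping.keys r. Poly_Mapping.single g (Poly_Mapping.lookup r g))"
  proof (rule poly_mapping_eqI)
    fix k
    have "Poly_Mapping.lookup (\<Sum>g\<in>Poly_Mapping.keys r. Poly_Mapping.single g (Poly_Mapping.lookup r g)) k =
      (\<Sum>g\<in>Poly_Mapping.keys r. if g = k then Poly_Mapping.lookup r g else 0)"
      by (simp add: Poly_Mapping.lookup_sum lookup_single when_def)
    then show "Poly_Mapping.lookup r k = Poly_Mapping.lookup (\<Sum>g\<in>Poly_Mapping.keys r. Poly_Mapping.single g (Poly_Mapping.lookup r g)) k"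
      by (simp add: in_keys_iff)
  qed
  have mono: "u (smul (Poly_Mapping.single g k) x) = imul k (u (smul (el g) x))" for g k
    by (rule additive_int[of "\<lambda>k. u (smul (Poly_Mapping.single g k) x)"])
       (simp add: single_add scale_left_distrib additive.add[OF u])
  have "u (smul r x) = u (smul (\<Sum>g\<in>Poly_Mapping.keys r. Poly_Mapping.single g (Poly_Mapping.lookup r g)) x)"
    by (simp only: r[symmetric])
  also have "\<dots> = (\<Sum>g\<in>Poly_Mapping.keys r. imul (Poly_Mapping.lookup r g) (u (smul (el g) x)))"
    unfolding smul_sum_left additive_sum[OF u] by (intro sum.cong refl mono)
  finally show ?thesis .
qed

lemma T_apply: "T g u x = u (smul (el (- g)) x)"
  by (simp add: dual_act_def)

lemma T_additive:
  assumes "Modules.additive (u :: 'a \<Rightarrow> rmodz)"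
  shows "Modules.additive (T g u)"
  using additive.add[OF assms] by (intro additive.intro) (simp add: T_apply scale_right_distrib)

lemma smul_el: "smul (el g) (smul (el h) x) = smul (el (g + h)) x"
  by (simp add: scale_scale mult_single)

lemma smul_el_0 [simp]: "smul (el 0) x = x"
  using scale_one[of x] by simp

sublocale sofic_system d \<sigma> X T
proof
  show "compact_space X" by (rule compact_dual)
  show "continuous_map X X (T g)" for g
  proof -
    have "continuous_on {u. Modules.additive u} (\<lambda>u :: 'a \<Rightarrow> rmodz. T g u)"
      unfolding dual_act_def
      by (intro continuous_on_coordinatewise_then_product continuous_on_subset[OF continuous_on_product_coordinates]) auto
    then show ?thesis
      unfolding dual_topology_def using T_additive by (auto simp: image_subset_iff)
  qed
  show "T (g + h) u = T g (T h u)" for g h u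
    by (simp add: fun_eq_iff T_apply smul_el minus_add)
  show "T 0 u = u" for u
    by (simp add: fun_eq_iff T_apply scale_one)
qed

lemma prod_X: "prod_topology X X = top_of_set ({u. Modules.additive u} \<times> {u. Modules.additive u})"
  by (simp add: dual_topology_def subtopology_Times prod_topology_subtopology_eu)

lemma continuous_on_fst_apply: "continuous_on A (\<lambda>z :: ('a \<Rightarrow> rmodz) \<times> ('a \<Rightarrow> rmodz). fst z x)"
  by (rule continuous_on_compose2[OF continuous_on_product_coordinates[of x] continuous_on_fst[OF continuous_on_id]]) auto

lemma continuous_on_snd_apply: "continuous_on A (\<lambda>z :: ('a \<Rightarrow> rmodz) \<times> ('a \<Rightarrow> rmodz). snd z x)"
  by (rule continuous_on_compose2[OF continuous_on_product_coordinates[of x] continuous_on_snd[OF continuous_on_id]]) auto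

lemma continuous_eval_dist: "continuous_map (prod_topology X X) euclideanreal (\<lambda>(u, v). dist (u x) (v y))"
proof -
  have "continuous_on A (\<lambda>z :: ('a \<Rightarrow> rmodz) \<times> ('a \<Rightarrow> rmodz). dist (fst z x) (snd z y))" for A
    by (intro continuous_on_dist continuous_on_fst_apply continuous_on_snd_apply)
  then show ?thesis unfolding prod_X case_prod_unfold by simp
qed

text \<open>
  Only the generators themselves are compared; their translates, which separate characters, enter
  through the action.
\<close>

definition rho0 :: "('a \<Rightarrow> rmodz) \<Rightarrow> ('a \<Rightarrow> rmodz) \<Rightarrow> real" where
  "rho0 u v = L2_set (\<lambda>s. dist (u (gen s)) (v (gen s))) {..<n}"

lemma dist_le_rho0: "s < n \<Longrightarrow> dist (u (gen s)) (v (gen s)) \<le> rho0 u v"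
  unfolding rho0_def by (rule member_le_L2_set) auto

lemma continuous_rho0: "continuous_pseudometric X rho0"
  unfolding continuous_pseudometric_def
proof (intro conjI ballI)
  fix u v w
  show "0 \<le> rho0 u v" by (simp add: rho0_def)
  show "rho0 u u = 0" by (simp add: rho0_def L2_set_def)
  show "rho0 u v = rho0 v u" by (simp add: rho0_def dist_commute)
  have "rho0 u w \<le> L2_set (\<lambda>s. dist (u (gen s)) (v (gen s)) + dist (v (gen s)) (w (gen s))) {..<n}"
    unfolding rho0_def by (intro L2_set_mono dist_triangle) auto
  also have "\<dots> \<le> rho0 u v + rho0 v w"
    unfolding rho0_def by (rule L2_set_triangle_ineq)
  finally show "rho0 u w \<le> rho0 u v + rho0 v w" .
next
  have "continuous_on A (\<lambda>z :: ('a \<Rightarrow> rmodz) \<times> ('a \<Rightarrow> rmodz). sqrt (\<Sum>s<n. (dist (fst z (gen s)) (snd z (gen s)))\<^sup>2))" for A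
    by (intro continuous_on_real_sqrt continuous_on_sum continuous_on_power continuous_on_dist
        continuous_on_fst_apply continuous_on_snd_apply)
  then show "continuous_map (prod_topology X X) euclideanreal (\<lambda>(u, v). rho0 u v)"
    unfolding prod_X case_prod_unfold rho0_def L2_set_def by simp
qed

lemma characters_separated:
  assumes u: "u \<in> topspace X" and v: "v \<in> topspace X" and "u \<noteq> v"
  obtains s g where "s < n" "u (smul (el g) (gen s)) \<noteq> v (smul (el g) (gen s))"
proof -
  have u: "Modules.additive u" and v: "Modules.additive v" using u v by simp_all
  obtain x where x: "u x \<noteq> v x" using assms(3) by auto
  obtain c where c: "x = (\<Sum>s<n. smul (c s) (gen s))" using generated by blast
  have eq: "w x = (\<Sum>s<n. \<Sum>g\<in>Poly_Mapping.keys (c s). imul (Poly_Mapping.lookup (c s) g) (w (smul (el g) (gen s))))"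
    if "Modules.additive w" for w :: "'a \<Rightarrow> rmodz"
    unfolding c additive_sum[OF that] by (intro sum.cong refl additive_smul[OF that])
  show thesis
  proof (rule ccontr)
    assume "\<not> thesis"
    then have "\<And>s g. s < n \<Longrightarrow> u (smul (el g) (gen s)) = v (smul (el g) (gen s))" using that by blast
    then have "u x = v x" unfolding eq[OF u] eq[OF v] by (intro sum.cong refl) simp
    with x show False by simp
  qed
qed

text \<open>
  The translates of the generators generate the group \<open>A\<close>, so distinct characters differ on one of
  them.
\<close>

lemma generating_rho0: "dynamically_generating X T rho0"
  unfolding dynamically_generating_def
proof (intro conjI continuous_rho0 ballI impI)
  fix u v assume "u \<in> topspace X" "v \<in> topspace X" "u \<noteq> v"
  then obtain s g where s: "s < n" "u (smul (el g) (gen s)) \<noteq> v (smul (el g) (gen s))"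
    by (rule characters_separated)
  then have "0 < dist (T (- g) u (gen s)) (T (- g) v (gen s))" by (simp add: T_apply)
  also have "\<dots> \<le> rho0 (T (- g) u) (T (- g) v)" by (rule dist_le_rho0[OF s(1)])
  finally show "\<exists>g. 0 < rho0 (T g u) (T g v)" by blast
qed

end

section \<open>Relations with vanishing kernel dimension bound the entropy\<close>

definition rep01 :: "rmodz \<Rightarrow> real" where
  "rep01 x = (SOME r. x = abs_rmodz r \<and> 0 \<le> r \<and> r < 1)"

lemma rep01: "abs_rmodz (rep01 x) = x" "0 \<le> rep01 x" "rep01 x < 1"
proof -
  have "\<exists>r. x = abs_rmodz r \<and> 0 \<le> r \<and> r < 1" by (rule rmodz_cases[of x]) auto
  from someI_ex[OF this] show "abs_rmodz (rep01 x) = x" "0 \<le> rep01 x" "rep01 x < 1"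
    unfolding rep01_def by auto
qed

locale dual_relations = dual_system d \<sigma> smul n gen + sofic_matrix d \<sigma> m n f
  for d and \<sigma> :: "nat \<Rightarrow> 'g::{group_add, countable} \<Rightarrow> nat \<Rightarrow> nat"
    and smul :: "('g \<Rightarrow>\<^sub>0 int) \<Rightarrow> 'a::ab_group_add \<Rightarrow> 'a" and n gen m
    and f :: "nat \<Rightarrow> nat \<Rightarrow> ('g \<Rightarrow>\<^sub>0 int)" +
  assumes relation: "l < m \<Longrightarrow> (\<Sum>s<n. smul (f l s) (gen s)) = 0"
begin

lemma character_relation:
  assumes "u \<in> topspace X" "l < m"
  shows "(\<Sum>s<n. \<Sum>g\<in>Poly_Mapping.keys (f l s). imul (Poly_Mapping.lookup (f l s) g) (T (- g) u (gen s))) = 0"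
proof -
  have u: "Modules.additive u" using assms(1) by simp
  have "(\<Sum>s<n. \<Sum>g\<in>Poly_Mapping.keys (f l s). imul (Poly_Mapping.lookup (f l s) g) (T (- g) u (gen s))) =
      u (\<Sum>s<n. smul (f l s) (gen s))"
    by (simp add: additive_sum[OF u] additive_smul[OF u, of "f l _"] T_apply)
  also have "\<dots> = 0" by (simp add: relation[OF assms(2)] additive.zero[OF u])
  finally show ?thesis .
qed

text \<open>
  Real coordinates for a map into the dual, to which the operators of the finite model can be
  applied.
\<close>

definition lift :: "nat \<Rightarrow> (nat \<Rightarrow> 'a \<Rightarrow> rmodz) \<Rightarrow> (nat \<times> nat \<Rightarrow>\<^sub>0 real)" where
  "lift i \<phi> = (\<Sum>k\<in>I i. rep01 (\<phi> (snd k) (gen (fst k))) *\<^sub>R unit k)"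

lemma lookup_lift: "Poly_Mapping.lookup (lift i \<phi>) k = (if k \<in> I i then rep01 (\<phi> (snd k) (gen (fst k))) else 0)"
proof -
  have "Poly_Mapping.lookup (lift i \<phi>) k = (\<Sum>k'\<in>I i. if k' = k then rep01 (\<phi> (snd k) (gen (fst k))) else 0)"
    unfolding lift_def lookup_sum lookup_scaleR lookup_unit by (intro sum.cong) auto
  then show ?thesis by simp
qed

lemma keys_lift: "Poly_Mapping.keys (lift i \<phi>) \<subseteq> I i"
  by (auto simp: in_keys_iff lookup_lift split: if_splits)

lemma lookup_lift_bounds: "0 \<le> Poly_Mapping.lookup (lift i \<phi>) k \<and> Poly_Mapping.lookup (lift i \<phi>) k \<le> 1"
  using rep01(2,3) by (auto simp: lookup_lift intro: less_imp_le)

lemma MM_lift_bound: "\<bar>Poly_Mapping.lookup (MM i (lift i \<phi>)) (l, j)\<bar> \<le> mat_norm m n f"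
proof (cases "l < m")
  case True
  have "\<bar>Poly_Mapping.lookup (MM i (lift i \<phi>)) (l, j)\<bar> \<le>
    (\<Sum>s<n. \<Sum>g\<in>Poly_Mapping.keys (f l s). \<bar>of_int (Poly_Mapping.lookup (f l s) g)\<bar>)"
    unfolding inverse_family.lookup_mat_op[OF model_family] using True lookup_lift_bounds
    by (auto intro!: order_trans[OF sum_abs] sum_mono simp: abs_mult mult_left_le)
  also have "\<dots> \<le> mat_norm m n f"
    unfolding mat_norm_def using True
    by (intro member_le_sum[of l "{..<m}" "\<lambda>l. \<Sum>s<n. \<Sum>g\<in>Poly_Mapping.keys (f l s). \<bar>of_int (Poly_Mapping.lookup (f l s) g)\<bar>"])
       (auto intro!: sum_nonneg)
  finally show ?thesis .
qed (use mat_norm_nonneg in \<open>simp add: inverse_family.lookup_mat_op[OF model_family]\<close>)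

definition supp_inv :: "'g set" where
  "supp_inv = uminus ` (\<Union>l<m. \<Union>s<n. Poly_Mapping.keys (f l s))"

definition nearest :: "nat \<Rightarrow> (nat \<Rightarrow> 'a \<Rightarrow> rmodz) \<Rightarrow> (nat \<times> nat \<Rightarrow>\<^sub>0 real)" where
  "nearest i \<phi> = (\<Sum>k\<in>{..<m} \<times> {1..d i}. of_int (round (Poly_Mapping.lookup (MM i (lift i \<phi>)) k)) *\<^sub>R unit k)"

lemma lookup_nearest: "Poly_Mapping.lookup (nearest i \<phi>) k =
  (if k \<in> {..<m} \<times> {1..d i} then of_int (round (Poly_Mapping.lookup (MM i (lift i \<phi>)) k)) else 0)"
proof -
  have "Poly_Mapping.lookup (nearest i \<phi>) k = (\<Sum>k'\<in>{..<m} \<times> {1..d i}. if k' = k then of_int (round (Poly_Mapping.lookup (MM i (lift i \<phi>)) k)) else 0)"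
    unfolding nearest_def lookup_sum lookup_scaleR lookup_unit by (intro sum.cong) auto
  then show ?thesis by simp
qed

text \<open>
  Modulo \<open>1\<close> the entry of \<open>M\<^sub>i (lift \<phi>)\<close> at \<open>(l, j)\<close> is the \<open>l\<close>-th relation with \<open>\<phi>(\<sigma>\<^sub>-\<^sub>g j)\<close> in place of
  \<open>-g \<cdot> \<phi>(j)\<close>. The character \<open>\<phi>(j)\<close> satisfies the relation exactly, and the error is controlled by the
  defect of equivariance.
\<close>

lemma norm_MM_nearest:
  assumes \<phi>: "\<phi> \<in> Maps rho0 supp_inv \<delta> i" and \<delta>: "0 < \<delta>"
  shows "(norm (MM i (lift i \<phi>) - nearest i \<phi>))\<^sup>2 \<le> real m * (real (d i) * (mat_norm m n f * \<delta>)\<^sup>2)"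
proof -
  let ?\<xi> = "lift i \<phi>"
  let ?e = "\<lambda>l j. circ (abs_rmodz (Poly_Mapping.lookup (MM i ?\<xi>) (l, j)))"
  have keys: "Poly_Mapping.keys (MM i ?\<xi> - nearest i \<phi>) \<subseteq> {..<m} \<times> {1..d i}"
  proof (rule subsetI, rule ccontr)
    fix k assume k: "k \<in> Poly_Mapping.keys (MM i ?\<xi> - nearest i \<phi>)" "k \<notin> {..<m} \<times> {1..d i}"
    then have "k \<notin> Poly_Mapping.keys (MM i ?\<xi>)" using keys_MM[OF keys_lift] by blast
    with k show False by (simp add: in_keys_iff lookup_minus lookup_nearest)
  qed
  have row: "(\<Sum>j\<in>{1..d i}. (?e l j)\<^sup>2) \<le> real (d i) * (mat_norm m n f * \<delta>)\<^sup>2" if l: "l < m" for l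
  proof -
    let ?c = "\<lambda>s g. \<bar>of_int (Poly_Mapping.lookup (f l s) g)\<bar> :: real"
    let ?p = "\<lambda>g j. rho0 (\<phi> (\<sigma> i (- g) j)) (T (- g) (\<phi> j))"
    have e: "?e l j \<le> (\<Sum>s<n. \<Sum>g\<in>Poly_Mapping.keys (f l s). ?c s g * ?p g j)" if j: "j \<in> {1..d i}" for j
    proof -
      have "abs_rmodz (Poly_Mapping.lookup (MM i ?\<xi>) (l, j)) =
        (\<Sum>s<n. \<Sum>g\<in>Poly_Mapping.keys (f l s). imul (Poly_Mapping.lookup (f l s) g) (\<phi> (\<sigma> i (- g) j) (gen s)))"
      proof -
        have abs_sum: "abs_rmodz (\<Sum>i\<in>A. r i) = (\<Sum>i\<in>A. abs_rmodz (r i))" for A and r :: "'z \<Rightarrow> real"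
          by (induction A rule: infinite_finite_induct) (auto simp: abs_rmodz_add)
        have in_I: "(s, \<sigma> i (- g) j) \<in> I i" if "s < n" for s g
          using that sigma_in[OF j] by (simp add: I_def)
        show ?thesis
          unfolding inverse_family.lookup_mat_op[OF model_family] using l in_I
          by (auto simp: abs_sum imul_abs[symmetric] lookup_lift rep01(1) intro!: sum.cong)
      qed
      also have "\<dots> = (\<Sum>s<n. \<Sum>g\<in>Poly_Mapping.keys (f l s). imul (Poly_Mapping.lookup (f l s) g) (\<phi> (\<sigma> i (- g) j) (gen s) - T (- g) (\<phi> j) (gen s)))"
        using character_relation[OF Maps_in[OF \<phi> j] l] by (simp add: imul_diff_right sum_subtractf)
      finally have "?e l j \<le> (\<Sum>s<n. circ (\<Sum>g\<in>Poly_Mapping.keys (f l s). imul (Poly_Mapping.lookup (f l s) g) (\<phi> (\<sigma> i (- g) j) (gen s) - T (- g) (\<phi> j) (gen s))))"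
        by (simp only: circ_sum)
      also have "\<dots> \<le> (\<Sum>s<n. \<Sum>g\<in>Poly_Mapping.keys (f l s). ?c s g * ?p g j)"
      proof (intro sum_mono order_trans[OF circ_sum] order_trans[OF circ_imul] mult_left_mono)
        fix s g assume "s \<in> {..<n}"
        then show "circ (\<phi> (\<sigma> i (- g) j) (gen s) - T (- g) (\<phi> j) (gen s)) \<le> ?p g j"
          using dist_le_rho0[of s] by (simp add: dist_rmodz_def)
      qed simp
      finally show ?thesis .
    qed
    have "qmean (d i) (?e l) \<le> qmean (d i) (\<lambda>j. \<Sum>s<n. \<Sum>g\<in>Poly_Mapping.keys (f l s). ?c s g * ?p g j)"
      by (intro qmean_mono e circ_nonneg)
    also have "\<dots> \<le> (\<Sum>s<n. \<Sum>g\<in>Poly_Mapping.keys (f l s). ?c s g * qmean (d i) (?p g))"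
      by (intro order_trans[OF qmean_sum] sum_mono) (simp add: qmean_cmult)
    also have "\<dots> \<le> (\<Sum>s<n. \<Sum>g\<in>Poly_Mapping.keys (f l s). ?c s g * \<delta>)"
    proof (intro sum_mono mult_left_mono)
      fix s g assume "s \<in> {..<n}" "g \<in> Poly_Mapping.keys (f l s)"
      then have "- g \<in> supp_inv" using l by (auto simp: supp_inv_def)
      from Maps_less[OF \<phi> this] show "qmean (d i) (?p g) \<le> \<delta>" by simp
    qed simp
    also have "\<dots> \<le> mat_norm m n f * \<delta>"
      unfolding mat_norm_def sum_distrib_right[symmetric] using l \<delta>
      by (intro mult_right_mono member_le_sum[of l "{..<m}" "\<lambda>l. \<Sum>s<n. \<Sum>g\<in>Poly_Mapping.keys (f l s). \<bar>of_int (Poly_Mapping.lookup (f l s) g)\<bar>"])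
         (auto intro!: sum_nonneg)
    finally have "(qmean (d i) (?e l))\<^sup>2 \<le> (mat_norm m n f * \<delta>)\<^sup>2"
      by (intro power_mono qmean_nonneg)
    then show ?thesis unfolding qmean_sq[OF d_pos] by (intro mult_left_mono) auto
  qed
  have "(norm (MM i ?\<xi> - nearest i \<phi>))\<^sup>2 = (\<Sum>k\<in>{..<m} \<times> {1..d i}. (?e (fst k) (snd k))\<^sup>2)"
  proof -
    have "(Poly_Mapping.lookup (MM i ?\<xi> - nearest i \<phi>) k)\<^sup>2 = (?e (fst k) (snd k))\<^sup>2" if "k \<in> {..<m} \<times> {1..d i}" for k
      using that by (simp add: lookup_minus lookup_nearest circ.abs_eq)
    then show ?thesis
      by (subst norm_poly_mapping_superset[OF _ keys]) auto
  qed
  also have "\<dots> = (\<Sum>l<m. \<Sum>j\<in>{1..d i}. (?e l j)\<^sup>2)"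
    by (simp add: sum.cartesian_product case_prod_unfold)
  also have "\<dots> \<le> (\<Sum>l<m. real (d i) * (mat_norm m n f * \<delta>)\<^sup>2)"
    by (intro sum_mono row) auto
  finally show ?thesis by simp
qed

lemma rho_2_le_lift: "rho_2 rho0 (d i) \<phi> \<psi> \<le> norm (lift i \<phi> - lift i \<psi>) / sqrt (real (d i))"
proof -
  have keys: "Poly_Mapping.keys (lift i \<phi> - lift i \<psi>) \<subseteq> I i"
  proof (rule subsetI, rule ccontr)
    fix k assume "k \<in> Poly_Mapping.keys (lift i \<phi> - lift i \<psi>)" "k \<notin> I i"
    then show False by (simp add: in_keys_iff lookup_minus lookup_lift)
  qed
  have "(\<Sum>j\<in>{1..d i}. (rho0 (\<phi> j) (\<psi> j))\<^sup>2) = (\<Sum>j\<in>{1..d i}. \<Sum>s<n. (dist (\<phi> j (gen s)) (\<psi> j (gen s)))\<^sup>2)"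
    by (simp add: rho0_def L2_set_def sum_nonneg)
  also have "\<dots> = (\<Sum>k\<in>I i. (dist (\<phi> (snd k) (gen (fst k))) (\<psi> (snd k) (gen (fst k))))\<^sup>2)"
    unfolding I_def by (subst sum.swap) (simp add: sum.cartesian_product case_prod_unfold)
  also have "\<dots> \<le> (\<Sum>k\<in>I i. (Poly_Mapping.lookup (lift i \<phi> - lift i \<psi>) k)\<^sup>2)"
  proof (rule sum_mono)
    fix k assume k: "k \<in> I i"
    let ?x = "\<phi> (snd k) (gen (fst k))" and ?y = "\<psi> (snd k) (gen (fst k))"
    have "dist ?x ?y \<le> \<bar>rep01 ?x - rep01 ?y\<bar>"
      using dist_abs_rmodz_le[of "rep01 ?x" "rep01 ?y"] by (simp add: rep01(1))
    then have "(dist ?x ?y)\<^sup>2 \<le> \<bar>rep01 ?x - rep01 ?y\<bar>\<^sup>2" by (intro power_mono) auto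
    then show "(dist ?x ?y)\<^sup>2 \<le> (Poly_Mapping.lookup (lift i \<phi> - lift i \<psi>) k)\<^sup>2"
      using k by (simp add: lookup_minus lookup_lift)
  qed
  also have "\<dots> = (norm (lift i \<phi> - lift i \<psi>))\<^sup>2"
    by (rule norm_poly_mapping_superset[symmetric, OF _ keys]) simp
  finally have "1 / real (d i) * (\<Sum>j\<in>{1..d i}. (rho0 (\<phi> j) (\<psi> j))\<^sup>2) \<le> 1 / real (d i) * (norm (lift i \<phi> - lift i \<psi>))\<^sup>2"
    by (intro mult_left_mono) auto
  then have "rho_2 rho0 (d i) \<phi> \<psi> \<le> sqrt (1 / real (d i) * (norm (lift i \<phi> - lift i \<psi>))\<^sup>2)"
    unfolding rho_2_def by (rule real_sqrt_le_mono)
  also have "\<dots> = norm (lift i \<phi> - lift i \<psi>) / sqrt (real (d i))"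
    by (simp add: real_sqrt_divide)
  finally show ?thesis .
qed

text \<open>
  The classes are given by the integer vector next to \<open>M\<^sub>i (lift \<phi>)\<close> and a 0/1 vector that rounds
  \<open>lift \<phi>\<close> in such a way that \<open>S\<^sub>i\<^sup>t\<close> hardly notices. For maps \<open>\<phi>\<close>, \<open>\<psi>\<close> in one class, the
  difference \<open>v\<close> of the lifts satisfies \<open>S\<^sub>i\<^sup>t v \<approx> 0\<close> by the second datum, and \<open>v \<approx> S\<^sub>i\<^sup>t v\<close> by
  the first. The number of classes grows at a rate \<open>m ln (2 Z + 1) + n ln 2\<close> that depends on the
  matrix only.
\<close>

theorem entropy_finite:
  assumes "tr_moment \<longlonglongrightarrow> 0"
  shows "sofic_entropy d \<sigma> X T < \<infinity>"
proof -
  define Z where "Z = \<lceil>mat_norm m n f\<rceil> + 1"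
  define B where "B = real m * ln (real (card {- Z..Z})) + real n * ln 2"
  have mn: "mat_norm m n f \<le> of_int Z - 1" by (simp add: Z_def)
  have Zpos: "0 \<le> Z" using mat_norm_nonneg[of m n f] by (simp add: Z_def)
  have cardZ: "1 \<le> card {- Z..Z}" using Zpos by simp
  show ?thesis
  proof (rule entropy_finiteI[OF generating_rho0])
    show "0 \<le> B" using cardZ by (simp add: B_def)
    fix \<epsilon> :: real assume \<epsilon>: "0 < \<epsilon>"
    define \<eta> where "\<eta> = \<epsilon>\<^sup>2 / 32"
    have \<eta>: "0 < \<eta>" using \<epsilon> by (simp add: \<eta>_def)
    obtain t0 where "tr_moment t0 < \<eta>"
      using order_tendstoD(2)[OF assms \<eta>] by (auto simp: eventually_sequentially)
    moreover have "tr_moment (2 * t0) \<le> tr_moment t0"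
      by (rule decseqD[OF vn_dim_conv_ker(3)]) simp
    ultimately have t: "tr_moment (2 * t0) \<le> \<eta>" by simp
    define \<kappa> where "\<kappa> = \<epsilon> / (4 * (real t0 + 1))"
    have \<kappa>: "0 < \<kappa>" using \<epsilon> by (simp add: \<kappa>_def)
    define \<delta> where "\<delta> = \<kappa> / ((real m + 1) * (mat_norm m n f + 1))"
    have pos: "0 < (real m + 1) * (mat_norm m n f + 1)"
      using mat_norm_nonneg[of m n f] by (intro mult_pos_pos) auto
    have \<delta>: "0 < \<delta>" unfolding \<delta>_def using \<kappa> pos by simp
    have \<delta>\<kappa>: "real m * (mat_norm m n f * \<delta>)\<^sup>2 \<le> \<kappa>\<^sup>2"
    proof -
      have "(real m + 1) * (mat_norm m n f * \<delta>) \<le> \<kappa>"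
      proof -
        have "(real m + 1) * (mat_norm m n f * \<delta>) \<le> (real m + 1) * ((mat_norm m n f + 1) * \<delta>)"
          using \<delta> by (intro mult_left_mono mult_right_mono) auto
        also have "\<dots> = \<kappa>" using pos by (simp add: \<delta>_def field_simps)
        finally show ?thesis .
      qed
      then have "((real m + 1) * (mat_norm m n f * \<delta>))\<^sup>2 \<le> \<kappa>\<^sup>2"
        using mat_norm_nonneg[of m n f] \<delta> by (intro power_mono) auto
      moreover have "real m \<le> (real m + 1)\<^sup>2" by (simp add: power2_sum)
      then have "real m * (mat_norm m n f * \<delta>)\<^sup>2 \<le> (real m + 1)\<^sup>2 * (mat_norm m n f * \<delta>)\<^sup>2"
        by (intro mult_right_mono) auto
      ultimately show ?thesis by (simp add: power_mult_distrib)
    qed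
    have "\<forall>\<^sub>F i in sequentially. span_num \<epsilon> (Maps rho0 supp_inv \<delta> i) (rho_2 rho0 (d i)) \<le> enat (card {- Z..Z} ^ (m * d i) * 2 ^ (n * d i))
       \<and> ln (real (card {- Z..Z} ^ (m * d i) * 2 ^ (n * d i))) \<le> B * real (d i)"
      using model_trace_generic[OF \<eta>, of "2 * t0"]
    proof eventually_elim
      case (elim i)
      interpret A: adjoint_pair "MM i" "MMa i" C by (rule model_pair)
      let ?d = "real (d i)"
      have d: "0 < ?d" using d_pos by simp
      have "(\<Sum>k\<in>I i. mom i (unit k) (2 * t0)) \<le> tr_moment (2 * t0) * ?d + \<eta> * ?d"
        using elim by (simp add: abs_le_iff)
      also have "\<dots> \<le> \<eta> * ?d + \<eta> * ?d" using t d by (intro add_mono mult_right_mono) auto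
      finally have trace: "(\<Sum>k\<in>I i. (norm ((A.S ^^ t0) (unit k)))\<^sup>2) \<le> (\<epsilon> / 4 * sqrt ?d)\<^sup>2"
        unfolding A.moment_even by (simp add: \<eta>_def power_mult_distrib power_divide mult.commute)
      have "\<exists>s. (\<forall>k. s k \<in> {0, 1 :: real}) \<and> norm ((A.S ^^ t0) (lift i \<phi>) - (\<Sum>k\<in>I i. s k *\<^sub>R (A.S ^^ t0) (unit k))) \<le> \<epsilon> / 4 * sqrt ?d" for \<phi>
      proof -
        obtain s where s: "\<forall>k. s k \<in> {0, 1 :: real}"
          "(norm (\<Sum>k\<in>I i. (Poly_Mapping.lookup (lift i \<phi>) k - s k) *\<^sub>R (A.S ^^ t0) (unit k)))\<^sup>2 \<le> (\<Sum>k\<in>I i. (norm ((A.S ^^ t0) (unit k)))\<^sup>2)"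
          using round_coefficients[of "I i" "Poly_Mapping.lookup (lift i \<phi>)" "\<lambda>k. (A.S ^^ t0) (unit k)"] lookup_lift_bounds by auto
        have "(A.S ^^ t0) (lift i \<phi>) = (\<Sum>k\<in>I i. Poly_Mapping.lookup (lift i \<phi>) k *\<^sub>R (A.S ^^ t0) (unit k))"
          by (subst unit_expansion[OF finite_I keys_lift])
             (simp add: linear_sum[OF A.linear_S_pow] linear_scale[OF A.linear_S_pow])
        then have "(A.S ^^ t0) (lift i \<phi>) - (\<Sum>k\<in>I i. s k *\<^sub>R (A.S ^^ t0) (unit k)) =
          (\<Sum>k\<in>I i. (Poly_Mapping.lookup (lift i \<phi>) k - s k) *\<^sub>R (A.S ^^ t0) (unit k))"
          by (simp add: scaleR_diff_left sum_subtractf)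
        moreover have "norm (\<Sum>k\<in>I i. (Poly_Mapping.lookup (lift i \<phi>) k - s k) *\<^sub>R (A.S ^^ t0) (unit k)) \<le> \<epsilon> / 4 * sqrt ?d"
          by (rule power2_le_imp_le[OF order_trans[OF s(2) trace]]) (use \<epsilon> d in auto)
        ultimately show ?thesis using s(1) by (intro exI[of _ s] conjI) simp_all
      qed
      then have "\<forall>\<phi>. \<exists>s. (\<forall>k. s k \<in> {0, 1 :: real}) \<and> norm ((A.S ^^ t0) (lift i \<phi>) - (\<Sum>k\<in>I i. s k *\<^sub>R (A.S ^^ t0) (unit k))) \<le> \<epsilon> / 4 * sqrt ?d"
        by blast
      from choice[OF this] obtain s where s01: "s \<phi> k \<in> {0, 1 :: real}"
        and s: "norm ((A.S ^^ t0) (lift i \<phi>) - (\<Sum>k\<in>I i. s \<phi> k *\<^sub>R (A.S ^^ t0) (unit k))) \<le> \<epsilon> / 4 * sqrt ?d" for \<phi> k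
        by blast
      define key where "key \<phi> = (restrict (\<lambda>k. round (Poly_Mapping.lookup (MM i (lift i \<phi>)) k)) ({..<m} \<times> {1..d i}), restrict (s \<phi>) (I i))" for \<phi>
      let ?K = "(({..<m} \<times> {1..d i}) \<rightarrow>\<^sub>E {- Z..Z}) \<times> (I i \<rightarrow>\<^sub>E {0, 1 :: real})"
      have finK: "finite ?K" by (intro finite_cartesian_product finite_PiE) auto
      have keyK: "key ` Maps rho0 supp_inv \<delta> i \<subseteq> ?K"
      proof
        fix y assume "y \<in> key ` Maps rho0 supp_inv \<delta> i"
        then obtain \<phi> where \<phi>: "y = key \<phi>" by blast
        have "round (Poly_Mapping.lookup (MM i (lift i \<phi>)) k) \<in> {- Z..Z}" for k
        proof -
          have "\<bar>Poly_Mapping.lookup (MM i (lift i \<phi>)) k\<bar> \<le> of_int Z - 1"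
            using MM_lift_bound[of i \<phi> "fst k" "snd k"] mn by simp
          then have "\<bar>real_of_int (round (Poly_Mapping.lookup (MM i (lift i \<phi>)) k))\<bar> \<le> of_int Z"
            using of_int_round_abs_le[of "Poly_Mapping.lookup (MM i (lift i \<phi>)) k"] by linarith
          then show ?thesis by (simp add: abs_le_iff flip: of_int_abs)
        qed
        then show "y \<in> ?K" using s01 by (auto simp: \<phi> key_def)
      qed
      have "span_num \<epsilon> (Maps rho0 supp_inv \<delta> i) (rho_2 rho0 (d i)) \<le> enat (card (key ` Maps rho0 supp_inv \<delta> i))"
      proof (rule span_num_le_classes)
        show "finite (key ` Maps rho0 supp_inv \<delta> i)" by (rule finite_subset[OF keyK finK])
        fix \<phi> \<psi> assume \<phi>: "\<phi> \<in> Maps rho0 supp_inv \<delta> i" and \<psi>: "\<psi> \<in> Maps rho0 supp_inv \<delta> i" and eq: "key \<phi> = key \<psi>"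
        let ?v = "lift i \<phi> - lift i \<psi>"
        have near: "norm (MM i (lift i \<omega>) - nearest i \<omega>) \<le> \<kappa> * sqrt ?d" if "\<omega> \<in> Maps rho0 supp_inv \<delta> i" for \<omega>
        proof (rule power2_le_imp_le)
          have "real m * (?d * (mat_norm m n f * \<delta>)\<^sup>2) = ?d * (real m * (mat_norm m n f * \<delta>)\<^sup>2)" by simp
          also have "\<dots> \<le> ?d * \<kappa>\<^sup>2" using \<delta>\<kappa> d by (intro mult_left_mono) auto
          also have "\<dots> = (\<kappa> * sqrt ?d)\<^sup>2" using d by (simp add: power_mult_distrib)
          finally show "(norm (MM i (lift i \<omega>) - nearest i \<omega>))\<^sup>2 \<le> (\<kappa> * sqrt ?d)\<^sup>2"
            using norm_MM_nearest[OF that \<delta>] by simp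
        qed (use \<kappa> d in auto)
        have "nearest i \<phi> = nearest i \<psi>"
        proof (rule poly_mapping_eqI)
          fix k
          have r: "fst (key \<phi>) k = fst (key \<psi>) k" by (simp only: eq)
          show "Poly_Mapping.lookup (nearest i \<phi>) k = Poly_Mapping.lookup (nearest i \<psi>) k"
          proof (cases "k \<in> {..<m} \<times> {1..d i}")
            case True
            have "round (Poly_Mapping.lookup (MM i (lift i \<phi>)) k) = round (Poly_Mapping.lookup (MM i (lift i \<psi>)) k)"
              using r unfolding key_def fst_conv restrict_apply'[OF True] .
            then show ?thesis by (simp add: lookup_nearest)
          next
            case False
            then show ?thesis by (simp only: lookup_nearest if_False)
          qed
        qed
        then have "MM i ?v = (MM i (lift i \<phi>) - nearest i \<phi>) - (MM i (lift i \<psi>) - nearest i \<psi>)"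
          by (simp add: linear_diff[OF A.linear_M])
        then have "norm (MM i ?v) \<le> norm (MM i (lift i \<phi>) - nearest i \<phi>) + norm (MM i (lift i \<psi>) - nearest i \<psi>)"
          by (simp only: norm_triangle_ineq4)
        then have Mv: "norm (MM i ?v) \<le> 2 * \<kappa> * sqrt ?d" using near[OF \<phi>] near[OF \<psi>] by simp
        have seq: "s \<phi> k = s \<psi> k" if "k \<in> I i" for k
        proof -
          have "snd (key \<phi>) k = snd (key \<psi>) k" by (simp only: eq)
          then show ?thesis unfolding key_def snd_conv restrict_apply'[OF that] .
        qed
        then have "(\<Sum>k\<in>I i. s \<phi> k *\<^sub>R (A.S ^^ t0) (unit k)) = (\<Sum>k\<in>I i. s \<psi> k *\<^sub>R (A.S ^^ t0) (unit k))"
          by (intro sum.cong) auto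
        then have "(A.S ^^ t0) ?v = ((A.S ^^ t0) (lift i \<phi>) - (\<Sum>k\<in>I i. s \<phi> k *\<^sub>R (A.S ^^ t0) (unit k))) -
            ((A.S ^^ t0) (lift i \<psi>) - (\<Sum>k\<in>I i. s \<psi> k *\<^sub>R (A.S ^^ t0) (unit k)))"
          by (simp add: linear_diff[OF A.linear_S_pow])
        then have "norm ((A.S ^^ t0) ?v) \<le> norm ((A.S ^^ t0) (lift i \<phi>) - (\<Sum>k\<in>I i. s \<phi> k *\<^sub>R (A.S ^^ t0) (unit k))) +
            norm ((A.S ^^ t0) (lift i \<psi>) - (\<Sum>k\<in>I i. s \<psi> k *\<^sub>R (A.S ^^ t0) (unit k)))"
          by (simp only: norm_triangle_ineq4)
        then have Sv: "norm ((A.S ^^ t0) ?v) \<le> \<epsilon> / 2 * sqrt ?d" using s[of \<phi>] s[of \<psi>] by simp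
        have "norm (?v - (A.S ^^ t0) ?v) \<le> real t0 * norm (MM i ?v) / sqrt C" by (rule A.norm_diff_S_pow_le)
        also have "\<dots> \<le> real t0 * norm (MM i ?v)"
          using C_ge_1 divide_left_mono[of 1 "sqrt C" "real t0 * norm (MM i ?v)"] by simp
        also have "\<dots> \<le> real t0 * (2 * \<kappa> * sqrt ?d)" by (intro mult_left_mono Mv) auto
        also have "\<dots> \<le> (real t0 + 1) * (2 * \<kappa> * sqrt ?d)" using \<kappa> d by (intro mult_right_mono) auto
        also have "\<dots> = \<epsilon> / 2 * sqrt ?d"
        proof -
          have "(real t0 + 1) * \<kappa> = \<epsilon> / 4" by (simp add: \<kappa>_def field_simps)
          moreover have "(real t0 + 1) * (2 * \<kappa> * sqrt ?d) = 2 * ((real t0 + 1) * \<kappa>) * sqrt ?d" by (simp only: mult_ac)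
          ultimately show ?thesis by simp
        qed
        finally have "norm (?v - (A.S ^^ t0) ?v) \<le> \<epsilon> / 2 * sqrt ?d" .
        then have "norm ?v \<le> \<epsilon> / 2 * sqrt ?d + \<epsilon> / 2 * sqrt ?d"
          using Sv norm_triangle_ineq[of "?v - (A.S ^^ t0) ?v" "(A.S ^^ t0) ?v"] by simp
        then have "norm ?v \<le> \<epsilon> * sqrt ?d" by simp
        then have "norm ?v / sqrt ?d \<le> \<epsilon>" using d by (simp add: pos_divide_le_eq)
        then show "rho_2 rho0 (d i) \<phi> \<psi> \<le> \<epsilon>" using rho_2_le_lift order_trans by blast
      qed
      also have "\<dots> \<le> enat (card ?K)" by (simp only: enat_ord_simps card_mono[OF finK keyK])
      also have "card ?K = card {- Z..Z} ^ (m * d i) * 2 ^ (n * d i)"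
      proof -
        have cardE: "card (S \<rightarrow>\<^sub>E W) = card W ^ card S" if "finite S" for S :: "(nat \<times> nat) set" and W :: "'w set"
          using that by (simp add: card_PiE)
        have "card ({..<m} \<times> {1..d i}) = m * d i" "card {0, 1 :: real} = 2" by simp_all
        then show ?thesis
          by (simp only: card_cartesian_product[of "_ \<rightarrow>\<^sub>E _"] cardE finite_I finite_cartesian_product finite_lessThan finite_atLeastAtMost card_I)
      qed
      finally have "span_num \<epsilon> (Maps rho0 supp_inv \<delta> i) (rho_2 rho0 (d i)) \<le> enat (card {- Z..Z} ^ (m * d i) * 2 ^ (n * d i))" .
      moreover have "ln (real (card {- Z..Z} ^ (m * d i) * 2 ^ (n * d i))) = B * ?d"
      proof -
        have c: "0 < real (card {- Z..Z})" using cardZ by linarith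
        have "real (card {- Z..Z} ^ (m * d i) * 2 ^ (n * d i)) = real (card {- Z..Z}) ^ (m * d i) * 2 ^ (n * d i)"
          by (simp only: of_nat_mult of_nat_power of_nat_numeral)
        also have "ln \<dots> = ln (real (card {- Z..Z}) ^ (m * d i)) + ln (2 ^ (n * d i))"
          by (rule ln_mult_pos) (use c in \<open>simp_all only: zero_less_power zero_less_numeral\<close>)
        also have "\<dots> = real (m * d i) * ln (real (card {- Z..Z})) + real (n * d i) * ln 2"
          using c by (simp only: ln_realpow zero_less_numeral)
        also have "\<dots> = B * ?d" unfolding B_def by (simp only: of_nat_mult distrib_left distrib_right mult_ac)
        finally show ?thesis .
      qed
      ultimately show ?case by simp
    qed
    then show "\<exists>F \<delta>. finite F \<and> 0 < \<delta> \<and> (\<forall>\<^sub>F i in sequentially. \<exists>k. span_num \<epsilon> (Maps rho0 F \<delta> i) (rho_2 rho0 (d i)) \<le> enat k \<and> ln (real k) \<le> B * real (d i))"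
      using \<delta> by (intro exI[of _ supp_inv] exI[of _ \<delta>] conjI) (auto simp: supp_inv_def elim!: eventually_mono)
  qed
qed

end

section \<open>A cube spanned by functions that take both extreme values\<close>

text \<open>
  An intermediate value theorem on the grid \<open>{0..p}\<^sup>N\<close>, a consequence of Kuhn's combinatorial
  lemma for the labels that record whether the value is below \<open>\<tau>\<close>: a cell at which every
  coordinate changes its label contains values on both sides of \<open>\<tau>\<close>, and adjacent values differ by
  at most \<open>e\<close>.
\<close>

lemma cube_attained:
  fixes Fv :: "(nat \<Rightarrow> nat) \<Rightarrow> nat \<Rightarrow> real" and \<tau> :: "nat \<Rightarrow> real"
  assumes p: "0 < p"
    and low: "\<And>x r. (\<And>r. r < N \<Longrightarrow> x r \<le> p) \<Longrightarrow> r < N \<Longrightarrow> x r = 0 \<Longrightarrow> Fv x r = 0"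
    and high: "\<And>x r. (\<And>r. r < N \<Longrightarrow> x r \<le> p) \<Longrightarrow> r < N \<Longrightarrow> x r = p \<Longrightarrow> Fv x r = 1"
    and step: "\<And>x y r. (\<And>r. r < N \<Longrightarrow> x r \<le> y r \<and> y r \<le> x r + 1) \<Longrightarrow> r < N \<Longrightarrow> \<bar>Fv x r - Fv y r\<bar> \<le> e"
    and \<tau>: "\<And>r. r < N \<Longrightarrow> 0 < \<tau> r \<and> \<tau> r \<le> 1"
  obtains q where "\<And>r. r < N \<Longrightarrow> q r \<le> p" "\<And>r. r < N \<Longrightarrow> \<bar>Fv q r - \<tau> r\<bar> \<le> e"
proof -
  define lab where "lab x r = (if Fv x r < \<tau> r then 0 else 1 :: nat)" for x r
  have 1: "\<forall>x. (\<forall>i<N. x i \<le> p) \<longrightarrow> (\<forall>i<N. lab x i = 0 \<or> lab x i = 1)" by (simp add: lab_def)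
  have 2: "\<forall>x. (\<forall>i<N. x i \<le> p) \<longrightarrow> (\<forall>i<N. x i = 0 \<longrightarrow> lab x i = 0)"
    using low \<tau> by (simp add: lab_def)
  have 3: "\<forall>x. (\<forall>i<N. x i \<le> p) \<longrightarrow> (\<forall>i<N. x i = p \<longrightarrow> lab x i = 1)"
  proof (intro allI impI)
    fix x i assume "\<forall>i<N. x i \<le> p" "i < N" "x i = p"
    then have "Fv x i = 1" by (intro high) auto
    then show "lab x i = 1" using \<tau>[OF \<open>i < N\<close>] by (simp add: lab_def)
  qed
  obtain q where q: "\<forall>i<N. q i < p"
    "\<forall>i<N. \<exists>r s. (\<forall>j<N. q j \<le> r j \<and> r j \<le> q j + 1) \<and> (\<forall>j<N. q j \<le> s j \<and> s j \<le> q j + 1) \<and> lab r i \<noteq> lab s i"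
    by (rule kuhn_lemma[OF p 1 2 3]) (rule that)
  show thesis
  proof (rule that[of q])
    show "q r \<le> p" if "r < N" for r using q(1) that by (simp add: less_imp_le)
    fix i assume i: "i < N"
    from q(2) i obtain r s where rs: "\<And>j. j < N \<Longrightarrow> q j \<le> r j \<and> r j \<le> q j + 1"
      "\<And>j. j < N \<Longrightarrow> q j \<le> s j \<and> s j \<le> q j + 1" "lab r i \<noteq> lab s i" by metis
    have "\<bar>Fv q i - Fv r i\<bar> \<le> e" "\<bar>Fv q i - Fv s i\<bar> \<le> e"
      by (rule step[OF rs(1) i], assumption) (rule step[OF rs(2) i], assumption)
    moreover have "(Fv r i < \<tau> i \<and> \<tau> i \<le> Fv s i) \<or> (Fv s i < \<tau> i \<and> \<tau> i \<le> Fv r i)"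
      using rs(3) by (auto simp: lab_def split: if_splits)
    ultimately show "\<bar>Fv q i - \<tau> i\<bar> \<le> e" by linarith
  qed
qed

section \<open>Finitely many relations almost determine the dual\<close>

lemma continuous_imul: "continuous_on A p \<Longrightarrow> continuous_on A (\<lambda>x. imul k (p x))"
proof -
  have "continuous_on UNIV (imul k)"
    unfolding continuous_on_iff
  proof (intro ballI allI impI)
    fix x :: rmodz and e :: real assume e: "0 < e"
    show "\<exists>\<delta>>0. \<forall>y\<in>UNIV. dist y x < \<delta> \<longrightarrow> dist (imul k y) (imul k x) < e"
    proof (intro exI[of _ "e / (\<bar>of_int k\<bar> + 1)"] conjI ballI impI)
      show "0 < e / (\<bar>of_int k\<bar> + 1)" using e by (intro divide_pos_pos) auto
      fix y assume y: "dist y x < e / (\<bar>of_int k\<bar> + 1)"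
      have "dist (imul k y) (imul k x) \<le> \<bar>of_int k\<bar> * dist y x"
        unfolding dist_rmodz_def imul_diff_right[symmetric] by (rule circ_imul)
      also have "\<dots> \<le> (\<bar>of_int k\<bar> + 1) * dist y x" by (intro mult_right_mono) auto
      also have "\<dots> < e" using y by (simp add: pos_less_divide_eq mult.commute add_nonneg_pos)
      finally show "dist (imul k y) (imul k x) < e" .
    qed
  qed
  then show "continuous_on A p \<Longrightarrow> continuous_on A (\<lambda>x. imul k (p x))"
    by (rule continuous_on_compose2) auto
qed

context dual_system
begin

abbreviation gm :: "nat \<Rightarrow> 'g \<Rightarrow> 'a" where "gm s g \<equiv> smul (el g) (gen s)"

text \<open>
  The value of the row \<open>r\<close> on a family of points of the circle; \<open>x (s, g)\<close> plays the role of
  \<open>u (g a\<^sub>s)\<close> for a character \<open>u\<close>.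
\<close>

definition ev :: "(nat \<Rightarrow> 'g \<Rightarrow>\<^sub>0 int) \<Rightarrow> (nat \<times> 'g \<Rightarrow> rmodz) \<Rightarrow> rmodz" where
  "ev r x = (\<Sum>s<n. \<Sum>g\<in>Poly_Mapping.keys (r s). imul (Poly_Mapping.lookup (r s) g) (x (s, g)))"

lemma ev_row_superset:
  assumes "finite A" "Poly_Mapping.keys r \<subseteq> A"
  shows "(\<Sum>g\<in>Poly_Mapping.keys r. imul (Poly_Mapping.lookup r g) (x g)) = (\<Sum>g\<in>A. imul (Poly_Mapping.lookup r g) (x g))"
  using assms by (intro sum.mono_neutral_left) (auto simp: in_keys_iff)

lemma ev_diff: "ev (\<lambda>s. r s - r' s) x = ev r x - ev r' x"
  unfolding ev_def sum_subtractf[symmetric]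
proof (rule sum.cong[OF refl])
  fix s
  let ?A = "Poly_Mapping.keys (r s) \<union> Poly_Mapping.keys (r' s)"
  have A: "finite ?A" "Poly_Mapping.keys (r s - r' s) \<subseteq> ?A" "Poly_Mapping.keys (r s) \<subseteq> ?A" "Poly_Mapping.keys (r' s) \<subseteq> ?A"
    by (auto simp: in_keys_iff lookup_minus)
  show "(\<Sum>g\<in>Poly_Mapping.keys (r s - r' s). imul (Poly_Mapping.lookup (r s - r' s) g) (x (s, g))) =
    (\<Sum>g\<in>Poly_Mapping.keys (r s). imul (Poly_Mapping.lookup (r s) g) (x (s, g))) -
    (\<Sum>g\<in>Poly_Mapping.keys (r' s). imul (Poly_Mapping.lookup (r' s) g) (x (s, g)))"
    unfolding ev_row_superset[OF A(1,2)] ev_row_superset[OF A(1,3)] ev_row_superset[OF A(1,4)]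
    by (simp only: lookup_minus imul_diff_left sum_subtractf)
qed

lemma ev_add: "ev (\<lambda>s. r s + r' s) x = ev r x + ev r' x"
proof -
  have "ev r x = ev (\<lambda>s. (r s + r' s) - r' s) x" by simp
  also have "\<dots> = ev (\<lambda>s. r s + r' s) x - ev r' x" by (rule ev_diff)
  finally show ?thesis by simp
qed

text \<open>
  The relations are exactly the obstruction to defining a character by \<open>u (\<Sum>\<^sub>s c\<^sub>s a\<^sub>s) = ev c x\<close>.
\<close>

lemma character_from_values:
  assumes "\<And>r. (\<Sum>s<n. smul (r s) (gen s)) = 0 \<Longrightarrow> ev r x = 0"
  obtains u where "u \<in> topspace X" "\<And>s g. s < n \<Longrightarrow> u (gm s g) = x (s, g)"
proof -
  obtain c where c: "\<And>y. y = (\<Sum>s<n. smul (c y s) (gen s))" using generated by metis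
  define u where "u y = ev (c y) x" for y
  have eqI: "ev r x = ev r' x" if "(\<Sum>s<n. smul (r s) (gen s)) = (\<Sum>s<n. smul (r' s) (gen s))" for r r'
  proof -
    have "(\<Sum>s<n. smul (r s - r' s) (gen s)) = 0" using that by (simp add: smul_diff_left sum_subtractf)
    from assms[OF this] show ?thesis by (simp add: ev_diff)
  qed
  have "u (y + z) = u y + u z" for y z
  proof -
    have "(\<Sum>s<n. smul (c y s + c z s) (gen s)) = (\<Sum>s<n. smul (c y s) (gen s)) + (\<Sum>s<n. smul (c z s) (gen s))"
      by (simp add: scale_left_distrib sum.distrib)
    also have "\<dots> = y + z" by (simp only: c[symmetric])
    also have "\<dots> = (\<Sum>s<n. smul (c (y + z) s) (gen s))" by (rule c)
    finally have "ev (\<lambda>s. c y s + c z s) x = ev (c (y + z)) x" by (rule eqI)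
    then show ?thesis by (simp add: u_def ev_add)
  qed
  then have "Modules.additive u" by (rule additive.intro)
  moreover have "u (gm s0 g) = x (s0, g)" if "s0 < n" for s0 g
  proof -
    let ?r = "\<lambda>s. if s = s0 then el g else 0"
    have "(\<Sum>s<n. smul (?r s) (gen s)) = (\<Sum>s<n. if s = s0 then gm s0 g else 0)"
      by (intro sum.cong) auto
    also have "\<dots> = gm s0 g" using that by simp
    also have "\<dots> = (\<Sum>s<n. smul (c (gm s0 g) s) (gen s))" by (rule c)
    finally have "ev ?r x = ev (c (gm s0 g)) x" by (rule eqI)
    moreover have "ev ?r x = (\<Sum>s<n. if s = s0 then x (s0, g) else 0)"
      unfolding ev_def by (intro sum.cong refl) (auto simp: keys_single)
    ultimately show ?thesis using that by (simp add: u_def)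
  qed
  ultimately show thesis using that[of u] by simp
qed

text \<open>
  A family that satisfies all relations comes from a character. The families that are close to a
  character on \<open>W\<close> together with those that violate some relation therefore form an open cover of
  a compact space, and finitely many relations occur in a finite subcover. This replaces a finite
  presentation of the module.
\<close>

lemma finitely_many_relations:
  assumes W: "finite W" and \<kappa>: "0 < \<kappa>"
  obtains m :: nat and f where "\<And>l. l < m \<Longrightarrow> (\<Sum>s<n. smul (f l s) (gen s)) = 0"
    "\<And>x. (\<And>l. l < m \<Longrightarrow> ev (f l) x = 0) \<Longrightarrow> \<exists>u\<in>topspace X. \<forall>s<n. \<forall>g\<in>W. dist (x (s, g)) (u (gm s g)) < \<kappa>"
proof -
  define R where "R = {r. (\<Sum>s<n. smul (r s) (gen s)) = 0}"
  define near where "near = (\<Union>u\<in>topspace X. \<Inter>k\<in>{..<n} \<times> W. {x :: nat \<times> 'g \<Rightarrow> rmodz. dist (x k) (u (gm (fst k) (snd k))) < \<kappa>})"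
  define Q where "Q q = (case q of None \<Rightarrow> near | Some r \<Rightarrow> {x. ev r x \<noteq> 0})" for q
  have "open near"
    unfolding near_def using W
    by (intro open_UN ballI open_INT finite_cartesian_product finite_lessThan open_Collect_less
        continuous_on_dist continuous_on_product_coordinates continuous_on_const)
  moreover have "open {x. ev r x \<noteq> 0}" for r
    unfolding ev_def
    by (intro open_Collect_neq continuous_on_sum continuous_imul continuous_on_product_coordinates continuous_on_const)
  ultimately have op: "open (Q q)" for q by (cases q) (simp_all add: Q_def)
  have cover: "UNIV \<subseteq> (\<Union>q\<in>insert None (Some ` R). Q q)"
  proof
    fix x
    show "x \<in> (\<Union>q\<in>insert None (Some ` R). Q q)"
    proof (cases "\<forall>r\<in>R. ev r x = 0")
      case True
      then obtain u where u: "u \<in> topspace X" "\<And>s g. s < n \<Longrightarrow> u (gm s g) = x (s, g)"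
        using character_from_values[of x] unfolding R_def by blast
      have "x \<in> near" unfolding near_def
      proof (intro UN_I[OF u(1)] INT_I)
        fix k assume "k \<in> {..<n} \<times> W"
        then have "u (gm (fst k) (snd k)) = x k" using u(2)[of "fst k" "snd k"] by auto
        then show "x \<in> {x. dist (x k) (u (gm (fst k) (snd k))) < \<kappa>}" using \<kappa> by simp
      qed
      then show ?thesis by (simp add: Q_def)
    next
      case False
      then show ?thesis by (auto simp: Q_def)
    qed
  qed
  obtain \<Q> where \<Q>: "\<Q> \<subseteq> insert None (Some ` R)" "finite \<Q>" "UNIV \<subseteq> (\<Union>q\<in>\<Q>. Q q)"
    using compactE_image[OF compact_UNIV_fun_rmodz, of "insert None (Some ` R)" Q] op cover by blast
  have "finite {r. Some r \<in> \<Q>}"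
    using finite_vimageI[OF \<Q>(2), of Some] by (simp add: vimage_def)
  then obtain rs where rs: "set rs = {r. Some r \<in> \<Q>}" using finite_list by blast
  show thesis
  proof (rule that[of "length rs" "\<lambda>l. rs ! l"])
    show "(\<Sum>s<n. smul ((rs ! l) s) (gen s)) = 0" if "l < length rs" for l
    proof -
      have "Some (rs ! l) \<in> \<Q>" using nth_mem[OF that] rs by auto
      then have "rs ! l \<in> R" using \<Q>(1) by auto
      then show ?thesis by (simp add: R_def)
    qed
    fix x assume ev0: "\<And>l. l < length rs \<Longrightarrow> ev (rs ! l) x = 0"
    have "x \<notin> Q (Some r)" if "Some r \<in> \<Q>" for r
    proof -
      have "r \<in> set rs" using that rs by simp
      then show ?thesis using ev0 by (auto simp: Q_def in_set_conv_nth)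
    qed
    moreover obtain q where "q \<in> \<Q>" "x \<in> Q q" using \<Q>(3) by blast
    ultimately have "x \<in> near" by (cases q) (auto simp: Q_def)
    then show "\<exists>u\<in>topspace X. \<forall>s<n. \<forall>g\<in>W. dist (x (s, g)) (u (gm s g)) < \<kappa>"
      unfolding near_def by fastforce
  qed
qed

section \<open>Lipschitz functions separating the values of a generator\<close>

text \<open>
  The distance to the set of characters with a value near \<open>0\<close> at the generator, cut off at \<open>1\<close>
  after division by \<open>\<epsilon>\<^sub>0\<close>. Characters with value near \<open>1/2\<close> are at distance at least \<open>3/8 > 1/8\<close>
  in the circle from the values of that set, hence \<open>\<epsilon>\<^sub>0\<close>-far from it.
\<close>

lemma coordinate_function:
  assumes \<rho>: "continuous_pseudometric X \<rho>" and \<epsilon>0: "0 < \<epsilon>0"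
    and sep: "\<And>u v s. u \<in> topspace X \<Longrightarrow> v \<in> topspace X \<Longrightarrow> s < n \<Longrightarrow> \<rho> u v < \<epsilon>0 \<Longrightarrow> dist (u (gen s)) (v (gen s)) < 1 / 8"
    and s: "s < n"
  obtains G where "\<And>u v. u \<in> topspace X \<Longrightarrow> v \<in> topspace X \<Longrightarrow> \<bar>G u - G v\<bar> \<le> \<rho> u v / \<epsilon>0"
    "\<And>u. u \<in> topspace X \<Longrightarrow> dist (u (gen s)) 0 \<le> 1 / 16 \<Longrightarrow> G u = 0"
    "\<And>u. u \<in> topspace X \<Longrightarrow> dist (u (gen s)) (abs_rmodz (1 / 2)) \<le> 1 / 16 \<Longrightarrow> G u = (1 :: real)"
proof -
  have tri: "\<And>x y z. x \<in> topspace X \<Longrightarrow> y \<in> topspace X \<Longrightarrow> z \<in> topspace X \<Longrightarrow> \<rho> x z \<le> \<rho> x y + \<rho> y z"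
    and sym: "\<And>x y. x \<in> topspace X \<Longrightarrow> y \<in> topspace X \<Longrightarrow> \<rho> x y = \<rho> y x"
    and nn: "\<And>x y. x \<in> topspace X \<Longrightarrow> y \<in> topspace X \<Longrightarrow> 0 \<le> \<rho> x y"
    and refl: "\<And>x. x \<in> topspace X \<Longrightarrow> \<rho> x x = 0"
    using \<rho> unfolding continuous_pseudometric_def by blast+
  define Z where "Z = {v \<in> topspace X. dist (v (gen s)) 0 \<le> 1 / 16}"
  have "(\<lambda>_. 0) \<in> Z" by (simp add: Z_def Modules.additive_def)
  then have Z: "Z \<noteq> {}" "Z \<subseteq> topspace X" by (auto simp: Z_def)
  define h where "h u = (INF v\<in>Z. \<rho> u v)" for u
  have bdd: "bdd_below (\<rho> u ` Z)" if "u \<in> topspace X" for u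
    using nn that Z(2) by (intro bdd_belowI[of _ 0]) auto
  have h0: "0 \<le> h u" if "u \<in> topspace X" for u
    unfolding h_def using nn that Z by (intro cINF_greatest) auto
  have le: "h u \<le> \<rho> u v + h v" if u: "u \<in> topspace X" and v: "v \<in> topspace X" for u v
  proof -
    have "h u - \<rho> u v \<le> h v"
      unfolding h_def[of v]
    proof (rule cINF_greatest[OF Z(1)])
      fix z assume z: "z \<in> Z"
      have "h u \<le> \<rho> u z" unfolding h_def by (rule cINF_lower[OF bdd[OF u] z])
      also have "\<dots> \<le> \<rho> u v + \<rho> v z" using z Z(2) u v by (intro tri) auto
      finally show "h u - \<rho> u v \<le> \<rho> v z" by simp
    qed
    then show ?thesis by simp
  qed
  define G where "G u = min 1 (h u / \<epsilon>0)" for u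
  show thesis
  proof (rule that[of G])
    fix u v assume u: "u \<in> topspace X" and v: "v \<in> topspace X"
    have "\<bar>h u - h v\<bar> \<le> \<rho> u v" using le[OF u v] le[OF v u] sym[OF u v] by simp
    then have "\<bar>h u / \<epsilon>0 - h v / \<epsilon>0\<bar> \<le> \<rho> u v / \<epsilon>0"
      using \<epsilon>0 by (simp add: diff_divide_distrib[symmetric] divide_right_mono)
    then show "\<bar>G u - G v\<bar> \<le> \<rho> u v / \<epsilon>0" unfolding G_def by linarith
  next
    fix u assume u: "u \<in> topspace X" and "dist (u (gen s)) 0 \<le> 1 / 16"
    then have "u \<in> Z" by (simp add: Z_def)
    then have "h u \<le> \<rho> u u" unfolding h_def by (rule cINF_lower[OF bdd[OF u]])
    then have "h u = 0" using refl[OF u] h0[OF u] by simp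
    then show "G u = 0" by (simp add: G_def)
  next
    fix u assume u: "u \<in> topspace X" and half: "dist (u (gen s)) (abs_rmodz (1 / 2)) \<le> 1 / 16"
    have "\<epsilon>0 \<le> h u"
      unfolding h_def
    proof (rule cINF_greatest[OF Z(1)])
      fix v assume v: "v \<in> Z"
      have "dist (abs_rmodz (1 / 2)) 0 = 1 / 2" by (simp add: dist_rmodz_def circ_half)
      moreover have "dist (abs_rmodz (1 / 2)) 0 \<le> dist (abs_rmodz (1 / 2)) (u (gen s)) + dist (u (gen s)) (v (gen s)) + dist (v (gen s)) 0"
        by (meson add_mono dist_triangle order_refl order_trans)
      moreover have "dist (v (gen s)) 0 \<le> 1 / 16" using v by (simp add: Z_def)
      ultimately have "\<not> dist (u (gen s)) (v (gen s)) < 1 / 8" using half by (simp add: dist_commute)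
      then show "\<epsilon>0 \<le> \<rho> u v" using sep[OF u _ s] v Z(2) by (meson not_less subsetD)
    qed
    then show "G u = 1" using \<epsilon>0 by (simp add: G_def)
  qed
qed

end

section \<open>Separated maps from kernels of the finite models\<close>

context dual_relations
begin

text \<open>
  For a weight \<open>w\<close> on the good part \<open>J'\<close> of \<open>J\<close>, the kernel vector \<open>\<xi> w\<close> equal to \<open>w\<close> on \<open>J'\<close>
  satisfies all the relations modulo \<open>1\<close>. The family \<open>x w j\<close> of its values along the orbit of \<open>j\<close>
  is therefore approximated by a character \<open>\<Phi> w j\<close>, and \<open>j \<mapsto> \<Phi> w j\<close> is approximately equivariant,
  because moving the base point amounts to translating the family. If \<open>w\<close> runs through a grid in
  \<open>[0, 1/2]\<^bsup>J'\<^esup>\<close>, the function of \<open>coordinate_function\<close> at \<open>(s, j) \<in> J'\<close> is \<open>0\<close> or \<open>1\<close> on the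
  faces where \<open>w (s, j)\<close> is \<open>0\<close> or \<open>1/2\<close>. By \<open>cube_attained\<close> every vector with entries in
  \<open>{1/L, \<dots>, 1}\<close> is almost attained, and different vectors require maps that are \<open>\<epsilon>\<close>-separated.
\<close>

lemma separated_maps:
  fixes W W' F :: "'g set"
  assumes \<rho>: "continuous_pseudometric X \<rho>" and \<epsilon>0: "0 < \<epsilon>0"
    and sep: "\<And>u v s. u \<in> topspace X \<Longrightarrow> v \<in> topspace X \<Longrightarrow> s < n \<Longrightarrow> \<rho> u v < \<epsilon>0 \<Longrightarrow> dist (u (gen s)) (v (gen s)) < 1 / 8"
    and W: "0 \<in> W" "W \<subseteq> W'" "\<And>h g. h \<in> F \<Longrightarrow> g \<in> W \<Longrightarrow> - h + g \<in> W'"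
    and \<kappa>2: "0 < \<kappa>2" "\<kappa>2 \<le> 1 / 4" and \<kappa>1: "0 < \<kappa>1" "\<kappa>1 \<le> \<delta> / 2" "\<kappa>1 \<le> \<epsilon> / 4"
    and modulus: "\<And>u v. u \<in> topspace X \<Longrightarrow> v \<in> topspace X \<Longrightarrow> (\<And>s g. s < n \<Longrightarrow> g \<in> W \<Longrightarrow> dist (u (gm s g)) (v (gm s g)) < \<kappa>2) \<Longrightarrow> \<rho> u v < \<kappa>1"
    and approx: "\<And>x. (\<And>l. l < m \<Longrightarrow> ev (f l) x = 0) \<Longrightarrow> \<exists>u\<in>topspace X. \<forall>s<n. \<forall>g\<in>W'. dist (x (s, g)) (u (gm s g)) < \<kappa>2 / 4"
    and D: "0 \<le> D" "\<And>u v. u \<in> topspace X \<Longrightarrow> v \<in> topspace X \<Longrightarrow> \<rho> u v \<le> D"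
    and good: "Gd \<subseteq> {1..d i}" "\<And>j. j \<in> Gd \<Longrightarrow> \<sigma> i 0 j = j"
      "\<And>j h g. j \<in> Gd \<Longrightarrow> h \<in> F \<Longrightarrow> g \<in> W \<Longrightarrow> \<sigma> i (- g) (\<sigma> i h j) = \<sigma> i (- g + h) j"
    and bad: "real (card ({1..d i} - Gd)) \<le> \<gamma>\<^sup>2 * real (d i)" "0 \<le> \<gamma>" "D * \<gamma> < \<delta> / 2"
    and \<epsilon>: "0 < \<epsilon>" "1 \<le> L" "real L * (2 * \<epsilon>) \<le> \<epsilon>0"
    and J: "J \<subseteq> I i" "\<And>k. k \<in> J \<Longrightarrow> MM i (b k) = 0"
      "\<And>k k'. k \<in> J \<Longrightarrow> k' \<in> J \<Longrightarrow> Poly_Mapping.lookup (b k) k' = (if k = k' then 1 else 0)"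
  obtains A where "finite A" "A \<noteq> {}" "A \<subseteq> Maps \<rho> F \<delta> i"
    "\<forall>a\<in>A. \<forall>b\<in>A. a \<noteq> b \<longrightarrow> (\<exists>j\<in>{1..d i}. \<epsilon> < \<rho> (a j) (b j))"
    "card A = L ^ card {k\<in>J. snd k \<in> Gd}"
proof -
  interpret A: adjoint_pair "MM i" "MMa i" C by (rule model_pair)
  define J' where "J' = {k\<in>J. snd k \<in> Gd}"
  have finJ: "finite J'" by (rule finite_subset[of _ "I i"]) (use J(1) in \<open>auto simp: J'_def\<close>)
  have J'I: "k \<in> I i" if "k \<in> J'" for k using that J(1) by (auto simp: J'_def)
  define \<xi> where "\<xi> w = (\<Sum>k\<in>J'. w k *\<^sub>R b k)" for w :: "nat \<times> nat \<Rightarrow> real"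
  have \<xi>_ker: "MM i (\<xi> w) = 0" for w
    unfolding \<xi>_def by (simp add: linear_sum[OF A.linear_M] linear_scale[OF A.linear_M] J(2) J'_def)
  have \<xi>_J: "Poly_Mapping.lookup (\<xi> w) k = w k" if k: "k \<in> J'" for w k
  proof -
    have "Poly_Mapping.lookup (\<xi> w) k = (\<Sum>k'\<in>J'. if k' = k then w k else 0)"
      unfolding \<xi>_def lookup_sum lookup_scaleR using J(3) k by (intro sum.cong) (auto simp: J'_def)
    then show ?thesis using k finJ by simp
  qed
  define x where "x w j k = abs_rmodz (Poly_Mapping.lookup (\<xi> w) (fst k, \<sigma> i (- snd k) j))" for w j and k :: "nat \<times> 'g"
  have "ev (f l) (x w j) = 0" if l: "l < m" for w j l
  proof -
    have abs_sum: "abs_rmodz (\<Sum>i\<in>B. r i) = (\<Sum>i\<in>B. abs_rmodz (r i))" for B and r :: "'z \<Rightarrow> real"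
      by (induction B rule: infinite_finite_induct) (auto simp: abs_rmodz_add)
    have "ev (f l) (x w j) = abs_rmodz (Poly_Mapping.lookup (MM i (\<xi> w)) (l, j))"
      unfolding inverse_family.lookup_mat_op[OF model_family] using l
      by (simp add: ev_def x_def abs_sum imul_abs)
    then show ?thesis by (simp add: \<xi>_ker)
  qed
  then have ex: "\<exists>u. u \<in> topspace X \<and> (\<forall>s<n. \<forall>g\<in>W'. dist (x w j (s, g)) (u (gm s g)) < \<kappa>2 / 4)" for w j
    using approx[of "x w j"] by blast
  define \<Phi> where "\<Phi> w j = (SOME u. u \<in> topspace X \<and> (\<forall>s<n. \<forall>g\<in>W'. dist (x w j (s, g)) (u (gm s g)) < \<kappa>2 / 4))" for w j
  have \<Phi>X: "\<Phi> w j \<in> topspace X"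
    and \<Phi>: "s < n \<Longrightarrow> g \<in> W' \<Longrightarrow> dist (x w j (s, g)) (\<Phi> w j (gm s g)) < \<kappa>2 / 4" for w j s g
    using someI_ex[OF ex[of w j]] unfolding \<Phi>_def[symmetric] by blast+
  \<comment> \<open>characters close to families that are close to each other are themselves close\<close>
  have near: "\<rho> u v < \<kappa>1" if uv: "u \<in> topspace X" "v \<in> topspace X"
    and pq: "\<And>s g. s < n \<Longrightarrow> g \<in> W \<Longrightarrow> dist (p s g) (u (gm s g)) < \<kappa>2 / 4 \<and> dist (q s g) (v (gm s g)) < \<kappa>2 / 4 \<and> dist (p s g) (q s g) \<le> \<kappa>2 / 4"
    for u v p q
  proof (rule modulus[OF uv])
    fix s g assume "s < n" "g \<in> W"
    note * = pq[OF this]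
    have "dist (u (gm s g)) (v (gm s g)) \<le> dist (u (gm s g)) (p s g) + dist (p s g) (v (gm s g))" by (rule dist_triangle)
    also have "dist (p s g) (v (gm s g)) \<le> dist (p s g) (q s g) + dist (q s g) (v (gm s g))" by (rule dist_triangle)
    finally show "dist (u (gm s g)) (v (gm s g)) < \<kappa>2" using * \<kappa>2(1) by (simp add: dist_commute)
  qed
  have nn: "\<And>x y. x \<in> topspace X \<Longrightarrow> y \<in> topspace X \<Longrightarrow> 0 \<le> \<rho> x y"
    and refl: "\<And>x. x \<in> topspace X \<Longrightarrow> \<rho> x x = 0"
    using \<rho> unfolding continuous_pseudometric_def by blast+
  define \<phi> where "\<phi> w = restrict (\<Phi> w) {1..d i}" for w
  have \<phi>: "\<phi> w j = \<Phi> w j" if "j \<in> {1..d i}" for w j using that by (simp add: \<phi>_def)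
  have Maps: "\<phi> w \<in> Maps \<rho> F \<delta> i" for w
  proof -
    have "qmean (d i) (\<lambda>j. \<rho> (\<phi> w (\<sigma> i h j)) (T h (\<phi> w j))) < \<delta>" if h: "h \<in> F" for h
    proof -
      have "qmean (d i) (\<lambda>j. \<rho> (\<phi> w (\<sigma> i h j)) (T h (\<phi> w j))) \<le> qmean (d i) (\<lambda>j. \<kappa>1 + (if j \<in> Gd then 0 else D))"
      proof (rule qmean_mono)
        fix j assume j: "j \<in> {1..d i}"
        have TX: "T h (\<Phi> w j) \<in> topspace X" by (rule act_in[OF \<Phi>X])
        show "0 \<le> \<rho> (\<phi> w (\<sigma> i h j)) (T h (\<phi> w j))"
          unfolding \<phi>[OF j] \<phi>[OF sigma_in[OF j]] by (rule nn[OF \<Phi>X TX])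
        show "\<rho> (\<phi> w (\<sigma> i h j)) (T h (\<phi> w j)) \<le> \<kappa>1 + (if j \<in> Gd then 0 else D)"
          unfolding \<phi>[OF j] \<phi>[OF sigma_in[OF j]]
        proof (cases "j \<in> Gd")
          case True
          have "\<rho> (\<Phi> w (\<sigma> i h j)) (T h (\<Phi> w j)) < \<kappa>1"
          proof (rule near[OF \<Phi>X TX])
            fix s g assume s: "s < n" and g: "g \<in> W"
            have eq: "x w (\<sigma> i h j) (s, g) = x w j (s, - h + g)"
              using good(3)[OF True h g] by (simp add: x_def minus_add)
            have "T h (\<Phi> w j) (gm s g) = \<Phi> w j (gm s (- h + g))"
              by (simp add: T_apply smul_el)
            then show "dist (x w (\<sigma> i h j) (s, g)) (\<Phi> w (\<sigma> i h j) (gm s g)) < \<kappa>2 / 4 \<and>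
                dist (x w j (s, - h + g)) (T h (\<Phi> w j) (gm s g)) < \<kappa>2 / 4 \<and>
                dist (x w (\<sigma> i h j) (s, g)) (x w j (s, - h + g)) \<le> \<kappa>2 / 4"
              using \<Phi>[OF s, of g w "\<sigma> i h j"] \<Phi>[OF s W(3)[OF h g], of w j] W(2) g eq \<kappa>2(1) by auto
          qed
          then show "\<rho> (\<Phi> w (\<sigma> i h j)) (T h (\<Phi> w j)) \<le> \<kappa>1 + (if j \<in> Gd then 0 else D)" using True by simp
        next
          case False
          have "\<rho> (\<Phi> w (\<sigma> i h j)) (T h (\<Phi> w j)) \<le> D" by (rule D(2)[OF \<Phi>X TX])
          then show "\<rho> (\<Phi> w (\<sigma> i h j)) (T h (\<Phi> w j)) \<le> \<kappa>1 + (if j \<in> Gd then 0 else D)" using False \<kappa>1(1) by simp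
        qed
      qed
      also have "\<dots> \<le> qmean (d i) (\<lambda>j. \<kappa>1) + qmean (d i) (\<lambda>j. if j \<in> Gd then 0 else D)" by (rule qmean_triangle)
      also have "qmean (d i) (\<lambda>j. \<kappa>1) = \<kappa>1" using \<kappa>1(1) d_pos by (intro qmean_const) auto
      also have "qmean (d i) (\<lambda>j. if j \<in> Gd then 0 else D) \<le> D * \<gamma>"
      proof (rule qmean_le_card[OF d_pos])
        have "card {j\<in>{1..d i}. (if j \<in> Gd then 0 else D) \<noteq> 0} \<le> card ({1..d i} - Gd)"
          by (intro card_mono) (auto split: if_splits)
        then show "real (card {j\<in>{1..d i}. (if j \<in> Gd then 0 else D) \<noteq> 0}) \<le> \<gamma>\<^sup>2 * real (d i)"
          using bad(1) by linarith
      qed (use D bad in auto)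
      finally show ?thesis using bad(3) \<kappa>1(2) by linarith
    qed
    then show ?thesis using \<Phi>X by (auto simp: Map_set_def rho_2_qmean \<phi>_def)
  qed
  define PG where "PG s G \<longleftrightarrow> (\<forall>u\<in>topspace X. \<forall>v\<in>topspace X. \<bar>G u - G v\<bar> \<le> \<rho> u v / \<epsilon>0) \<and>
    (\<forall>u\<in>topspace X. dist (u (gen s)) 0 \<le> 1 / 16 \<longrightarrow> G u = 0) \<and>
    (\<forall>u\<in>topspace X. dist (u (gen s)) (abs_rmodz (1 / 2)) \<le> 1 / 16 \<longrightarrow> G u = (1 :: real))" for s G
  have exG: "\<exists>G. PG s G" if s: "s < n" for s
  proof (rule coordinate_function[OF \<rho> \<epsilon>0, of s])
    show "dist (u (gen s')) (v (gen s')) < 1 / 8"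
      if "u \<in> topspace X" "v \<in> topspace X" "s' < n" "\<rho> u v < \<epsilon>0" for u v s'
      using sep that by blast
    fix G assume "\<And>u v. u \<in> topspace X \<Longrightarrow> v \<in> topspace X \<Longrightarrow> \<bar>G u - G v\<bar> \<le> \<rho> u v / \<epsilon>0"
      "\<And>u. u \<in> topspace X \<Longrightarrow> dist (u (gen s)) 0 \<le> 1 / 16 \<Longrightarrow> G u = 0"
      "\<And>u. u \<in> topspace X \<Longrightarrow> dist (u (gen s)) (abs_rmodz (1 / 2)) \<le> 1 / 16 \<Longrightarrow> G u = (1 :: real)"
    then have "PG s G" unfolding PG_def by blast
    then show ?thesis by blast
  qed (rule s)
  define G where "G s = (SOME G. PG s G)" for s
  have PG: "PG s (G s)" if "s < n" for s unfolding G_def by (rule someI_ex[OF exG[OF that]])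
  define N where "N = card J'"
  obtain e where e: "bij_betw e {..<N} J'"
    using ex_bij_betw_nat_finite[OF finJ] unfolding N_def atLeast0LessThan by blast
  define pos where "pos = the_inv_into {..<N} e"
  have pos: "pos (e r) = r" if "r < N" for r
    unfolding pos_def using e that by (intro the_inv_into_f_f) (auto simp: bij_betw_def)
  have pos_less: "pos k < N" if "k \<in> J'" for k
    using that e pos by (auto simp: bij_betw_def)
  have eJ: "e r \<in> J'" if "r < N" for r using e that by (auto simp: bij_betw_def)
  define Bs where "Bs = (\<Sum>k\<in>J'. \<Sum>k'\<in>I i. \<bar>Poly_Mapping.lookup (b k) k'\<bar>)"
  have Bs0: "0 \<le> Bs" by (simp add: Bs_def sum_nonneg)
  \<comment> \<open>so fine a grid that a step in it moves every coordinate of \<open>\<xi>\<close> by at most \<open>\<kappa>2 / 4\<close>\<close>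
  define p where "p = Suc (nat \<lceil>Bs * 2 / \<kappa>2\<rceil>)"
  have p: "0 < p" "Bs * (1 / (2 * real p)) \<le> \<kappa>2 / 4"
  proof -
    have "Bs * 2 / \<kappa>2 \<le> real p" unfolding p_def by linarith
    then have "Bs * 2 \<le> real p * \<kappa>2" using \<kappa>2(1) by (simp add: pos_divide_le_eq)
    moreover show "0 < p" by (simp add: p_def)
    ultimately show "Bs * (1 / (2 * real p)) \<le> \<kappa>2 / 4" by (simp add: field_simps)
  qed
  \<comment> \<open>grid points \<open>y\<close> with entries in \<open>{0..p}\<close> correspond to weights in \<open>[0, 1/2]\<close>\<close>
  define wx where "wx y k = real (y (pos k)) / (2 * real p)" for y :: "nat \<Rightarrow> nat" and k
  define Fv where "Fv y r = G (fst (e r)) (\<Phi> (wx y) (snd (e r)))" for y r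
  have e_props: "fst (e r) < n" "snd (e r) \<in> {1..d i}" "snd (e r) \<in> Gd" if "r < N" for r
    using J'I[OF eJ[OF that]] eJ[OF that] by (auto simp: I_def J'_def)
  have near_value: "dist (abs_rmodz (real (y r) / (2 * real p))) (\<Phi> (wx y) (snd (e r)) (gen (fst (e r)))) \<le> 1 / 16" if r: "r < N" for y r
  proof -
    have "x (wx y) (snd (e r)) (fst (e r), 0) = abs_rmodz (Poly_Mapping.lookup (\<xi> (wx y)) (e r))"
      by (simp add: x_def good(2)[OF e_props(3)[OF r]])
    also have "\<dots> = abs_rmodz (real (y r) / (2 * real p))"
      by (simp add: \<xi>_J[OF eJ[OF r]] wx_def pos[OF r])
    finally show ?thesis
      using \<Phi>[OF e_props(1)[OF r], of 0 "wx y" "snd (e r)"] W(1,2) \<kappa>2(2) by (auto simp: scale_one)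
  qed
  have low: "Fv y r = 0" if "r < N" "y r = 0" for y r
    using near_value[OF that(1), of y] PG[OF e_props(1)[OF that(1)]] \<Phi>X that(2)
    by (simp add: Fv_def PG_def dist_commute)
  have high: "Fv y r = 1" if "r < N" "y r = p" for y r
    using near_value[OF that(1), of y] PG[OF e_props(1)[OF that(1)]] \<Phi>X that(2) p(1)
    by (simp add: Fv_def PG_def dist_commute)
  have step: "\<bar>Fv y r - Fv y' r\<bar> \<le> \<kappa>1 / \<epsilon>0" if adj: "\<And>r. r < N \<Longrightarrow> y r \<le> y' r \<and> y' r \<le> y r + 1" and r: "r < N" for y y' r
  proof -
    have w: "\<bar>wx y k - wx y' k\<bar> \<le> 1 / (2 * real p)" if "k \<in> J'" for k
    proof -
      have "\<bar>real (y (pos k)) - real (y' (pos k))\<bar> \<le> 1" using adj[OF pos_less[OF that]] by linarith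
      then have "\<bar>real (y (pos k)) - real (y' (pos k))\<bar> / (2 * real p) \<le> 1 / (2 * real p)" by (intro divide_right_mono) auto
      then show ?thesis by (simp add: wx_def diff_divide_distrib[symmetric])
    qed
    have lk: "\<bar>Poly_Mapping.lookup (\<xi> (wx y)) k' - Poly_Mapping.lookup (\<xi> (wx y')) k'\<bar> \<le> \<kappa>2 / 4" if k': "k' \<in> I i" for k'
    proof -
      have "Poly_Mapping.lookup (\<xi> (wx y)) k' - Poly_Mapping.lookup (\<xi> (wx y')) k' =
        (\<Sum>k\<in>J'. (wx y k - wx y' k) * Poly_Mapping.lookup (b k) k')"
        by (simp add: \<xi>_def Poly_Mapping.lookup_sum lookup_scaleR sum_subtractf left_diff_distrib)
      also have "\<bar>\<dots>\<bar> \<le> (\<Sum>k\<in>J'. \<bar>wx y k - wx y' k\<bar> * \<bar>Poly_Mapping.lookup (b k) k'\<bar>)"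
        by (rule order_trans[OF sum_abs]) (simp add: abs_mult)
      also have "\<dots> \<le> (\<Sum>k\<in>J'. 1 / (2 * real p) * (\<Sum>k'\<in>I i. \<bar>Poly_Mapping.lookup (b k) k'\<bar>))"
        using k' by (intro sum_mono mult_mono w member_le_sum) auto
      also have "\<dots> = Bs * (1 / (2 * real p))" unfolding Bs_def sum_distrib_left[symmetric] by (rule mult.commute)
      finally show ?thesis using p(2) by linarith
    qed
    let ?j = "snd (e r)"
    have "\<rho> (\<Phi> (wx y) ?j) (\<Phi> (wx y') ?j) < \<kappa>1"
    proof (rule near[OF \<Phi>X \<Phi>X])
      fix s g assume s: "s < n" and g: "g \<in> W"
      have "(s, \<sigma> i (- g) ?j) \<in> I i" using s sigma_in[OF e_props(2)[OF r]] by (simp add: I_def)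
      from order_trans[OF dist_abs_rmodz_le lk[OF this]]
      show "dist (x (wx y) ?j (s, g)) (\<Phi> (wx y) ?j (gm s g)) < \<kappa>2 / 4 \<and>
        dist (x (wx y') ?j (s, g)) (\<Phi> (wx y') ?j (gm s g)) < \<kappa>2 / 4 \<and>
        dist (x (wx y) ?j (s, g)) (x (wx y') ?j (s, g)) \<le> \<kappa>2 / 4"
        using \<Phi>[OF s] W(2) g by (auto simp: x_def)
    qed
    moreover have "\<bar>Fv y r - Fv y' r\<bar> \<le> \<rho> (\<Phi> (wx y) ?j) (\<Phi> (wx y') ?j) / \<epsilon>0"
      using PG[OF e_props(1)[OF r]] \<Phi>X unfolding Fv_def PG_def by blast
    ultimately show ?thesis using \<epsilon>0 by (meson divide_right_mono less_imp_le order_trans)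
  qed
  let ?\<T> = "{..<N} \<rightarrow>\<^sub>E {1..L}"
  have ex_q: "\<exists>q. \<forall>r<N. \<bar>Fv q r - real (\<tau> r) / real L\<bar> \<le> \<kappa>1 / \<epsilon>0" if \<tau>: "\<tau> \<in> ?\<T>" for \<tau>
  proof -
    have \<tau>01: "0 < real (\<tau> r) / real L \<and> real (\<tau> r) / real L \<le> 1" if "r < N" for r
    proof -
      have "\<tau> r \<in> {1..L}" by (rule PiE_mem[OF \<tau>]) (simp add: that)
      then show ?thesis using \<epsilon>(2) by simp
    qed
    show ?thesis
    proof (rule cube_attained[of p N Fv "\<kappa>1 / \<epsilon>0" "\<lambda>r. real (\<tau> r) / real L"])
      fix q assume "\<And>r. r < N \<Longrightarrow> \<bar>Fv q r - real (\<tau> r) / real L\<bar> \<le> \<kappa>1 / \<epsilon>0"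
      then show ?thesis by (intro exI[of _ q] allI impI)
    next
      show "Fv y r = 0" if "r < N" "y r = 0" for y r by (rule low[where y = y and r = r, OF that])
      show "Fv y r = 1" if "r < N" "y r = p" for y r by (rule high[where y = y and r = r, OF that])
      show "\<bar>Fv y r - Fv y' r\<bar> \<le> \<kappa>1 / \<epsilon>0"
        if "\<And>r. r < N \<Longrightarrow> y r \<le> y' r \<and> y' r \<le> y r + 1" "r < N" for y y' r
        by (rule step[OF that])
    qed (rule p(1) \<tau>01, assumption?)+
  qed
  define Q where "Q \<tau> = (SOME q. \<forall>r<N. \<bar>Fv q r - real (\<tau> r) / real L\<bar> \<le> \<kappa>1 / \<epsilon>0)" for \<tau> :: "nat \<Rightarrow> nat"
  have Q: "\<bar>Fv (Q \<tau>) r - real (\<tau> r) / real L\<bar> \<le> \<kappa>1 / \<epsilon>0" if "\<tau> \<in> ?\<T>" "r < N" for \<tau> r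
    using someI_ex[OF ex_q[OF that(1)]] that(2) unfolding Q_def[symmetric] by blast
  define \<psi> where "\<psi> \<tau> = \<phi> (wx (Q \<tau>))" for \<tau>
  have separated: "\<exists>j\<in>{1..d i}. \<epsilon> < \<rho> (\<psi> \<tau> j) (\<psi> \<tau>' j)" if \<tau>: "\<tau> \<in> ?\<T>" "\<tau>' \<in> ?\<T>" "\<tau> \<noteq> \<tau>'" for \<tau> \<tau>'
  proof -
    obtain r where r: "r < N" "\<tau> r \<noteq> \<tau>' r" using PiE_ext[OF \<tau>(1,2)] \<tau>(3) by blast
    let ?j = "snd (e r)"
    have L: "0 < real L" using \<epsilon>(2) by simp
    have "1 \<le> \<bar>real (\<tau> r) - real (\<tau>' r)\<bar>" using r(2) by linarith
    then have "1 / real L \<le> \<bar>real (\<tau> r) - real (\<tau>' r)\<bar> / real L" using L by (intro divide_right_mono) auto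
    also have "\<dots> = \<bar>real (\<tau> r) / real L - real (\<tau>' r) / real L\<bar>" by (simp add: diff_divide_distrib[symmetric])
    finally have "1 / real L \<le> \<bar>Fv (Q \<tau>) r - Fv (Q \<tau>') r\<bar> + 2 * (\<kappa>1 / \<epsilon>0)"
      using Q[OF \<tau>(1) r(1)] Q[OF \<tau>(2) r(1)] by linarith
    also have "\<bar>Fv (Q \<tau>) r - Fv (Q \<tau>') r\<bar> \<le> \<rho> (\<psi> \<tau> ?j) (\<psi> \<tau>' ?j) / \<epsilon>0"
      using PG[OF e_props(1)[OF r(1)]] \<Phi>X unfolding Fv_def PG_def \<psi>_def \<phi>[OF e_props(2)[OF r(1)]] by blast
    finally have "1 / real L \<le> (\<rho> (\<psi> \<tau> ?j) (\<psi> \<tau>' ?j) + 2 * \<kappa>1) / \<epsilon>0" by (simp add: add_divide_distrib)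
    then have "\<epsilon>0 * (1 / real L) \<le> \<rho> (\<psi> \<tau> ?j) (\<psi> \<tau>' ?j) + 2 * \<kappa>1" using \<epsilon>0 by (simp add: pos_le_divide_eq mult.commute)
    moreover have "2 * \<epsilon> \<le> \<epsilon>0 * (1 / real L)" using \<epsilon>(3) L by (simp add: pos_le_divide_eq mult.commute)
    ultimately have "\<epsilon> < \<rho> (\<psi> \<tau> ?j) (\<psi> \<tau>' ?j)" using \<kappa>1(3) \<epsilon>(1) by linarith
    then show ?thesis using e_props(2)[OF r(1)] by blast
  qed
  have inj: "inj_on \<psi> ?\<T>"
  proof (rule inj_onI, rule ccontr)
    fix \<tau> \<tau>' assume *: "\<tau> \<in> ?\<T>" "\<tau>' \<in> ?\<T>" "\<psi> \<tau> = \<psi> \<tau>'" "\<tau> \<noteq> \<tau>'"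
    then obtain j where j: "j \<in> {1..d i}" "\<epsilon> < \<rho> (\<psi> \<tau> j) (\<psi> \<tau>' j)" using separated by blast
    have "\<psi> \<tau>' j \<in> topspace X" unfolding \<psi>_def \<phi>[OF j(1)] by (rule \<Phi>X)
    with j(2) *(3) refl \<epsilon>(1) show False by simp
  qed
  show thesis
  proof (rule that[of "\<psi> ` ?\<T>"])
    show "finite (\<psi> ` ?\<T>)" by (intro finite_imageI finite_PiE) auto
    have "(\<lambda>r\<in>{..<N}. 1) \<in> ?\<T>" using \<epsilon>(2) by auto
    then show "\<psi> ` ?\<T> \<noteq> {}" by blast
    show "\<psi> ` ?\<T> \<subseteq> Maps \<rho> F \<delta> i" using Maps by (auto simp: \<psi>_def)
    show "\<forall>a\<in>\<psi> ` ?\<T>. \<forall>b\<in>\<psi> ` ?\<T>. a \<noteq> b \<longrightarrow> (\<exists>j\<in>{1..d i}. \<epsilon> < \<rho> (a j) (b j))"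
      using separated by blast
    show "card (\<psi> ` ?\<T>) = L ^ card {k\<in>J. snd k \<in> Gd}"
      unfolding card_image[OF inj] by (simp add: card_PiE N_def J'_def)
  qed
qed

end

section \<open>Positive metric mean dimension\<close>

context dual_system
begin

lemma eventually_many_good_points:
  assumes F: "finite F" and W: "finite W" and \<beta>: "0 < \<beta>"
  shows "\<forall>\<^sub>F i in sequentially. real (card ({1..d i} -
    {j\<in>{1..d i}. \<sigma> i 0 j = j \<and> (\<forall>h\<in>F. \<forall>g\<in>W. \<sigma> i (- g) (\<sigma> i h j) = \<sigma> i (- g + h) j)})) \<le> \<beta> * real (d i)"
proof -
  have "eventually (\<lambda>z. \<forall>h\<in>F. \<forall>g\<in>W. case z of (i, j) \<Rightarrow> \<sigma> i (- g) (\<sigma> i h j) = \<sigma> i (- g + h) j) (generic d)"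
    by (intro eventually_ball_finite ballI F W generic_mult)
  with generic_zero have "eventually (\<lambda>(i, j). \<sigma> i 0 j = j \<and>
      (\<forall>h\<in>F. \<forall>g\<in>W. \<sigma> i (- g) (\<sigma> i h j) = \<sigma> i (- g + h) j)) (generic d)"
    by eventually_elim auto
  from generic_card_le[OF this \<beta>] show ?thesis
  proof eventually_elim
    case (elim i)
    have "{1..d i} - {j\<in>{1..d i}. \<sigma> i 0 j = j \<and> (\<forall>h\<in>F. \<forall>g\<in>W. \<sigma> i (- g) (\<sigma> i h j) = \<sigma> i (- g + h) j)} =
      {j\<in>{1..d i}. \<not> (case (i, j) of (i, j) \<Rightarrow> \<sigma> i 0 j = j \<and> (\<forall>h\<in>F. \<forall>g\<in>W. \<sigma> i (- g) (\<sigma> i h j) = \<sigma> i (- g + h) j))}"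
      by auto
    then show ?case using elim by simp
  qed
qed

text \<open>
  The finite data are chosen in the order of their dependence: a finite window \<open>W\<close> on which
  closeness of characters implies \<open>\<rho>\<close>-closeness, then a matrix of relations that controls the
  window \<open>W'\<close> needed for translates by \<open>F\<close>, then the coordinates \<open>J\<close> of the kernel of the model.
  At most \<open>(c/8) d/(n + 1)\<close> points are bad, and each of them carries at most \<open>n\<close> elements of \<open>J\<close>,
  so at least half of \<open>J\<close> survives their removal.
\<close>

lemma many_separated_maps:
  assumes c: "0 < c" and \<rho>: "continuous_pseudometric X \<rho>"
    and large: "\<And>m f t. (\<And>l. l < m \<Longrightarrow> (\<Sum>s<n. smul (f l s) (gen s)) = 0) \<Longrightarrow> c \<le> group_matrix.tr_moment m n f t"
    and \<epsilon>0: "0 < \<epsilon>0"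
    and sep: "\<And>u v s. u \<in> topspace X \<Longrightarrow> v \<in> topspace X \<Longrightarrow> s < n \<Longrightarrow> \<rho> u v < \<epsilon>0 \<Longrightarrow> dist (u (gen s)) (v (gen s)) < 1 / 8"
    and F: "finite F" and \<delta>: "0 < \<delta>" and \<epsilon>: "0 < \<epsilon>" "1 \<le> L" "real L * (2 * \<epsilon>) \<le> \<epsilon>0"
  shows "\<forall>\<^sub>F i in sequentially. \<exists>A N. finite A \<and> A \<noteq> {} \<and> A \<subseteq> Maps \<rho> F \<delta> i \<and>
      (\<forall>a\<in>A. \<forall>b\<in>A. a \<noteq> b \<longrightarrow> (\<exists>j\<in>{1..d i}. \<epsilon> < \<rho> (a j) (b j))) \<and>
      card A = L ^ N \<and> c / 8 * real (d i) \<le> real N"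
proof -
  define \<kappa>1 where "\<kappa>1 = min (\<delta> / 2) (\<epsilon> / 4)"
  have \<kappa>1: "0 < \<kappa>1" "\<kappa>1 \<le> \<delta> / 2" "\<kappa>1 \<le> \<epsilon> / 4" using \<delta> \<epsilon> by (simp_all add: \<kappa>1_def)
  define p where "p h u v = (if fst h < n then dist (u (gm (fst h) (snd h))) (v (gm (fst h) (snd h))) else 0)"
    for h :: "nat \<times> 'g" and u v :: "'a \<Rightarrow> rmodz"
  have p_cont: "continuous_map (prod_topology X X) euclideanreal (\<lambda>(u, v). p h u v)" for h
    using continuous_eval_dist[of "gm (fst h) (snd h)"] by (simp add: p_def case_prod_unfold)
  have p_sep: "\<exists>h. 0 < p h u v" if "u \<in> topspace X" "v \<in> topspace X" "u \<noteq> v" for u v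
  proof -
    note uv = that
    obtain s g where "s < n" "u (gm s g) \<noteq> v (gm s g)"
      using characters_separated[OF uv] by blast
    then have "0 < p (s, g) u v" by (simp add: p_def)
    then show ?thesis by blast
  qed
  obtain E \<kappa> where E: "finite E" "0 < \<kappa>"
    and E_le: "\<And>u v. u \<in> topspace X \<Longrightarrow> v \<in> topspace X \<Longrightarrow> (\<And>h. h \<in> E \<Longrightarrow> p h u v < \<kappa>) \<Longrightarrow> \<rho> u v < \<kappa>1"
  proof (rule separation_modulus[OF \<rho> p_cont p_sep \<kappa>1(1)])
    fix E \<kappa> assume "finite E" "0 < \<kappa>"
      "\<And>u v. u \<in> topspace X \<Longrightarrow> v \<in> topspace X \<Longrightarrow> (\<And>h. h \<in> E \<Longrightarrow> p h u v < \<kappa>) \<Longrightarrow> \<rho> u v < \<kappa>1"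
    then show thesis by (rule that)
  qed
  define \<kappa>2 where "\<kappa>2 = min \<kappa> (1 / 4)"
  have \<kappa>2: "0 < \<kappa>2" "\<kappa>2 \<le> 1 / 4" "\<kappa>2 \<le> \<kappa>" using E(2) by (simp_all add: \<kappa>2_def)
  define W where "W = insert 0 (snd ` E)"
  define W' where "W' = W \<union> (\<lambda>(h, g). - h + g) ` (F \<times> W)"
  have W: "finite W" "0 \<in> W" "W \<subseteq> W'" "finite W'" using E(1) F by (auto simp: W_def W'_def)
  have W'_mem: "- h + g \<in> W'" if "h \<in> F" "g \<in> W" for h g using that by (auto simp: W'_def)
  have modulus: "\<rho> u v < \<kappa>1" if u: "u \<in> topspace X" and v: "v \<in> topspace X"
    and close: "\<And>s g. s < n \<Longrightarrow> g \<in> W \<Longrightarrow> dist (u (gm s g)) (v (gm s g)) < \<kappa>2" for u v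
  proof (rule E_le[OF u v])
    fix h assume "h \<in> E"
    then have "snd h \<in> W" by (simp add: W_def)
    then show "p h u v < \<kappa>" using close[of "fst h" "snd h"] \<kappa>2(3) E(2) by (auto simp: p_def)
  qed
  have "0 < \<kappa>2 / 4" using \<kappa>2 by simp
  obtain m :: nat and f where rel: "\<And>l. l < m \<Longrightarrow> (\<Sum>s<n. smul (f l s) (gen s)) = 0"
    and approx: "\<And>x. (\<And>l. l < m \<Longrightarrow> ev (f l) x = 0) \<Longrightarrow>
      \<exists>u\<in>topspace X. \<forall>s<n. \<forall>g\<in>W'. dist (x (s, g)) (u (gm s g)) < \<kappa>2 / 4"
  proof (rule finitely_many_relations[OF W(4) \<open>0 < \<kappa>2 / 4\<close>])
    fix m :: nat and f assume "\<And>l. l < m \<Longrightarrow> (\<Sum>s<n. smul (f l s) (gen s)) = 0"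
      "\<And>x. (\<And>l. l < m \<Longrightarrow> ev (f l) x = 0) \<Longrightarrow>
        \<exists>u\<in>topspace X. \<forall>s<n. \<forall>g\<in>W'. dist (x (s, g)) (u (gm s g)) < \<kappa>2 / 4"
    then show thesis by (rule that)
  qed
  interpret R: dual_relations d \<sigma> smul n gen m f
    by unfold_locales (rule rel)
  obtain D where D: "0 < D" "\<And>u v. u \<in> topspace X \<Longrightarrow> v \<in> topspace X \<Longrightarrow> \<rho> u v \<le> D"
    using pseudometric_bounded[OF \<rho>] by metis
  \<comment> \<open>the quadratic mean of a defect \<open>D\<close> on a proportion \<open>\<gamma>\<^sup>2\<close> of the points is \<open>D \<gamma> < \<delta>/2\<close>\<close>
  define \<gamma> where "\<gamma> = \<delta> / (4 * D)"
  have \<gamma>: "0 < \<gamma>" "D * \<gamma> < \<delta> / 2" using \<delta> D(1) by (simp_all add: \<gamma>_def)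
  define \<beta> where "\<beta> = min (\<gamma>\<^sup>2) (c / (8 * (real n + 1)))"
  have \<beta>: "0 < \<beta>" using \<gamma>(1) c by (simp add: \<beta>_def)
  have n\<beta>: "real n * \<beta> \<le> c / 8"
  proof -
    have "real n * \<beta> \<le> (real n + 1) * (c / (8 * (real n + 1)))"
      using \<beta> by (intro mult_mono) (auto simp: \<beta>_def)
    also have "\<dots> = c / 8" by (simp add: field_simps)
    finally show ?thesis .
  qed
  define Gd where "Gd i = {j\<in>{1..d i}. \<sigma> i 0 j = j \<and> (\<forall>h\<in>F. \<forall>g\<in>W. \<sigma> i (- g) (\<sigma> i h j) = \<sigma> i (- g + h) j)}" for i
  have "\<forall>\<^sub>F i in sequentially. real (card ({1..d i} - Gd i)) \<le> \<beta> * real (d i)"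
    unfolding Gd_def by (rule eventually_many_good_points[OF F W(1) \<beta>])
  moreover have "c \<le> R.tr_moment t" for t by (rule large[OF rel])
  note R.kernel_dimension[OF c this]
  ultimately show ?thesis
  proof eventually_elim
    case (elim i)
    have lin: "linear (R.MM i)" by (rule adjoint_pair.linear_M[OF R.model_pair])
    obtain J b where J: "J \<subseteq> R.I i"
      "\<And>x. Poly_Mapping.keys x \<subseteq> R.I i \<Longrightarrow> R.MM i x = 0 \<Longrightarrow> (\<And>k. k \<in> J \<Longrightarrow> Poly_Mapping.lookup x k = 0) \<Longrightarrow> x = 0"
      "\<And>k. k \<in> J \<Longrightarrow> Poly_Mapping.keys (b k) \<subseteq> R.I i \<and> R.MM i (b k) = 0"
      "\<And>k k'. k \<in> J \<Longrightarrow> k' \<in> J \<Longrightarrow> Poly_Mapping.lookup (b k) k' = (if k = k' then 1 else 0)"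
    proof (rule dual_basis_of_kernel[OF lin R.finite_I[of i]])
      fix J b assume "J \<subseteq> R.I i"
        "\<And>x. Poly_Mapping.keys x \<subseteq> R.I i \<Longrightarrow> R.MM i x = 0 \<Longrightarrow> (\<And>k. k \<in> J \<Longrightarrow> Poly_Mapping.lookup x k = 0) \<Longrightarrow> x = 0"
        "\<And>k. k \<in> J \<Longrightarrow> Poly_Mapping.keys (b k) \<subseteq> R.I i \<and> R.MM i (b k) = 0"
        "\<And>k k'. k \<in> J \<Longrightarrow> k' \<in> J \<Longrightarrow> Poly_Mapping.lookup (b k) k' = (if k = k' then 1 else 0)"
      then show thesis by (rule that)
    qed
    have cardJ: "c / 4 * real (d i) \<le> real (card J)"
      using elim(2)[rule_format, OF J(1)] J(2) by blast
    have bad: "real (card ({1..d i} - Gd i)) \<le> \<gamma>\<^sup>2 * real (d i)"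
      by (rule order_trans[OF elim(1)]) (auto simp: \<beta>_def intro!: mult_right_mono)
    have gd: "Gd i \<subseteq> {1..d i}" "\<And>j. j \<in> Gd i \<Longrightarrow> \<sigma> i 0 j = j"
      "\<And>j h g. j \<in> Gd i \<Longrightarrow> h \<in> F \<Longrightarrow> g \<in> W \<Longrightarrow> \<sigma> i (- g) (\<sigma> i h j) = \<sigma> i (- g + h) j"
      by (auto simp: Gd_def)
    have ker: "\<And>k. k \<in> J \<Longrightarrow> R.MM i (b k) = 0" using J(3) by blast
    have separated: "\<exists>A. finite A \<and> A \<noteq> {} \<and> A \<subseteq> Maps \<rho> F \<delta> i \<and>
      (\<forall>a\<in>A. \<forall>b\<in>A. a \<noteq> b \<longrightarrow> (\<exists>j\<in>{1..d i}. \<epsilon> < \<rho> (a j) (b j))) \<and>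
      card A = L ^ card {k\<in>J. snd k \<in> Gd i}"
    proof (rule R.separated_maps[OF \<rho> \<epsilon>0, where F = F and \<delta> = \<delta> and \<epsilon> = \<epsilon> and W = W and W' = W' and ?\<kappa>2.0 = \<kappa>2 and ?\<kappa>1.0 = \<kappa>1
          and D = D and Gd = "Gd i" and \<gamma> = \<gamma> and L = L and J = J and b = b and i = i])
      show "\<And>u v s. u \<in> topspace X \<Longrightarrow> v \<in> topspace X \<Longrightarrow> s < n \<Longrightarrow> \<rho> u v < \<epsilon>0 \<Longrightarrow> dist (u (gen s)) (v (gen s)) < 1 / 8"
        by (rule sep)
      show "\<And>u v. u \<in> topspace X \<Longrightarrow> v \<in> topspace X \<Longrightarrow>
        (\<And>s g. s < n \<Longrightarrow> g \<in> W \<Longrightarrow> dist (u (gm s g)) (v (gm s g)) < \<kappa>2) \<Longrightarrow> \<rho> u v < \<kappa>1"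
        by (rule modulus)
      show "\<And>x. (\<And>l. l < m \<Longrightarrow> ev (f l) x = 0) \<Longrightarrow>
        \<exists>u\<in>topspace X. \<forall>s<n. \<forall>g\<in>W'. dist (x (s, g)) (u (gm s g)) < \<kappa>2 / 4"
        by (rule approx)
      show "\<And>k k'. k \<in> J \<Longrightarrow> k' \<in> J \<Longrightarrow> Poly_Mapping.lookup (b k) k' = (if k = k' then 1 else 0)"
        by (rule J(4))
      show "0 \<le> D" "0 \<le> \<gamma>" using D(1) \<gamma>(1) by simp_all
      fix A assume "finite A" "A \<noteq> {}" "A \<subseteq> Maps \<rho> F \<delta> i"
        "\<forall>a\<in>A. \<forall>b\<in>A. a \<noteq> b \<longrightarrow> (\<exists>j\<in>{1..d i}. \<epsilon> < \<rho> (a j) (b j))"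
        "card A = L ^ card {k\<in>J. snd k \<in> Gd i}"
      then show ?thesis by blast
    qed (fact W W'_mem \<kappa>2 \<kappa>1 D(2) gd bad \<gamma>(2) \<epsilon> J(1) ker)+
    have finJ: "finite J" using J(1) R.finite_I finite_subset by blast
    have "J \<subseteq> {k\<in>J. snd k \<in> Gd i} \<union> ({..<n} \<times> ({1..d i} - Gd i))"
    proof
      fix k assume k: "k \<in> J"
      with J(1) have "k \<in> {..<n} \<times> {1..d i}" unfolding R.I_def by (rule subsetD)
      then show "k \<in> {k\<in>J. snd k \<in> Gd i} \<union> ({..<n} \<times> ({1..d i} - Gd i))" using k by (simp add: mem_Times_iff)
    qed
    then have "card J \<le> card ({k\<in>J. snd k \<in> Gd i} \<union> ({..<n} \<times> ({1..d i} - Gd i)))"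
    proof (rule card_mono[rotated])
      have "finite {k\<in>J. snd k \<in> Gd i}" by (rule finite_subset[OF _ finJ]) (rule Collect_restrict)
      then show "finite ({k\<in>J. snd k \<in> Gd i} \<union> ({..<n} \<times> ({1..d i} - Gd i)))"
        by (intro finite_UnI finite_cartesian_product finite_lessThan finite_Diff finite_atLeastAtMost)
    qed
    also have "\<dots> \<le> card {k\<in>J. snd k \<in> Gd i} + card ({..<n} \<times> ({1..d i} - Gd i))" by (rule card_Un_le)
    finally have "real (card J) \<le> real (card {k\<in>J. snd k \<in> Gd i}) + real n * real (card ({1..d i} - Gd i))"
      by (simp add: card_cartesian_product flip: of_nat_mult of_nat_add)
    also have "real n * real (card ({1..d i} - Gd i)) \<le> real n * (\<beta> * real (d i))"
      by (intro mult_left_mono elim(1)) auto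
    also have "\<dots> \<le> c / 8 * real (d i)"
      using mult_right_mono[OF n\<beta>, of "real (d i)"] by (simp add: mult.assoc)
    finally have "c / 8 * real (d i) \<le> real (card {k\<in>J. snd k \<in> Gd i})" using cardJ by simp
    with separated show ?case by (elim exE, intro exI conjI) (assumption | elim conjE)+
  qed
qed

theorem metric_mdim_ge_of_moments:
  assumes c: "0 < c" and \<rho>: "compatible_metric X \<rho>"
    and large: "\<And>m f t. (\<And>l. l < m \<Longrightarrow> (\<Sum>s<n. smul (f l s) (gen s)) = 0) \<Longrightarrow> c \<le> group_matrix.tr_moment m n f t"
  shows "ereal (c / 16) \<le> metric_mdim_wrt d \<sigma> X T \<rho>"
proof -
  have cont: "continuous_pseudometric X \<rho>" by (rule compatible_continuous[OF \<rho>])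
  then have \<rho>_cont: "continuous_map (prod_topology X X) euclideanreal (\<lambda>(x, y). \<rho> x y)"
    by (simp add: continuous_pseudometric_def)
  interpret MS: Metric_space "topspace X" \<rho> using \<rho> by (simp add: compatible_metric_def)
  \<comment> \<open>a family with a single member: closeness for \<open>\<rho>\<close> alone implies closeness at the generators\<close>
  obtain E :: "unit set" and \<epsilon>0 where \<epsilon>0: "0 < \<epsilon>0"
    and E: "\<And>u v. u \<in> topspace X \<Longrightarrow> v \<in> topspace X \<Longrightarrow> (\<And>h. h \<in> E \<Longrightarrow> \<rho> u v < \<epsilon>0) \<Longrightarrow> rho0 u v < 1 / 8"
  proof (rule separation_modulus[OF continuous_rho0, of "\<lambda>_ :: unit. \<rho>" "1 / 8"])
    show "continuous_map (prod_topology X X) euclideanreal (\<lambda>(x, y). \<rho> x y)" by (rule \<rho>_cont)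
    show "\<exists>h :: unit. 0 < \<rho> x y" if "x \<in> topspace X" "y \<in> topspace X" "x \<noteq> y" for x y
      using MS.mdist_pos_less[OF that(3,1,2)] by simp
    show "0 < (1 / 8 :: real)" by simp
    fix E :: "unit set" and \<kappa> assume "finite E" and E: "0 < \<kappa>"
      "\<And>u v. u \<in> topspace X \<Longrightarrow> v \<in> topspace X \<Longrightarrow> (\<And>h. h \<in> E \<Longrightarrow> \<rho> u v < \<kappa>) \<Longrightarrow> rho0 u v < 1 / 8"
    from E show thesis by (rule that)
  qed
  have sep: "dist (u (gen s)) (v (gen s)) < 1 / 8"
    if "u \<in> topspace X" "v \<in> topspace X" "s < n" "\<rho> u v < \<epsilon>0" for u v s
    using E[OF that(1,2)] that(4) dist_le_rho0[OF that(3), of u v] by (meson le_less_trans)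
  define D where "D = - (c / 8 * ln (\<epsilon>0 / 4))"
  have "ereal ((c / 8) / 2) \<le> metric_mdim_wrt d \<sigma> X T \<rho>"
  proof (rule metric_mdim_ge[where D = D and ?\<epsilon>0.0 = "min 1 (\<epsilon>0 / 4)"])
    show "0 < c / 8" "0 < min 1 (\<epsilon>0 / 4)" using c \<epsilon>0 by simp_all
    fix \<epsilon> F \<delta> assume \<epsilon>: "0 < \<epsilon>" "\<epsilon> < min 1 (\<epsilon>0 / 4)" and F: "finite (F :: 'g set)" and \<delta>: "0 < (\<delta> :: real)"
    \<comment> \<open>at least \<open>\<epsilon>0 / (4 \<epsilon>)\<close>, so that its logarithm is \<open>|ln \<epsilon>|\<close> up to a constant\<close>
    define L where "L = nat \<lfloor>\<epsilon>0 / (2 * \<epsilon>)\<rfloor>"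
    have ratio: "2 < \<epsilon>0 / (2 * \<epsilon>)" using \<epsilon> by (simp add: field_simps)
    then have L: "real L \<le> \<epsilon>0 / (2 * \<epsilon>)" "\<epsilon>0 / (2 * \<epsilon>) - 1 \<le> real L" unfolding L_def by linarith+
    have L1: "1 \<le> L" using ratio unfolding L_def by linarith
    have L\<epsilon>: "real L * (2 * \<epsilon>) \<le> \<epsilon>0" using L(1) \<epsilon>(1) by (simp add: pos_le_divide_eq)
    have "\<epsilon>0 / (4 * \<epsilon>) = \<epsilon>0 / (2 * \<epsilon>) / 2" by simp
    then have L2: "\<epsilon>0 / (4 * \<epsilon>) \<le> real L" using L(2) ratio by linarith
    have lnL: "ln (\<epsilon>0 / 4) + \<bar>ln \<epsilon>\<bar> \<le> ln (real L)"
    proof -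
      have "ln (\<epsilon>0 / (4 * \<epsilon>)) \<le> ln (real L)" using L2 \<epsilon>0 \<epsilon> by (simp add: ln_mono)
      moreover have "ln (\<epsilon>0 / (4 * \<epsilon>)) = ln (\<epsilon>0 / 4) - ln \<epsilon>"
        using \<epsilon>0 \<epsilon>(1) ln_div[of "\<epsilon>0 / 4" \<epsilon>] by (simp add: divide_divide_eq_left)
      moreover have "\<bar>ln \<epsilon>\<bar> = - ln \<epsilon>" using \<epsilon> by (simp add: ln_less_zero abs_of_neg)
      ultimately show ?thesis by simp
    qed
    have many: "\<forall>\<^sub>F i in sequentially. \<exists>A N. finite A \<and> A \<noteq> {} \<and> A \<subseteq> Maps \<rho> F \<delta> i \<and>
      (\<forall>a\<in>A. \<forall>b\<in>A. a \<noteq> b \<longrightarrow> (\<exists>j\<in>{1..d i}. \<epsilon> < \<rho> (a j) (b j))) \<and>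
      card A = L ^ N \<and> c / 8 * real (d i) \<le> real N"
      by (rule many_separated_maps[where ?\<epsilon>0.0 = \<epsilon>0])
        ((rule c cont large \<epsilon>0 sep F \<delta> \<epsilon>(1) L1 L\<epsilon>; assumption?)+)
    show "\<forall>\<^sub>F i in sequentially. \<exists>A. finite A \<and> A \<noteq> {} \<and> A \<subseteq> Maps \<rho> F \<delta> i \<and>
      (\<forall>a\<in>A. \<forall>b\<in>A. a \<noteq> b \<longrightarrow> (\<exists>j\<in>{1..d i}. \<epsilon> < \<rho> (a j) (b j))) \<and>
      (c / 8 * \<bar>ln \<epsilon>\<bar> - D) * real (d i) \<le> ln (real (card A))"
      using many
    proof eventually_elim
      case (elim i)
      then obtain A N where A: "finite A" "A \<noteq> {}" "A \<subseteq> Maps \<rho> F \<delta> i"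
        "\<forall>a\<in>A. \<forall>b\<in>A. a \<noteq> b \<longrightarrow> (\<exists>j\<in>{1..d i}. \<epsilon> < \<rho> (a j) (b j))"
        and N: "card A = L ^ N" "c / 8 * real (d i) \<le> real N" by (elim exE conjE)
      have "(c / 8 * \<bar>ln \<epsilon>\<bar> - D) * real (d i) = c / 8 * real (d i) * (ln (\<epsilon>0 / 4) + \<bar>ln \<epsilon>\<bar>)"
        by (simp add: D_def algebra_simps)
      also have "\<dots> \<le> c / 8 * real (d i) * ln (real L)" using c by (intro mult_left_mono lnL) auto
      also have "\<dots> \<le> real N * ln (real L)" using L1 by (intro mult_right_mono N(2)) auto
      also have "\<dots> = ln (real (card A))" using L1 by (simp add: N(1) ln_realpow)
      finally show ?case using A by blast
    qed
  qed
  then show ?thesis by simp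
qed

end


section \<open>Orders of finite subgroups and the values of the von Neumann dimension\<close>

text \<open>
  Every order of a finite subgroup divides \<open>B!\<close>.
\<close>

lemma order_group_discrete:
  assumes B: "\<And>H :: 'g::group_add set. finite_subgroup H \<Longrightarrow> card H \<le> B"
    and q: "q \<in> order_group TYPE('g)"
  shows "of_nat (fact B) * q \<in> \<int>"
  using q unfolding order_group_def
proof (induction rule: group_closure.induct)
  case (base s)
  then consider "s = 0" | "s \<in> {1 / of_nat (card H) |H :: 'g set. finite_subgroup H}" by blast
  then show ?case
  proof cases
    case 2
    then obtain H :: "'g set" where H: "finite_subgroup H" "s = 1 / of_nat (card H)" by auto
  have "0 < card H" using H(1) by (auto simp: finite_subgroup_def card_gt_0_iff)
  then have "card H dvd fact B" using B[OF H(1)] by (intro dvd_fact) auto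
  then obtain k where "fact B = card H * k" by (auto simp: dvd_def)
  then have "of_nat (fact B) * s = of_nat k" using H(2) \<open>0 < card H\<close> by simp
  then show ?thesis by simp
  qed simp
next
  case (diff s t)
  then show ?case unfolding right_diff_distrib by (intro Ints_diff)
qed

text \<open>
  The dimension is a nonnegative element of \<open>(1/B!)\<int>\<close>, and the moments decrease to it.
\<close>

lemma small_dimension_vanishes:
  fixes f :: "nat \<Rightarrow> nat \<Rightarrow> ('g::group_add \<Rightarrow>\<^sub>0 int)"
  assumes "strong_atiyah TYPE('g)" and B: "\<And>H :: 'g set. finite_subgroup H \<Longrightarrow> card H \<le> B"
  shows "group_matrix.tr_moment m n f \<longlonglongrightarrow> 0 \<or> (\<forall>t. 1 / fact B \<le> group_matrix.tr_moment m n f t)"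
proof -
  interpret group_matrix m n f .
  have "vn_dim n (conv_ker m n f) \<in> of_rat ` order_group TYPE('g)"
    using assms(1) by (simp add: strong_atiyah_def)
  then obtain q where q: "q \<in> order_group TYPE('g)" "complex_of_real (lim tr_moment) = of_rat q"
    unfolding vn_dim_conv_ker(1) by blast
  have "complex_of_real (lim tr_moment) = complex_of_real (of_rat q)" unfolding q(2)
    by (cases q) (simp add: of_rat_rat)
  then have lim: "lim tr_moment = of_rat q" by (simp only: of_real_eq_iff)
  obtain k where k: "of_nat (fact B) * q = of_int k"
    using order_group_discrete[OF B q(1)] by (auto elim: Ints_cases)
  have "of_rat (of_nat (fact B) * q) = (of_rat (of_int k) :: real)" by (simp only: k)
  then have limk: "fact B * lim tr_moment = of_int k" 
    unfolding of_rat_mult of_rat_of_nat_eq of_rat_of_int_eq by (simp add: lim)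
  have "0 \<le> lim tr_moment"
    by (rule LIMSEQ_le_const[OF vn_dim_conv_ker(2)]) (auto simp: tr_moment_def intro!: sum_nonneg GA.moment_nonneg)
  then have "0 \<le> real_of_int k" by (simp flip: limk)
  then consider "k = 0" | "1 \<le> k" by linarith
  then show ?thesis
  proof cases
    case 1
    then have "lim tr_moment = 0" using limk by simp
    then show ?thesis using vn_dim_conv_ker(2) by simp
  next
    case 2
    then have "1 \<le> fact B * lim tr_moment" by (simp add: limk)
    then have "1 / fact B \<le> lim tr_moment" by (simp add: pos_divide_le_eq mult.commute)
    then show ?thesis
      using decseq_ge[OF vn_dim_conv_ker(3,2)] order_trans by blast
  qed
qed

section \<open>The dichotomy\<close>

text \<open>
  By \<open>small_dimension_vanishes\<close>, either some matrix of relations has vanishing kernel dimension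
  and bounds the entropy, or all of them have the common lower bound \<open>1/B!\<close> and the metric mean
  dimension is positive.
\<close>

lemma (in dual_system) metric_mdim_zero_iff:
  assumes "strong_atiyah TYPE('g)" and B: "\<And>H :: 'g set. finite_subgroup H \<Longrightarrow> card H \<le> B"
    and "countable (UNIV :: 'a set)"
  shows "metric_mdim d \<sigma> X T = 0 \<longleftrightarrow> sofic_entropy d \<sigma> X T < \<infinity>"
proof
  assume fin: "sofic_entropy d \<sigma> X T < \<infinity>"
  obtain \<rho> where \<rho>: "compatible_metric X \<rho>"
    using metrizable_dual[OF assms(3)] unfolding metrizable_space_def compatible_metric_def
    by (metis Metric_space.topspace_mtopology)
  have "metric_mdim_wrt d \<sigma> X T \<rho> \<le> 0"
    using metric_mdim_le_0[OF compatible_continuous[OF \<rho>]] fin entropy_eq[OF compatible_generating[OF \<rho>]] by simp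
  then have "metric_mdim d \<sigma> X T \<le> 0"
    unfolding metric_mdim_def using \<rho> by (intro INF_lower2[of \<rho>]) auto
  moreover have "0 \<le> metric_mdim d \<sigma> X T"
    unfolding metric_mdim_def
  proof (rule INF_greatest)
    fix \<rho> assume "\<rho> \<in> {\<rho>. compatible_metric X \<rho>}"
    then show "0 \<le> metric_mdim_wrt d \<sigma> X T \<rho>"
      by (intro metric_mdim_nonneg[of "\<lambda>_. 0"]) (auto simp: dual_act_def Modules.additive_def)
  qed
  ultimately show "metric_mdim d \<sigma> X T = 0" by (rule antisym)
next
  assume zero: "metric_mdim d \<sigma> X T = 0"
  show "sofic_entropy d \<sigma> X T < \<infinity>"
  proof (cases "\<exists>(m :: nat) f. (\<forall>l<m. (\<Sum>s<n. smul (f l s) (gen s)) = 0) \<and> group_matrix.tr_moment m n f \<longlonglongrightarrow> 0")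
    case True
    then obtain m :: nat and f where rel: "\<And>l. l < m \<Longrightarrow> (\<Sum>s<n. smul (f l s) (gen s)) = 0"
      and lim: "group_matrix.tr_moment m n f \<longlonglongrightarrow> 0" by blast
    interpret R: dual_relations d \<sigma> smul n gen m f by unfold_locales (rule rel)
    show ?thesis by (rule R.entropy_finite[OF lim])
  next
    case False
    have "1 / fact B \<le> group_matrix.tr_moment m n f t"
      if "\<And>l. l < m \<Longrightarrow> (\<Sum>s<n. smul (f l s) (gen s)) = 0" for m f t
      using False small_dimension_vanishes[OF assms(1) B, of m n f] that by blast
    then have "ereal (1 / fact B / 16) \<le> metric_mdim_wrt d \<sigma> X T \<rho>" if "compatible_metric X \<rho>" for \<rho>
      by (intro metric_mdim_ge_of_moments that) auto
    then have "ereal (1 / fact B / 16) \<le> metric_mdim d \<sigma> X T"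
      unfolding metric_mdim_def by (intro INF_greatest) auto
    moreover have "0 < ereal (1 / fact B / 16)" by simp
    ultimately show ?thesis using zero leD by metis
  qed
qed

text \<open>
  A finitely supported function is determined by the finite graph of its restriction to the
  support.
\<close>

lemma countable_poly_mapping:
  fixes A :: "('k::countable \<Rightarrow>\<^sub>0 'v::{countable, zero}) set"
  shows "countable A"
proof -
  let ?graph = "\<lambda>x :: 'k \<Rightarrow>\<^sub>0 'v. (\<lambda>k. (k, Poly_Mapping.lookup x k)) ` Poly_Mapping.keys x"
  have "inj ?graph"
  proof (rule injI, rule poly_mapping_eqI)
    fix x y :: "'k \<Rightarrow>\<^sub>0 'v" and k
    assume eq: "?graph x = ?graph y"
    have "v \<noteq> 0 \<and> Poly_Mapping.lookup z k = v \<longleftrightarrow> (k, v) \<in> ?graph z" for z v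
      by (auto simp: in_keys_iff)
    then show "Poly_Mapping.lookup x k = Poly_Mapping.lookup y k" using eq by metis
  qed
  moreover have "countable (range ?graph)"
    by (rule countable_subset[OF _ countable_Collect_finite]) auto
  ultimately have "countable (UNIV :: ('k \<Rightarrow>\<^sub>0 'v) set)" by (metis countable_image_inj_eq)
  then show ?thesis by (rule countable_subset[OF subset_UNIV])
qed

lemma finitely_generated_enumeration:
  assumes "finitely_generated smul"
  obtains n and gen :: "nat \<Rightarrow> 'a::ab_group_add" where "\<And>x. \<exists>c. x = (\<Sum>s<n. smul (c s) (gen s))"
proof -
  obtain S :: "'a set" where S: "finite S" "\<And>a. \<exists>c. a = (\<Sum>s\<in>S. smul (c s) s)"
    using assms unfolding finitely_generated_def by blast
  obtain gen :: "nat \<Rightarrow> 'a" where gen: "bij_betw gen {0..<card S} S"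
    using ex_bij_betw_nat_finite[OF S(1)] by blast
  have "\<exists>c. x = (\<Sum>s<card S. smul (c s) (gen s))" for x
  proof -
    obtain c where "x = (\<Sum>s\<in>S. smul (c s) s)" using S(2) by blast
    also have "\<dots> = (\<Sum>s<card S. smul (c (gen s)) (gen s))"
      using sum.reindex_bij_betw[OF gen, of "\<lambda>s. smul (c s) s"] by (simp add: lessThan_atLeast0)
    finally show ?thesis by (rule exI[of _ "\<lambda>s. c (gen s)"])
  qed
  then show thesis by (rule that)
qed

lemma countable_finitely_generated:
  fixes smul :: "('g::{group_add, countable} \<Rightarrow>\<^sub>0 int) \<Rightarrow> 'a::ab_group_add \<Rightarrow> 'a" and n :: nat
  assumes "\<And>x. \<exists>c. x = (\<Sum>s<n. smul (c s) (gen s))"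
  shows "countable (UNIV :: 'a set)"
proof -
  have "UNIV \<subseteq> (\<lambda>c. \<Sum>s<n. smul (c s) (gen s)) ` ({..<n} \<rightarrow>\<^sub>E UNIV)"
  proof
    fix x
    obtain c where "x = (\<Sum>s<n. smul (c s) (gen s))" using assms by blast
    then have "x = (\<Sum>s<n. smul (restrict c {..<n} s) (gen s))" by simp
    then show "x \<in> (\<lambda>c. \<Sum>s<n. smul (c s) (gen s)) ` ({..<n} \<rightarrow>\<^sub>E UNIV)" by (rule image_eqI[where x = "restrict c {..<n}"]) simp
  qed
  moreover have "countable ({..<n} \<rightarrow>\<^sub>E (UNIV :: ('g \<Rightarrow>\<^sub>0 int) set))"
    by (intro countable_PiE countable_poly_mapping) simp
  ultimately show ?thesis by (rule countable_subset[OF _ countable_image])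
qed

theorem theorem6p19:
  fixes d :: "nat \<Rightarrow> nat"
    and \<sigma> :: "nat \<Rightarrow> 'g::{group_add, countable} \<Rightarrow> nat \<Rightarrow> nat"
    and smul :: "('g \<Rightarrow>\<^sub>0 int) \<Rightarrow> 'a::ab_group_add \<Rightarrow> 'a"
  assumes "sofic TYPE('g)"
    and "strong_atiyah TYPE('g)"
    and "(SUP \<Lambda>\<in>{\<Lambda> :: 'g set. finite_subgroup \<Lambda>}. enat (card \<Lambda>)) < \<infinity>"
    and "sofic_approximation d \<sigma>"
    and "left_module smul"
    and "finitely_generated smul"
  shows "metric_mdim d \<sigma> (dual_topology :: ('a \<Rightarrow> rmodz) topology) (dual_act smul) = 0 \<longleftrightarrow>
         sofic_entropy d \<sigma> (dual_topology :: ('a \<Rightarrow> rmodz) topology) (dual_act smul) < \<infinity>"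
proof -
  obtain B where B: "(SUP \<Lambda>\<in>{\<Lambda> :: 'g set. finite_subgroup \<Lambda>}. enat (card \<Lambda>)) = enat B"
    using assms(3) by (cases "SUP \<Lambda>\<in>{\<Lambda> :: 'g set. finite_subgroup \<Lambda>}. enat (card \<Lambda>)") auto
  have card_le: "card H \<le> B" if "finite_subgroup H" for H :: "'g set"
  proof -
    have "enat (card H) \<le> (SUP \<Lambda>\<in>{\<Lambda> :: 'g set. finite_subgroup \<Lambda>}. enat (card \<Lambda>))"
      using that by (intro SUP_upper) simp
    then show ?thesis by (simp add: B)
  qed
  obtain n and gen :: "nat \<Rightarrow> 'a" where gen: "\<And>x. \<exists>c. x = (\<Sum>s<n. smul (c s) (gen s))"
    using finitely_generated_enumeration[OF assms(6)] by blast
  interpret dual_system d \<sigma> smul n gen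
    using assms(4,5) gen
    by (intro dual_system.intro sofic_model.intro dual_system_axioms.intro) auto
  show ?thesis
    by (rule metric_mdim_zero_iff[OF assms(2) card_le countable_finitely_generated[OF gen]])
qed

end
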